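(* Let $f\in Y^*$, $u_0\in L^2(\Omega)$, let $\widetilde u_0\in X$ be an extension of $u_0$ (i.e. $\widetilde u_0(\cdot,0)=u_0$), and let $\widetilde u\in X_0$ and $\widetilde u_h\in X_{0,h}$ be the unique solutions of $b(\widetilde u+\widetilde u_0,v)=\langle f,v\rangle_Q$ for all $v\in Y$, and of $b(\widetilde u_h+\widetilde u_0,v_h)=\langle f,v_h\rangle_Q$ for all $v_h\in Y_h$, respectively. Assume $\widetilde u\in H^{2,1}(Q)\cap H^{3/2}(0,T;H^{-1}(\Omega))$. Then, for $h_t\simeq h_x^2$, $$\|\widetilde u-\widetilde u_h\|_X\le c\,h_x\Big[\|\widetilde u\|^2_{H^{2,1}(Q)}+\|\widetilde u\|^2_{H^{3/2}(0,T;H^{-1}(\Omega))}\Big]^{1/2},$$ with a constant $c>0$ independent of $h_x$, $h_t$ and $\widetilde u$.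
   Context: Let $\Omega\subset\mathbb{R}^n$, $n\in\{1,2,3\}$, be a bounded Lipschitz domain, $T>0$, $Q:=\Omega\times(0,T)$. Put $Y:=L^2(0,T;H^1_0(\Omega))$ with $\|v\|_Y:=\|\nabla_x v\|_{L^2(Q)}$; $Y^*$ is its dual with the dual norm, and $\langle\cdot,\cdot\rangle_Q$ is the duality pairing extending the $L^2(Q)$ inner product. Put $X:=\{u\in Y:\partial_t u\in Y^*\}$ with $\|u\|_X:=(\|u\|_Y^2+\|\partial_t u\|_{Y^*}^2)^{1/2}$, $X_0:=\{u\in X:u(\cdot,0)=0\}$, and $b(u,v):=\langle\partial_t u,v\rangle_Q+\langle\nabla_x u,\nabla_x v\rangle_{L^2(Q)}$ for $u\in X$, $v\in Y$. $H^{2,1}(Q):=L^2(0,T;H^2(\Omega))\cap H^1(0,T;L^2(\Omega))$. Discretization: $V_{h_x}\subset H^1_0(\Omega)$ is the space of continuous piecewise linear functions on an admissible, shape regular, globally quasi-uniform simplicial decomposition of $\Omega$ of mesh size $h_x$. The interval $(0,T)$ is divided uniformly with $h_t=T/N_t$, $t_i=ih_t$. $W_{h_t}^1$ is the space of continuous piecewise linear functions on this temporal mesh vanishing at $t=0$, and $W_{h_t}^0$ the space of piecewise constant functions. $X_{0,h}:=W_{h_t}^1\otimes V_{h_x}\subset X_0$, $Y_h:=W_{h_t}^0\otimes V_{h_x}\subset Y$. Standing properties (constants independent of $h_x$): the inverse inequality $\|\nabla_x v_h\|_{L^2(\Omega)}\le c\,h_x^{-1}\|v_h\|_{L^2(\Omega)}$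 for $v_h\in V_{h_x}$; and for the $L^2(\Omega)$ projection $Q^1_{h_x}$ onto $V_{h_x}$: $\|\nabla_x Q^1_{h_x}u\|_{L^2(\Omega)}\le c_Q\|\nabla_x u\|_{L^2(\Omega)}$ for $u\in H^1_0(\Omega)$, and $\|u-Q^1_{h_x}u\|_{L^2(\Omega)}\le c\,h_x^s|u|_{H^s(\Omega)}$, $\|\nabla_x(u-Q^1_{h_x}u)\|_{L^2(\Omega)}\le c\,h_x^{s-1}|u|_{H^s(\Omega)}$ for $u\in H^1_0(\Omega)\cap H^s(\Omega)$, $s\in[1,2]$. $h_t\simeq h_x^2$ means that $h_t/h_x^2$ is bounded above and below by fixed positive constants; $c$ may depend on these, on $\Omega$, $T$ and the shape regularity and quasi-uniformity constants. *)

theory Defs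
  imports "HOL-Analysis.Analysis"
begin

(* Conventions.  Elements of Lebesgue and Sobolev spaces are represented by functions; all norms are
   seminorms on representatives.  Values outside the underlying domain are irrelevant. *)

section \<open>Lipschitz domains\<close>

(* Near every boundary point the domain is, in suitable orthogonal coordinates, the region below the
   graph of a Lipschitz function on the hyperplane orthogonal to e. *)
definition lipschitz_domain :: "'a::euclidean_space set \<Rightarrow> bool" where
  "lipschitz_domain \<Omega> \<longleftrightarrow>
     open \<Omega> \<and> connected \<Omega> \<and> \<Omega> \<noteq> {} \<and>
     (\<forall>p\<in>frontier \<Omega>. \<exists>U e \<gamma> L. open U \<and> p \<in> U \<and> norm e = 1 \<and>
        L-lipschitz_on {y. y \<bullet> e = 0} \<gamma> \<and>
        \<Omega> \<inter> U = {x\<in>U. x \<bullet> e < (\<gamma> (x - (x \<bullet> e) *\<^sub>R e) :: real)})"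

section \<open>Spaces on a domain\<close>

subsection \<open>Test functions\<close>

primrec C_k :: "nat \<Rightarrow> ('a::euclidean_space \<Rightarrow> real) \<Rightarrow> bool" where
  "C_k 0 f \<longleftrightarrow> continuous_on UNIV f"
| "C_k (Suc k) f \<longleftrightarrow> (\<forall>x. f differentiable (at x)) \<and>
     (\<forall>i\<in>Basis. C_k k (\<lambda>x. frechet_derivative f (at x) i))"

definition test_functions :: "'a::euclidean_space set \<Rightarrow> ('a \<Rightarrow> real) set" where
  "test_functions S = {\<phi>. (\<forall>k. C_k k \<phi>) \<and>
     compact (closure {x. \<phi> x \<noteq> 0}) \<and> closure {x. \<phi> x \<noteq> 0} \<subseteq> S}"

subsection \<open>The Lebesgue space \<open>L\<^sup>2\<close>, for scalar and vector fields\<close>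

definition L2_space :: "'a::euclidean_space set \<Rightarrow> ('a \<Rightarrow> 'b::euclidean_space) set" where
  "L2_space \<Omega> = {u. u \<in> borel_measurable (lebesgue_on \<Omega>) \<and>
     integrable (lebesgue_on \<Omega>) (\<lambda>x. (norm (u x))\<^sup>2)}"

definition L2_inner :: "'a::euclidean_space set \<Rightarrow> ('a \<Rightarrow> 'b::euclidean_space) \<Rightarrow> ('a \<Rightarrow> 'b) \<Rightarrow> real" where
  "L2_inner \<Omega> u v = (LINT x|lebesgue_on \<Omega>. u x \<bullet> v x)"

definition L2_norm :: "'a::euclidean_space set \<Rightarrow> ('a \<Rightarrow> 'b::euclidean_space) \<Rightarrow> real" where
  "L2_norm \<Omega> u = sqrt (L2_inner \<Omega> u u)"

subsection \<open>Sobolev spaces\<close>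

definition is_weak_grad :: "'a::euclidean_space set \<Rightarrow> ('a \<Rightarrow> real) \<Rightarrow> ('a \<Rightarrow> 'a) \<Rightarrow> bool" where
  "is_weak_grad \<Omega> u g \<longleftrightarrow> g \<in> L2_space \<Omega> \<and>
     (\<forall>\<phi>\<in>test_functions \<Omega>. \<forall>i\<in>Basis.
        L2_inner \<Omega> u (\<lambda>x. frechet_derivative \<phi> (at x) i) = - L2_inner \<Omega> (\<lambda>x. g x \<bullet> i) \<phi>)"

(* unique up to a null set, whenever it exists *)
definition wgrad :: "'a::euclidean_space set \<Rightarrow> ('a \<Rightarrow> real) \<Rightarrow> 'a \<Rightarrow> 'a" where
  "wgrad \<Omega> u = (SOME g. is_weak_grad \<Omega> u g)"

definition H1_space :: "'a::euclidean_space set \<Rightarrow> ('a \<Rightarrow> real) set" where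
  "H1_space \<Omega> = {u \<in> L2_space \<Omega>. \<exists>g. is_weak_grad \<Omega> u g}"

definition H1_norm :: "'a::euclidean_space set \<Rightarrow> ('a \<Rightarrow> real) \<Rightarrow> real" where
  "H1_norm \<Omega> u = sqrt ((L2_norm \<Omega> u)\<^sup>2 + (L2_norm \<Omega> (wgrad \<Omega> u))\<^sup>2)"

definition H10_space :: "'a::euclidean_space set \<Rightarrow> ('a \<Rightarrow> real) set" where
  "H10_space \<Omega> = {u \<in> H1_space \<Omega>. \<exists>\<phi>. (\<forall>k. \<phi> k \<in> test_functions \<Omega>) \<and>
     (\<lambda>k::nat. H1_norm \<Omega> (\<lambda>x. u x - \<phi> k x)) \<longlonglongrightarrow> 0}"

definition H10_norm :: "'a::euclidean_space set \<Rightarrow> ('a \<Rightarrow> real) \<Rightarrow> real" where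
  "H10_norm \<Omega> u = L2_norm \<Omega> (wgrad \<Omega> u)"

definition H2_space :: "'a::euclidean_space set \<Rightarrow> ('a \<Rightarrow> real) set" where
  "H2_space \<Omega> = {u \<in> H1_space \<Omega>. \<forall>i\<in>Basis. (\<lambda>x. wgrad \<Omega> u x \<bullet> i) \<in> H1_space \<Omega>}"

definition H2_seminorm :: "'a::euclidean_space set \<Rightarrow> ('a \<Rightarrow> real) \<Rightarrow> real" where
  "H2_seminorm \<Omega> u = sqrt (\<Sum>i\<in>Basis. (L2_norm \<Omega> (wgrad \<Omega> (\<lambda>x. wgrad \<Omega> u x \<bullet> i)))\<^sup>2)"

definition H2_norm :: "'a::euclidean_space set \<Rightarrow> ('a \<Rightarrow> real) \<Rightarrow> real" where
  "H2_norm \<Omega> u = sqrt ((H1_norm \<Omega> u)\<^sup>2 + (H2_seminorm \<Omega> u)\<^sup>2)"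

(* square of the Sobolev-Slobodeckii seminorm of order \<theta>, for 0 < \<theta> < 1 *)
definition slobodeckii :: "'a::euclidean_space set \<Rightarrow> real \<Rightarrow> ('a \<Rightarrow> 'a) \<Rightarrow> ennreal" where
  "slobodeckii \<Omega> \<theta> g = (\<integral>\<^sup>+x. (\<integral>\<^sup>+y.
     ennreal ((norm (g x - g y))\<^sup>2 / norm (x - y) powr (real DIM('a) + 2 * \<theta>))
     \<partial>lebesgue_on \<Omega>) \<partial>lebesgue_on \<Omega>)"

(* the space and the seminorm of order s, for 1 \<le> s \<le> 2 *)
definition Hs_space :: "'a::euclidean_space set \<Rightarrow> real \<Rightarrow> ('a \<Rightarrow> real) set" where
  "Hs_space \<Omega> s =
     (if s = 1 then H1_space \<Omega>
      else if s = 2 then H2_space \<Omega>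
      else {u \<in> H1_space \<Omega>. slobodeckii \<Omega> (s - 1) (wgrad \<Omega> u) < \<infinity>})"

definition Hs_seminorm :: "'a::euclidean_space set \<Rightarrow> real \<Rightarrow> ('a \<Rightarrow> real) \<Rightarrow> real" where
  "Hs_seminorm \<Omega> s u =
     (if s = 1 then L2_norm \<Omega> (wgrad \<Omega> u)
      else if s = 2 then H2_seminorm \<Omega> u
      else sqrt (enn2real (slobodeckii \<Omega> (s - 1) (wgrad \<Omega> u))))"

subsection \<open>Dual spaces\<close>

definition dual_space :: "('b \<Rightarrow> real) set \<Rightarrow> (('b \<Rightarrow> real) \<Rightarrow> real) \<Rightarrow> (('b \<Rightarrow> real) \<Rightarrow> real) set" where
  "dual_space V N = {F.
     (\<forall>u\<in>V. \<forall>v\<in>V. F (\<lambda>x. u x + v x) = F u + F v) \<and>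
     (\<forall>c. \<forall>u\<in>V. F (\<lambda>x. c * u x) = c * F u) \<and>
     (\<exists>C. \<forall>u\<in>V. \<bar>F u\<bar> \<le> C * N u)}"

(* elements of norm zero contribute x / 0 = 0 *)
definition dual_norm :: "('b \<Rightarrow> real) set \<Rightarrow> (('b \<Rightarrow> real) \<Rightarrow> real) \<Rightarrow> (('b \<Rightarrow> real) \<Rightarrow> real) \<Rightarrow> real" where
  "dual_norm V N F = (SUP v\<in>V. \<bar>F v\<bar> / N v)"

definition Hm1_space :: "'a::euclidean_space set \<Rightarrow> (('a \<Rightarrow> real) \<Rightarrow> real) set" where
  "Hm1_space \<Omega> = dual_space (H10_space \<Omega>) (H10_norm \<Omega>)"

definition Hm1_norm :: "'a::euclidean_space set \<Rightarrow> (('a \<Rightarrow> real) \<Rightarrow> real) \<Rightarrow> real" where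
  "Hm1_norm \<Omega> = dual_norm (H10_space \<Omega>) (H10_norm \<Omega>)"

section \<open>Spaces on the space-time cylinder\<close>

subsection \<open>Bochner spaces \<open>L\<^sup>2(0,T;V)\<close>\<close>

abbreviation time_measure :: "real \<Rightarrow> real measure" where
  "time_measure T \<equiv> lebesgue_on {0<..<T}"

(* V is a space of real functions with (semi)norm N *)
definition simple_into :: "real \<Rightarrow> ('b \<Rightarrow> real) set \<Rightarrow> (real \<Rightarrow> 'b \<Rightarrow> real) \<Rightarrow> bool" where
  "simple_into T V s \<longleftrightarrow> finite (s ` {0<..<T}) \<and> s ` {0<..<T} \<subseteq> V \<and>
     (\<forall>v. {t\<in>{0<..<T}. s t = v} \<in> sets lebesgue)"

definition bochner_L2 ::
    "real \<Rightarrow> ('b \<Rightarrow> real) set \<Rightarrow> (('b \<Rightarrow> real) \<Rightarrow> real) \<Rightarrow> (real \<Rightarrow> 'b \<Rightarrow> real) set" where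
  "bochner_L2 T V N = {u.
     (AE t in time_measure T. u t \<in> V) \<and>
     (\<exists>s. (\<forall>k::nat. simple_into T V (s k)) \<and>
        (AE t in time_measure T. (\<lambda>k. N (\<lambda>x. s k t x - u t x)) \<longlonglongrightarrow> 0)) \<and>
     integrable (time_measure T) (\<lambda>t. (N (u t))\<^sup>2)}"

definition bochner_norm :: "real \<Rightarrow> (('b \<Rightarrow> real) \<Rightarrow> real) \<Rightarrow> (real \<Rightarrow> 'b \<Rightarrow> real) \<Rightarrow> real" where
  "bochner_norm T N u = sqrt (LINT t|time_measure T. (N (u t))\<^sup>2)"

(* A function u(x,t) on \<Omega> \<times> (0,T) is identified with the curve t \<mapsto> u(.,t). *)
definition slice :: "('a \<times> real \<Rightarrow> 'b) \<Rightarrow> real \<Rightarrow> 'a \<Rightarrow> 'b" where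
  "slice u t = (\<lambda>x. u (x, t))"

definition tensor :: "('a \<Rightarrow> real) \<Rightarrow> (real \<Rightarrow> real) \<Rightarrow> 'a \<times> real \<Rightarrow> real" where
  "tensor w \<phi> = (\<lambda>(x, t). w x * \<phi> t)"

(* L^2(Q) = L^2(0,T;L^2(\<Omega>)).  Integrals over Q are iterated, since representatives chosen
   separately for each t need not be jointly measurable. *)
definition L2Q_inner ::
    "'a::euclidean_space set \<Rightarrow> real \<Rightarrow> ('a \<times> real \<Rightarrow> 'b::euclidean_space) \<Rightarrow> ('a \<times> real \<Rightarrow> 'b) \<Rightarrow> real" where
  "L2Q_inner \<Omega> T u v = (LINT t|time_measure T. L2_inner \<Omega> (slice u t) (slice v t))"

definition L2Q_norm :: "'a::euclidean_space set \<Rightarrow> real \<Rightarrow> ('a \<times> real \<Rightarrow> 'b::euclidean_space) \<Rightarrow> real" where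
  "L2Q_norm \<Omega> T u = sqrt (L2Q_inner \<Omega> T u u)"

definition grad_x :: "'a::euclidean_space set \<Rightarrow> ('a \<times> real \<Rightarrow> real) \<Rightarrow> 'a \<times> real \<Rightarrow> 'a" where
  "grad_x \<Omega> u = (\<lambda>(x, t). wgrad \<Omega> (slice u t) x)"

subsection \<open>The spaces \<open>Y\<close>, \<open>X\<close> and the bilinear form\<close>

definition Y_space :: "'a::euclidean_space set \<Rightarrow> real \<Rightarrow> ('a \<times> real \<Rightarrow> real) set" where
  "Y_space \<Omega> T = {v. slice v \<in> bochner_L2 T (H10_space \<Omega>) (H10_norm \<Omega>)}"

definition Y_norm :: "'a::euclidean_space set \<Rightarrow> real \<Rightarrow> ('a \<times> real \<Rightarrow> real) \<Rightarrow> real" where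
  "Y_norm \<Omega> T v = L2Q_norm \<Omega> T (grad_x \<Omega> v)"

definition Ystar_space :: "'a::euclidean_space set \<Rightarrow> real \<Rightarrow> (('a \<times> real \<Rightarrow> real) \<Rightarrow> real) set" where
  "Ystar_space \<Omega> T = dual_space (Y_space \<Omega> T) (Y_norm \<Omega> T)"

definition Ystar_norm :: "'a::euclidean_space set \<Rightarrow> real \<Rightarrow> (('a \<times> real \<Rightarrow> real) \<Rightarrow> real) \<Rightarrow> real" where
  "Ystar_norm \<Omega> T = dual_norm (Y_space \<Omega> T) (Y_norm \<Omega> T)"

(* distributional time derivative of u in Y^*, the duality pairing extending the L^2(Q) product *)
definition is_time_deriv ::
    "'a::euclidean_space set \<Rightarrow> real \<Rightarrow> ('a \<times> real \<Rightarrow> real) \<Rightarrow> (('a \<times> real \<Rightarrow> real) \<Rightarrow> real) \<Rightarrow> bool" where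
  "is_time_deriv \<Omega> T u g \<longleftrightarrow> g \<in> Ystar_space \<Omega> T \<and>
     (\<forall>w\<in>H10_space \<Omega>. \<forall>\<phi>\<in>test_functions {0<..<T}.
        g (tensor w \<phi>) = - L2Q_inner \<Omega> T u (tensor w (deriv \<phi>)))"

(* unique as a functional on Y, whenever it exists *)
definition time_deriv ::
    "'a::euclidean_space set \<Rightarrow> real \<Rightarrow> ('a \<times> real \<Rightarrow> real) \<Rightarrow> ('a \<times> real \<Rightarrow> real) \<Rightarrow> real" where
  "time_deriv \<Omega> T u = (SOME g. is_time_deriv \<Omega> T u g)"

definition X_space :: "'a::euclidean_space set \<Rightarrow> real \<Rightarrow> ('a \<times> real \<Rightarrow> real) set" where
  "X_space \<Omega> T = {u \<in> Y_space \<Omega> T. \<exists>g. is_time_deriv \<Omega> T u g}"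

definition X_norm :: "'a::euclidean_space set \<Rightarrow> real \<Rightarrow> ('a \<times> real \<Rightarrow> real) \<Rightarrow> real" where
  "X_norm \<Omega> T u = sqrt ((Y_norm \<Omega> T u)\<^sup>2 + (Ystar_norm \<Omega> T (time_deriv \<Omega> T u))\<^sup>2)"

(* u(.,0) = u0, where u(.,0) is the value at 0 of the representative of u in C([0,T];L^2(\<Omega>)) *)
definition has_initial_value ::
    "'a::euclidean_space set \<Rightarrow> real \<Rightarrow> ('a \<times> real \<Rightarrow> real) \<Rightarrow> ('a \<Rightarrow> real) \<Rightarrow> bool" where
  "has_initial_value \<Omega> T u u0 \<longleftrightarrow> (\<exists>w. (\<forall>t\<in>{0..T}. w t \<in> L2_space \<Omega>) \<and>
     (\<forall>t\<in>{0..T}. ((\<lambda>r. L2_norm \<Omega> (\<lambda>x. w r x - w t x)) \<longlongrightarrow> 0) (at t within {0..T})) \<and>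
     (AE t in time_measure T. L2_norm \<Omega> (\<lambda>x. slice u t x - w t x) = 0) \<and>
     L2_norm \<Omega> (\<lambda>x. w 0 x - u0 x) = 0)"

definition X0_space :: "'a::euclidean_space set \<Rightarrow> real \<Rightarrow> ('a \<times> real \<Rightarrow> real) set" where
  "X0_space \<Omega> T = {u \<in> X_space \<Omega> T. has_initial_value \<Omega> T u (\<lambda>x. 0)}"

definition b_form ::
    "'a::euclidean_space set \<Rightarrow> real \<Rightarrow> ('a \<times> real \<Rightarrow> real) \<Rightarrow> ('a \<times> real \<Rightarrow> real) \<Rightarrow> real" where
  "b_form \<Omega> T u v = time_deriv \<Omega> T u v + L2Q_inner \<Omega> T (grad_x \<Omega> u) (grad_x \<Omega> v)"

subsection \<open>The regularity spaces \<open>H\<^sup>2\<^sup>,\<^sup>1(Q)\<close> and \<open>H\<^sup>3\<^sup>/\<^sup>2(0,T;H\<^sup>-\<^sup>1(\<Omega>))\<close>\<close>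

definition is_L2_time_deriv ::
    "'a::euclidean_space set \<Rightarrow> real \<Rightarrow> ('a \<times> real \<Rightarrow> real) \<Rightarrow> ('a \<times> real \<Rightarrow> real) \<Rightarrow> bool" where
  "is_L2_time_deriv \<Omega> T u d \<longleftrightarrow> slice d \<in> bochner_L2 T (L2_space \<Omega>) (L2_norm \<Omega>) \<and>
     (\<forall>w\<in>L2_space \<Omega>. \<forall>\<phi>\<in>test_functions {0<..<T}.
        L2Q_inner \<Omega> T d (tensor w \<phi>) = - L2Q_inner \<Omega> T u (tensor w (deriv \<phi>)))"

definition H21_space :: "'a::euclidean_space set \<Rightarrow> real \<Rightarrow> ('a \<times> real \<Rightarrow> real) set" where
  "H21_space \<Omega> T = {u.
     slice u \<in> bochner_L2 T (H2_space \<Omega>) (H2_norm \<Omega>) \<and>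
     slice u \<in> bochner_L2 T (L2_space \<Omega>) (L2_norm \<Omega>) \<and>
     (\<exists>d. is_L2_time_deriv \<Omega> T u d)}"

definition H21_norm :: "'a::euclidean_space set \<Rightarrow> real \<Rightarrow> ('a \<times> real \<Rightarrow> real) \<Rightarrow> real" where
  "H21_norm \<Omega> T u = sqrt (
     (bochner_norm T (H2_norm \<Omega>) (slice u))\<^sup>2 +
     ((L2Q_norm \<Omega> T u)\<^sup>2 + (L2Q_norm \<Omega> T (SOME d. is_L2_time_deriv \<Omega> T u d))\<^sup>2))"

(* the curve t \<mapsto> u(.,t) in H^{-1}, where L^2 is embedded through the L^2 inner product *)
definition Hm1_curve ::
    "'a::euclidean_space set \<Rightarrow> ('a \<times> real \<Rightarrow> real) \<Rightarrow> real \<Rightarrow> ('a \<Rightarrow> real) \<Rightarrow> real" where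
  "Hm1_curve \<Omega> u = (\<lambda>t w. L2_inner \<Omega> (slice u t) w)"

definition is_Hm1_time_deriv ::
    "'a::euclidean_space set \<Rightarrow> real \<Rightarrow> ('a \<times> real \<Rightarrow> real) \<Rightarrow> (real \<Rightarrow> ('a \<Rightarrow> real) \<Rightarrow> real) \<Rightarrow> bool" where
  "is_Hm1_time_deriv \<Omega> T u d \<longleftrightarrow> d \<in> bochner_L2 T (Hm1_space \<Omega>) (Hm1_norm \<Omega>) \<and>
     (\<forall>w\<in>H10_space \<Omega>. \<forall>\<phi>\<in>test_functions {0<..<T}.
        (LINT t|time_measure T. \<phi> t * d t w) =
        - (LINT t|time_measure T. deriv \<phi> t * Hm1_curve \<Omega> u t w))"

(* square of the Sobolev-Slobodeckii seminorm of order 1/2 on (0,T) with values in H^{-1} *)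
definition slobodeckii_half_Hm1 ::
    "'a::euclidean_space set \<Rightarrow> real \<Rightarrow> (real \<Rightarrow> ('a \<Rightarrow> real) \<Rightarrow> real) \<Rightarrow> ennreal" where
  "slobodeckii_half_Hm1 \<Omega> T d = (\<integral>\<^sup>+t. (\<integral>\<^sup>+r.
     ennreal ((Hm1_norm \<Omega> (\<lambda>w. d t w - d r w))\<^sup>2 / (t - r)\<^sup>2)
     \<partial>time_measure T) \<partial>time_measure T)"

definition H32_Hm1_space :: "'a::euclidean_space set \<Rightarrow> real \<Rightarrow> ('a \<times> real \<Rightarrow> real) set" where
  "H32_Hm1_space \<Omega> T = {u.
     Hm1_curve \<Omega> u \<in> bochner_L2 T (Hm1_space \<Omega>) (Hm1_norm \<Omega>) \<and>
     (\<exists>d. is_Hm1_time_deriv \<Omega> T u d \<and> slobodeckii_half_Hm1 \<Omega> T d < \<infinity>)}"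

definition H32_Hm1_norm :: "'a::euclidean_space set \<Rightarrow> real \<Rightarrow> ('a \<times> real \<Rightarrow> real) \<Rightarrow> real" where
  "H32_Hm1_norm \<Omega> T u = (let d = (SOME d. is_Hm1_time_deriv \<Omega> T u d) in
     sqrt ((bochner_norm T (Hm1_norm \<Omega>) (Hm1_curve \<Omega> u))\<^sup>2 +
       (bochner_norm T (Hm1_norm \<Omega>) d)\<^sup>2 +
       enn2real (slobodeckii_half_Hm1 \<Omega> T d)))"

section \<open>Discretization\<close>

subsection \<open>Space\<close>

definition admissible_mesh :: "'a::euclidean_space set \<Rightarrow> 'a set set \<Rightarrow> bool" where
  "admissible_mesh \<Omega> \<T> \<longleftrightarrow>
     triangulation \<T> \<and> (\<forall>K\<in>\<T>. int DIM('a) simplex K) \<and> \<Union>\<T> = closure \<Omega>"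

definition mesh_size :: "'a::euclidean_space set set \<Rightarrow> real" where
  "mesh_size \<T> = Max (diameter ` \<T>)"

definition inradius :: "'a::euclidean_space set \<Rightarrow> real" where
  "inradius K = Sup {r. \<exists>x. cball x r \<subseteq> K}"

definition shape_regular :: "real \<Rightarrow> 'a::euclidean_space set set \<Rightarrow> bool" where
  "shape_regular \<sigma> \<T> \<longleftrightarrow> (\<forall>K\<in>\<T>. diameter K \<le> \<sigma> * inradius K)"

definition quasi_uniform :: "real \<Rightarrow> 'a::euclidean_space set set \<Rightarrow> bool" where
  "quasi_uniform q \<T> \<longleftrightarrow> (\<forall>K\<in>\<T>. mesh_size \<T> \<le> q * diameter K)"

definition V_h :: "'a::euclidean_space set \<Rightarrow> 'a set set \<Rightarrow> ('a \<Rightarrow> real) set" where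
  "V_h \<Omega> \<T> = {v \<in> H10_space \<Omega>. continuous_on (closure \<Omega>) v \<and>
     (\<forall>K\<in>\<T>. \<exists>a \<beta>. \<forall>x\<in>K. v x = a \<bullet> x + \<beta>)}"

(* unique up to a null set *)
definition L2_proj :: "'a::euclidean_space set \<Rightarrow> ('a \<Rightarrow> real) set \<Rightarrow> ('a \<Rightarrow> real) \<Rightarrow> 'a \<Rightarrow> real" where
  "L2_proj \<Omega> V u = (SOME p. p \<in> V \<and> (\<forall>v\<in>V. L2_inner \<Omega> p v = L2_inner \<Omega> u v))"

definition inverse_inequality :: "real \<Rightarrow> 'a::euclidean_space set \<Rightarrow> 'a set set \<Rightarrow> bool" where
  "inverse_inequality c \<Omega> \<T> \<longleftrightarrow>
     (\<forall>v\<in>V_h \<Omega> \<T>. L2_norm \<Omega> (wgrad \<Omega> v) \<le> c * inverse (mesh_size \<T>) * L2_norm \<Omega> v)"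

definition L2_proj_H1_stable :: "real \<Rightarrow> 'a::euclidean_space set \<Rightarrow> 'a set set \<Rightarrow> bool" where
  "L2_proj_H1_stable c \<Omega> \<T> \<longleftrightarrow>
     (\<forall>u\<in>H10_space \<Omega>.
        L2_norm \<Omega> (wgrad \<Omega> (L2_proj \<Omega> (V_h \<Omega> \<T>) u)) \<le> c * L2_norm \<Omega> (wgrad \<Omega> u))"

(* the constant may depend on the order s *)
definition L2_proj_approximation :: "(real \<Rightarrow> real) \<Rightarrow> 'a::euclidean_space set \<Rightarrow> 'a set set \<Rightarrow> bool" where
  "L2_proj_approximation c \<Omega> \<T> \<longleftrightarrow>
     (\<forall>s\<in>{1..2}. \<forall>u\<in>H10_space \<Omega> \<inter> Hs_space \<Omega> s.
        let e = (\<lambda>x. u x - L2_proj \<Omega> (V_h \<Omega> \<T>) u x) in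
          L2_norm \<Omega> e \<le> c s * mesh_size \<T> powr s * Hs_seminorm \<Omega> s u \<and>
          L2_norm \<Omega> (wgrad \<Omega> e) \<le> c s * mesh_size \<T> powr (s - 1) * Hs_seminorm \<Omega> s u)"

subsection \<open>Time, and the space-time tensor products\<close>

definition W1_h :: "real \<Rightarrow> nat \<Rightarrow> (real \<Rightarrow> real) set" where
  "W1_h T N = {\<phi>. continuous_on {0..T} \<phi> \<and> \<phi> 0 = 0 \<and>
     (\<forall>i<N. \<exists>\<alpha> \<beta>. \<forall>t\<in>{real i * (T / N)..real (Suc i) * (T / N)}. \<phi> t = \<alpha> * t + \<beta>)}"

definition W0_h :: "real \<Rightarrow> nat \<Rightarrow> (real \<Rightarrow> real) set" where
  "W0_h T N = {\<phi>.
     \<forall>i<N. \<exists>\<beta>. \<forall>t\<in>{real i * (T / N)<..<real (Suc i) * (T / N)}. \<phi> t = \<beta>}"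

definition tensor_space :: "(real \<Rightarrow> real) set \<Rightarrow> ('a \<Rightarrow> real) set \<Rightarrow> ('a \<times> real \<Rightarrow> real) set" where
  "tensor_space W V = {u. \<exists>(m::nat) w \<phi>. (\<forall>j<m. w j \<in> V \<and> \<phi> j \<in> W) \<and>
     u = (\<lambda>z. \<Sum>j<m. tensor (w j) (\<phi> j) z)}"

definition X0_h :: "'a::euclidean_space set \<Rightarrow> real \<Rightarrow> 'a set set \<Rightarrow> nat \<Rightarrow> ('a \<times> real \<Rightarrow> real) set" where
  "X0_h \<Omega> T \<T> N = tensor_space (W1_h T N) (V_h \<Omega> \<T>)"

definition Y_h :: "'a::euclidean_space set \<Rightarrow> real \<Rightarrow> 'a set set \<Rightarrow> nat \<Rightarrow> ('a \<times> real \<Rightarrow> real) set" where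
  "Y_h \<Omega> T \<T> N = tensor_space (W0_h T N) (V_h \<Omega> \<T>)"

end

theory Submission
  imports Defs
begin

text \<open>Let \<open>z\<^sub>h\<close> be the piecewise linear interpolation in time of the spatial \<open>L\<^sup>2\<close>-projection of the solution
  \<open>u\<close>, and split the error as \<open>u - u\<^sub>h = (u - z\<^sub>h) - (u\<^sub>h - z\<^sub>h)\<close>. Because the projection commutes with the time
  derivative, Galerkin orthogonality turns into a Crank-Nicolson scheme for the nodal values of
  \<open>u\<^sub>h - z\<^sub>h\<close> whose right-hand side only sees the gradient of \<open>u - z\<^sub>h\<close>. Testing with the midpoint values
  bounds the gradients of these; testing with the increments bounds the gradients of the increments,
  by the inverse inequality and \<open>h\<^sub>t \<le> \<kappa>\<^sub>2 h\<^sub>x\<^sup>2\<close>. The same two ingredients bound the gradient of \<open>u - z\<^sub>h\<close> by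
  \<open>h\<^sub>x\<close> times the \<open>H\<^sup>2\<^sup>,\<^sup>1\<close>-norm. For the time derivative the \<open>H\<^sup>-\<^sup>1\<close>-norm is tested with projected functions,
  up to a projection error of order \<open>h\<^sub>x\<close> times the derivative; on each cell the derivative differs from its mean by
  at most \<open>h\<^sub>t\<^sup>1\<^sup>/\<^sup>2\<close> times the Slobodeckii seminorm, and the remaining terms come from the equation.\<close>

section \<open>The Lebesgue space\<close>

text \<open>Test functions are piecewise constant in time, so the discrete equation sees the
  gradient of a trial function only through its means over the time cells, that is, through the
  midpoints of its nodal values. Nodal values alternating in sign can have midpoints much smaller
  than themselves. The separate bound for the increments rules this out; it costs the inverse
  inequality twice, which is where \<tau> has to be coupled to the square of \<open>hx\<close>.

  The interpolant needs values at single times, while elements of \<open>X_space\<close> are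
  determined only for almost every time. The continuous representative \<open>w\<close> behind the
  initial condition supplies them, but it is only used in tested form: its inner products are
  primitives of those of the time derivative.

  Norms are seminorms on representatives, and gradients and time derivatives are picked by
  \<open>SOME\<close>, the latter in three guises: as a functional on Y, as a square integrable
  function, and as a curve in the dual of \<open>H10_space\<close>. The preparatory sections show
  that these choices are unique up to null sets, that they agree with each other, and that the
  integrands are measurable.\<close>

lemma discriminant_bound:
  fixes a b d :: real
  assumes "\<And>c. 0 \<le> a + 2 * c * b + c\<^sup>2 * d" "0 \<le> d"
  shows "b\<^sup>2 \<le> a * d"
proof (cases "d = 0")
  case True
  have "b = 0"
  proof (rule ccontr)
    assume "b \<noteq> 0"
    \<comment> \<open>The value of \<open>c\<close> is chosen such that \<open>a + 2 * c * b\<close>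
      equals -1.\<close>
    then show False
      using assms(1)[of "- (a + 1) / (2 * b)"] True by (simp add: field_simps)
  qed
  then show ?thesis using True by simp
next
  case False
  then have "d > 0" using assms(2) by simp
  \<comment> \<open>The quadratic attains its minimum at \<open>c = - b / d\<close>.\<close>
  have "0 \<le> a + 2 * (- b / d) * b + (- b / d)\<^sup>2 * d" by (rule assms(1))
  also have "\<dots> = a - b\<^sup>2 / d"
    using \<open>d > 0\<close> by (simp add: power2_eq_square field_simps)
  finally show ?thesis using \<open>d > 0\<close> by (simp add: field_simps)
qed

lemma L2_space_zero [simp]: "(\<lambda>_. 0) \<in> L2_space S"
  by (simp add: L2_space_def)

lemma L2_inner_integrable:
  assumes "u \<in> L2_space S" "v \<in> L2_space S"
  shows "integrable (lebesgue_on S) (\<lambda>x. u x \<bullet> v x)"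
proof (rule Bochner_Integration.integrable_bound)
  show "integrable (lebesgue_on S) (\<lambda>x. (norm (u x))\<^sup>2 + (norm (v x))\<^sup>2)"
    using assms by (simp add: L2_space_def)
  show "(\<lambda>x. u x \<bullet> v x) \<in> borel_measurable (lebesgue_on S)"
    using assms by (simp add: L2_space_def borel_measurable_inner)
  have "\<bar>a \<bullet> b\<bar> \<le> (norm a)\<^sup>2 + (norm b)\<^sup>2" for a b :: 'b
  proof -
    have "\<bar>a \<bullet> b\<bar> \<le> norm a * norm b" by (rule Cauchy_Schwarz_ineq2)
    also have "\<dots> \<le> (norm a)\<^sup>2 + (norm b)\<^sup>2"
      using sum_squares_bound[of "norm a" "norm b"] mult_nonneg_nonneg[OF norm_ge_zero norm_ge_zero, of a b]
      by linarith
    finally show ?thesis .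
  qed
  then show "AE x in lebesgue_on S. norm (u x \<bullet> v x) \<le> norm ((norm (u x))\<^sup>2 + (norm (v x))\<^sup>2)"
    by simp
qed

lemma L2_space_add:
  assumes "u \<in> L2_space S" "v \<in> L2_space S"
  shows "(\<lambda>x. u x + v x) \<in> L2_space S"
proof -
  have [measurable]: "u \<in> borel_measurable (lebesgue_on S)" "v \<in> borel_measurable (lebesgue_on S)"
    using assms by (simp_all add: L2_space_def)
  have "integrable (lebesgue_on S) (\<lambda>x. (norm (u x + v x))\<^sup>2)"
  proof (rule Bochner_Integration.integrable_bound)
    show "integrable (lebesgue_on S) (\<lambda>x. 2 * (norm (u x))\<^sup>2 + 2 * (norm (v x))\<^sup>2)"
      using assms by (simp add: L2_space_def)
    show "(\<lambda>x. (norm (u x + v x))\<^sup>2) \<in> borel_measurable (lebesgue_on S)"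
      by measurable
    have "(norm (a + b))\<^sup>2 \<le> 2 * (norm a)\<^sup>2 + 2 * (norm b)\<^sup>2" for a b :: 'b
    proof -
      have "(norm (a + b))\<^sup>2 \<le> (norm a + norm b)\<^sup>2"
        by (simp add: norm_triangle_ineq power_mono)
      also have "\<dots> \<le> 2 * (norm a)\<^sup>2 + 2 * (norm b)\<^sup>2"
        using sum_squares_bound[of "norm a" "norm b"] by (simp add: power2_sum)
      finally show ?thesis .
    qed
    then show "AE x in lebesgue_on S. norm ((norm (u x + v x))\<^sup>2) \<le> norm (2 * (norm (u x))\<^sup>2 + 2 * (norm (v x))\<^sup>2)"
      by simp
  qed
  then show ?thesis by (simp add: L2_space_def)
qed

lemma L2_space_scaleR: "u \<in> L2_space S \<Longrightarrow> (\<lambda>x. c *\<^sub>R u x) \<in> L2_space S"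
  by (simp add: L2_space_def power_mult_distrib borel_measurable_scaleR)

lemma L2_space_scale: "u \<in> L2_space S \<Longrightarrow> (\<lambda>x. c * u x) \<in> L2_space S" for u :: "_ \<Rightarrow> real"
  using L2_space_scaleR[of u S c] by simp

lemma L2_space_diff:
  "u \<in> L2_space S \<Longrightarrow> v \<in> L2_space S \<Longrightarrow> (\<lambda>x. u x - v x) \<in> L2_space S"
  using L2_space_add[OF _ L2_space_scaleR, of u S v "-1"] by simp

lemma L2_space_component: "u \<in> L2_space S \<Longrightarrow> (\<lambda>x. u x \<bullet> i) \<in> L2_space S"
  for u :: "'a::euclidean_space \<Rightarrow> 'b::euclidean_space"
proof -
  assume u: "u \<in> L2_space S"
  then have [measurable]: "u \<in> borel_measurable (lebesgue_on S)" by (simp add: L2_space_def)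
  have "integrable (lebesgue_on S) (\<lambda>x. (norm (u x \<bullet> i))\<^sup>2)"
  proof (rule Bochner_Integration.integrable_bound)
    show "integrable (lebesgue_on S) (\<lambda>x. (norm (u x))\<^sup>2 * (norm i)\<^sup>2)"
      using u by (simp add: L2_space_def)
    have "\<bar>u x \<bullet> i\<bar>\<^sup>2 \<le> (norm (u x) * norm i)\<^sup>2" for x
      by (rule power_mono[OF Cauchy_Schwarz_ineq2]) simp
    then show "AE x in lebesgue_on S. norm ((norm (u x \<bullet> i))\<^sup>2) \<le> norm ((norm (u x))\<^sup>2 * (norm i)\<^sup>2)"
      by (simp add: power_mult_distrib)
  qed measurable
  then show ?thesis by (simp add: L2_space_def)
qed

lemma L2_inner_commute: "L2_inner S u v = L2_inner S v u"
  by (simp add: L2_inner_def inner_commute)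

lemma L2_inner_add_left:
  assumes "u \<in> L2_space S" "v \<in> L2_space S" "w \<in> L2_space S"
  shows "L2_inner S (\<lambda>x. u x + v x) w = L2_inner S u w + L2_inner S v w"
  using assms by (simp add: L2_inner_def inner_add_left L2_inner_integrable)

lemma L2_inner_scale_left: "L2_inner S (\<lambda>x. c *\<^sub>R u x) w = c * L2_inner S u w"
  by (simp add: L2_inner_def)

lemma L2_inner_mult_left: "L2_inner S (\<lambda>x. c * u x) w = c * L2_inner S u w" for u :: "_ \<Rightarrow> real"
  using L2_inner_scale_left[of S c u w] by simp

lemma L2_inner_diff_left:
  assumes "u \<in> L2_space S" "v \<in> L2_space S" "w \<in> L2_space S"
  shows "L2_inner S (\<lambda>x. u x - v x) w = L2_inner S u w - L2_inner S v w"
  using assms by (simp add: L2_inner_def inner_diff_left L2_inner_integrable)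

lemma L2_inner_add_right:
  assumes "u \<in> L2_space S" "v \<in> L2_space S" "w \<in> L2_space S"
  shows "L2_inner S w (\<lambda>x. u x + v x) = L2_inner S w u + L2_inner S w v"
  using L2_inner_add_left[OF assms] by (simp add: L2_inner_commute)

lemma L2_inner_mult_right: "L2_inner S w (\<lambda>x. c * u x) = c * L2_inner S w u" for u :: "_ \<Rightarrow> real"
  using L2_inner_mult_left[of S c u w] by (simp add: L2_inner_commute)

lemma L2_inner_diff_right:
  assumes "u \<in> L2_space S" "v \<in> L2_space S" "w \<in> L2_space S"
  shows "L2_inner S w (\<lambda>x. u x - v x) = L2_inner S w u - L2_inner S w v"
  using L2_inner_diff_left[OF assms] by (simp add: L2_inner_commute)

lemma L2_inner_zero_left [simp]: "L2_inner S (\<lambda>x. 0) u = 0"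
  by (simp add: L2_inner_def)

lemma L2_inner_self_nonneg [simp]: "0 \<le> L2_inner S u u"
  by (simp add: L2_inner_def)

lemma L2_norm_nonneg [simp]: "0 \<le> L2_norm S u"
  by (simp add: L2_norm_def)

lemma L2_norm_power2: "(L2_norm S u)\<^sup>2 = L2_inner S u u"
  by (simp add: L2_norm_def)

lemma L2_norm_zero [simp]: "L2_norm S (\<lambda>x. 0) = 0"
  by (simp add: L2_norm_def)

text \<open>The squared norm of \<open>u + c v\<close> is a nonnegative quadratic in
  \<open>c\<close>. A representative \<open>v\<close> may have norm zero without being zero, hence
  the degenerate case in \<open>discriminant_bound\<close>.\<close>

lemma L2_Cauchy_Schwarz:
  assumes u: "u \<in> L2_space S" and v: "v \<in> L2_space S"
  shows "\<bar>L2_inner S u v\<bar> \<le> L2_norm S u * L2_norm S v"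
proof -
  have "(L2_inner S u v)\<^sup>2 \<le> L2_inner S u u * L2_inner S v v"
  proof (rule discriminant_bound)
    fix c
    have cv: "(\<lambda>x. c *\<^sub>R v x) \<in> L2_space S" by (rule L2_space_scaleR[OF v])
    have "0 \<le> L2_inner S (\<lambda>x. u x + c *\<^sub>R v x) (\<lambda>x. u x + c *\<^sub>R v x)" by simp
    also have "\<dots> = L2_inner S u u + 2 * c * L2_inner S u v + c\<^sup>2 * L2_inner S v v"
      using u v cv L2_space_add[OF u cv]
      by (simp add: L2_inner_add_left L2_inner_add_right L2_inner_scale_left
          L2_inner_commute[of S _ "\<lambda>x. c *\<^sub>R v x"] L2_inner_commute[of S v u] power2_eq_square algebra_simps)
    finally show "0 \<le> L2_inner S u u + 2 * c * L2_inner S u v + c\<^sup>2 * L2_inner S v v" .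
  qed simp
  then have "sqrt ((L2_inner S u v)\<^sup>2) \<le> sqrt (L2_inner S u u * L2_inner S v v)"
    by (rule real_sqrt_le_mono)
  then show ?thesis by (simp add: L2_norm_def real_sqrt_mult)
qed

lemma L2_norm_triangle:
  assumes u: "u \<in> L2_space S" and v: "v \<in> L2_space S"
  shows "L2_norm S (\<lambda>x. u x + v x) \<le> L2_norm S u + L2_norm S v"
proof (rule power2_le_imp_le)
  have "(L2_norm S (\<lambda>x. u x + v x))\<^sup>2 = (L2_norm S u)\<^sup>2 + 2 * L2_inner S u v + (L2_norm S v)\<^sup>2"
    using u v L2_space_add[OF u v]
    by (simp add: L2_norm_power2 L2_inner_add_left L2_inner_add_right L2_inner_commute[of S v u])
  also have "\<dots> \<le> (L2_norm S u + L2_norm S v)\<^sup>2"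
    using L2_Cauchy_Schwarz[OF u v] by (simp add: power2_sum)
  finally show "(L2_norm S (\<lambda>x. u x + v x))\<^sup>2 \<le> (L2_norm S u + L2_norm S v)\<^sup>2" .
qed simp

lemma L2_norm_scaleR: "L2_norm S (\<lambda>x. c *\<^sub>R u x) = \<bar>c\<bar> * L2_norm S u"
  by (simp add: L2_norm_def L2_inner_def real_sqrt_mult flip: power2_eq_square mult.assoc)

lemma L2_norm_scale: "L2_norm S (\<lambda>x. c * u x) = \<bar>c\<bar> * L2_norm S u" for u :: "_ \<Rightarrow> real"
  using L2_norm_scaleR[of S c u] by simp

lemma L2_norm_AE_cong:
  assumes "AE x in lebesgue_on S. u x = v x" "u \<in> L2_space S" "v \<in> L2_space S"
  shows "L2_norm S u = L2_norm S v"
  unfolding L2_norm_def L2_inner_def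
  using assms by (intro arg_cong[where f=sqrt] integral_cong_AE) (auto simp: L2_space_def)

lemma L2_inner_AE_cong:
  assumes "AE x in lebesgue_on S. u x = v x" "u \<in> L2_space S" "v \<in> L2_space S" "w \<in> L2_space S"
  shows "L2_inner S u w = L2_inner S v w"
  unfolding L2_inner_def
  using assms by (intro integral_cong_AE) (auto simp: L2_space_def)

lemma L2_space_mult_bounded:
  fixes f :: "'a::euclidean_space \<Rightarrow> real"
  assumes "u \<in> L2_space S" "f \<in> borel_measurable (lebesgue_on S)" "\<And>x. x \<in> S \<Longrightarrow> \<bar>f x\<bar> \<le> B"
  shows "(\<lambda>x. f x * u x) \<in> L2_space S"
proof -
  have [measurable]: "u \<in> borel_measurable (lebesgue_on S)" "f \<in> borel_measurable (lebesgue_on S)"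
    using assms by (simp_all add: L2_space_def)
  have "integrable (lebesgue_on S) (\<lambda>x. (norm (f x * u x))\<^sup>2)"
  proof (rule Bochner_Integration.integrable_bound)
    show "integrable (lebesgue_on S) (\<lambda>x. B\<^sup>2 * (norm (u x))\<^sup>2)"
      using assms by (simp add: L2_space_def)
    show "AE x in lebesgue_on S. norm ((norm (f x * u x))\<^sup>2) \<le> norm (B\<^sup>2 * (norm (u x))\<^sup>2)"
    proof (rule AE_I2)
      fix x assume "x \<in> space (lebesgue_on S)"
      then have "\<bar>f x\<bar>\<^sup>2 \<le> B\<^sup>2" using assms(3)[of x] by (intro power_mono) (auto simp: space_restrict_space)
      then show "norm ((norm (f x * u x))\<^sup>2) \<le> norm (B\<^sup>2 * (norm (u x))\<^sup>2)"
        by (simp add: abs_mult power_mult_distrib mult_right_mono)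
    qed
  qed measurable
  then show ?thesis by (simp add: L2_space_def)
qed

section \<open>Seminorms and dual spaces\<close>

text \<open>Vectors are real functions on an arbitrary type, and the axioms concern members of
  \<open>V\<close> only. A functional on such vectors is again a real function, so Sobolev spaces,
  their duals, Bochner spaces and the dual of \<open>Y_space\<close> are all instances of the same
  locale.\<close>

locale seminormed =
  fixes V :: "('b \<Rightarrow> real) set" and N :: "('b \<Rightarrow> real) \<Rightarrow> real"
  assumes zero_mem: "(\<lambda>_. 0) \<in> V"
    and add_mem: "u \<in> V \<Longrightarrow> v \<in> V \<Longrightarrow> (\<lambda>x. u x + v x) \<in> V"
    and scale_mem: "u \<in> V \<Longrightarrow> (\<lambda>x. c * u x) \<in> V"
    and N_nonneg: "u \<in> V \<Longrightarrow> 0 \<le> N u"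
    and N_triangle: "u \<in> V \<Longrightarrow> v \<in> V \<Longrightarrow> N (\<lambda>x. u x + v x) \<le> N u + N v"
    and N_scale: "u \<in> V \<Longrightarrow> N (\<lambda>x. c * u x) = \<bar>c\<bar> * N u"
begin

lemma N_zero: "N (\<lambda>_. 0) = 0"
  using N_scale[OF zero_mem, of 0] by simp

lemma diff_mem: "u \<in> V \<Longrightarrow> v \<in> V \<Longrightarrow> (\<lambda>x. u x - v x) \<in> V"
  using add_mem[OF _ scale_mem, of u v "-1"] by simp

lemma N_diff: "u \<in> V \<Longrightarrow> v \<in> V \<Longrightarrow> N (\<lambda>x. u x - v x) \<le> N u + N v"
  using N_triangle[OF _ scale_mem, of u v "-1"] N_scale[of v "-1"] by simp

lemma N_diff_commute: "u \<in> V \<Longrightarrow> v \<in> V \<Longrightarrow> N (\<lambda>x. u x - v x) = N (\<lambda>x. v x - u x)"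
  using N_scale[OF diff_mem, of u v "-1"] by simp

lemma N_diff_triangle:
  "u \<in> V \<Longrightarrow> v \<in> V \<Longrightarrow> w \<in> V \<Longrightarrow> N (\<lambda>x. u x - w x) \<le> N (\<lambda>x. u x - v x) + N (\<lambda>x. v x - w x)"
  using N_triangle[OF diff_mem diff_mem, of u v v w] by simp

lemma N_le_diff: "u \<in> V \<Longrightarrow> v \<in> V \<Longrightarrow> N u \<le> N v + N (\<lambda>x. u x - v x)"
  using N_triangle[OF _ diff_mem, of v u v] by simp

lemma N_abs_diff: "u \<in> V \<Longrightarrow> v \<in> V \<Longrightarrow> \<bar>N u - N v\<bar> \<le> N (\<lambda>x. u x - v x)"
  using N_le_diff[of u v] N_le_diff[of v u] N_diff_commute[of u v] by linarith

lemma N_tendsto: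
  assumes "\<And>k::nat. a k \<in> V" "u \<in> V" "(\<lambda>k. N (\<lambda>x. a k x - u x)) \<longlonglongrightarrow> 0"
  shows "(\<lambda>k. N (a k)) \<longlonglongrightarrow> N u"
proof -
  have "(\<lambda>k. N (a k) - N u) \<longlonglongrightarrow> 0"
    using assms N_abs_diff by (intro Lim_null_comparison[OF _ assms(3)]) (auto intro!: always_eventually)
  then show ?thesis by (simp add: LIM_zero_iff)
qed

lemma sum_mem: "finite A \<Longrightarrow> (\<And>i. i \<in> A \<Longrightarrow> f i \<in> V) \<Longrightarrow> (\<lambda>x. \<Sum>i\<in>A. f i x) \<in> V"
  by (induction rule: finite_induct) (auto intro: zero_mem add_mem)

lemma dual_bound_ex:
  assumes "F \<in> dual_space V N"
  obtains C where "0 \<le> C" "\<And>u. u \<in> V \<Longrightarrow> \<bar>F u\<bar> \<le> C * N u"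
proof -
  obtain C where C: "\<forall>u\<in>V. \<bar>F u\<bar> \<le> C * N u" using assms by (auto simp: dual_space_def)
  have "\<bar>F u\<bar> \<le> max C 0 * N u" if "u \<in> V" for u
    using C that N_nonneg[OF that] by (meson max.cobounded1 mult_right_mono order_trans)
  then show thesis using that[of "max C 0"] by simp
qed

lemma dual_norm_bdd:
  assumes "F \<in> dual_space V N"
  shows "bdd_above ((\<lambda>v. \<bar>F v\<bar> / N v) ` V)"
proof -
  obtain C where C: "0 \<le> C" "\<And>u. u \<in> V \<Longrightarrow> \<bar>F u\<bar> \<le> C * N u"
    using dual_bound_ex[OF assms] by blast
  have "\<bar>F u\<bar> / N u \<le> C" if "u \<in> V" for u
    using C(2)[OF that] N_nonneg[OF that] C(1) by (cases "N u = 0") (auto simp: divide_le_eq)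
  then show ?thesis by (auto intro!: bdd_aboveI2)
qed

lemma dual_norm_nonneg: "F \<in> dual_space V N \<Longrightarrow> 0 \<le> dual_norm V N F"
  unfolding dual_norm_def
  using cSUP_upper[OF zero_mem dual_norm_bdd] N_zero by fastforce

text \<open>Where \<open>N u\<close> is zero the quotient in \<open>dual_norm\<close> carries no
  information; there the boundedness of \<open>F\<close> forces \<open>F u = 0\<close>.\<close>

lemma dual_norm_bound:
  assumes F: "F \<in> dual_space V N" and u: "u \<in> V"
  shows "\<bar>F u\<bar> \<le> dual_norm V N F * N u"
proof (cases "N u = 0")
  case True
  then show ?thesis using dual_bound_ex[OF F] u by (metis mult_zero_right)
next
  case False
  have "\<bar>F u\<bar> / N u \<le> dual_norm V N F"
    unfolding dual_norm_def by (rule cSUP_upper[OF u dual_norm_bdd[OF F]])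
  then show ?thesis using False N_nonneg[OF u] by (simp add: divide_le_eq)
qed

lemma dual_norm_le:
  assumes "0 \<le> C" "\<And>u. u \<in> V \<Longrightarrow> \<bar>F u\<bar> \<le> C * N u"
  shows "dual_norm V N F \<le> C"
  unfolding dual_norm_def
proof (rule cSUP_least)
  show "V \<noteq> {}" using zero_mem by auto
  show "\<bar>F u\<bar> / N u \<le> C" if "u \<in> V" for u
    using assms(2)[OF that] N_nonneg[OF that] assms(1) by (cases "N u = 0") (auto simp: divide_le_eq)
qed

lemma dual_norm_cong: "(\<And>u. u \<in> V \<Longrightarrow> F u = G u) \<Longrightarrow> dual_norm V N F = dual_norm V N G"
  unfolding dual_norm_def by (auto intro!: arg_cong[where f=Sup] image_cong)

lemma dual_add: "F \<in> dual_space V N \<Longrightarrow> u \<in> V \<Longrightarrow> v \<in> V \<Longrightarrow> F (\<lambda>x. u x + v x) = F u + F v"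
  by (simp add: dual_space_def)

lemma dual_scale: "F \<in> dual_space V N \<Longrightarrow> u \<in> V \<Longrightarrow> F (\<lambda>x. c * u x) = c * F u"
  by (simp add: dual_space_def)

lemma dual_diff: "F \<in> dual_space V N \<Longrightarrow> u \<in> V \<Longrightarrow> v \<in> V \<Longrightarrow> F (\<lambda>x. u x - v x) = F u - F v"
  using dual_add[OF _ _ scale_mem, of F u v "-1"] dual_scale[of F v "-1"] by simp

lemma dual_zero: "F \<in> dual_space V N \<Longrightarrow> F (\<lambda>_. 0) = 0"
  using dual_scale[OF _ zero_mem, of F 0] by simp

lemma dual_seminormed: "seminormed (dual_space V N) (dual_norm V N)"
proof
  show "(\<lambda>_. 0) \<in> dual_space V N"
    by (auto simp: dual_space_def intro!: exI[of _ 0])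
  show add: "(\<lambda>x. F x + G x) \<in> dual_space V N" if F: "F \<in> dual_space V N" and G: "G \<in> dual_space V N" for F G
  proof -
    have "\<bar>F u + G u\<bar> \<le> (dual_norm V N F + dual_norm V N G) * N u" if "u \<in> V" for u
      using dual_norm_bound[OF F that] dual_norm_bound[OF G that] by (simp add: algebra_simps)
    then have "\<exists>C. \<forall>u\<in>V. \<bar>F u + G u\<bar> \<le> C * N u" by blast
    then show ?thesis using F G by (simp add: dual_space_def algebra_simps)
  qed
  show scale: "(\<lambda>x. c * F x) \<in> dual_space V N" if F: "F \<in> dual_space V N" for F c
  proof -
    have "\<bar>c * F u\<bar> \<le> (\<bar>c\<bar> * dual_norm V N F) * N u" if "u \<in> V" for u
      using dual_norm_bound[OF F that] by (simp add: abs_mult mult.assoc mult_left_mono)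
    then have "\<exists>C. \<forall>u\<in>V. \<bar>c * F u\<bar> \<le> C * N u" by blast
    then show ?thesis using F by (simp add: dual_space_def algebra_simps)
  qed
  show "0 \<le> dual_norm V N F" if "F \<in> dual_space V N" for F
    by (rule dual_norm_nonneg[OF that])
  show "dual_norm V N (\<lambda>x. F x + G x) \<le> dual_norm V N F + dual_norm V N G"
    if F: "F \<in> dual_space V N" and G: "G \<in> dual_space V N" for F G
  proof (rule dual_norm_le)
    show "0 \<le> dual_norm V N F + dual_norm V N G" using dual_norm_nonneg F G by simp
    show "\<bar>F u + G u\<bar> \<le> (dual_norm V N F + dual_norm V N G) * N u" if "u \<in> V" for u
      using dual_norm_bound[OF F that] dual_norm_bound[OF G that] by (simp add: algebra_simps)
  qed
  have le: "dual_norm V N (\<lambda>x. c * F x) \<le> \<bar>c\<bar> * dual_norm V N F" if F: "F \<in> dual_space V N" for F c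
  proof (rule dual_norm_le)
    show "0 \<le> \<bar>c\<bar> * dual_norm V N F" using dual_norm_nonneg F by simp
    show "\<bar>c * F u\<bar> \<le> (\<bar>c\<bar> * dual_norm V N F) * N u" if "u \<in> V" for u
      using dual_norm_bound[OF F that] by (simp add: abs_mult mult.assoc mult_left_mono)
  qed
  show "dual_norm V N (\<lambda>x. c * F x) = \<bar>c\<bar> * dual_norm V N F" if F: "F \<in> dual_space V N" for F c
  proof (cases "c = 0")
    case True
    have "dual_norm V N (\<lambda>x. 0) = 0"
      using le[OF F, of 0] dual_norm_nonneg[OF scale[OF F, of 0]] by simp
    then show ?thesis using True by simp
  next
    case False
    \<comment> \<open>The missing inequality is \<open>le\<close> for the factor
      \<open>inverse c\<close>, applied to the scaled functional.\<close>
    have "dual_norm V N (\<lambda>x. inverse c * (c * F x)) \<le> \<bar>inverse c\<bar> * dual_norm V N (\<lambda>x. c * F x)"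
      by (rule le[OF scale[OF F]])
    then have "\<bar>c\<bar> * dual_norm V N F \<le> dual_norm V N (\<lambda>x. c * F x)"
      using False by (simp add: field_simps flip: mult.assoc)
    then show ?thesis using le[OF F, of c] by simp
  qed
qed

text \<open>A vector whose quotient nearly reaches the supremum is normalised; if the dual norm is
  at most \<open>e\<close>, the zero vector already serves. Such vectors form the norming families
  for curves of functionals.\<close>

lemma dual_almost_attained:
  assumes F: "F \<in> dual_space V N" and "0 < e"
  shows "\<exists>w\<in>V. N w \<le> 1 \<and> dual_norm V N F - e \<le> \<bar>F w\<bar>"
proof (cases "dual_norm V N F - e \<le> 0")
  case True
  then show ?thesis using zero_mem N_zero dual_zero[OF F] by (intro bexI[of _ "\<lambda>_. 0"]) auto
next
  case False
  have "\<exists>w\<in>V. dual_norm V N F - e < \<bar>F w\<bar> / N w"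
    unfolding dual_norm_def
    using zero_mem \<open>0 < e\<close> dual_norm_bdd[OF F] by (subst less_cSUP_iff[symmetric]) auto
  then obtain w where w: "w \<in> V" "dual_norm V N F - e < \<bar>F w\<bar> / N w" by blast
  have Nw: "N w > 0"
    using w False N_nonneg[OF w(1)] by (cases "N w = 0") auto
  show ?thesis
    using w Nw scale_mem[OF w(1), of "1 / N w"] N_scale[OF w(1), of "1 / N w"] dual_scale[OF F w(1), of "1 / N w"]
    by (intro bexI[of _ "\<lambda>x. 1 / N w * w x"]) (auto simp: abs_mult)
qed

end

lemma seminormed_L2: "seminormed (L2_space S) (L2_norm S)"
  by standard (auto simp: L2_space_add L2_space_scale L2_norm_triangle L2_norm_scale)

section \<open>Simple functions and Bochner spaces\<close>

lemma AE_lebesgue_on_iff: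
  "S \<in> sets lebesgue \<Longrightarrow> (AE x in lebesgue_on S. P x) \<longleftrightarrow> (AE x in lebesgue. x \<in> S \<longrightarrow> P x)"
  by (rule AE_restrict_space_iff) simp

text \<open>Lebesgue measure is complete; the restriction to \<open>S\<close> is reduced to the
  whole space by extending functions by zero.\<close>

lemma borel_measurable_lebesgue_on_AE_cong:
  fixes f g :: "'a::euclidean_space \<Rightarrow> real"
  assumes S: "S \<in> sets lebesgue" and f: "f \<in> borel_measurable (lebesgue_on S)"
    and fg: "AE x in lebesgue_on S. f x = g x"
  shows "g \<in> borel_measurable (lebesgue_on S)"
proof -
  have *: "h \<in> borel_measurable (lebesgue_on S) \<longleftrightarrow> (\<lambda>x. indicat_real S x *\<^sub>R h x) \<in> borel_measurable lebesgue"
    for h :: "'a \<Rightarrow> real"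
    by (rule borel_measurable_restrict_space_iff) (simp add: S)
  have "AE x in lebesgue. indicat_real S x *\<^sub>R f x = indicat_real S x *\<^sub>R g x"
    using fg[unfolded AE_lebesgue_on_iff[OF S]] by eventually_elim (auto simp: indicator_def)
  then show ?thesis using f unfolding * by (rule borel_measurable_AE[rotated])
qed

text \<open>Convergence is only known almost everywhere, so the pointwise \<open>lim\<close>, which
  is measurable without exception, is modified on a null set.\<close>

lemma borel_measurable_lebesgue_on_LIMSEQ_AE:
  fixes f :: "nat \<Rightarrow> 'a::euclidean_space \<Rightarrow> real"
  assumes S: "S \<in> sets lebesgue" and f: "\<And>k. f k \<in> borel_measurable (lebesgue_on S)"
    and lim: "AE x in lebesgue_on S. (\<lambda>k. f k x) \<longlonglongrightarrow> g x"
  shows "g \<in> borel_measurable (lebesgue_on S)"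
proof (rule borel_measurable_lebesgue_on_AE_cong[OF S])
  show "(\<lambda>x. lim (\<lambda>k. f k x)) \<in> borel_measurable (lebesgue_on S)"
    by (intro borel_measurable_lim_metric f)
  show "AE x in lebesgue_on S. lim (\<lambda>k. f k x) = g x"
    using lim by eventually_elim (rule limI)
qed

text \<open>This is \<open>simple_into\<close> without the target space, for values of any type.
  Every map, measurable or not, can be composed with such functions, since the new level sets are
  finite unions of old ones.\<close>

definition finitely_valued :: "real \<Rightarrow> (real \<Rightarrow> 'c) \<Rightarrow> bool" where
  "finitely_valued T s \<longleftrightarrow> finite (s ` {0<..<T}) \<and> (\<forall>v. {t\<in>{0<..<T}. s t = v} \<in> sets lebesgue)"

lemma simple_into_iff: "simple_into T V s \<longleftrightarrow> finitely_valued T s \<and> s ` {0<..<T} \<subseteq> V"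
  by (auto simp: simple_into_def finitely_valued_def)

lemma simple_intoD: "simple_into T V s \<Longrightarrow> t \<in> {0<..<T} \<Longrightarrow> s t \<in> V"
  by (auto simp: simple_into_def)

lemma finitely_valued_comp:
  assumes "finitely_valued T s"
  shows "finitely_valued T (\<lambda>t. F (s t))"
proof -
  have "{t\<in>{0<..<T}. F (s t) = v} = (\<Union>y\<in>{y \<in> s ` {0<..<T}. F y = v}. {t\<in>{0<..<T}. s t = y})" for v
    by auto
  moreover have "(\<Union>y\<in>{y \<in> s ` {0<..<T}. F y = v}. {t\<in>{0<..<T}. s t = y}) \<in> sets lebesgue" for v
    using assms by (intro sets.finite_UN) (simp_all add: finitely_valued_def)
  moreover have "(\<lambda>t. F (s t)) ` {0<..<T} = F ` s ` {0<..<T}" by auto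
  ultimately show ?thesis using assms by (simp add: finitely_valued_def)
qed

lemma finitely_valued_Pair:
  assumes "finitely_valued T s" "finitely_valued T r"
  shows "finitely_valued T (\<lambda>t. (s t, r t))"
proof -
  have "{t\<in>{0<..<T}. (s t, r t) = v} = {t\<in>{0<..<T}. s t = fst v} \<inter> {t\<in>{0<..<T}. r t = snd v}" for v
    by auto
  moreover have "finite ((\<lambda>t. (s t, r t)) ` {0<..<T})"
    by (rule finite_subset[of _ "s ` {0<..<T} \<times> r ` {0<..<T}"])
      (use assms in \<open>auto simp: finitely_valued_def\<close>)
  ultimately show ?thesis
    using assms by (simp add: finitely_valued_def sets.Int)
qed

lemma finitely_valued_comp2:
  "finitely_valued T s \<Longrightarrow> finitely_valued T r \<Longrightarrow> finitely_valued T (\<lambda>t. F (s t) (r t))"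
  using finitely_valued_comp[OF finitely_valued_Pair, of T s r "case_prod F"] by simp

lemma finitely_valued_measurable_set:
  assumes "A \<in> sets lebesgue"
  shows "finitely_valued T (\<lambda>t. t \<in> A)"
proof -
  have "{t\<in>{0<..<T}. (t \<in> A) = v} = (if v then {0<..<T} \<inter> A else {0<..<T} - A)" for v by auto
  moreover have "finite ((\<lambda>t. t \<in> A) ` {0<..<T})" by (rule finite_subset[of _ UNIV]) auto
  ultimately show ?thesis using assms by (simp add: finitely_valued_def sets.Int sets.Diff)
qed

lemma finitely_valued_borel:
  fixes s :: "real \<Rightarrow> real"
  assumes "finitely_valued T s"
  shows "s \<in> borel_measurable (time_measure T)"
proof -
  have "simple_function (time_measure T) s"
    unfolding simple_function_def
  proof (intro conjI ballI)
    show "finite (s ` space (time_measure T))" using assms by (simp add: finitely_valued_def)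
    fix x
    have "s -` {x} \<inter> space (time_measure T) = {t\<in>{0<..<T}. s t = x}" by auto
    then show "s -` {x} \<inter> space (time_measure T) \<in> sets (time_measure T)"
      using assms by (subst sets_restrict_space_iff) (auto simp: finitely_valued_def)
  qed
  then show ?thesis by (rule borel_measurable_simple_function)
qed

lemma finitely_valued_bounded:
  fixes s :: "real \<Rightarrow> real"
  assumes "finitely_valued T s"
  obtains B where "0 \<le> B" "\<And>t. t \<in> {0<..<T} \<Longrightarrow> \<bar>s t\<bar> \<le> B"
proof -
  have "finite ((\<lambda>t. \<bar>s t\<bar>) ` {0<..<T})"
    using finitely_valued_comp[OF assms, of abs] by (simp add: finitely_valued_def)
  then obtain B where "\<And>t. t \<in> {0<..<T} \<Longrightarrow> \<bar>s t\<bar> \<le> B"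
    by (meson bdd_above_finite bdd_above.E image_eqI)
  then show thesis using that[of "max B 0"] by (meson max.cobounded1 max.cobounded2 order_trans)
qed

lemma integrable_bounded_lebesgue_on:
  fixes f :: "'a::euclidean_space \<Rightarrow> real"
  assumes "S \<in> lmeasurable" "f \<in> borel_measurable (lebesgue_on S)" "\<And>t. t \<in> S \<Longrightarrow> \<bar>f t\<bar> \<le> B"
  shows "integrable (lebesgue_on S) f"
proof (rule Bochner_Integration.integrable_bound)
  show "integrable (lebesgue_on S) (\<lambda>_. B)"
    using finite_measure.integrable_const[OF finite_measure_lebesgue_on[OF assms(1)]] .
  show "AE t in lebesgue_on S. norm (f t) \<le> norm B"
    using assms(3) by (intro AE_I2) force
qed (use assms in simp)

lemma bochner_L2E:
  assumes "u \<in> bochner_L2 T V N"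
  obtains a where "\<And>k. simple_into T V (a k)"
    "AE t in time_measure T. (\<lambda>k::nat. N (\<lambda>x. a k t x - u t x)) \<longlonglongrightarrow> 0"
  using assms unfolding bochner_L2_def by blast

lemma bochner_L2_AE: "u \<in> bochner_L2 T V N \<Longrightarrow> AE t in time_measure T. u t \<in> V"
  by (simp add: bochner_L2_def)

lemma bochner_L2I:
  assumes "AE t in time_measure T. u t \<in> V" "\<And>k. simple_into T V (a k)"
    "AE t in time_measure T. (\<lambda>k::nat. N (\<lambda>x. a k t x - u t x)) \<longlonglongrightarrow> 0"
    "integrable (time_measure T) (\<lambda>t. (N (u t))\<^sup>2)"
  shows "u \<in> bochner_L2 T V N"
  using assms unfolding bochner_L2_def by blast

text \<open>No measurable structure on \<open>V\<close> and \<open>W\<close> is involved: along the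
  approximating simple functions \<open>F\<close> takes finitely many values, and its sequential
  continuity carries measurability to the limit.\<close>

lemma bochner_measurable2:
  fixes F :: "('b \<Rightarrow> real) \<Rightarrow> ('c \<Rightarrow> real) \<Rightarrow> real"
  assumes u: "u \<in> bochner_L2 T V N" and v: "v \<in> bochner_L2 T W M"
    and lim: "\<And>x y a b. x \<in> V \<Longrightarrow> y \<in> W \<Longrightarrow> (\<And>k. a k \<in> V) \<Longrightarrow> (\<And>k. b k \<in> W) \<Longrightarrow>
      (\<lambda>k::nat. N (\<lambda>z. a k z - x z)) \<longlonglongrightarrow> 0 \<Longrightarrow> (\<lambda>k. M (\<lambda>z. b k z - y z)) \<longlonglongrightarrow> 0 \<Longrightarrow>
      (\<lambda>k. F (a k) (b k)) \<longlonglongrightarrow> F x y"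
  shows "(\<lambda>t. F (u t) (v t)) \<in> borel_measurable (time_measure T)"
proof -
  obtain a where a: "\<And>k. simple_into T V (a k)"
    "AE t in time_measure T. (\<lambda>k::nat. N (\<lambda>x. a k t x - u t x)) \<longlonglongrightarrow> 0"
    using bochner_L2E[OF u] by blast
  obtain b where b: "\<And>k. simple_into T W (b k)"
    "AE t in time_measure T. (\<lambda>k::nat. M (\<lambda>x. b k t x - v t x)) \<longlonglongrightarrow> 0"
    using bochner_L2E[OF v] by blast
  have uv: "AE t in time_measure T. u t \<in> V" "AE t in time_measure T. v t \<in> W"
    using u v by (auto intro: bochner_L2_AE)
  have sp: "AE t in time_measure T. t \<in> {0<..<T}" by (rule AE_I2) simp
  show ?thesis
  proof (rule borel_measurable_lebesgue_on_LIMSEQ_AE[where f="\<lambda>k t. F (a k t) (b k t)"])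
    show "{0<..<T} \<in> sets lebesgue" by simp
    show "(\<lambda>t. F (a k t) (b k t)) \<in> borel_measurable (time_measure T)" for k
      using a(1)[of k] b(1)[of k] finitely_valued_borel[OF finitely_valued_comp2, of T "a k" "b k" F]
      by (simp add: simple_into_iff)
    show "AE t in time_measure T. (\<lambda>k. F (a k t) (b k t)) \<longlonglongrightarrow> F (u t) (v t)"
      using a(2) b(2) uv sp
    proof eventually_elim
      case (elim t)
      have "a k t \<in> V" "b k t \<in> W" for k
        using simple_intoD[OF a(1)] simple_intoD[OF b(1)] elim(5) by auto
      then show ?case using elim by (intro lim)
    qed
  qed
qed

context seminormed
begin

lemma simple_into_bochner:
  assumes s: "simple_into T V s"
  shows "s \<in> bochner_L2 T V N"
proof -
  have fv: "finitely_valued T (\<lambda>t. (N (s t))\<^sup>2)" and sV: "\<And>t. t \<in> {0<..<T} \<Longrightarrow> s t \<in> V"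
    using s finitely_valued_comp[of T s "\<lambda>v. (N v)\<^sup>2"] by (auto simp: simple_into_iff)
  have "integrable (time_measure T) (\<lambda>t. (N (s t))\<^sup>2)"
    using finitely_valued_bounded[OF fv] integrable_bounded_lebesgue_on[OF _ finitely_valued_borel[OF fv]]
    by (metis lmeasurable_interval(2))
  moreover have "AE t in time_measure T. s t \<in> V" using sV by (intro AE_I2) simp
  ultimately show ?thesis
    using s N_zero by (intro bochner_L2I[where a="\<lambda>_. s"]) auto
qed

lemma bochner_measurable1:
  fixes F :: "('b \<Rightarrow> real) \<Rightarrow> real"
  assumes u: "u \<in> bochner_L2 T V N"
    and lim: "\<And>x a. x \<in> V \<Longrightarrow> (\<And>k. a k \<in> V) \<Longrightarrow> (\<lambda>k::nat. N (\<lambda>z. a k z - x z)) \<longlonglongrightarrow> 0 \<Longrightarrow>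
      (\<lambda>k. F (a k)) \<longlonglongrightarrow> F x"
  shows "(\<lambda>t. F (u t)) \<in> borel_measurable (time_measure T)"
  by (rule bochner_measurable2[OF u u]) (rule lim)

lemma bochner_N_measurable: "u \<in> bochner_L2 T V N \<Longrightarrow> (\<lambda>t. N (u t)) \<in> borel_measurable (time_measure T)"
  by (rule bochner_measurable1) (auto intro: N_tendsto)

lemma bochner_N_L2: "u \<in> bochner_L2 T V N \<Longrightarrow> (\<lambda>t. N (u t)) \<in> L2_space {0<..<T}"
  using bochner_N_measurable[of u T] by (auto simp: L2_space_def bochner_L2_def)

lemma bochner_add:
  assumes u: "u \<in> bochner_L2 T V N" and v: "v \<in> bochner_L2 T V N"
  shows "(\<lambda>t x. u t x + v t x) \<in> bochner_L2 T V N"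
proof -
  obtain a where a: "\<And>k. simple_into T V (a k)"
    "AE t in time_measure T. (\<lambda>k::nat. N (\<lambda>x. a k t x - u t x)) \<longlonglongrightarrow> 0"
    using bochner_L2E[OF u] by blast
  obtain b where b: "\<And>k. simple_into T V (b k)"
    "AE t in time_measure T. (\<lambda>k::nat. N (\<lambda>x. b k t x - v t x)) \<longlonglongrightarrow> 0"
    using bochner_L2E[OF v] by blast
  have uv: "AE t in time_measure T. u t \<in> V" "AE t in time_measure T. v t \<in> V"
    using u v by (auto intro: bochner_L2_AE)
  have sp: "AE t in time_measure T. t \<in> {0<..<T}" by (rule AE_I2) simp
  have abV: "a k t \<in> V" "b k t \<in> V" if "t \<in> {0<..<T}" for k t
    using simple_intoD[OF a(1) that] simple_intoD[OF b(1) that] by auto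
  have tri: "N (\<lambda>x. (p x + q x) - (y x + z x)) \<le> N (\<lambda>x. p x - y x) + N (\<lambda>x. q x - z x)"
    if "p \<in> V" "q \<in> V" "y \<in> V" "z \<in> V" for p q y z
    using N_triangle[OF diff_mem diff_mem, of p y q z] that by (simp add: algebra_simps)
  have "simple_into T V (\<lambda>t x. a k t x + b k t x)" for k
    using a(1)[of k] b(1)[of k] abV
      finitely_valued_comp2[of T "a k" "b k" "\<lambda>p q x. p x + q x"]
    by (auto simp: simple_into_iff add_mem)
  moreover have "AE t in time_measure T. (\<lambda>k. N (\<lambda>x. (a k t x + b k t x) - (u t x + v t x))) \<longlonglongrightarrow> 0"
    using a(2) b(2) uv sp
  proof eventually_elim
    case (elim t)
    have "(\<lambda>k. N (\<lambda>x. a k t x - u t x) + N (\<lambda>x. b k t x - v t x)) \<longlonglongrightarrow> 0"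
      using tendsto_add[OF elim(1,2)] by simp
    then show ?case
      by (rule Lim_null_comparison[rotated])
        (use elim abV in \<open>auto intro!: always_eventually tri simp: N_nonneg add_mem diff_mem\<close>)
  qed
  moreover have "integrable (time_measure T) (\<lambda>t. (N (\<lambda>x. u t x + v t x))\<^sup>2)"
  proof (rule Bochner_Integration.integrable_bound)
    have "(\<lambda>t. N (u t) + N (v t)) \<in> L2_space {0<..<T}"
      using bochner_N_L2 u v by (intro L2_space_add)
    then show "integrable (time_measure T) (\<lambda>t. (N (u t) + N (v t))\<^sup>2)" by (simp add: L2_space_def)
    \<comment> \<open>The norm of a sum is no function of the two norms, so its measurability is
      derived from the continuity of addition.\<close>
    have "(\<lambda>t. N (\<lambda>x. u t x + v t x)) \<in> borel_measurable (time_measure T)"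
    proof (rule bochner_measurable2[OF u v])
      fix x y a b
      assume h: "x \<in> V" "y \<in> V" "\<And>k. a k \<in> V" "\<And>k. b k \<in> V"
        "(\<lambda>k::nat. N (\<lambda>z. a k z - x z)) \<longlonglongrightarrow> 0" "(\<lambda>k. N (\<lambda>z. b k z - y z)) \<longlonglongrightarrow> 0"
      have "(\<lambda>k. N (\<lambda>z. (a k z + b k z) - (x z + y z))) \<longlonglongrightarrow> 0"
        using tendsto_add[OF h(5,6)] h
        by (intro Lim_null_comparison[OF _ tendsto_add[OF h(5,6), simplified]])
          (auto intro!: always_eventually tri simp: N_nonneg add_mem diff_mem)
      then show "(\<lambda>k. N (\<lambda>z. a k z + b k z)) \<longlonglongrightarrow> N (\<lambda>z. x z + y z)"
        using h by (intro N_tendsto) (auto intro: add_mem)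
    qed
    then show "(\<lambda>t. (N (\<lambda>x. u t x + v t x))\<^sup>2) \<in> borel_measurable (time_measure T)" by simp
    show "AE t in time_measure T. norm ((N (\<lambda>x. u t x + v t x))\<^sup>2) \<le> norm ((N (u t) + N (v t))\<^sup>2)"
      using uv by eventually_elim (auto intro!: power_mono N_triangle N_nonneg add_mem)
  qed
  moreover have "AE t in time_measure T. (\<lambda>x. u t x + v t x) \<in> V"
    using uv by eventually_elim (rule add_mem)
  ultimately show ?thesis by (intro bochner_L2I[where a="\<lambda>k t x. a k t x + b k t x"])
qed

lemma bochner_scale:
  assumes u: "u \<in> bochner_L2 T V N"
  shows "(\<lambda>t x. c * u t x) \<in> bochner_L2 T V N"
proof -
  obtain a where a: "\<And>k. simple_into T V (a k)"
    "AE t in time_measure T. (\<lambda>k::nat. N (\<lambda>x. a k t x - u t x)) \<longlonglongrightarrow> 0"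
    using bochner_L2E[OF u] by blast
  have uV: "AE t in time_measure T. u t \<in> V" by (rule bochner_L2_AE[OF u])
  have sp: "AE t in time_measure T. t \<in> {0<..<T}" by (rule AE_I2) simp
  have aV: "a k t \<in> V" if "t \<in> {0<..<T}" for k t
    using simple_intoD[OF a(1) that] .
  have "simple_into T V (\<lambda>t x. c * a k t x)" for k
    using a(1)[of k] aV finitely_valued_comp[of T "a k" "\<lambda>p x. c * p x"]
    by (auto simp: simple_into_iff scale_mem)
  moreover have "AE t in time_measure T. (\<lambda>k. N (\<lambda>x. c * a k t x - c * u t x)) \<longlonglongrightarrow> 0"
    using a(2) uV sp
  proof eventually_elim
    case (elim t)
    have "N (\<lambda>x. c * a k t x - c * u t x) = \<bar>c\<bar> * N (\<lambda>x. a k t x - u t x)" for k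
      using N_scale[OF diff_mem, of "a k t" "u t" c] elim aV by (simp add: algebra_simps)
    then show ?case using tendsto_mult_left[OF elim(1), of "\<bar>c\<bar>"] by simp
  qed
  moreover have "integrable (time_measure T) (\<lambda>t. (N (\<lambda>x. c * u t x))\<^sup>2)"
  proof -
    have "integrable (time_measure T) (\<lambda>t. c\<^sup>2 * (N (u t))\<^sup>2)" using u by (simp add: bochner_L2_def)
    moreover have "(\<lambda>t. N (\<lambda>x. c * u t x)) \<in> borel_measurable (time_measure T)"
    proof (rule borel_measurable_lebesgue_on_AE_cong)
      show "(\<lambda>t. \<bar>c\<bar> * N (u t)) \<in> borel_measurable (time_measure T)"
        using bochner_N_measurable[OF u] by simp
      show "AE t in time_measure T. \<bar>c\<bar> * N (u t) = N (\<lambda>x. c * u t x)"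
        using uV by eventually_elim (simp add: N_scale)
    qed simp
    moreover have "AE t in time_measure T. c\<^sup>2 * (N (u t))\<^sup>2 = (N (\<lambda>x. c * u t x))\<^sup>2"
      using uV by eventually_elim (simp add: N_scale power_mult_distrib)
    ultimately show ?thesis
      using bochner_N_measurable[OF u] by (subst integrable_cong_AE[symmetric]) auto
  qed
  moreover have "AE t in time_measure T. (\<lambda>x. c * u t x) \<in> V"
    using uV by eventually_elim (rule scale_mem)
  ultimately show ?thesis by (intro bochner_L2I[where a="\<lambda>k t x. c * a k t x"])
qed

lemma bochner_diff:
  "u \<in> bochner_L2 T V N \<Longrightarrow> v \<in> bochner_L2 T V N \<Longrightarrow> (\<lambda>t x. u t x - v t x) \<in> bochner_L2 T V N"
  using bochner_add[OF _ bochner_scale, of u T v "-1"] by simp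

lemma bochner_sum:
  "finite A \<Longrightarrow> (\<And>i. i \<in> A \<Longrightarrow> u i \<in> bochner_L2 T V N) \<Longrightarrow> (\<lambda>t x. \<Sum>i\<in>A. u i t x) \<in> bochner_L2 T V N"
proof (induction rule: finite_induct)
  case empty
  have "simple_into T V (\<lambda>_ _. 0)"
    using zero_mem finitely_valued_comp[OF finitely_valued_measurable_set[of "{}" T], of "\<lambda>_ _. 0"]
    by (auto simp: simple_into_iff)
  then show ?case using simple_into_bochner by simp
next
  case (insert i A)
  then show ?case using bochner_add[of "u i" T "\<lambda>t x. \<Sum>i\<in>A. u i t x"] by simp
qed

text \<open>Truncation turns convergence almost everywhere into convergence in the mean square: an
  approximant is replaced by zero wherever its norm exceeds twice that of \<open>u t\<close>. The
  distance to \<open>u t\<close> is then dominated by \<open>3 * N (u t)\<close>.\<close>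

lemma bochner_density:
  assumes u: "u \<in> bochner_L2 T V N"
  obtains s where "\<And>k::nat. simple_into T V (s k)"
    "(\<lambda>k. LINT t|time_measure T. (N (\<lambda>x. s k t x - u t x))\<^sup>2) \<longlonglongrightarrow> 0"
proof -
  obtain a where a: "\<And>k. simple_into T V (a k)"
    "AE t in time_measure T. (\<lambda>k::nat. N (\<lambda>x. a k t x - u t x)) \<longlonglongrightarrow> 0"
    using bochner_L2E[OF u] by blast
  have uV: "AE t in time_measure T. u t \<in> V" by (rule bochner_L2_AE[OF u])
  have sp: "AE t in time_measure T. t \<in> {0<..<T}" by (rule AE_I2) simp
  have aV: "a k t \<in> V" if "t \<in> {0<..<T}" for k t
    using simple_intoD[OF a(1) that] .
  define A where "A k = {t\<in>{0<..<T}. N (a k t) \<le> 2 * N (u t)}" for k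
  have A: "A k \<in> sets lebesgue" for k
  proof -
    have [measurable]: "(\<lambda>t. N (a k t)) \<in> borel_measurable (time_measure T)"
      "(\<lambda>t. N (u t)) \<in> borel_measurable (time_measure T)"
      using bochner_N_measurable u simple_into_bochner[OF a(1)] by auto
    have "{t\<in>space (time_measure T). N (a k t) \<le> 2 * N (u t)} \<in> sets (time_measure T)" by measurable
    then show ?thesis unfolding A_def by (subst (asm) sets_restrict_space_iff) auto
  qed
  define s where "s = (\<lambda>k t. if t \<in> A k then a k t else (\<lambda>_. 0))"
  have s: "simple_into T V (s k)" for k
    using a(1)[of k] zero_mem finitely_valued_comp2[OF finitely_valued_measurable_set[OF A[of k]], of T "a k" "\<lambda>b v. if b then v else (\<lambda>_. 0)"]
    by (auto simp: simple_into_iff s_def)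
  have bd: "N (\<lambda>x. s k t x - u t x) \<le> 3 * N (u t)" if "t \<in> {0<..<T}" "u t \<in> V" for k t
    using N_diff[OF aV that(2), of t k] that N_diff[OF zero_mem that(2)] N_zero N_nonneg[OF that(2)]
    by (auto simp: s_def A_def)
  have lim: "AE t in time_measure T. (\<lambda>k. (N (\<lambda>x. s k t x - u t x))\<^sup>2) \<longlonglongrightarrow> 0"
    using a(2) uV sp
  proof eventually_elim
    case (elim t)
    have sV: "s k t \<in> V" for k using simple_intoD[OF s elim(3)] .
    have "(\<lambda>k. N (\<lambda>x. s k t x - u t x)) \<longlonglongrightarrow> 0"
    \<comment> \<open>If \<open>N (u t)\<close> vanishes, the truncation may be active for every
      \<open>k\<close>, but then \<open>bd\<close> already gives zero. Otherwise it is inactive from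
      some \<open>k\<close> on.\<close>
    proof (cases "N (u t) = 0")
      case True
      have "N (\<lambda>x. s k t x - u t x) = 0" for k
        using bd[OF elim(3,2), of k] N_nonneg[OF diff_mem[OF sV elim(2)], of k] True by simp
      then show ?thesis by simp
    next
      case False
      have "(\<lambda>k. N (a k t)) \<longlonglongrightarrow> N (u t)" using elim aV by (intro N_tendsto) auto
      moreover have "N (u t) < 2 * N (u t)" using False N_nonneg[OF elim(2)] by simp
      ultimately have "\<forall>\<^sub>F k in sequentially. N (a k t) < 2 * N (u t)"
        by (rule order_tendstoD)
      then have "\<forall>\<^sub>F k in sequentially. N (\<lambda>x. a k t x - u t x) = N (\<lambda>x. s k t x - u t x)"
        by eventually_elim (use elim in \<open>simp add: s_def A_def\<close>)
      then show ?thesis using elim(1) Lim_transform_eventually by fastforce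
    qed
    then show ?case by (metis tendsto_power zero_power2)
  qed
  have meas: "(\<lambda>t. (N (\<lambda>x. s k t x - u t x))\<^sup>2) \<in> borel_measurable (time_measure T)" for k
    using bochner_N_measurable[OF bochner_diff[OF simple_into_bochner[OF s] u]] by simp
  have "(\<lambda>k. LINT t|time_measure T. (N (\<lambda>x. s k t x - u t x))\<^sup>2) \<longlonglongrightarrow> (LINT t|time_measure T. 0)"
  proof (rule integral_dominated_convergence)
    show "integrable (time_measure T) (\<lambda>t. 9 * (N (u t))\<^sup>2)" using u by (simp add: bochner_L2_def)
    show "AE t in time_measure T. norm ((N (\<lambda>x. s k t x - u t x))\<^sup>2) \<le> 9 * (N (u t))\<^sup>2" for k
      using uV sp
    proof eventually_elim
      case (elim t)
      have "s k t \<in> V" using simple_intoD[OF s elim(2)] .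
      then have "(N (\<lambda>x. s k t x - u t x))\<^sup>2 \<le> (3 * N (u t))\<^sup>2"
        using bd elim by (intro power_mono N_nonneg diff_mem) auto
      then show ?case by (simp add: power_mult_distrib)
    qed
  qed (use meas lim in auto)
  then show thesis by (intro that[OF s]) simp
qed

end

section \<open>Test functions\<close>

lemma frechet_derivative_eqI: "(f has_derivative f') (at x) \<Longrightarrow> frechet_derivative f (at x) = f'"
  using frechet_derivative_at by metis

text \<open>\<open>C_k\<close> peels off one derivative per level, so a family closed under partial
  derivatives passes every level at once.\<close>

lemma C_k_coinduct:
  assumes "f \<in> S"
    and diff: "\<And>f x. f \<in> S \<Longrightarrow> f differentiable (at x)"
    and deriv: "\<And>f i. f \<in> S \<Longrightarrow> i \<in> Basis \<Longrightarrow> (\<lambda>x. frechet_derivative f (at x) i) \<in> S"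
  shows "C_k k f"
  using assms(1)
proof (induction k arbitrary: f)
  case 0
  then show ?case
    using differentiable_imp_continuous_within[OF diff[OF 0]] by (auto simp: continuous_on_eq_continuous_within)
next
  case (Suc k)
  then show ?case using diff deriv by auto
qed

lemma C_k_add: "C_k k f \<Longrightarrow> C_k k g \<Longrightarrow> C_k k (\<lambda>x. f x + g x)"
proof (induction k arbitrary: f g)
  case 0
  then show ?case by (auto intro: continuous_on_add)
next
  case (Suc k)
  have "frechet_derivative (\<lambda>x. f x + g x) (at x) = (\<lambda>h. frechet_derivative f (at x) h + frechet_derivative g (at x) h)" for x
    using Suc.prems frechet_derivative_works by (intro frechet_derivative_eqI has_derivative_add) auto
  then show ?case using Suc by (auto intro: differentiable_add)
qed

lemma C_k_scale: "C_k k f \<Longrightarrow> C_k k (\<lambda>x. c * f x)"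
proof (induction k arbitrary: f)
  case 0
  then show ?case by (auto intro: continuous_intros)
next
  case (Suc k)
  have "frechet_derivative (\<lambda>x. c * f x) (at x) = (\<lambda>h. c * frechet_derivative f (at x) h)" for x
    using Suc.prems frechet_derivative_works by (intro frechet_derivative_eqI has_derivative_mult_right) auto
  then show ?case using Suc by (auto intro: differentiable_mult)
qed

lemma test_functionsI:
  assumes "\<And>k. C_k k f" "compact K" "K \<subseteq> S" "\<And>x. x \<notin> K \<Longrightarrow> f x = 0"
  shows "f \<in> test_functions S"
proof -
  have "closure {x. f x \<noteq> 0} \<subseteq> K"
    using assms(2,4) by (intro closure_minimal) (auto intro: compact_imp_closed)
  then show ?thesis
    using assms closed_Int_compact[OF closed_closure assms(2), of "{x. f x \<noteq> 0}"]
    by (auto simp: test_functions_def Int_absorb2)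
qed

lemma test_functions_zero: "(\<lambda>_. 0) \<in> test_functions S"
proof (rule test_functionsI[where K="{}"])
  show "C_k k (\<lambda>_. 0)" for k
    by (rule C_k_coinduct[where S="{\<lambda>_. 0}"]) auto
qed auto

lemma test_functions_add:
  assumes "f \<in> test_functions S" "g \<in> test_functions S"
  shows "(\<lambda>x. f x + g x) \<in> test_functions S"
proof (rule test_functionsI)
  let ?K = "closure {x. f x \<noteq> 0} \<union> closure {x. g x \<noteq> 0}"
  show "C_k k (\<lambda>x. f x + g x)" for k using assms by (intro C_k_add) (auto simp: test_functions_def)
  show "compact ?K" "?K \<subseteq> S" using assms by (auto simp: test_functions_def simp del: compact_closure)
  show "f x + g x = 0" if "x \<notin> ?K" for x
  proof -
    have "f x = 0" using that closure_subset[of "{x. f x \<noteq> 0}"] by blast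
    moreover have "g x = 0" using that closure_subset[of "{x. g x \<noteq> 0}"] by blast
    ultimately show ?thesis by simp
  qed
qed

lemma test_functions_scale:
  assumes "f \<in> test_functions S"
  shows "(\<lambda>x. c * f x) \<in> test_functions S"
  by (rule test_functionsI[where K="closure {x. f x \<noteq> 0}"])
    (use assms closure_subset[of "{x. f x \<noteq> 0}"] in \<open>auto simp: test_functions_def intro!: C_k_scale\<close>)

lemma test_functions_mono: "S \<subseteq> R \<Longrightarrow> test_functions S \<subseteq> test_functions R"
  by (auto simp: test_functions_def)

lemma test_functions_zero_outside: "f \<in> test_functions S \<Longrightarrow> x \<notin> S \<Longrightarrow> f x = 0"
  using closure_subset[of "{x. f x \<noteq> 0}"] by (auto simp: test_functions_def)

text \<open>The classical smooth function exp(-1/t), continued by zero, divided by a power of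
  \<open>t\<close>. With the powers included, derivatives are combinations of members of the same
  family.\<close>

definition flat_exp :: "nat \<Rightarrow> real \<Rightarrow> real" where
  "flat_exp m t = (if 0 < t then exp (- 1 / t) / t ^ m else 0)"

lemma flat_exp_tendsto_0: "(flat_exp m \<longlongrightarrow> 0) (at 0)"
proof -
  \<comment> \<open>Under \<open>x = 1 / t\<close> the limit at 0 from the right becomes the decay
    of a power against the exponential at infinity.\<close>
  have "((\<lambda>x. x ^ m / exp x) \<longlongrightarrow> (0::real)) at_top" by (rule tendsto_power_div_exp_0)
  then have "((\<lambda>t. (inverse t) ^ m / exp (inverse t)) \<longlongrightarrow> (0::real)) (at_right 0)"
    by (rule filterlim_compose) (rule filterlim_inverse_at_top_right)
  then have right: "(flat_exp m \<longlongrightarrow> 0) (at_right 0)"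
  proof (rule Lim_transform_eventually)
    show "\<forall>\<^sub>F t in at_right 0. (inverse t) ^ m / exp (inverse t) = flat_exp m t"
      by (rule eventually_at_right_less[THEN eventually_mono])
        (simp add: flat_exp_def exp_minus field_simps)
  qed
  have "(flat_exp m \<longlongrightarrow> 0) (at_left 0)"
    by (rule tendsto_eventually) (auto simp: eventually_at_filter flat_exp_def)
  then show ?thesis using right by (simp add: filterlim_at_split)
qed

lemma flat_exp_has_derivative:
  "(flat_exp m has_real_derivative (flat_exp (m + 2) t - real m * flat_exp (m + 1) t)) (at t)"
proof -
  consider "t > 0" | "t < 0" | "t = 0" by linarith
  then show ?thesis
  proof cases
    case 1
    let ?s = "inverse t"
    have "((\<lambda>t. exp (- inverse t) * inverse t ^ m) has_real_derivative
        (exp (- ?s) * ?s\<^sup>2 * ?s ^ m + exp (- ?s) * (real m * ?s ^ (m - 1) * (- ?s\<^sup>2)))) (at t)"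
      using 1 by (auto intro!: derivative_eq_intros simp: power2_eq_square)
    also have "exp (- ?s) * ?s\<^sup>2 * ?s ^ m + exp (- ?s) * (real m * ?s ^ (m - 1) * (- ?s\<^sup>2)) =
        exp (- ?s) * ?s ^ (m + 2) - real m * (exp (- ?s) * ?s ^ (m + 1))"
      by (cases m) (simp_all add: power2_eq_square algebra_simps)
    also have "\<dots> = flat_exp (m + 2) t - real m * flat_exp (m + 1) t"
      using 1 by (simp add: flat_exp_def divide_inverse power_inverse)
    finally have "((\<lambda>t. exp (- inverse t) * inverse t ^ m) has_real_derivative
        (flat_exp (m + 2) t - real m * flat_exp (m + 1) t)) (at t)" .
    then show ?thesis
      by (rule has_field_derivative_transform_within_open[where S="{0<..}"])
        (use 1 in \<open>auto simp: flat_exp_def divide_inverse power_inverse\<close>)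
  next
    case 2
    have "((\<lambda>_. 0) has_real_derivative (flat_exp (m + 2) t - real m * flat_exp (m + 1) t)) (at t)"
      using 2 by (simp add: flat_exp_def)
    then show ?thesis
      by (rule has_field_derivative_transform_within_open[where S="{..<0}"]) (use 2 in \<open>auto simp: flat_exp_def\<close>)
  next
    case 3
    \<comment> \<open>At 0 the difference quotient of \<open>flat_exp m\<close> is
      \<open>flat_exp (m + 1)\<close>, which is already known to tend to zero.\<close>
    have "((\<lambda>h. (flat_exp m (0 + h) - flat_exp m 0) / h) \<longlongrightarrow> 0) (at 0)"
      by (rule Lim_transform_eventually[OF flat_exp_tendsto_0[of "m + 1"]])
        (auto simp: flat_exp_def eventually_at_filter)
    then show ?thesis using 3 by (simp add: DERIV_def flat_exp_def)
  qed
qed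

lemma flat_exp_0_bounds: "0 \<le> flat_exp 0 t" "flat_exp 0 t \<le> 1"
  by (auto simp: flat_exp_def)

lemma flat_exp_0_tendsto_1:
  assumes "0 < t"
  shows "(\<lambda>k. flat_exp 0 (real (Suc k) * t)) \<longlonglongrightarrow> 1"
proof -
  have "(\<lambda>k. exp (- (1 / t) * inverse (real (Suc k)))) \<longlonglongrightarrow> exp (- (1 / t) * 0)"
    by (intro tendsto_intros LIMSEQ_inverse_real_of_nat)
  moreover have "exp (- (1 / t) * inverse (real (Suc k))) = flat_exp 0 (real (Suc k) * t)" for k
    using assms by (simp add: flat_exp_def inverse_eq_divide)
  ultimately show ?thesis by simp
qed

text \<open>An algebra generated by \<open>flat_exp\<close> of affine functions of one linear
  coordinate. It contains the bumps below and is closed under directional derivatives, so that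
  \<open>C_k_coinduct\<close> gives smoothness.\<close>

inductive_set smooth_gen :: "('a::euclidean_space \<Rightarrow> real) set" where
  const: "(\<lambda>_. c) \<in> smooth_gen"
| flat: "(\<lambda>x. flat_exp m (\<alpha> * (x \<bullet> i) + \<beta>)) \<in> smooth_gen"
| add: "f \<in> smooth_gen \<Longrightarrow> g \<in> smooth_gen \<Longrightarrow> (\<lambda>x. f x + g x) \<in> smooth_gen"
| mult: "f \<in> smooth_gen \<Longrightarrow> g \<in> smooth_gen \<Longrightarrow> (\<lambda>x. f x * g x) \<in> smooth_gen"

lemma smooth_gen_has_derivative:
  "f \<in> smooth_gen \<Longrightarrow>
    \<exists>f'. (\<forall>x. (f has_derivative f' x) (at x)) \<and> (\<forall>i. (\<lambda>x. f' x i) \<in> smooth_gen)"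
proof (induction rule: smooth_gen.induct)
  case (const c)
  show ?case by (rule exI[of _ "\<lambda>_ _. 0"]) (auto intro: smooth_gen.const)
next
  case (flat m \<alpha> i \<beta>)
  let ?D = "\<lambda>t. flat_exp (m + 2) t - real m * flat_exp (m + 1) t"
  have "((\<lambda>x. flat_exp m (\<alpha> * (x \<bullet> i) + \<beta>)) has_derivative
      (\<lambda>h. ?D (\<alpha> * (x \<bullet> i) + \<beta>) * (\<alpha> * (h \<bullet> i)))) (at x)" for x :: 'a
    by (rule has_derivative_compose[where g="flat_exp m", OF _ flat_exp_has_derivative[unfolded has_field_derivative_def]])
      (auto intro!: derivative_eq_intros)
  moreover have "(\<lambda>x. ?D (\<alpha> * (x \<bullet> i) + \<beta>) * (\<alpha> * (h \<bullet> i))) \<in> smooth_gen" for h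
  proof -
    have "(\<lambda>x. flat_exp (m + 2) (\<alpha> * (x \<bullet> i) + \<beta>) * (\<alpha> * (h \<bullet> i))
        + flat_exp (m + 1) (\<alpha> * (x \<bullet> i) + \<beta>) * (- real m * (\<alpha> * (h \<bullet> i)))) \<in> smooth_gen"
      by (intro smooth_gen.intros)
    then show ?thesis by (simp add: algebra_simps)
  qed
  ultimately show ?case
    by (intro exI[of _ "\<lambda>x h. ?D (\<alpha> * (x \<bullet> i) + \<beta>) * (\<alpha> * (h \<bullet> i))"]) blast
next
  case (add f g)
  then obtain f' g' where "\<forall>x. (f has_derivative f' x) (at x)" "\<forall>i. (\<lambda>x. f' x i) \<in> smooth_gen"
    "\<forall>x. (g has_derivative g' x) (at x)" "\<forall>i. (\<lambda>x. g' x i) \<in> smooth_gen" by blast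
  then show ?case
    by (intro exI[of _ "\<lambda>x h. f' x h + g' x h"]) (auto intro: has_derivative_add smooth_gen.add)
next
  case (mult f g)
  then obtain f' g' where d: "\<And>x. (f has_derivative f' x) (at x)" "\<And>i. (\<lambda>x. f' x i) \<in> smooth_gen"
    "\<And>x. (g has_derivative g' x) (at x)" "\<And>i. (\<lambda>x. g' x i) \<in> smooth_gen" by blast
  show ?case
    by (intro exI[of _ "\<lambda>x h. f x * g' x h + f' x h * g x"] conjI allI has_derivative_mult d
        smooth_gen.add smooth_gen.mult mult.hyps)
qed

lemma smooth_gen_C_k:
  assumes "f \<in> smooth_gen"
  shows "C_k k f"
proof (rule C_k_coinduct[OF assms])
  fix f :: "'a \<Rightarrow> real" assume "f \<in> smooth_gen"
  then obtain f' where f': "\<And>x. (f has_derivative f' x) (at x)" "\<And>i. (\<lambda>x. f' x i) \<in> smooth_gen"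
    using smooth_gen_has_derivative by blast
  then show "f differentiable (at x)" for x by (auto simp: differentiable_def)
  show "(\<lambda>x. frechet_derivative f (at x) i) \<in> smooth_gen" for i
    using f'(2)[of i] by (simp add: frechet_derivative_eqI[OF f'(1)])
qed

lemma smooth_gen_prod:
  "finite A \<Longrightarrow> (\<And>i. i \<in> A \<Longrightarrow> f i \<in> smooth_gen) \<Longrightarrow> (\<lambda>x. \<Prod>i\<in>A. f i x) \<in> smooth_gen"
proof (induction rule: finite_induct)
  case empty
  show ?case by (simp add: smooth_gen.const)
next
  case (insert i A)
  then have "(\<lambda>x. f i x * (\<Prod>i\<in>A. f i x)) \<in> smooth_gen" by (intro smooth_gen.mult) auto
  then show ?case using insert by simp
qed

text \<open>Each factor is exp of minus the inverse of the distance to one face of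
  \<open>box a b\<close>, the distance being scaled by \<open>Suc k\<close>. Inside the box every
  factor tends to 1 as \<open>k\<close> grows, so these are smooth substitutes for the indicator of
  the box.\<close>

definition bump :: "'a::euclidean_space \<Rightarrow> 'a \<Rightarrow> nat \<Rightarrow> 'a \<Rightarrow> real" where
  "bump a b k x = (\<Prod>i\<in>Basis. flat_exp 0 (real (Suc k) * (x \<bullet> i - a \<bullet> i)) * flat_exp 0 (real (Suc k) * (b \<bullet> i - x \<bullet> i)))"

lemma bump_smooth: "bump a b k \<in> smooth_gen"
proof -
  have "(\<lambda>x. \<Prod>i\<in>Basis. flat_exp 0 (real (Suc k) * (x \<bullet> i) + (- real (Suc k) * (a \<bullet> i)))
      * flat_exp 0 (- real (Suc k) * (x \<bullet> i) + real (Suc k) * (b \<bullet> i))) \<in> smooth_gen"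
    by (intro smooth_gen_prod smooth_gen.mult smooth_gen.flat) auto
  then show ?thesis by (simp add: bump_def[abs_def] algebra_simps)
qed

lemma bump_bounds: "0 \<le> bump a b k x" "bump a b k x \<le> 1"
  unfolding bump_def
  by (intro prod_nonneg prod_le_1 ballI conjI mult_nonneg_nonneg mult_le_one flat_exp_0_bounds)+

lemma bump_outside: "x \<notin> box a b \<Longrightarrow> bump a b k x = 0"
proof -
  assume "x \<notin> box a b"
  then obtain i where i: "i \<in> Basis" "\<not> (a \<bullet> i < x \<bullet> i \<and> x \<bullet> i < b \<bullet> i)" by (auto simp: mem_box)
  have "flat_exp 0 (real (Suc k) * (x \<bullet> i - a \<bullet> i)) * flat_exp 0 (real (Suc k) * (b \<bullet> i - x \<bullet> i)) = 0"
    using i(2) by (auto simp: flat_exp_def zero_less_mult_iff)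
  then show ?thesis unfolding bump_def using i(1) by (intro prod_zero bexI[of _ i]) auto
qed

lemma bump_tendsto:
  assumes "x \<in> box a b"
  shows "(\<lambda>k. bump a b k x) \<longlonglongrightarrow> 1"
proof -
  have "(\<lambda>k. bump a b k x) \<longlonglongrightarrow> (\<Prod>i\<in>(Basis::'a set). 1 * 1)"
    unfolding bump_def
    using assms by (intro tendsto_prod tendsto_mult flat_exp_0_tendsto_1) (auto simp: mem_box)
  then show ?thesis by simp
qed

text \<open>An open set is the union of countably many rational boxes whose closures it contains.
  The first \<open>k\<close> bumps are united by subtracting from 1 the product of their complements
  to 1, which keeps smoothness and values between 0 and 1.\<close>

lemma open_test_approx:
  fixes U :: "'a::euclidean_space set"
  assumes "open U"
  obtains \<phi> where "\<And>k::nat. \<phi> k \<in> test_functions U" "\<And>k x. 0 \<le> \<phi> k x" "\<And>k x. \<phi> k x \<le> 1"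
    "\<And>x. (\<lambda>k. \<phi> k x) \<longlonglongrightarrow> indicator U x"
proof -
  define R where "R = {a::'a. \<forall>i\<in>Basis. a \<bullet> i \<in> \<rat>}"
  define D where "D = {p \<in> R \<times> R. closure (box (fst p) (snd p)) \<subseteq> U}"
  have "countable R"
  proof -
    have "R \<subseteq> (\<lambda>f. \<Sum>i\<in>Basis. f i *\<^sub>R i) ` (PiE Basis (\<lambda>_. \<rat>))"
    proof
      fix a assume "a \<in> R"
      then have "restrict (\<lambda>i. a \<bullet> i) Basis \<in> PiE Basis (\<lambda>_. \<rat>)" by (auto simp: R_def)
      moreover have "a = (\<Sum>i\<in>Basis. restrict (\<lambda>i. a \<bullet> i) Basis i *\<^sub>R i)"
        by (simp add: euclidean_representation)
      ultimately show "a \<in> (\<lambda>f. \<Sum>i\<in>Basis. f i *\<^sub>R i) ` (PiE Basis (\<lambda>_. \<rat>))" by blast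
    qed
    then show ?thesis
      by (rule countable_subset) (intro countable_image countable_PiE, auto intro: countable_rat)
  qed
  then have "countable D" by (auto simp: D_def intro: countable_subset[of _ "R \<times> R"])
  \<comment> \<open>The degenerate box is empty; it keeps \<open>D\<close> nonempty even for empty
    \<open>U\<close>, as the enumeration by \<open>from_nat_into\<close> requires.\<close>
  moreover have "(0, 0) \<in> D" by (auto simp: D_def R_def)
  ultimately have rg: "range (from_nat_into D) = D" by (intro range_from_nat_into) auto
  define a where "a j = fst (from_nat_into D j)" for j
  define b where "b j = snd (from_nat_into D j)" for j
  have ab: "closure (box (a j) (b j)) \<subseteq> U" for j
  proof -
    have "from_nat_into D j \<in> D" using rg by blast
    then show ?thesis by (simp add: D_def a_def b_def)
  qed
  have cover: "\<exists>j. x \<in> box (a j) (b j)" if xU: "x \<in> U" for x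
  proof -
    obtain e where e: "e > 0" "cball x e \<subseteq> U"
      using \<open>open U\<close> xU by (meson open_contains_cball)
    obtain c d where cd: "\<forall>i\<in>Basis. c \<bullet> i \<in> \<rat> \<and> d \<bullet> i \<in> \<rat>" "x \<in> box c d" "box c d \<subseteq> ball x e"
      using rational_boxes[OF e(1)] by blast
    have "closure (box c d) \<subseteq> cball x e"
      using closure_mono[OF cd(3)] e(1) by simp
    then have "(c, d) \<in> D" using cd e by (auto simp: D_def R_def)
    then obtain j where "from_nat_into D j = (c, d)" using rg by (metis imageE)
    then show ?thesis using cd(2) by (auto simp: a_def b_def intro!: exI[of _ j])
  qed
  define \<phi> where "\<phi> k x = 1 + (-1) * (\<Prod>j<k. 1 + (-1) * bump (a j) (b j) k x)" for k x
  have "\<phi> k \<in> smooth_gen" for k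
    unfolding \<phi>_def[abs_def] by (intro smooth_gen.add smooth_gen.mult smooth_gen.const smooth_gen_prod bump_smooth) auto
  then have \<phi>_test: "\<phi> k \<in> test_functions U" for k
  proof (intro test_functionsI[where K="\<Union>j<k. closure (box (a j) (b j))"])
    show "\<phi> k x = 0" if "x \<notin> (\<Union>j<k. closure (box (a j) (b j)))" for x
    proof -
      have "bump (a j) (b j) k x = 0" if "j < k" for j
        using bump_outside[of x "a j" "b j"] closure_subset that \<open>x \<notin> _\<close> by auto
      then show ?thesis by (simp add: \<phi>_def)
    qed
  qed (use ab in \<open>auto intro!: smooth_gen_C_k compact_UN simp: compact_closure\<close>)
  have pb: "0 \<le> (\<Prod>j<k. 1 + (-1) * bump (a j) (b j) k x)"
    "(\<Prod>j<k. 1 + (-1) * bump (a j) (b j) k x) \<le> 1" for k x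
    by (auto intro!: prod_nonneg prod_le_1 simp: bump_bounds)
  have \<phi>_lim: "(\<lambda>k. \<phi> k x) \<longlonglongrightarrow> indicator U x" for x
  proof (cases "x \<in> U")
    case True
    then obtain j where j: "x \<in> box (a j) (b j)" using cover by blast
    \<comment> \<open>From \<open>k > j\<close> on the product contains the factor belonging to the
      box around \<open>x\<close>, and this factor tends to zero.\<close>
    have "(\<lambda>k. \<Prod>j<k. 1 + (-1) * bump (a j) (b j) k x) \<longlonglongrightarrow> 0"
    proof (rule Lim_null_comparison)
      have "(\<lambda>k. 1 - bump (a j) (b j) k x) \<longlonglongrightarrow> 1 - 1"
        by (intro tendsto_intros bump_tendsto j)
      then show "(\<lambda>k. 1 - bump (a j) (b j) k x) \<longlonglongrightarrow> 0" by simp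
      show "\<forall>\<^sub>F k in sequentially. norm (\<Prod>j<k. 1 + (-1) * bump (a j) (b j) k x) \<le> 1 - bump (a j) (b j) k x"
        using eventually_gt_at_top[of j]
      proof eventually_elim
        case (elim k)
        have "(\<Prod>j<k. 1 + (-1) * bump (a j) (b j) k x) =
            (1 + (-1) * bump (a j) (b j) k x) * (\<Prod>j\<in>{..<k} - {j}. 1 + (-1) * bump (a j) (b j) k x)"
          using elim by (intro prod.remove) auto
        also have "\<dots> \<le> (1 + (-1) * bump (a j) (b j) k x) * 1"
          by (intro mult_left_mono prod_le_1) (auto simp: bump_bounds)
        finally show ?case using pb(1)[of k x] by simp
      qed
    qed
    then have "(\<lambda>k. \<phi> k x) \<longlonglongrightarrow> 1 + (-1) * 0" unfolding \<phi>_def by (intro tendsto_intros)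
    then show ?thesis using True by simp
  next
    case False
    then show ?thesis using test_functions_zero_outside[OF \<phi>_test] by simp
  qed
  show thesis
  proof (rule that[of \<phi>, OF \<phi>_test _ _ \<phi>_lim])
    show "0 \<le> \<phi> k x" "\<phi> k x \<le> 1" for k x
      using pb[of k x] unfolding \<phi>_def by linarith+
  qed
qed

text \<open>A Lebesgue set is up to a null set a decreasing intersection of open sets, so no linearity is
  needed to pass from test functions to indicators.\<close>

lemma indicator_from_test_functions:
  fixes S :: "'a::euclidean_space set"
  assumes S: "open S" and A: "A \<in> sets lebesgue" "A \<subseteq> S"
    and test: "\<And>\<phi>. \<phi> \<in> test_functions S \<Longrightarrow> P \<phi>"
    and lim: "\<And>f g. (\<And>k::nat. P (f k)) \<Longrightarrow> (\<And>k. f k \<in> borel_measurable (lebesgue_on S)) \<Longrightarrow>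
      (\<And>k x. 0 \<le> f k x) \<Longrightarrow> (\<And>k x. f k x \<le> 1) \<Longrightarrow> g \<in> borel_measurable (lebesgue_on S) \<Longrightarrow>
      (\<And>x. 0 \<le> g x) \<Longrightarrow> (\<And>x. g x \<le> 1) \<Longrightarrow>
      AE x in lebesgue_on S. (\<lambda>k. f k x) \<longlonglongrightarrow> g x \<Longrightarrow> P g"
  shows "P (indicator A)"
proof -
  have ind: "(indicator B :: 'a \<Rightarrow> real) \<in> borel_measurable (lebesgue_on S)" if "B \<in> sets lebesgue" for B
    using that S by (auto intro!: measurable_restrict_space1)
  have op: "P (indicator U)" if U: "open U" "U \<subseteq> S" for U
  proof -
    obtain \<phi> where \<phi>: "\<And>k::nat. \<phi> k \<in> test_functions U" "\<And>k x. 0 \<le> \<phi> k x" "\<And>k x. \<phi> k x \<le> 1"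
      "\<And>x. (\<lambda>k. \<phi> k x) \<longlonglongrightarrow> indicator U x" using open_test_approx[OF U(1)] by blast
    show ?thesis
    proof (rule lim[of \<phi>])
      show "P (\<phi> k)" for k using \<phi>(1) test_functions_mono[OF U(2)] test by blast
      have "continuous_on UNIV (\<phi> k)" for k using \<phi>(1)[of k] C_k.simps(1) unfolding test_functions_def by blast
      then show "\<phi> k \<in> borel_measurable (lebesgue_on S)" for k
        by (intro continuous_imp_measurable_on_sets_lebesgue) (use S in \<open>auto intro: continuous_on_subset\<close>)
    qed (use \<phi> ind U in auto)
  qed
  obtain C N where C: "gdelta C" "N \<in> null_sets lebesgue" "A \<union> N = C" "disjnt A N"
    using lebesgue_set_almost_gdelta[OF A(1)] .
  obtain F where F: "\<And>n::nat. open (F n)" "C = \<Inter>(range F)"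
    using C(1) by (auto simp: gdelta.simps)
  \<comment> \<open>Finite intersections stay open and decrease to \<open>S \<inter> C\<close>,
    which differs from \<open>A\<close> by a null set only.\<close>
  define G where "G n = S \<inter> (\<Inter>m\<le>n. F m)" for n
  have "open (G n)" for n using S F by (auto simp: G_def)
  show ?thesis
  proof (rule lim[of "\<lambda>n. indicator (G n)"])
    show "P (indicator (G n))" for n by (rule op) (use \<open>open (G n)\<close> in \<open>auto simp: G_def\<close>)
    show "AE x in lebesgue_on S. (\<lambda>k. indicat_real (G k) x) \<longlonglongrightarrow> indicat_real A x"
    proof -
      have "(\<lambda>k. indicat_real (G k) x) \<longlonglongrightarrow> indicat_real A x" if "x \<notin> N" "x \<in> S" for x
      proof (cases "x \<in> A")
        case True
        then have "x \<in> G k" for k using C(3) F(2) that by (auto simp: G_def)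
        then show ?thesis using True by simp
      next
        case False
        then have "x \<notin> C" using C(3) that by auto
        then obtain m where m: "x \<notin> F m" using F(2) by auto
        have "\<forall>\<^sub>F k in sequentially. indicat_real (G k) x = indicat_real A x"
          using eventually_ge_at_top[of m] by eventually_elim (use m False in \<open>auto simp: G_def indicator_def\<close>)
        then show ?thesis by (rule tendsto_eventually)
      qed
      then show ?thesis
        using S C(2) by (subst AE_lebesgue_on_iff) (auto intro!: AE_I'[of N])
    qed
    show "(indicator (G k) :: 'a \<Rightarrow> real) \<in> borel_measurable (lebesgue_on S)" for k
      by (rule ind) (use \<open>open (G k)\<close> in auto)
    show "(indicator A :: 'a \<Rightarrow> real) \<in> borel_measurable (lebesgue_on S)" by (rule ind[OF A(1)])
  qed (simp_all add: indicator_def)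
qed

section \<open>Weak gradients\<close>

lemma support_zero: "x \<notin> closure {x. f x \<noteq> 0} \<Longrightarrow> f x = (0::real)"
  using closure_subset[of "{x. f x \<noteq> 0}"] by blast

lemma test_functions_deriv:
  assumes "f \<in> test_functions S" "i \<in> Basis"
  shows "(\<lambda>x. frechet_derivative f (at x) i) \<in> test_functions S"
proof (rule test_functionsI)
  let ?K = "closure {x. f x \<noteq> 0}"
  have C: "C_k (Suc k) f" for k using assms(1) by (simp add: test_functions_def del: C_k.simps)
  then show "C_k k (\<lambda>x. frechet_derivative f (at x) i)" for k
    using assms(2) unfolding C_k.simps(2) by blast
  show "compact ?K" "?K \<subseteq> S" using assms(1) by (auto simp: test_functions_def simp del: compact_closure)
  show "frechet_derivative f (at x) i = 0" if "x \<notin> ?K" for x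
  proof -
    have "((\<lambda>_. 0) has_derivative (\<lambda>_. 0)) (at x)" by simp
    then have "(f has_derivative (\<lambda>_. 0)) (at x)"
    proof (rule has_derivative_transform_within_open)
      show "open (- ?K)" by (intro open_Compl closed_closure)
      show "0 = f y" if "y \<in> - ?K" for y
        using support_zero[of y f] that by simp
    qed (use that in simp)
    then show ?thesis by (simp add: frechet_derivative_eqI)
  qed
qed

lemma test_functions_has_derivative:
  "f \<in> test_functions S \<Longrightarrow> (f has_derivative frechet_derivative f (at x)) (at x)"
  using C_k.simps(2)[of 0 f] unfolding test_functions_def frechet_derivative_works[symmetric] by blast

lemma test_functions_continuous: "f \<in> test_functions S \<Longrightarrow> continuous_on R f"
  using C_k.simps(1)[of f] continuous_on_subset[of UNIV f R] unfolding test_functions_def by blast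

lemma test_functions_compact_support:
  assumes "f \<in> test_functions S"
  obtains K where "compact K" "K \<subseteq> S" "\<And>x. x \<notin> K \<Longrightarrow> f x = 0"
proof (rule that)
  let ?K = "closure {x. f x \<noteq> 0}"
  show "compact ?K" "?K \<subseteq> S" using assms(1) by (auto simp: test_functions_def simp del: compact_closure)
  show "f x = 0" if "x \<notin> ?K" for x using that by (rule support_zero)
qed

lemma compact_support_bounded:
  fixes f :: "'a::euclidean_space \<Rightarrow> real"
  assumes "continuous_on UNIV f" "compact K" "\<And>x. x \<notin> K \<Longrightarrow> f x = 0"
  obtains B where "0 \<le> B" "\<And>x. \<bar>f x\<bar> \<le> B"
proof -
  have "bounded (f ` K)"
    using assms by (intro compact_imp_bounded compact_continuous_image) (auto intro: continuous_on_subset)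
  then obtain B where B: "\<And>x. x \<in> K \<Longrightarrow> \<bar>f x\<bar> \<le> B" by (auto simp: bounded_iff)
  show thesis
  proof (rule that)
    show "\<bar>f x\<bar> \<le> max B 0" for x using B[of x] assms(3)[of x] by (cases "x \<in> K") auto
  qed simp
qed

lemma test_functions_bounded:
  assumes "f \<in> test_functions S"
  obtains B where "0 \<le> B" "\<And>x. \<bar>f x\<bar> \<le> B"
  using test_functions_compact_support[OF assms]
    compact_support_bounded[OF test_functions_continuous[OF assms]] by metis

lemma L2_space_bounded:
  fixes f :: "'a::euclidean_space \<Rightarrow> real"
  assumes "S \<in> lmeasurable" "f \<in> borel_measurable (lebesgue_on S)" "\<And>x. x \<in> S \<Longrightarrow> \<bar>f x\<bar> \<le> B"
  shows "f \<in> L2_space S"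
proof -
  have "\<bar>(f x)\<^sup>2\<bar> \<le> B\<^sup>2" if "x \<in> S" for x using power_mono[OF assms(3)[OF that], of 2] by simp
  then have "integrable (lebesgue_on S) (\<lambda>x. (f x)\<^sup>2)"
    using assms by (intro integrable_bounded_lebesgue_on[where B="B\<^sup>2"]) auto
  then show ?thesis using assms by (simp add: L2_space_def)
qed

lemma test_functions_measurable:
  "f \<in> test_functions R \<Longrightarrow> S \<in> sets lebesgue \<Longrightarrow> f \<in> borel_measurable (lebesgue_on S)"
  by (intro continuous_imp_measurable_on_sets_lebesgue test_functions_continuous)

lemma test_functions_L2:
  assumes "f \<in> test_functions R" "S \<in> lmeasurable"
  shows "f \<in> L2_space S"
  using test_functions_bounded[OF assms(1)] L2_space_bounded[OF assms(2) test_functions_measurable[OF assms(1)]]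
    assms(2) by (metis fmeasurableD)

lemma integral_translation:
  fixes f :: "'a::euclidean_space \<Rightarrow> real"
  assumes [measurable]: "f \<in> borel_measurable borel"
  shows "(LINT x|lborel. f (c + x)) = (LINT x|lborel. f x)"
proof -
  have "(LINT x|lborel. f x) = (LINT x|distr lborel borel ((+) c). f x)" by (simp add: lborel_distr_plus)
  also have "\<dots> = (LINT x|lborel. f (c + x))" by (rule integral_distr) auto
  finally show ?thesis by simp
qed

lemma integrable_compact_support:
  fixes f :: "'a::euclidean_space \<Rightarrow> real"
  assumes "continuous_on UNIV f" "compact K" "\<And>x. x \<notin> K \<Longrightarrow> f x = 0"
  shows "integrable lborel f"
proof -
  have "integrable lborel (\<lambda>x. indicator K x *\<^sub>R f x)"
    using assms by (intro borel_integrable_compact) (auto intro: continuous_on_subset)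
  moreover have "(\<lambda>x. indicator K x *\<^sub>R f x) = f" using assms(3) by (intro ext) (auto simp: indicator_def)
  ultimately show ?thesis by simp
qed

text \<open>Differentiating the translation invariance of the integral avoids Fubini's theorem.\<close>

lemma integral_directional_derivative:
  fixes \<psi> :: "'a::euclidean_space \<Rightarrow> real"
  assumes der: "\<And>x. (\<psi> has_derivative \<psi>' x) (at x)" and cont: "continuous_on UNIV (\<lambda>x. \<psi>' x i)"
    and K: "compact K" "\<And>x. x \<notin> K \<Longrightarrow> \<psi> x = 0"
  shows "(LINT x|lborel. \<psi>' x i) = 0"
proof -
  have "\<psi>' x i = 0" if "x \<notin> K" for x
  proof -
    have "((\<lambda>_. 0) has_derivative (\<lambda>_. 0)) (at x)" by simp
    then have "(\<psi> has_derivative (\<lambda>_. 0)) (at x)"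
      by (rule has_derivative_transform_within_open[where s="- K"])
        (use that K compact_imp_closed in auto)
    then have "\<psi>' x = (\<lambda>_. 0)" using der has_derivative_unique by blast
    then show ?thesis by simp
  qed
  then obtain B where B: "0 \<le> B" "\<And>x. \<bar>\<psi>' x i\<bar> \<le> B" using compact_support_bounded[OF cont K(1)] by metis
  have c\<psi>: "continuous_on UNIV \<psi>"
    using has_derivative_continuous[OF der] by (simp add: continuous_on_eq_continuous_at)
  then have [measurable]: "\<psi> \<in> borel_measurable borel" by (rule borel_measurable_continuous_onI)
  have [measurable]: "(\<lambda>x. \<psi>' x i) \<in> borel_measurable borel" by (rule borel_measurable_continuous_onI[OF cont])
  obtain R where R: "\<And>x. x \<in> K \<Longrightarrow> norm x \<le> R"
    using compact_imp_bounded[OF K(1)] by (auto simp: bounded_iff)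
  define h where "h n = inverse (real (Suc n))" for n
  have h: "0 < h n" "h n \<le> 1" for n by (auto simp: h_def field_simps)
  have h0: "h \<longlonglongrightarrow> 0" unfolding h_def by (rule LIMSEQ_inverse_real_of_nat)
  define f where "f n x = (\<psi> (h n *\<^sub>R i + x) - \<psi> x) / h n" for n x
  have line: "((\<lambda>t. \<psi> (t *\<^sub>R i + x)) has_real_derivative \<psi>' (t *\<^sub>R i + x) i) (at t)" for x t
  proof -
    have "((\<lambda>t. \<psi> (t *\<^sub>R i + x)) has_derivative (\<lambda>s. \<psi>' (t *\<^sub>R i + x) (s *\<^sub>R i))) (at t)"
      by (rule has_derivative_compose[OF _ der]) (auto intro!: derivative_eq_intros)
    moreover have "(\<lambda>s. \<psi>' y (s *\<^sub>R i)) = (*) (\<psi>' y i)" for y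
      using linear_scale[OF has_derivative_linear[OF der]] by (intro ext) (simp add: mult.commute)
    ultimately show ?thesis unfolding has_field_derivative_def by simp
  qed
  \<comment> \<open>The mean value theorem bounds the difference quotients by \<open>B\<close>. As
    the steps \<open>h n\<close> are at most 1, the quotients vanish outside the ball of radius
    \<open>R + norm i\<close>, which provides an integrable majorant.\<close>
  have "(\<lambda>n. LINT x|lborel. f n x) \<longlonglongrightarrow> (LINT x|lborel. \<psi>' x i)"
  proof (rule integral_dominated_convergence)
    show "integrable lborel (\<lambda>x. B * indicat_real (cball 0 (R + norm i)) x)"
      by (intro integrable_mult_right integrable_real_indicator emeasure_lborel_cball_finite) auto
    show "AE x in lborel. (\<lambda>n. f n x) \<longlonglongrightarrow> \<psi>' x i"
    proof (rule AE_I2)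
      fix x
      have "((\<lambda>t. (\<psi> ((0 + t) *\<^sub>R i + x) - \<psi> (0 *\<^sub>R i + x)) / t) \<longlongrightarrow> \<psi>' x i) (at 0)"
        using line[of x 0] by (simp add: DERIV_def)
      moreover have "filterlim h (at 0) sequentially"
        using h0 h by (auto simp: filterlim_at less_imp_neq[symmetric] intro!: always_eventually)
      ultimately show "(\<lambda>n. f n x) \<longlonglongrightarrow> \<psi>' x i"
        unfolding f_def by (drule_tac filterlim_compose) (auto)
    qed
    show "AE x in lborel. norm (f n x) \<le> B * indicat_real (cball 0 (R + norm i)) x" for n
    proof (rule AE_I2)
      fix x
      show "norm (f n x) \<le> B * indicat_real (cball 0 (R + norm i)) x"
      proof (cases "x \<in> cball 0 (R + norm i)")
        case True
        obtain z where "\<psi> (h n *\<^sub>R i + x) - \<psi> (0 *\<^sub>R i + x) = (h n - 0) * \<psi>' (z *\<^sub>R i + x) i"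
          using MVT2[of 0 "h n" "\<lambda>t. \<psi> (t *\<^sub>R i + x)" "\<lambda>t. \<psi>' (t *\<^sub>R i + x) i"] h line by blast
        then have "f n x = \<psi>' (z *\<^sub>R i + x) i" using h(1)[of n] by (simp add: f_def)
        then show ?thesis using B True by simp
      next
        case False
        then have x: "norm x > R + norm i" by simp
        have "norm (h n *\<^sub>R i) \<le> norm i" using h[of n] by (simp add: mult_left_le_one_le)
        then have "norm (h n *\<^sub>R i + x) > R"
          using x norm_triangle_ineq4[of "h n *\<^sub>R i + x" "h n *\<^sub>R i"] by simp
        moreover have "norm x > R" using x norm_ge_zero[of i] by linarith
        ultimately have "\<psi> (h n *\<^sub>R i + x) = 0" "\<psi> x = 0" using R K(2) by (meson not_le)+
        then show ?thesis using False by (simp add: f_def)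
      qed
    qed
  qed (simp_all add: f_def)
  moreover have "(LINT x|lborel. f n x) = 0" for n
  proof -
    have i1: "integrable lborel \<psi>" by (rule integrable_compact_support[OF c\<psi> K])
    have "integrable (distr lborel borel ((+) (h n *\<^sub>R i))) \<psi>" using i1 by (simp add: lborel_distr_plus)
    then have i2: "integrable lborel (\<lambda>x. \<psi> (h n *\<^sub>R i + x))" by (rule integrable_distr[rotated]) simp
    show ?thesis
      unfolding f_def using i1 i2 integral_translation[of \<psi> "h n *\<^sub>R i"] by simp
  qed
  ultimately show ?thesis using LIMSEQ_unique[OF _ tendsto_const] by simp
qed

lemma integral_lebesgue_on_lborel:
  fixes f :: "'a::euclidean_space \<Rightarrow> real"
  assumes "S \<in> sets lebesgue" "f \<in> borel_measurable borel" "\<And>x. x \<notin> S \<Longrightarrow> f x = 0"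
  shows "(LINT x|lebesgue_on S. f x) = (LINT x|lborel. f x)"
proof -
  have "(\<lambda>x. indicator S x *\<^sub>R f x) = f" using assms(3) by (intro ext) (auto simp: indicator_def)
  then show ?thesis
    using assms by (simp add: integral_restrict_space integral_completion del: real_scaleR_def)
qed

lemma L2_norm_mono_AE:
  assumes "u \<in> L2_space S" "v \<in> L2_space S" "AE x in lebesgue_on S. norm (u x) \<le> norm (v x)"
  shows "L2_norm S u \<le> L2_norm S v"
proof -
  have "L2_inner S u u \<le> L2_inner S v v"
    unfolding L2_inner_def
  proof (rule integral_mono_AE)
    show "AE x in lebesgue_on S. u x \<bullet> u x \<le> v x \<bullet> v x"
      using assms(3) by eventually_elim (simp add: dot_square_norm power_mono)
  qed (use assms L2_inner_integrable in auto)
  then show ?thesis by (simp add: L2_norm_def)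
qed

lemma L2_norm_mono:
  assumes "u \<in> L2_space S" "v \<in> L2_space S" "\<And>x. x \<in> S \<Longrightarrow> norm (u x) \<le> norm (v x)"
  shows "L2_norm S u \<le> L2_norm S v"
  using assms by (intro L2_norm_mono_AE AE_I2) auto

text \<open>Orthogonality to test functions extends to indicators of measurable sets by dominated
  convergence. Taking the sets where \<open>g\<close> is positive and where it is negative, the
  integral of the absolute value of \<open>g\<close> is zero.\<close>

lemma fundamental_lemma:
  fixes g :: "'a::euclidean_space \<Rightarrow> real"
  assumes S: "open S" "S \<in> lmeasurable" and g: "g \<in> L2_space S"
    and orth: "\<And>\<phi>. \<phi> \<in> test_functions S \<Longrightarrow> L2_inner S g \<phi> = 0"
  shows "AE x in lebesgue_on S. g x = 0"
proof -
  have one: "(\<lambda>_. 1::real) \<in> L2_space S" by (rule L2_space_bounded[OF S(2)]) auto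
  have int_g: "integrable (lebesgue_on S) g" using L2_inner_integrable[OF g one] by simp
  have [measurable]: "g \<in> borel_measurable (lebesgue_on S)" using g by (simp add: L2_space_def)
  have ind: "L2_inner S g (indicator A) = 0" if "A \<in> sets lebesgue" "A \<subseteq> S" for A
    using S(1) that orth
  proof (rule indicator_from_test_functions)
    fix f h
    assume f: "\<And>k::nat. L2_inner S g (f k) = 0" "\<And>k. f k \<in> borel_measurable (lebesgue_on S)"
      "\<And>k x. 0 \<le> f k x" "\<And>k x. f k x \<le> 1" and [measurable]: "h \<in> borel_measurable (lebesgue_on S)"
      and lim: "AE x in lebesgue_on S. (\<lambda>k. f k x) \<longlonglongrightarrow> h x"
    note f(2)[measurable]
    have "(\<lambda>k. L2_inner S g (f k)) \<longlonglongrightarrow> L2_inner S g h"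
      unfolding L2_inner_def inner_real_def
    proof (rule integral_dominated_convergence)
      show "integrable (lebesgue_on S) (\<lambda>x. \<bar>g x\<bar>)" using int_g by simp
      show "AE x in lebesgue_on S. (\<lambda>k. g x * f k x) \<longlonglongrightarrow> g x * h x"
        using lim by eventually_elim (rule tendsto_mult_left)
      show "AE x in lebesgue_on S. norm (g x * f k x) \<le> \<bar>g x\<bar>" for k
        using f(3,4) by (intro AE_I2) (simp add: abs_mult mult_left_le)
    qed measurable
    then show "L2_inner S g h = 0" using f(1) LIMSEQ_unique[OF _ tendsto_const] by simp
  qed
  let ?P = "{x\<in>S. g x > 0}" and ?M = "{x\<in>S. g x < 0}"
  have S': "S \<in> sets lebesgue" using S by auto
  have "{x\<in>space (lebesgue_on S). g x > 0} \<in> sets (lebesgue_on S)"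
    "{x\<in>space (lebesgue_on S). g x < 0} \<in> sets (lebesgue_on S)" by measurable
  then have sets: "?P \<in> sets lebesgue" "?M \<in> sets lebesgue"
    using S' by (auto simp: sets_restrict_space_iff)
  have int: "integrable (lebesgue_on S) (\<lambda>x. g x * indicat_real A x)" if "A \<in> sets lebesgue" for A
  proof (rule Bochner_Integration.integrable_bound[OF int_g])
    have "indicat_real A \<in> borel_measurable (lebesgue_on S)" using that by (auto intro!: measurable_restrict_space1)
    then show "(\<lambda>x. g x * indicat_real A x) \<in> borel_measurable (lebesgue_on S)" by simp
  qed (auto simp: indicator_def)
  have "(LINT x|lebesgue_on S. \<bar>g x\<bar>) = (LINT x|lebesgue_on S. g x * indicator ?P x - g x * indicator ?M x)"
    by (rule Bochner_Integration.integral_cong) (auto simp: indicator_def)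
  also have "\<dots> = L2_inner S g (indicator ?P) - L2_inner S g (indicator ?M)"
    using int sets by (simp add: L2_inner_def)
  also have "\<dots> = 0" using ind[OF sets(1)] ind[OF sets(2)] by auto
  finally have "AE x in lebesgue_on S. \<bar>g x\<bar> = 0"
    using int_g by (subst (asm) integral_nonneg_eq_0_iff_AE) auto
  then show ?thesis by simp
qed

section \<open>Sobolev functions on a bounded open set\<close>

locale bounded_domain =
  fixes \<Omega> :: "'a::euclidean_space set"
  assumes open_dom: "open \<Omega>" and bounded_dom: "bounded \<Omega>"
begin

lemma lmeasurable_dom: "\<Omega> \<in> lmeasurable"
  by (rule lmeasurable_open[OF bounded_dom open_dom])

lemma sets_dom [simp]: "\<Omega> \<in> sets lebesgue"
  using lmeasurable_dom by auto

lemma test_L2: "f \<in> test_functions \<Omega> \<Longrightarrow> f \<in> L2_space \<Omega>"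
  by (rule test_functions_L2[OF _ lmeasurable_dom])

lemma test_deriv_L2:
  "f \<in> test_functions \<Omega> \<Longrightarrow> i \<in> Basis \<Longrightarrow> (\<lambda>x. frechet_derivative f (at x) i) \<in> L2_space \<Omega>"
  by (intro test_L2 test_functions_deriv)

lemma is_weak_grad_add:
  assumes "u \<in> L2_space \<Omega>" "v \<in> L2_space \<Omega>" "is_weak_grad \<Omega> u g" "is_weak_grad \<Omega> v h"
  shows "is_weak_grad \<Omega> (\<lambda>x. u x + v x) (\<lambda>x. g x + h x)"
  using assms
  by (simp add: is_weak_grad_def L2_space_add inner_add_left L2_inner_add_left test_L2 test_deriv_L2 L2_space_component)

lemma is_weak_grad_scale:
  assumes "is_weak_grad \<Omega> u g"
  shows "is_weak_grad \<Omega> (\<lambda>x. c * u x) (\<lambda>x. c *\<^sub>R g x)"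
  using assms by (auto simp: is_weak_grad_def L2_space_scaleR L2_inner_mult_left)

text \<open>\<open>wgrad\<close> is chosen separately for every function. Uniqueness, from the
  fundamental lemma in each component, is what makes it linear up to null sets.\<close>

lemma is_weak_grad_unique:
  assumes g: "is_weak_grad \<Omega> u g" and h: "is_weak_grad \<Omega> u h"
  shows "AE x in lebesgue_on \<Omega>. g x = h x"
proof -
  have L: "g \<in> L2_space \<Omega>" "h \<in> L2_space \<Omega>" using g h by (auto simp: is_weak_grad_def)
  have "AE x in lebesgue_on \<Omega>. g x \<bullet> i - h x \<bullet> i = 0" if i: "i \<in> Basis" for i
  proof (rule fundamental_lemma[OF open_dom lmeasurable_dom])
    show "(\<lambda>x. g x \<bullet> i - h x \<bullet> i) \<in> L2_space \<Omega>" using L by (intro L2_space_diff L2_space_component)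
    show "L2_inner \<Omega> (\<lambda>x. g x \<bullet> i - h x \<bullet> i) \<phi> = 0" if "\<phi> \<in> test_functions \<Omega>" for \<phi>
    proof -
      have "L2_inner \<Omega> (\<lambda>x. g x \<bullet> i) \<phi> = L2_inner \<Omega> (\<lambda>x. h x \<bullet> i) \<phi>"
        using g h that i unfolding is_weak_grad_def by (metis neg_equal_iff_equal)
      then show ?thesis using L that by (simp add: L2_inner_diff_left L2_space_component test_L2)
    qed
  qed
  then have "AE x in lebesgue_on \<Omega>. \<forall>i\<in>Basis. g x \<bullet> i - h x \<bullet> i = 0"
    by (intro AE_finite_allI) auto
  then show ?thesis by eventually_elim (auto intro: euclidean_eqI)
qed

lemma H1_L2: "u \<in> H1_space \<Omega> \<Longrightarrow> u \<in> L2_space \<Omega>"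
  by (simp add: H1_space_def)

lemma wgrad_is_weak_grad: "u \<in> H1_space \<Omega> \<Longrightarrow> is_weak_grad \<Omega> u (wgrad \<Omega> u)"
  unfolding H1_space_def wgrad_def by (metis (mono_tags, lifting) mem_Collect_eq someI_ex)

lemma wgrad_L2: "u \<in> H1_space \<Omega> \<Longrightarrow> wgrad \<Omega> u \<in> L2_space \<Omega>"
  using wgrad_is_weak_grad by (auto simp: is_weak_grad_def)

lemma H1_spaceI: "u \<in> L2_space \<Omega> \<Longrightarrow> is_weak_grad \<Omega> u g \<Longrightarrow> u \<in> H1_space \<Omega>"
  by (auto simp: H1_space_def)

lemma wgrad_AE: "u \<in> L2_space \<Omega> \<Longrightarrow> is_weak_grad \<Omega> u g \<Longrightarrow> AE x in lebesgue_on \<Omega>. wgrad \<Omega> u x = g x"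
  using is_weak_grad_unique wgrad_is_weak_grad H1_spaceI by blast

lemma H1_add: "u \<in> H1_space \<Omega> \<Longrightarrow> v \<in> H1_space \<Omega> \<Longrightarrow> (\<lambda>x. u x + v x) \<in> H1_space \<Omega>"
  by (rule H1_spaceI[OF L2_space_add[OF H1_L2 H1_L2]
        is_weak_grad_add[OF H1_L2 H1_L2 wgrad_is_weak_grad wgrad_is_weak_grad]])

lemma H1_scale: "u \<in> H1_space \<Omega> \<Longrightarrow> (\<lambda>x. c * u x) \<in> H1_space \<Omega>"
  by (rule H1_spaceI[OF L2_space_scale[OF H1_L2] is_weak_grad_scale[OF wgrad_is_weak_grad]])

lemma wgrad_add:
  assumes "u \<in> H1_space \<Omega>" "v \<in> H1_space \<Omega>"
  shows "AE x in lebesgue_on \<Omega>. wgrad \<Omega> (\<lambda>x. u x + v x) x = wgrad \<Omega> u x + wgrad \<Omega> v x"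
  using assms by (intro wgrad_AE is_weak_grad_add L2_space_add wgrad_is_weak_grad) (auto simp: H1_L2)

lemma wgrad_scale:
  assumes "u \<in> H1_space \<Omega>"
  shows "AE x in lebesgue_on \<Omega>. wgrad \<Omega> (\<lambda>x. c * u x) x = c *\<^sub>R wgrad \<Omega> u x"
  using assms by (intro wgrad_AE is_weak_grad_scale L2_space_scale wgrad_is_weak_grad) (auto simp: H1_L2)

definition dirichlet :: "('a \<Rightarrow> real) \<Rightarrow> ('a \<Rightarrow> real) \<Rightarrow> real" where
  "dirichlet u v = L2_inner \<Omega> (wgrad \<Omega> u) (wgrad \<Omega> v)"

lemma dirichlet_commute: "dirichlet u v = dirichlet v u"
  by (simp add: dirichlet_def L2_inner_commute)

lemma dirichlet_add_left:
  assumes "u \<in> H1_space \<Omega>" "v \<in> H1_space \<Omega>" "w \<in> H1_space \<Omega>"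
  shows "dirichlet (\<lambda>x. u x + v x) w = dirichlet u w + dirichlet v w"
  unfolding dirichlet_def
  using assms L2_inner_AE_cong[OF wgrad_add[OF assms(1,2)], where w="wgrad \<Omega> w"]
  by (simp add: wgrad_L2 H1_add L2_space_add L2_inner_add_left)

lemma dirichlet_scale_left:
  assumes "u \<in> H1_space \<Omega>" "w \<in> H1_space \<Omega>"
  shows "dirichlet (\<lambda>x. c * u x) w = c * dirichlet u w"
  unfolding dirichlet_def
  using assms L2_inner_AE_cong[OF wgrad_scale[OF assms(1)], where w="wgrad \<Omega> w"]
  by (simp add: wgrad_L2 H1_scale L2_space_scaleR L2_inner_scale_left)

lemma H10_norm_power2: "(H10_norm \<Omega> u)\<^sup>2 = dirichlet u u"
  by (simp add: H10_norm_def dirichlet_def L2_norm_power2)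

lemma dirichlet_bound:
  "u \<in> H1_space \<Omega> \<Longrightarrow> v \<in> H1_space \<Omega> \<Longrightarrow> \<bar>dirichlet u v\<bar> \<le> H10_norm \<Omega> u * H10_norm \<Omega> v"
  by (simp add: dirichlet_def H10_norm_def L2_Cauchy_Schwarz wgrad_L2)

lemma seminormed_H1_grad: "seminormed (H1_space \<Omega>) (H10_norm \<Omega>)"
proof
  show "(\<lambda>_. 0) \<in> H1_space \<Omega>"
    by (rule H1_spaceI[where g="\<lambda>_. 0"]) (auto simp: is_weak_grad_def)
  show "H10_norm \<Omega> (\<lambda>x. u x + v x) \<le> H10_norm \<Omega> u + H10_norm \<Omega> v"
    if "u \<in> H1_space \<Omega>" "v \<in> H1_space \<Omega>" for u v
    using that L2_norm_AE_cong[OF wgrad_add[OF that]] L2_norm_triangle[OF wgrad_L2 wgrad_L2, OF that]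
    by (simp add: H10_norm_def wgrad_L2 H1_add L2_space_add)
  show "H10_norm \<Omega> (\<lambda>x. c * u x) = \<bar>c\<bar> * H10_norm \<Omega> u" if "u \<in> H1_space \<Omega>" for u c
    using that L2_norm_AE_cong[OF wgrad_scale[OF that]]
    by (simp add: H10_norm_def wgrad_L2 H1_scale L2_space_scaleR L2_norm_scaleR)
qed (auto simp: H1_add H1_scale H10_norm_def)

lemma H1_norm_ge: "L2_norm \<Omega> u \<le> H1_norm \<Omega> u" "H10_norm \<Omega> u \<le> H1_norm \<Omega> u"
  by (auto simp: H1_norm_def H10_norm_def intro!: real_le_rsqrt)

lemma H1_norm_le: "H1_norm \<Omega> u \<le> L2_norm \<Omega> u + H10_norm \<Omega> u"
  by (simp add: H1_norm_def H10_norm_def sqrt_sum_squares_le_sum)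

text \<open>Integration by parts: the product of two test functions has compact support, so the
  integral of its partial derivative is zero.\<close>

lemma test_weak_grad:
  assumes f: "f \<in> test_functions \<Omega>"
  shows "is_weak_grad \<Omega> f (\<lambda>x. \<Sum>i\<in>Basis. frechet_derivative f (at x) i *\<^sub>R i)"
  unfolding is_weak_grad_def
proof (intro conjI ballI)
  let ?g = "\<lambda>x. \<Sum>i\<in>Basis. frechet_derivative f (at x) i *\<^sub>R i"
  have sumL2: "(\<lambda>x. \<Sum>i\<in>A. frechet_derivative f (at x) i *\<^sub>R i) \<in> L2_space \<Omega>" if "finite A" "A \<subseteq> Basis" for A
    using that
  proof (induction rule: finite_induct)
    case (insert i A)
    have D: "(\<lambda>x. frechet_derivative f (at x) i) \<in> L2_space \<Omega>"
      using insert test_L2[OF test_functions_deriv[OF f]] by auto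
    then have "(\<lambda>x. frechet_derivative f (at x) i *\<^sub>R i) \<in> L2_space \<Omega>"
      by (auto simp: L2_space_def power_mult_distrib intro!: borel_measurable_scaleR)
    then show ?case using insert by (simp add: L2_space_add)
  qed simp
  then show "?g \<in> L2_space \<Omega>" by simp
  fix \<eta> i assume eta: "\<eta> \<in> test_functions \<Omega>" and i: "i \<in> (Basis :: 'a set)"
  let ?D = "\<lambda>x. f x * frechet_derivative \<eta> (at x) i + frechet_derivative f (at x) i * \<eta> x"
  obtain K where K: "compact K" "K \<subseteq> \<Omega>" "\<And>x. x \<notin> K \<Longrightarrow> f x = 0"
    using test_functions_compact_support[OF f] by metis
  have cont: "continuous_on UNIV ?D"
    by (intro continuous_intros test_functions_continuous[OF f] test_functions_continuous[OF eta]
        test_functions_continuous[OF test_functions_deriv[OF f i]] test_functions_continuous[OF test_functions_deriv[OF eta i]])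
  have "(LINT x|lborel. ?D x) = 0"
  proof (rule integral_directional_derivative[where K=K and \<psi>="\<lambda>x. f x * \<eta> x"
        and \<psi>'="\<lambda>x h. f x * frechet_derivative \<eta> (at x) h + frechet_derivative f (at x) h * \<eta> x"])
    show "((\<lambda>x. f x * \<eta> x) has_derivative (\<lambda>h. f x * frechet_derivative \<eta> (at x) h + frechet_derivative f (at x) h * \<eta> x)) (at x)" for x
      by (intro has_derivative_mult test_functions_has_derivative[OF f] test_functions_has_derivative[OF eta])
  qed (use K cont in auto)
  moreover have "(LINT x|lebesgue_on \<Omega>. ?D x) = (LINT x|lborel. ?D x)"
    using test_functions_zero_outside[OF f] test_functions_zero_outside[OF eta]
    by (intro integral_lebesgue_on_lborel borel_measurable_continuous_onI[OF cont]) auto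
  ultimately have "(LINT x|lebesgue_on \<Omega>. ?D x) = 0" by simp
  then have "L2_inner \<Omega> f (\<lambda>x. frechet_derivative \<eta> (at x) i) + L2_inner \<Omega> (\<lambda>x. frechet_derivative f (at x) i) \<eta> = 0"
    unfolding L2_inner_def
    using L2_inner_integrable[OF test_L2[OF f] test_L2[OF test_functions_deriv[OF eta i]]]
      L2_inner_integrable[OF test_L2[OF test_functions_deriv[OF f i]] test_L2[OF eta]] by simp
  then show "L2_inner \<Omega> f (\<lambda>x. frechet_derivative \<eta> (at x) i) = - L2_inner \<Omega> (\<lambda>x. ?g x \<bullet> i) \<eta>"
    using i by simp
qed

lemma test_H1: "f \<in> test_functions \<Omega> \<Longrightarrow> f \<in> H1_space \<Omega>"
  by (rule H1_spaceI[OF test_L2 test_weak_grad])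

lemma H10_H1: "u \<in> H10_space \<Omega> \<Longrightarrow> u \<in> H1_space \<Omega>"
  by (simp add: H10_space_def)

lemma H10_L2: "u \<in> H10_space \<Omega> \<Longrightarrow> u \<in> L2_space \<Omega>"
  by (simp add: H10_H1 H1_L2)

lemma H1_diff: "u \<in> H1_space \<Omega> \<Longrightarrow> v \<in> H1_space \<Omega> \<Longrightarrow> (\<lambda>x. u x - v x) \<in> H1_space \<Omega>"
  using H1_add[OF _ H1_scale, of u v "-1"] by simp

lemma seminormed_H10: "seminormed (H10_space \<Omega>) (H10_norm \<Omega>)"
proof -
  interpret G: seminormed "H1_space \<Omega>" "H10_norm \<Omega>" by (rule seminormed_H1_grad)
  interpret L: seminormed "L2_space \<Omega>" "L2_norm \<Omega>" by (rule seminormed_L2)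
  \<comment> \<open>The factor 2 comes from passing to the sum of the two seminorms and back; it is
    harmless, as the bound only serves to show convergence to zero.\<close>
  have H1_norm_add: "H1_norm \<Omega> (\<lambda>x. u x + v x) \<le> 2 * H1_norm \<Omega> u + 2 * H1_norm \<Omega> v"
    if "u \<in> H1_space \<Omega>" "v \<in> H1_space \<Omega>" for u v
    using H1_norm_le[of "\<lambda>x. u x + v x"] G.N_triangle[OF that] L.N_triangle[OF H1_L2 H1_L2, OF that]
      H1_norm_ge[of u] H1_norm_ge[of v] by linarith
  have H1_norm_scale: "H1_norm \<Omega> (\<lambda>x. c * u x) \<le> 2 * \<bar>c\<bar> * H1_norm \<Omega> u" if "u \<in> H1_space \<Omega>" for u c
    using H1_norm_le[of "\<lambda>x. c * u x"] G.N_scale[OF that] L.N_scale[OF H1_L2[OF that]]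
      mult_left_mono[OF H1_norm_ge(1), of "\<bar>c\<bar>" u] mult_left_mono[OF H1_norm_ge(2), of "\<bar>c\<bar>" u] by simp
  have nonneg: "0 \<le> H1_norm \<Omega> u" for u by (simp add: H1_norm_def)
  show ?thesis
  proof
    have "H1_norm \<Omega> (\<lambda>_. 0) = 0"
      using nonneg[of "\<lambda>_. 0"] H1_norm_le[of "\<lambda>_. 0"] G.N_zero by simp
    then show "(\<lambda>_. 0) \<in> H10_space \<Omega>"
      using G.zero_mem test_functions_zero by (auto simp: H10_space_def intro!: exI[of _ "\<lambda>_ _. 0"])
    show "(\<lambda>x. u x + v x) \<in> H10_space \<Omega>" if u: "u \<in> H10_space \<Omega>" and v: "v \<in> H10_space \<Omega>" for u v
    proof -
      obtain a b where ab: "\<And>k. a k \<in> test_functions \<Omega>" "(\<lambda>k::nat. H1_norm \<Omega> (\<lambda>x. u x - a k x)) \<longlonglongrightarrow> 0"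
        "\<And>k. b k \<in> test_functions \<Omega>" "(\<lambda>k::nat. H1_norm \<Omega> (\<lambda>x. v x - b k x)) \<longlonglongrightarrow> 0"
        using u v unfolding H10_space_def by blast
      have "(\<lambda>k. H1_norm \<Omega> (\<lambda>x. (u x + v x) - (a k x + b k x))) \<longlonglongrightarrow> 0"
      proof (rule Lim_null_comparison)
        show "(\<lambda>k. 2 * H1_norm \<Omega> (\<lambda>x. u x - a k x) + 2 * H1_norm \<Omega> (\<lambda>x. v x - b k x)) \<longlonglongrightarrow> 0"
          using tendsto_add[OF tendsto_mult_left[OF ab(2), of 2] tendsto_mult_left[OF ab(4), of 2]] by simp
        have "norm (H1_norm \<Omega> (\<lambda>x. (u x + v x) - (a k x + b k x)))
            \<le> 2 * H1_norm \<Omega> (\<lambda>x. u x - a k x) + 2 * H1_norm \<Omega> (\<lambda>x. v x - b k x)" for k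
          using H1_norm_add[of "\<lambda>x. u x - a k x" "\<lambda>x. v x - b k x"] nonneg
            H1_diff[OF H10_H1[OF u] test_H1[OF ab(1)]] H1_diff[OF H10_H1[OF v] test_H1[OF ab(3)]]
          by (simp add: algebra_simps)
        then show "\<forall>\<^sub>F k in sequentially. norm (H1_norm \<Omega> (\<lambda>x. (u x + v x) - (a k x + b k x)))
            \<le> 2 * H1_norm \<Omega> (\<lambda>x. u x - a k x) + 2 * H1_norm \<Omega> (\<lambda>x. v x - b k x)" by simp
      qed
      then show ?thesis
        using H1_add[OF H10_H1 H10_H1, OF u v] test_functions_add[OF ab(1) ab(3)]
        by (auto simp: H10_space_def intro!: exI[of _ "\<lambda>k x. a k x + b k x"])
    qed
    show "(\<lambda>x. c * u x) \<in> H10_space \<Omega>" if u: "u \<in> H10_space \<Omega>" for u c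
    proof -
      obtain a where a: "\<And>k. a k \<in> test_functions \<Omega>" "(\<lambda>k::nat. H1_norm \<Omega> (\<lambda>x. u x - a k x)) \<longlonglongrightarrow> 0"
        using u unfolding H10_space_def by blast
      have "(\<lambda>k. H1_norm \<Omega> (\<lambda>x. c * u x - c * a k x)) \<longlonglongrightarrow> 0"
      proof (rule Lim_null_comparison)
        show "(\<lambda>k. 2 * \<bar>c\<bar> * H1_norm \<Omega> (\<lambda>x. u x - a k x)) \<longlonglongrightarrow> 0"
          using tendsto_mult_left[OF a(2), of "2 * \<bar>c\<bar>"] by simp
        have "norm (H1_norm \<Omega> (\<lambda>x. c * u x - c * a k x)) \<le> 2 * \<bar>c\<bar> * H1_norm \<Omega> (\<lambda>x. u x - a k x)" for k
          using H1_norm_scale[of "\<lambda>x. u x - a k x" c] nonneg H1_diff[OF H10_H1[OF u] test_H1[OF a(1)]]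
          by (simp add: algebra_simps)
        then show "\<forall>\<^sub>F k in sequentially. norm (H1_norm \<Omega> (\<lambda>x. c * u x - c * a k x))
            \<le> 2 * \<bar>c\<bar> * H1_norm \<Omega> (\<lambda>x. u x - a k x)" by simp
      qed
      then show ?thesis
        using H1_scale[OF H10_H1[OF u]] test_functions_scale[OF a(1)]
        by (auto simp: H10_space_def intro!: exI[of _ "\<lambda>k x. c * a k x"])
    qed
  qed (auto simp: H10_H1 G.N_nonneg G.N_triangle G.N_scale)
qed

text \<open>The derivative of \<open>(x \<bullet> i) f\<^sup>2\<close> in the direction \<open>i\<close> integrates to zero.\<close>

lemma poincare_test:
  assumes f: "f \<in> test_functions \<Omega>" and R: "\<And>x. x \<in> \<Omega> \<Longrightarrow> norm x \<le> R" "0 \<le> R"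
  shows "L2_norm \<Omega> f \<le> 2 * R * H10_norm \<Omega> f"
proof -
  obtain i :: 'a where i: "i \<in> Basis" using nonempty_Basis by blast
  let ?d = "\<lambda>x. frechet_derivative f (at x) i"
  let ?D = "\<lambda>x. (x \<bullet> i) * (2 * f x * ?d x) + (i \<bullet> i) * (f x * f x)"
  obtain K where K: "compact K" "K \<subseteq> \<Omega>" "\<And>x. x \<notin> K \<Longrightarrow> f x = 0"
    using test_functions_compact_support[OF f] by metis
  have cont: "continuous_on UNIV ?D"
    by (intro continuous_intros test_functions_continuous[OF f] test_functions_continuous[OF test_functions_deriv[OF f i]])
  have "(LINT x|lborel. ?D x) = 0"
  proof (rule integral_directional_derivative[where K=K and \<psi>="\<lambda>x. (x \<bullet> i) * (f x * f x)"
        and \<psi>'="\<lambda>x h. (x \<bullet> i) * (2 * f x * frechet_derivative f (at x) h) + (h \<bullet> i) * (f x * f x)"])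
    show "((\<lambda>x. (x \<bullet> i) * (f x * f x)) has_derivative
        (\<lambda>h. (x \<bullet> i) * (2 * f x * frechet_derivative f (at x) h) + (h \<bullet> i) * (f x * f x))) (at x)" for x
      by (rule has_derivative_eq_rhs[OF has_derivative_mult[OF _ has_derivative_mult[OF
          test_functions_has_derivative[OF f] test_functions_has_derivative[OF f]]]])
        (auto intro!: derivative_eq_intros simp: algebra_simps)
  qed (use K cont in auto)
  moreover have "(LINT x|lebesgue_on \<Omega>. ?D x) = (LINT x|lborel. ?D x)"
    using test_functions_zero_outside[OF f]
    by (intro integral_lebesgue_on_lborel borel_measurable_continuous_onI[OF cont]) auto
  ultimately have 0: "(LINT x|lebesgue_on \<Omega>. ?D x) = 0" by simp
  have xf: "(\<lambda>x. (x \<bullet> i) * f x) \<in> L2_space \<Omega>"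
  proof (rule L2_space_mult_bounded[OF test_L2[OF f]])
    show "(\<lambda>x. x \<bullet> i) \<in> borel_measurable (lebesgue_on \<Omega>)"
      by (intro continuous_imp_measurable_on_sets_lebesgue continuous_intros) simp
    show "\<bar>x \<bullet> i\<bar> \<le> R" if "x \<in> \<Omega>" for x
      using Basis_le_norm[OF i, of x] R(1)[OF that] by linarith
  qed
  have d: "?d \<in> L2_space \<Omega>" by (rule test_L2[OF test_functions_deriv[OF f i]])
  have eq: "?D = (\<lambda>x. 2 * (((x \<bullet> i) * f x) \<bullet> ?d x) + f x \<bullet> f x)" using i by auto
  have "(LINT x|lebesgue_on \<Omega>. ?D x) = 2 * L2_inner \<Omega> (\<lambda>x. (x \<bullet> i) * f x) ?d + L2_inner \<Omega> f f"
    unfolding eq unfolding L2_inner_def using L2_inner_integrable[OF xf d] L2_inner_integrable[OF test_L2 test_L2, OF f f] by simp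
  then have "(L2_norm \<Omega> f)\<^sup>2 \<le> 2 * \<bar>L2_inner \<Omega> (\<lambda>x. (x \<bullet> i) * f x) ?d\<bar>"
    using 0 by (simp add: L2_norm_power2)
  also have "\<dots> \<le> 2 * (L2_norm \<Omega> (\<lambda>x. (x \<bullet> i) * f x) * L2_norm \<Omega> ?d)"
    using L2_Cauchy_Schwarz[OF xf d] by simp
  also have "L2_norm \<Omega> (\<lambda>x. (x \<bullet> i) * f x) \<le> L2_norm \<Omega> (\<lambda>x. R * f x)"
  proof (rule L2_norm_mono[OF xf L2_space_scale[OF test_L2[OF f]]])
    show "norm ((x \<bullet> i) * f x) \<le> norm (R * f x)" if "x \<in> \<Omega>" for x
      using Basis_le_norm[OF i, of x] R(1)[OF that] R(2) by (simp add: abs_mult mult_right_mono)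
  qed
  also have "L2_norm \<Omega> (\<lambda>x. R * f x) = R * L2_norm \<Omega> f" using R(2) by (simp add: L2_norm_scale)
  also have "L2_norm \<Omega> ?d \<le> L2_norm \<Omega> (\<lambda>x. \<Sum>j\<in>Basis. frechet_derivative f (at x) j *\<^sub>R j)"
  proof (rule L2_norm_mono[OF d])
    show "(\<lambda>x. \<Sum>j\<in>Basis. frechet_derivative f (at x) j *\<^sub>R j) \<in> L2_space \<Omega>"
      using test_weak_grad[OF f] by (simp add: is_weak_grad_def)
    show "norm (?d x) \<le> norm (\<Sum>j\<in>Basis. frechet_derivative f (at x) j *\<^sub>R j)" for x
      using Basis_le_norm[OF i, of "\<Sum>j\<in>Basis. frechet_derivative f (at x) j *\<^sub>R j"] i by simp
  qed
  also have "\<dots> = H10_norm \<Omega> f"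
    unfolding H10_norm_def
    using test_weak_grad[OF f] wgrad_AE[OF test_L2[OF f] test_weak_grad[OF f]] wgrad_L2[OF test_H1[OF f]]
    by (intro L2_norm_AE_cong) (auto simp: is_weak_grad_def elim: eventually_mono)
  finally have "L2_norm \<Omega> f * L2_norm \<Omega> f \<le> (2 * R * H10_norm \<Omega> f) * L2_norm \<Omega> f"
    using R(2) by (simp add: mult_left_mono mult_right_mono power2_eq_square algebra_simps)
  then show ?thesis
    using R(2) L2_norm_nonneg[of \<Omega> f]
    by (cases "L2_norm \<Omega> f = 0") (auto simp: H10_norm_def)
qed

text \<open>The constant is twice the radius of a ball about the origin containing the domain. The
  inequality passes to the limit along the test functions that witness membership in
  \<open>H10_space\<close>.\<close>

lemma poincare:
  obtains C where "0 \<le> C" "\<And>u. u \<in> H10_space \<Omega> \<Longrightarrow> L2_norm \<Omega> u \<le> C * H10_norm \<Omega> u"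
proof -
  interpret G: seminormed "H1_space \<Omega>" "H10_norm \<Omega>" by (rule seminormed_H1_grad)
  interpret L: seminormed "L2_space \<Omega>" "L2_norm \<Omega>" by (rule seminormed_L2)
  obtain R0 where "\<And>x. x \<in> \<Omega> \<Longrightarrow> norm x \<le> R0" using bounded_dom by (auto simp: bounded_iff)
  then have R: "\<And>x. x \<in> \<Omega> \<Longrightarrow> norm x \<le> max R0 0" "0 \<le> max R0 0" by (auto simp: le_max_iff_disj)
  let ?C = "2 * max R0 0"
  show thesis
  proof (rule that)
    show "0 \<le> ?C" by simp
    fix u assume u: "u \<in> H10_space \<Omega>"
    obtain a where a: "\<And>k. a k \<in> test_functions \<Omega>" "(\<lambda>k::nat. H1_norm \<Omega> (\<lambda>x. u x - a k x)) \<longlonglongrightarrow> 0"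
      using u unfolding H10_space_def by blast
    have "L2_norm \<Omega> u \<le> ?C * H10_norm \<Omega> u + (1 + ?C) * H1_norm \<Omega> (\<lambda>x. u x - a k x)" for k
    proof -
      let ?e = "\<lambda>x. u x - a k x"
      note uk = H10_H1[OF u] test_H1[OF a(1), of k]
      have "L2_norm \<Omega> u \<le> L2_norm \<Omega> (a k) + L2_norm \<Omega> ?e" using uk by (intro L.N_le_diff) (auto simp: H1_L2)
      moreover have "L2_norm \<Omega> (a k) \<le> ?C * H10_norm \<Omega> (a k)" by (rule poincare_test[OF a(1) R])
      moreover have "H10_norm \<Omega> (a k) \<le> H10_norm \<Omega> u + H1_norm \<Omega> ?e"
        using G.N_le_diff[OF uk(2,1)] G.N_diff_commute[OF uk] H1_norm_ge(2)[of ?e] by linarith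
      then have "?C * H10_norm \<Omega> (a k) \<le> ?C * (H10_norm \<Omega> u + H1_norm \<Omega> ?e)" by (intro mult_left_mono) auto
      moreover note H1_norm_ge(1)[of ?e]
      ultimately show ?thesis unfolding distrib_right distrib_left by linarith
    qed
    moreover have "(\<lambda>k. ?C * H10_norm \<Omega> u + (1 + ?C) * H1_norm \<Omega> (\<lambda>x. u x - a k x)) \<longlonglongrightarrow> ?C * H10_norm \<Omega> u + (1 + ?C) * 0"
      by (intro tendsto_intros a(2))
    ultimately show "L2_norm \<Omega> u \<le> ?C * H10_norm \<Omega> u"
      by (intro LIMSEQ_le_const[where a="L2_norm \<Omega> u"]) auto
  qed
qed

end

section \<open>Bochner spaces as seminormed spaces\<close>

lemma bochner_norm_L2_norm: "bochner_norm T N u = L2_norm {0<..<T} (\<lambda>t. N (u t))"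
  by (simp add: bochner_norm_def L2_norm_def L2_inner_def power2_eq_square)

lemma AE_time: "AE t in time_measure T. t \<in> {0<..<T}"
  by (rule AE_I2) simp

text \<open>Applied to the inner product of \<open>L2_space\<close>, to the Dirichlet form, and to
  the pairing of \<open>Hm1_space\<close> with \<open>H10_space\<close>. The bound makes
  \<open>B\<close> continuous, hence the integrand measurable; Cauchy-Schwarz in time does the
  rest.\<close>

lemma bochner_bilinear:
  fixes B :: "('b \<Rightarrow> real) \<Rightarrow> ('c \<Rightarrow> real) \<Rightarrow> real"
  assumes V: "seminormed V N" and W: "seminormed W M" and C: "0 \<le> C"
    and diffL: "\<And>a x b. a \<in> V \<Longrightarrow> x \<in> V \<Longrightarrow> b \<in> W \<Longrightarrow> B (\<lambda>z. a z - x z) b = B a b - B x b"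
    and diffR: "\<And>a b y. a \<in> V \<Longrightarrow> b \<in> W \<Longrightarrow> y \<in> W \<Longrightarrow> B a (\<lambda>z. b z - y z) = B a b - B a y"
    and bound: "\<And>a b. a \<in> V \<Longrightarrow> b \<in> W \<Longrightarrow> \<bar>B a b\<bar> \<le> C * N a * M b"
    and u: "u \<in> bochner_L2 T V N" and v: "v \<in> bochner_L2 T W M"
  shows "(\<lambda>t. B (u t) (v t)) \<in> borel_measurable (time_measure T)" (is ?meas)
    and "integrable (time_measure T) (\<lambda>t. B (u t) (v t))" (is ?int)
    and "\<bar>LINT t|time_measure T. B (u t) (v t)\<bar> \<le> C * bochner_norm T N u * bochner_norm T M v" (is ?bd)
proof -
  interpret V: seminormed V N by (rule V)
  interpret W: seminormed W M by (rule W)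
  show meas: ?meas
  proof (rule bochner_measurable2[OF u v])
    fix x y a b
    assume h: "x \<in> V" "y \<in> W" "\<And>k. a k \<in> V" "\<And>k. b k \<in> W"
      "(\<lambda>k::nat. N (\<lambda>z. a k z - x z)) \<longlonglongrightarrow> 0" "(\<lambda>k. M (\<lambda>z. b k z - y z)) \<longlonglongrightarrow> 0"
    have "(\<lambda>k. B (a k) (b k) - B x y) \<longlonglongrightarrow> 0"
    proof (rule Lim_null_comparison)
      have "(\<lambda>k. C * N (\<lambda>z. a k z - x z) * M (b k) + C * N x * M (\<lambda>z. b k z - y z)) \<longlonglongrightarrow> C * 0 * M y + C * N x * 0"
        by (intro tendsto_intros h W.N_tendsto)
      then show "(\<lambda>k. C * N (\<lambda>z. a k z - x z) * M (b k) + C * N x * M (\<lambda>z. b k z - y z)) \<longlonglongrightarrow> 0" by simp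
      have "norm (B (a k) (b k) - B x y) \<le> C * N (\<lambda>z. a k z - x z) * M (b k) + C * N x * M (\<lambda>z. b k z - y z)" for k
      proof -
        have "B (a k) (b k) - B x y = B (\<lambda>z. a k z - x z) (b k) + B x (\<lambda>z. b k z - y z)"
          using diffL[OF h(3,1,4)] diffR[OF h(1,4,2)] by simp
        moreover have "\<bar>B (\<lambda>z. a k z - x z) (b k)\<bar> \<le> C * N (\<lambda>z. a k z - x z) * M (b k)"
          using h by (intro bound V.diff_mem)
        moreover have "\<bar>B x (\<lambda>z. b k z - y z)\<bar> \<le> C * N x * M (\<lambda>z. b k z - y z)"
          using h by (intro bound W.diff_mem)
        ultimately show ?thesis unfolding real_norm_def by linarith
      qed
      then show "\<forall>\<^sub>F k in sequentially. norm (B (a k) (b k) - B x y)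
          \<le> C * N (\<lambda>z. a k z - x z) * M (b k) + C * N x * M (\<lambda>z. b k z - y z)" by simp
    qed
    then show "(\<lambda>k. B (a k) (b k)) \<longlonglongrightarrow> B x y" by (simp add: LIM_zero_iff)
  qed
  have NM: "integrable (time_measure T) (\<lambda>t. C * (N (u t) * M (v t)))"
    using L2_inner_integrable[OF V.bochner_N_L2[OF u] W.bochner_N_L2[OF v]] by simp
  have le: "AE t in time_measure T. \<bar>B (u t) (v t)\<bar> \<le> C * (N (u t) * M (v t))"
    using bochner_L2_AE[OF u] bochner_L2_AE[OF v] by eventually_elim (simp add: bound flip: mult.assoc)
  have le': "AE t in time_measure T. norm (B (u t) (v t)) \<le> norm (C * (N (u t) * M (v t)))"
    using le by eventually_elim auto
  show int: ?int by (rule Bochner_Integration.integrable_bound[OF NM meas le'])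
  have "\<bar>LINT t|time_measure T. B (u t) (v t)\<bar> \<le> (LINT t|time_measure T. \<bar>B (u t) (v t)\<bar>)"
    by (rule integral_abs_bound)
  also have "\<dots> \<le> (LINT t|time_measure T. C * (N (u t) * M (v t)))"
    using int NM le by (intro integral_mono_AE) auto
  also have "\<dots> = C * L2_inner {0<..<T} (\<lambda>t. N (u t)) (\<lambda>t. M (v t))" by (simp add: L2_inner_def)
  also have "\<dots> \<le> C * (L2_norm {0<..<T} (\<lambda>t. N (u t)) * L2_norm {0<..<T} (\<lambda>t. M (v t)))"
    using L2_Cauchy_Schwarz[OF V.bochner_N_L2[OF u] W.bochner_N_L2[OF v]] C by (intro mult_left_mono) auto
  finally show ?bd by (simp add: bochner_norm_L2_norm)
qed

text \<open>Lipschitz maps preserve strong measurability and square integrability. The instances are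
  the embeddings of \<open>H10_space\<close> into \<open>L2_space\<close> and of
  \<open>L2_space\<close> into \<open>Hm1_space\<close>.\<close>

lemma bochner_map:
  assumes V: "seminormed V N" and W: "seminormed W M"
    and A: "\<And>a. a \<in> V \<Longrightarrow> A a \<in> W"
    and bound: "\<And>a. a \<in> V \<Longrightarrow> M (A a) \<le> C * N a"
    and diff: "\<And>a b. a \<in> V \<Longrightarrow> b \<in> V \<Longrightarrow> M (\<lambda>y. A a y - A b y) \<le> C * N (\<lambda>x. a x - b x)"
    and u: "u \<in> bochner_L2 T V N"
  shows "(\<lambda>t. A (u t)) \<in> bochner_L2 T W M"
proof -
  interpret V: seminormed V N by (rule V)
  interpret W: seminormed W M by (rule W)
  obtain a where a: "\<And>k. simple_into T V (a k)"
    "AE t in time_measure T. (\<lambda>k::nat. N (\<lambda>x. a k t x - u t x)) \<longlonglongrightarrow> 0"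
    using bochner_L2E[OF u] by blast
  have a': "simple_into T W (\<lambda>t. A (a k t))" for k
    using finitely_valued_comp[of T "a k" A] a(1)[of k] A by (auto simp: simple_into_iff)
  have lim: "AE t in time_measure T. (\<lambda>k::nat. M (\<lambda>y. A (a k t) y - A (u t) y)) \<longlonglongrightarrow> 0"
    using a(2) bochner_L2_AE[OF u] AE_time
  proof eventually_elim
    case (elim t)
    show ?case
    proof (rule Lim_null_comparison)
      show "(\<lambda>k. C * N (\<lambda>x. a k t x - u t x)) \<longlonglongrightarrow> 0"
        using tendsto_mult_left[OF elim(1), of C] by simp
      have "norm (M (\<lambda>y. A (a k t) y - A (u t) y)) \<le> C * N (\<lambda>x. a k t x - u t x)" for k
        using diff[OF simple_intoD[OF a(1) elim(3)] elim(2)]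
          W.N_nonneg[OF W.diff_mem[OF simple_intoD[OF a' elim(3)] A[OF elim(2)]]] by simp
      then show "\<forall>\<^sub>F k in sequentially. norm (M (\<lambda>y. A (a k t) y - A (u t) y)) \<le> C * N (\<lambda>x. a k t x - u t x)"
        by simp
    qed
  qed
  have ae: "AE t in time_measure T. A (u t) \<in> W"
    using bochner_L2_AE[OF u] by eventually_elim (rule A)
  have meas: "(\<lambda>t. M (A (u t))) \<in> borel_measurable (time_measure T)"
  proof (rule borel_measurable_lebesgue_on_LIMSEQ_AE)
    show "(\<lambda>t. M (A (a k t))) \<in> borel_measurable (time_measure T)" for k
      using a(1)[of k] finitely_valued_borel[OF finitely_valued_comp[of T "a k" "\<lambda>x. M (A x)"]] by (simp add: simple_into_iff)
    show "AE t in time_measure T. (\<lambda>k. M (A (a k t))) \<longlonglongrightarrow> M (A (u t))"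
      using lim ae AE_time by eventually_elim (intro W.N_tendsto simple_intoD[OF a'])
  qed simp
  have "integrable (time_measure T) (\<lambda>t. (M (A (u t)))\<^sup>2)"
  proof (rule Bochner_Integration.integrable_bound)
    show "integrable (time_measure T) (\<lambda>t. C\<^sup>2 * (N (u t))\<^sup>2)"
      using u by (simp add: bochner_L2_def)
    show "AE t in time_measure T. norm ((M (A (u t)))\<^sup>2) \<le> norm (C\<^sup>2 * (N (u t))\<^sup>2)"
      using bochner_L2_AE[OF u] ae
    proof eventually_elim
      case (elim t)
      show ?case using power_mono[OF bound[OF elim(1)] W.N_nonneg[OF elim(2)], of 2] by (simp add: power_mult_distrib)
    qed
  qed (use meas in simp)
  then show ?thesis using ae a' lim by (intro bochner_L2I)
qed

lemma slice_arith:
  "slice (\<lambda>_. 0) = (\<lambda>_ _. 0)"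
  "slice (\<lambda>z. u z + v z) = (\<lambda>t x. slice u t x + slice v t x)"
  "slice (\<lambda>z. u z - v z) = (\<lambda>t x. slice u t x - slice v t x)"
  "slice (\<lambda>z. c * f z) = (\<lambda>t x. c * slice f t x)"
  "slice (\<lambda>z. \<Sum>i\<in>A. h i z) = (\<lambda>t x. \<Sum>i\<in>A. slice (h i) t x)"
  by (simp_all add: slice_def fun_eq_iff)

context seminormed
begin

lemma bochner_zero: "(\<lambda>_ _. 0) \<in> bochner_L2 T V N"
  using bochner_sum[of "{}"] by simp

text \<open>Phrased for functions on the cylinder instead of curves, as \<open>Y_space\<close> is,
  so that \<open>Y_space\<close> and its dual become instances of the locale.\<close>

lemma seminormed_bochner: "seminormed {u. slice u \<in> bochner_L2 T V N} (\<lambda>u. bochner_norm T N (slice u))"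
proof
  show "bochner_norm T N (slice (\<lambda>z. u z + v z)) \<le> bochner_norm T N (slice u) + bochner_norm T N (slice v)"
    if "u \<in> {u. slice u \<in> bochner_L2 T V N}" "v \<in> {u. slice u \<in> bochner_L2 T V N}" for u v
  proof -
    have uv: "slice u \<in> bochner_L2 T V N" "slice v \<in> bochner_L2 T V N" using that by auto
    have L: "(\<lambda>t. N (slice u t) + N (slice v t)) \<in> L2_space {0<..<T}"
      using uv by (intro L2_space_add bochner_N_L2)
    have "AE t in time_measure T. norm (N (\<lambda>x. slice u t x + slice v t x)) \<le> norm (N (slice u t) + N (slice v t))"
      using bochner_L2_AE[OF uv(1)] bochner_L2_AE[OF uv(2)]
    proof eventually_elim
      case (elim t)
      then show ?case using N_triangle[OF elim] N_nonneg[OF add_mem, OF elim] by simp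
    qed
    then have "L2_norm {0<..<T} (\<lambda>t. N (\<lambda>x. slice u t x + slice v t x)) \<le> L2_norm {0<..<T} (\<lambda>t. N (slice u t) + N (slice v t))"
      by (rule L2_norm_mono_AE[OF bochner_N_L2[OF bochner_add[OF uv]] L])
    also have "\<dots> \<le> L2_norm {0<..<T} (\<lambda>t. N (slice u t)) + L2_norm {0<..<T} (\<lambda>t. N (slice v t))"
      using uv by (intro L2_norm_triangle bochner_N_L2)
    finally show ?thesis by (simp add: bochner_norm_L2_norm slice_def)
  qed
  show "bochner_norm T N (slice (\<lambda>z. c * u z)) = \<bar>c\<bar> * bochner_norm T N (slice u)"
    if "u \<in> {u. slice u \<in> bochner_L2 T V N}" for u c
  proof -
    have u: "slice u \<in> bochner_L2 T V N" using that by auto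
    have ae: "AE t in time_measure T. N (\<lambda>x. c * slice u t x) = \<bar>c\<bar> * N (slice u t)"
      using bochner_L2_AE[OF u] by eventually_elim (rule N_scale)
    have "L2_norm {0<..<T} (\<lambda>t. N (\<lambda>x. c * slice u t x)) = L2_norm {0<..<T} (\<lambda>t. \<bar>c\<bar> * N (slice u t))"
      by (rule L2_norm_AE_cong[OF ae bochner_N_L2[OF bochner_scale[OF u]] L2_space_scale[OF bochner_N_L2[OF u]]])
    then show ?thesis by (simp add: bochner_norm_L2_norm slice_def L2_norm_scale)
  qed
  show "0 \<le> bochner_norm T N (slice u)" for u by (simp add: bochner_norm_L2_norm)
qed (auto simp: slice_arith intro: bochner_zero bochner_add bochner_scale)

text \<open>The approximating simple functions are real simple functions converging to the time
  factor, multiplied by the fixed vector \<open>w\<close>.\<close>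

lemma bochner_tensor:
  fixes \<phi> :: "real \<Rightarrow> real"
  assumes w: "w \<in> V" and \<phi>: "\<phi> \<in> borel_measurable (time_measure T)"
    and B: "\<And>t. t \<in> {0<..<T} \<Longrightarrow> \<bar>\<phi> t\<bar> \<le> B"
  shows "slice (tensor w \<phi>) \<in> bochner_L2 T V N"
proof -
  have eq: "slice (tensor w \<phi>) = (\<lambda>t x. \<phi> t * w x)" by (auto simp: slice_def tensor_def fun_eq_iff)
  obtain F where F: "\<And>i. simple_function (time_measure T) (F i)"
    "\<And>t. t \<in> space (time_measure T) \<Longrightarrow> (\<lambda>i. F i t) \<longlonglongrightarrow> \<phi> t"
    using borel_measurable_implies_sequence_metric[OF \<phi>, of 0] by blast
  have fv: "finitely_valued T (F i)" for i
  proof -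
    have "{t\<in>{0<..<T}. F i t = v} \<in> sets lebesgue" for v
    proof -
      have "F i -` {v} \<inter> space (time_measure T) \<in> sets (time_measure T)"
        by (rule simple_functionD[OF F(1)])
      moreover have "F i -` {v} \<inter> space (time_measure T) = {t\<in>{0<..<T}. F i t = v}" by auto
      ultimately show ?thesis by (simp add: sets_restrict_space_iff)
    qed
    then show ?thesis using simple_functionD(1)[OF F(1), of i] by (simp add: finitely_valued_def)
  qed
  show ?thesis
    unfolding eq
  proof (rule bochner_L2I[where a="\<lambda>i t x. F i t * w x"])
    show "AE t in time_measure T. (\<lambda>x. \<phi> t * w x) \<in> V" using w by (intro AE_I2 scale_mem)
    show "simple_into T V (\<lambda>t x. F i t * w x)" for i
      using finitely_valued_comp[OF fv, of "\<lambda>c x. c * w x" i] w scale_mem by (auto simp: simple_into_iff)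
    show "AE t in time_measure T. (\<lambda>k. N (\<lambda>x. F k t * w x - \<phi> t * w x)) \<longlonglongrightarrow> 0"
    proof (rule AE_I2)
      fix t assume t: "t \<in> space (time_measure T)"
      have "N (\<lambda>x. F k t * w x - \<phi> t * w x) = \<bar>F k t - \<phi> t\<bar> * N w" for k
        using N_scale[OF w, of "F k t - \<phi> t"] by (simp add: algebra_simps)
      moreover have "(\<lambda>k. \<bar>F k t - \<phi> t\<bar> * N w) \<longlonglongrightarrow> \<bar>\<phi> t - \<phi> t\<bar> * N w"
        by (intro tendsto_intros F(2)[OF t])
      ultimately show "(\<lambda>k. N (\<lambda>x. F k t * w x - \<phi> t * w x)) \<longlonglongrightarrow> 0" by simp
    qed
    have "integrable (time_measure T) (\<lambda>t. (\<phi> t)\<^sup>2 * (N w)\<^sup>2)"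
    proof (rule integrable_bounded_lebesgue_on[where B="B\<^sup>2 * (N w)\<^sup>2"])
      show "(\<lambda>t. (\<phi> t)\<^sup>2 * (N w)\<^sup>2) \<in> borel_measurable (time_measure T)" using \<phi> by simp
      show "\<bar>(\<phi> t)\<^sup>2 * (N w)\<^sup>2\<bar> \<le> B\<^sup>2 * (N w)\<^sup>2" if "t \<in> {0<..<T}" for t
        using power_mono[OF B[OF that], of 2] by (simp add: mult_right_mono abs_mult)
    qed simp
    then show "integrable (time_measure T) (\<lambda>t. (N (\<lambda>x. \<phi> t * w x))\<^sup>2)"
      using N_scale[OF w] by (simp add: power_mult_distrib)
  qed
qed

lemma bochner_const: "v \<in> V \<Longrightarrow> (\<lambda>_. v) \<in> bochner_L2 T V N"
proof -
  assume v: "v \<in> V"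
  have "slice (tensor v (\<lambda>_. 1)) = (\<lambda>_. v)" by (simp add: slice_def tensor_def fun_eq_iff)
  then show ?thesis using bochner_tensor[OF v, of "\<lambda>_. 1" T 1] by simp
qed

end

section \<open>The space-time cylinder\<close>

locale cylinder = bounded_domain \<Omega> for \<Omega> :: "'a::euclidean_space set" +
  fixes T :: real
  assumes T_pos: "0 < T"
begin

sublocale L2: seminormed "L2_space \<Omega> :: ('a \<Rightarrow> real) set" "L2_norm \<Omega>"
  by (rule seminormed_L2)

sublocale H10: seminormed "H10_space \<Omega>" "H10_norm \<Omega>"
  by (rule seminormed_H10)

sublocale Hm1: seminormed "Hm1_space \<Omega>" "Hm1_norm \<Omega>"
  unfolding Hm1_space_def Hm1_norm_def by (rule H10.dual_seminormed)

lemma slice_grad_x: "slice (grad_x \<Omega> u) t = wgrad \<Omega> (slice u t)"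
  by (simp add: slice_def grad_x_def)

lemma Y_norm_bochner: "Y_norm \<Omega> T = (\<lambda>v. bochner_norm T (H10_norm \<Omega>) (slice v))"
  by (simp add: fun_eq_iff Y_norm_def L2Q_norm_def L2Q_inner_def bochner_norm_def slice_grad_x H10_norm_def L2_norm_power2)

sublocale Y: seminormed "Y_space \<Omega> T" "Y_norm \<Omega> T"
  unfolding Y_space_def Y_norm_bochner by (rule H10.seminormed_bochner)

sublocale Ystar: seminormed "Ystar_space \<Omega> T" "Ystar_norm \<Omega> T"
  unfolding Ystar_space_def Ystar_norm_def by (rule Y.dual_seminormed)

lemma Y_spaceD: "v \<in> Y_space \<Omega> T \<Longrightarrow> slice v \<in> bochner_L2 T (H10_space \<Omega>) (H10_norm \<Omega>)"
  by (simp add: Y_space_def)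

lemma Ystar_bound: "F \<in> Ystar_space \<Omega> T \<Longrightarrow> v \<in> Y_space \<Omega> T \<Longrightarrow> \<bar>F v\<bar> \<le> Ystar_norm \<Omega> T F * Y_norm \<Omega> T v"
  unfolding Ystar_space_def Ystar_norm_def by (rule Y.dual_norm_bound)

lemma Ystar_diff:
  "F \<in> Ystar_space \<Omega> T \<Longrightarrow> u \<in> Y_space \<Omega> T \<Longrightarrow> v \<in> Y_space \<Omega> T \<Longrightarrow> F (\<lambda>z. u z - v z) = F u - F v"
  unfolding Ystar_space_def by (rule Y.dual_diff)

lemma Hm1_bound: "F \<in> Hm1_space \<Omega> \<Longrightarrow> w \<in> H10_space \<Omega> \<Longrightarrow> \<bar>F w\<bar> \<le> Hm1_norm \<Omega> F * H10_norm \<Omega> w"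
  unfolding Hm1_space_def Hm1_norm_def by (rule H10.dual_norm_bound)

lemma bochner_H10_L2:
  assumes "u \<in> bochner_L2 T (H10_space \<Omega>) (H10_norm \<Omega>)"
  shows "u \<in> bochner_L2 T (L2_space \<Omega>) (L2_norm \<Omega>)"
proof -
  obtain C where C: "0 \<le> C" "\<And>u. u \<in> H10_space \<Omega> \<Longrightarrow> L2_norm \<Omega> u \<le> C * H10_norm \<Omega> u"
    using poincare by blast
  show ?thesis
    by (rule bochner_map[where A="\<lambda>u. u" and C=C, OF seminormed_H10 seminormed_L2 _ _ _ assms])
      (auto intro: H10_L2 C H10.diff_mem)
qed

lemma L2_inner_bochner:
  fixes u v :: "real \<Rightarrow> 'a \<Rightarrow> real"
  assumes "u \<in> bochner_L2 T (L2_space \<Omega>) (L2_norm \<Omega>)" "v \<in> bochner_L2 T (L2_space \<Omega>) (L2_norm \<Omega>)"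
  shows "(\<lambda>t. L2_inner \<Omega> (u t) (v t)) \<in> borel_measurable (time_measure T)"
    and "integrable (time_measure T) (\<lambda>t. L2_inner \<Omega> (u t) (v t))"
    and "\<bar>LINT t|time_measure T. L2_inner \<Omega> (u t) (v t)\<bar> \<le> bochner_norm T (L2_norm \<Omega>) u * bochner_norm T (L2_norm \<Omega>) v"
proof -
  have 1: "\<bar>L2_inner \<Omega> a b\<bar> \<le> 1 * L2_norm \<Omega> a * L2_norm \<Omega> b"
    if "a \<in> L2_space \<Omega>" "b \<in> L2_space \<Omega>" for a b :: "'a \<Rightarrow> real"
    using L2_Cauchy_Schwarz[OF that] by simp
  note * = bochner_bilinear[OF seminormed_L2 seminormed_L2 _ L2_inner_diff_left L2_inner_diff_right 1 assms]
  show "(\<lambda>t. L2_inner \<Omega> (u t) (v t)) \<in> borel_measurable (time_measure T)" by (rule *(1)) simp_all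
  show "integrable (time_measure T) (\<lambda>t. L2_inner \<Omega> (u t) (v t))" by (rule *(2)) simp_all
  have "\<bar>LINT t|time_measure T. L2_inner \<Omega> (u t) (v t)\<bar> \<le> 1 * bochner_norm T (L2_norm \<Omega>) u * bochner_norm T (L2_norm \<Omega>) v"
    by (rule *(3)) simp_all
  then show "\<bar>LINT t|time_measure T. L2_inner \<Omega> (u t) (v t)\<bar> \<le> bochner_norm T (L2_norm \<Omega>) u * bochner_norm T (L2_norm \<Omega>) v"
    by simp
qed

lemma dirichlet_diff_left:
  assumes "u \<in> H10_space \<Omega>" "v \<in> H10_space \<Omega>" "w \<in> H10_space \<Omega>"
  shows "dirichlet (\<lambda>x. u x - v x) w = dirichlet u w - dirichlet v w"
  using dirichlet_add_left[of u "\<lambda>x. (-1) * v x" w] dirichlet_scale_left[of v w "-1"]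
    H1_scale[OF H10_H1[OF assms(2)], of "-1"] assms
  by (simp add: H10_H1)

lemma dirichlet_diff_right:
  assumes "u \<in> H10_space \<Omega>" "v \<in> H10_space \<Omega>" "w \<in> H10_space \<Omega>"
  shows "dirichlet w (\<lambda>x. u x - v x) = dirichlet w u - dirichlet w v"
  using dirichlet_diff_left[OF assms] by (simp add: dirichlet_commute[of w])

lemma dirichlet_bochner:
  fixes u v :: "real \<Rightarrow> 'a \<Rightarrow> real"
  assumes "u \<in> bochner_L2 T (H10_space \<Omega>) (H10_norm \<Omega>)" "v \<in> bochner_L2 T (H10_space \<Omega>) (H10_norm \<Omega>)"
  shows "integrable (time_measure T) (\<lambda>t. dirichlet (u t) (v t))"
    and "\<bar>LINT t|time_measure T. dirichlet (u t) (v t)\<bar> \<le> bochner_norm T (H10_norm \<Omega>) u * bochner_norm T (H10_norm \<Omega>) v"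
proof -
  have 1: "\<bar>dirichlet a b\<bar> \<le> 1 * H10_norm \<Omega> a * H10_norm \<Omega> b"
    if "a \<in> H10_space \<Omega>" "b \<in> H10_space \<Omega>" for a b
    using dirichlet_bound[of a b] that by (simp add: H10_H1)
  note * = bochner_bilinear[OF seminormed_H10 seminormed_H10 _ dirichlet_diff_left dirichlet_diff_right 1 assms]
  show "integrable (time_measure T) (\<lambda>t. dirichlet (u t) (v t))" by (rule *(2)) simp_all
  have "\<bar>LINT t|time_measure T. dirichlet (u t) (v t)\<bar> \<le> 1 * bochner_norm T (H10_norm \<Omega>) u * bochner_norm T (H10_norm \<Omega>) v"
    by (rule *(3)) simp_all
  then show "\<bar>LINT t|time_measure T. dirichlet (u t) (v t)\<bar> \<le> bochner_norm T (H10_norm \<Omega>) u * bochner_norm T (H10_norm \<Omega>) v"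
    by simp
qed

lemma L2Q_grad: "L2Q_inner \<Omega> T (grad_x \<Omega> u) (grad_x \<Omega> v) = (LINT t|time_measure T. dirichlet (slice u t) (slice v t))"
  by (simp add: L2Q_inner_def slice_grad_x dirichlet_def)

end

section \<open>Time derivatives\<close>

context cylinder
begin

lemma time_test_facts:
  assumes "\<phi> \<in> test_functions {0<..<T}"
  shows "\<phi> \<in> borel_measurable (time_measure T)" "\<exists>B. \<forall>t. \<bar>\<phi> t\<bar> \<le> B"
    "deriv \<phi> \<in> test_functions {0<..<T}" "(\<phi> has_real_derivative deriv \<phi> t) (at t)"
proof -
  show "\<phi> \<in> borel_measurable (time_measure T)" by (rule test_functions_measurable[OF assms]) simp
  show "\<exists>B. \<forall>t. \<bar>\<phi> t\<bar> \<le> B" using test_functions_bounded[OF assms] by metis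
  have d: "(\<phi> has_derivative frechet_derivative \<phi> (at t)) (at t)" for t
    by (rule test_functions_has_derivative[OF assms])
  have D: "(\<phi> has_real_derivative frechet_derivative \<phi> (at t) 1) (at t)" for t
  proof -
    have "frechet_derivative \<phi> (at t) h = frechet_derivative \<phi> (at t) 1 * h" for h
      using linear_scale[OF has_derivative_linear[OF d[of t]], of h 1] unfolding real_scaleR_def mult_1_right by (simp only: mult.commute)
    then have "frechet_derivative \<phi> (at t) = (*) (frechet_derivative \<phi> (at t) 1)" by (rule ext)
    then show ?thesis using d[of t] unfolding has_field_derivative_def by simp
  qed
  have eq: "deriv \<phi> = (\<lambda>t. frechet_derivative \<phi> (at t) 1)" using DERIV_imp_deriv[OF D] by auto
  show "(\<phi> has_real_derivative deriv \<phi> t) (at t)" using D by (simp add: eq)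
  show "deriv \<phi> \<in> test_functions {0<..<T}" unfolding eq by (rule test_functions_deriv[OF assms]) simp
qed

lemma tensor_Y:
  assumes "w \<in> H10_space \<Omega>" "\<phi> \<in> borel_measurable (time_measure T)" "\<And>t. t \<in> {0<..<T} \<Longrightarrow> \<bar>\<phi> t\<bar> \<le> B"
  shows "tensor w \<phi> \<in> Y_space \<Omega> T"
  unfolding Y_space_def using H10.bochner_tensor[OF assms] by simp

lemma tensor_test_L2:
  "w \<in> L2_space \<Omega> \<Longrightarrow> \<phi> \<in> test_functions {0<..<T} \<Longrightarrow> slice (tensor w \<phi>) \<in> bochner_L2 T (L2_space \<Omega>) (L2_norm \<Omega>)"
  using L2.bochner_tensor time_test_facts(1,2) by metis

text \<open>Representatives have arbitrary values at times outside the interval. A bounded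
  functional ignores them, because the difference has norm zero.\<close>

lemma Ystar_cong:
  assumes F: "F \<in> Ystar_space \<Omega> T" and uv: "u \<in> Y_space \<Omega> T" "v \<in> Y_space \<Omega> T"
    and eq: "\<And>t. t \<in> {0<..<T} \<Longrightarrow> slice u t = slice v t"
  shows "F u = F v"
proof -
  have "Y_norm \<Omega> T (\<lambda>z. u z - v z) = 0"
  proof -
    have "(LINT t|time_measure T. (H10_norm \<Omega> (slice (\<lambda>z. u z - v z) t))\<^sup>2) = (LINT t|time_measure T. 0)"
      using eq H10.N_zero by (intro Bochner_Integration.integral_cong) (auto simp: slice_arith)
    then show ?thesis by (simp add: Y_norm_bochner bochner_norm_def)
  qed
  then show ?thesis using Ystar_bound[OF F Y.diff_mem[OF uv]] Ystar_diff[OF F uv] by simp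
qed

text \<open>A time derivative is only prescribed on tensors of test functions with elements of \<open>H\<^sub>0\<^sup>1\<close>. That
  these determine it on all of \<open>Y\<close> is what makes the derivative chosen by \<open>SOME\<close> meaningful.\<close>

lemma Ystar_indicator_zero:
  assumes F: "F \<in> Ystar_space \<Omega> T" and w: "w \<in> H10_space \<Omega>"
    and zero: "\<And>\<phi>. \<phi> \<in> test_functions {0<..<T} \<Longrightarrow> F (tensor w \<phi>) = 0"
    and A: "A \<in> sets lebesgue" "A \<subseteq> {0<..<T}"
  shows "F (tensor w (indicator A)) = 0"
proof (rule indicator_from_test_functions[of "{0<..<T}", OF _ A zero])
  fix f g
  assume f0: "\<And>k::nat. F (tensor w (f k)) = 0" and f: "\<And>k. f k \<in> borel_measurable (time_measure T)"
    "\<And>k x. 0 \<le> f k x" "\<And>k x. f k x \<le> 1" and g: "g \<in> borel_measurable (time_measure T)"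
    "\<And>x. 0 \<le> g x" "\<And>x. g x \<le> (1::real)"
    and lim: "AE t in time_measure T. (\<lambda>k. f k t) \<longlonglongrightarrow> g t"
  have fY: "tensor w (f k) \<in> Y_space \<Omega> T" for k
    using f by (intro tensor_Y[OF w, where B=1]) auto
  have gY: "tensor w g \<in> Y_space \<Omega> T" using g by (intro tensor_Y[OF w, where B=1]) auto
  let ?N = "\<lambda>k. Y_norm \<Omega> T (\<lambda>z. tensor w g z - tensor w (f k) z)"
  have N: "?N k = sqrt (LINT t|time_measure T. (g t - f k t)\<^sup>2 * (H10_norm \<Omega> w)\<^sup>2)" for k
  proof -
    have "H10_norm \<Omega> (\<lambda>x. slice (tensor w g) t x - slice (tensor w (f k)) t x) = \<bar>g t - f k t\<bar> * H10_norm \<Omega> w" for t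
      using H10.N_scale[OF w, of "g t - f k t"] by (simp add: slice_def tensor_def algebra_simps)
    then show ?thesis by (simp add: Y_norm_bochner bochner_norm_def slice_arith power_mult_distrib)
  qed
  have "(\<lambda>k. LINT t|time_measure T. (g t - f k t)\<^sup>2 * (H10_norm \<Omega> w)\<^sup>2) \<longlonglongrightarrow> (LINT t|time_measure T. 0)"
  proof (rule integral_dominated_convergence)
    show "integrable (time_measure T) (\<lambda>_. (H10_norm \<Omega> w)\<^sup>2)"
      by (rule integrable_bounded_lebesgue_on) auto
    show "AE t in time_measure T. (\<lambda>k. (g t - f k t)\<^sup>2 * (H10_norm \<Omega> w)\<^sup>2) \<longlonglongrightarrow> 0"
      using lim
    proof eventually_elim
      case (elim t)
      have "(\<lambda>k. (g t - f k t)\<^sup>2 * (H10_norm \<Omega> w)\<^sup>2) \<longlonglongrightarrow> (g t - g t)\<^sup>2 * (H10_norm \<Omega> w)\<^sup>2"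
        by (intro tendsto_intros elim)
      then show ?case by simp
    qed
    show "AE t in time_measure T. norm ((g t - f k t)\<^sup>2 * (H10_norm \<Omega> w)\<^sup>2) \<le> (H10_norm \<Omega> w)\<^sup>2" for k
    proof (rule AE_I2)
      fix t
      have "\<bar>g t - f k t\<bar> \<le> 1" using f(2,3)[of k t] g(2,3)[of t] by linarith
      then have "(g t - f k t)\<^sup>2 \<le> 1" by (simp add: abs_square_le_1)
      then show "norm ((g t - f k t)\<^sup>2 * (H10_norm \<Omega> w)\<^sup>2) \<le> (H10_norm \<Omega> w)\<^sup>2"
        by (simp add: abs_mult mult_left_le_one_le)
    qed
  qed (use f g in auto)
  then have "(\<lambda>k. sqrt (LINT t|time_measure T. (g t - f k t)\<^sup>2 * (H10_norm \<Omega> w)\<^sup>2)) \<longlonglongrightarrow> sqrt 0"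
    by (intro tendsto_real_sqrt) simp
  then have N0: "?N \<longlonglongrightarrow> 0" by (simp add: N)
  have "\<bar>F (tensor w g)\<bar> \<le> Ystar_norm \<Omega> T F * ?N k" for k
    using Ystar_bound[OF F Y.diff_mem[OF gY fY]] Ystar_diff[OF F gY fY] f0 by simp
  moreover have "(\<lambda>k. Ystar_norm \<Omega> T F * ?N k) \<longlonglongrightarrow> Ystar_norm \<Omega> T F * 0"
    by (intro tendsto_intros N0)
  ultimately have "\<bar>F (tensor w g)\<bar> \<le> Ystar_norm \<Omega> T F * 0"
    by (intro LIMSEQ_le_const) auto
  then show "F (tensor w g) = 0" by simp
qed auto

lemma Ystar_sum:
  assumes F: "F \<in> Ystar_space \<Omega> T" and "finite A" "\<And>i. i \<in> A \<Longrightarrow> u i \<in> Y_space \<Omega> T"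
  shows "F (\<lambda>z. \<Sum>i\<in>A. u i z) = (\<Sum>i\<in>A. F (u i))"
  using assms(2,3)
proof (induction rule: finite_induct)
  case empty
  show ?case using F Y.dual_zero by (simp add: Ystar_space_def)
next
  case (insert i A)
  have "F (\<lambda>z. u i z + (\<Sum>i\<in>A. u i z)) = F (u i) + F (\<lambda>z. \<Sum>i\<in>A. u i z)"
    using F insert unfolding Ystar_space_def by (intro Y.dual_add Y.sum_mem) auto
  then show ?case using insert by simp
qed

text \<open>A simple function is a finite sum of tensors of its values with the indicators of its
  level sets, where \<open>F\<close> is already known to vanish; simple functions are dense in
  \<open>Y_space\<close>.\<close>

lemma Ystar_zero:
  assumes F: "F \<in> Ystar_space \<Omega> T"
    and zero: "\<And>w \<phi>. w \<in> H10_space \<Omega> \<Longrightarrow> \<phi> \<in> test_functions {0<..<T} \<Longrightarrow> F (tensor w \<phi>) = 0"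
    and v: "v \<in> Y_space \<Omega> T"
  shows "F v = 0"
proof -
  have simple: "F (\<lambda>(x, t). s t x) = 0 \<and> (\<lambda>(x, t). s t x) \<in> Y_space \<Omega> T"
    if s: "simple_into T (H10_space \<Omega>) s" for s
  proof -
    let ?S = "\<lambda>(x, t). s t x"
    have sl: "slice ?S = s" by (simp add: slice_def fun_eq_iff)
    have SY: "?S \<in> Y_space \<Omega> T" using H10.simple_into_bochner[OF s] by (simp add: Y_space_def sl)
    let ?W = "s ` {0<..<T}" and ?A = "\<lambda>w. {t\<in>{0<..<T}. s t = w}"
    have W: "finite ?W" "?W \<subseteq> H10_space \<Omega>" and A: "\<And>w. ?A w \<in> sets lebesgue"
      using s by (auto simp: simple_into_def)
    have ind: "(indicator (?A w) :: real \<Rightarrow> real) \<in> borel_measurable (time_measure T)" for w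
      using A by (auto intro!: measurable_restrict_space1)
    have tY: "tensor w (indicator (?A w)) \<in> Y_space \<Omega> T" if "w \<in> ?W" for w
      using that W(2) ind by (intro tensor_Y[where B=1]) auto
    \<comment> \<open>The sum reproduces \<open>s\<close> for times inside the interval only, hence
      the appeal to \<open>Ystar_cong\<close>.\<close>
    let ?R = "\<lambda>z. \<Sum>w\<in>?W. tensor w (indicator (?A w)) z"
    have "F ?S = F ?R"
    proof (rule Ystar_cong[OF F SY Y.sum_mem[OF W(1) tY]])
      fix t assume t: "t \<in> {0<..<T}"
      have "(\<Sum>w\<in>?W. w x * indicat_real (?A w) t) = s t x" for x
      proof -
        have "(\<Sum>w\<in>?W. w x * indicat_real (?A w) t) = (\<Sum>w\<in>?W. if w = s t then w x else 0)"
          using t by (intro sum.cong) (auto simp: indicator_def)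
        then show ?thesis using W(1) t by (simp add: sum.delta)
      qed
      then show "slice ?S t = slice ?R t"
        by (simp add: slice_def tensor_def fun_eq_iff)
    qed
    also have "\<dots> = (\<Sum>w\<in>?W. F (tensor w (indicator (?A w))))" by (rule Ystar_sum[OF F W(1) tY])
    also have "\<dots> = 0"
      using W(2) A by (intro sum.neutral ballI Ystar_indicator_zero[OF F _ zero]) auto
    finally show ?thesis using SY by simp
  qed
  obtain s where s: "\<And>k::nat. simple_into T (H10_space \<Omega>) (s k)"
    "(\<lambda>k. LINT t|time_measure T. (H10_norm \<Omega> (\<lambda>x. s k t x - slice v t x))\<^sup>2) \<longlonglongrightarrow> 0"
    using H10.bochner_density[OF Y_spaceD[OF v]] by blast
  let ?S = "\<lambda>k. \<lambda>(x, t). s k t x"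
  have N0: "(\<lambda>k. Y_norm \<Omega> T (\<lambda>z. ?S k z - v z)) \<longlonglongrightarrow> 0"
  proof -
    have "(\<lambda>k. sqrt (LINT t|time_measure T. (H10_norm \<Omega> (\<lambda>x. s k t x - slice v t x))\<^sup>2)) \<longlonglongrightarrow> sqrt 0"
      by (intro tendsto_real_sqrt s(2))
    then show ?thesis by (simp add: Y_norm_bochner bochner_norm_def slice_def)
  qed
  have "\<bar>F v\<bar> \<le> Ystar_norm \<Omega> T F * Y_norm \<Omega> T (\<lambda>z. ?S k z - v z)" for k
    using Ystar_bound[OF F Y.diff_mem[OF conjunct2[OF simple[OF s(1)]] v]]
      Ystar_diff[OF F conjunct2[OF simple[OF s(1)]] v] conjunct1[OF simple[OF s(1)]] by simp
  moreover have "(\<lambda>k. Ystar_norm \<Omega> T F * Y_norm \<Omega> T (\<lambda>z. ?S k z - v z)) \<longlonglongrightarrow> Ystar_norm \<Omega> T F * 0"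
    by (intro tendsto_intros N0)
  ultimately have "\<bar>F v\<bar> \<le> Ystar_norm \<Omega> T F * 0" by (intro LIMSEQ_le_const) auto
  then show ?thesis by simp
qed

lemma is_time_deriv_unique:
  assumes "is_time_deriv \<Omega> T u F" "is_time_deriv \<Omega> T u G" "v \<in> Y_space \<Omega> T"
  shows "F v = G v"
proof -
  have "(\<lambda>v. F v - G v) \<in> Ystar_space \<Omega> T"
    using assms by (intro Ystar.diff_mem) (simp_all add: is_time_deriv_def)
  moreover have "F (tensor w \<phi>) - G (tensor w \<phi>) = 0"
    if "w \<in> H10_space \<Omega>" "\<phi> \<in> test_functions {0<..<T}" for w \<phi>
    using assms(1,2) that by (simp add: is_time_deriv_def)
  ultimately have "F v - G v = 0" by (rule Ystar_zero[OF _ _ assms(3)])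
  then show ?thesis by simp
qed

text \<open>From here on any derivative at hand may replace the one selected by \<open>SOME\<close>,
  as long as it is evaluated on \<open>Y_space\<close>.\<close>

lemma time_deriv_eq:
  assumes "is_time_deriv \<Omega> T u F" "v \<in> Y_space \<Omega> T"
  shows "time_deriv \<Omega> T u v = F v"
  using is_time_deriv_unique[OF _ assms] someI[of "is_time_deriv \<Omega> T u", OF assms(1)]
  by (simp add: time_deriv_def)

lemma Y_L2: "u \<in> Y_space \<Omega> T \<Longrightarrow> slice u \<in> bochner_L2 T (L2_space \<Omega>) (L2_norm \<Omega>)"
  by (rule bochner_H10_L2[OF Y_spaceD])

lemma L2Q_inner_add_left:
  fixes u v w :: "'a \<times> real \<Rightarrow> real"
  assumes "slice u \<in> bochner_L2 T (L2_space \<Omega>) (L2_norm \<Omega>)" "slice v \<in> bochner_L2 T (L2_space \<Omega>) (L2_norm \<Omega>)"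
    "slice w \<in> bochner_L2 T (L2_space \<Omega>) (L2_norm \<Omega>)"
  shows "L2Q_inner \<Omega> T (\<lambda>z. u z + v z) w = L2Q_inner \<Omega> T u w + L2Q_inner \<Omega> T v w"
proof -
  have "AE t in time_measure T. L2_inner \<Omega> (\<lambda>x. slice u t x + slice v t x) (slice w t)
      = L2_inner \<Omega> (slice u t) (slice w t) + L2_inner \<Omega> (slice v t) (slice w t)"
    using bochner_L2_AE[OF assms(1)] bochner_L2_AE[OF assms(2)] bochner_L2_AE[OF assms(3)]
    by eventually_elim (rule L2_inner_add_left)
  then have "(LINT t|time_measure T. L2_inner \<Omega> (\<lambda>x. slice u t x + slice v t x) (slice w t))
      = (LINT t|time_measure T. L2_inner \<Omega> (slice u t) (slice w t) + L2_inner \<Omega> (slice v t) (slice w t))"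
    using L2_inner_bochner(1)[OF L2.bochner_add[OF assms(1,2)] assms(3)]
      L2_inner_bochner(1)[OF assms(1,3)] L2_inner_bochner(1)[OF assms(2,3)]
    by (intro integral_cong_AE) auto
  then show ?thesis
    using L2_inner_bochner(2)[OF assms(1,3)] L2_inner_bochner(2)[OF assms(2,3)]
    by (simp add: L2Q_inner_def slice_arith)
qed

lemma L2Q_inner_commute: "L2Q_inner \<Omega> T u v = L2Q_inner \<Omega> T v u"
  by (simp add: L2Q_inner_def L2_inner_commute)

lemma L2Q_inner_scale_left: "L2Q_inner \<Omega> T (\<lambda>z. c * u z) w = c * L2Q_inner \<Omega> T u w" for u :: "_ \<Rightarrow> real"
  by (simp add: L2Q_inner_def slice_arith L2_inner_mult_left)

lemma is_time_deriv_add: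
  assumes u: "u \<in> Y_space \<Omega> T" "is_time_deriv \<Omega> T u F" and v: "v \<in> Y_space \<Omega> T" "is_time_deriv \<Omega> T v G"
  shows "is_time_deriv \<Omega> T (\<lambda>z. u z + v z) (\<lambda>y. F y + G y)"
  unfolding is_time_deriv_def
proof (intro conjI ballI)
  show "(\<lambda>y. F y + G y) \<in> Ystar_space \<Omega> T"
    using u v by (intro Ystar.add_mem) (auto simp: is_time_deriv_def)
  fix w \<phi> assume w: "w \<in> H10_space \<Omega>" and \<phi>: "\<phi> \<in> test_functions {0<..<T}"
  show "F (tensor w \<phi>) + G (tensor w \<phi>) = - L2Q_inner \<Omega> T (\<lambda>z. u z + v z) (tensor w (deriv \<phi>))"
    using u v w \<phi> L2Q_inner_add_left[OF Y_L2[OF u(1)] Y_L2[OF v(1)] tensor_test_L2[OF H10_L2[OF w] time_test_facts(3)[OF \<phi>]]]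
    by (simp add: is_time_deriv_def)
qed

text \<open>Poincare's inequality bounds the pairing with a square integrable function by the
  gradient norm of its argument.\<close>

lemma L2Q_functional:
  assumes d: "slice d \<in> bochner_L2 T (L2_space \<Omega>) (L2_norm \<Omega>)"
  shows "(\<lambda>v. L2Q_inner \<Omega> T d v) \<in> Ystar_space \<Omega> T"
proof -
  obtain C where C: "0 \<le> C" "\<And>u. u \<in> H10_space \<Omega> \<Longrightarrow> L2_norm \<Omega> u \<le> C * H10_norm \<Omega> u"
    using poincare by blast
  have bd: "\<bar>L2Q_inner \<Omega> T d v\<bar> \<le> (bochner_norm T (L2_norm \<Omega>) (slice d) * C) * Y_norm \<Omega> T v"
    if v: "v \<in> Y_space \<Omega> T" for v
  proof -
    have "bochner_norm T (L2_norm \<Omega>) (slice v) \<le> L2_norm {0<..<T} (\<lambda>t. C * H10_norm \<Omega> (slice v t))"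
      unfolding bochner_norm_L2_norm
    proof (rule L2_norm_mono_AE[OF L2.bochner_N_L2[OF Y_L2[OF v]] L2_space_scale[OF H10.bochner_N_L2[OF Y_spaceD[OF v]]]])
      show "AE t in time_measure T. norm (L2_norm \<Omega> (slice v t)) \<le> norm (C * H10_norm \<Omega> (slice v t))"
        using bochner_L2_AE[OF Y_spaceD[OF v]]
      proof eventually_elim
        case (elim t)
        then show ?case using C(2)[OF elim] abs_ge_self[of "C * H10_norm \<Omega> (slice v t)"]
          unfolding real_norm_def by (simp del: abs_ge_self)
      qed
    qed
    also have "\<dots> = C * Y_norm \<Omega> T v"
      using C(1) by (simp add: L2_norm_scale Y_norm_bochner bochner_norm_L2_norm)
    finally have "bochner_norm T (L2_norm \<Omega>) (slice d) * bochner_norm T (L2_norm \<Omega>) (slice v)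
        \<le> bochner_norm T (L2_norm \<Omega>) (slice d) * (C * Y_norm \<Omega> T v)"
      by (rule mult_left_mono) (simp add: bochner_norm_L2_norm)
    then show ?thesis
      using L2_inner_bochner(3)[OF d Y_L2[OF v]] by (simp add: L2Q_inner_def mult.assoc)
  qed
  have add: "L2Q_inner \<Omega> T d (\<lambda>z. u z + v z) = L2Q_inner \<Omega> T d u + L2Q_inner \<Omega> T d v"
    if "u \<in> Y_space \<Omega> T" "v \<in> Y_space \<Omega> T" for u v
    using L2Q_inner_add_left[OF Y_L2[OF that(1)] Y_L2[OF that(2)] d] by (simp add: L2Q_inner_commute)
  have scale: "L2Q_inner \<Omega> T d (\<lambda>z. c * u z) = c * L2Q_inner \<Omega> T d u" for c u
    using L2Q_inner_scale_left[of c u d] by (simp add: L2Q_inner_commute)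
  have "\<exists>C. \<forall>v\<in>Y_space \<Omega> T. \<bar>L2Q_inner \<Omega> T d v\<bar> \<le> C * Y_norm \<Omega> T v" using bd by blast
  then show ?thesis using add scale by (simp add: Ystar_space_def dual_space_def)
qed

lemma L2_time_deriv_is_time_deriv:
  assumes "is_L2_time_deriv \<Omega> T u d"
  shows "is_time_deriv \<Omega> T u (\<lambda>v. L2Q_inner \<Omega> T d v)"
  using assms L2Q_functional[of d] by (simp add: is_time_deriv_def is_L2_time_deriv_def H10_L2)

lemma is_L2_time_deriv_add:
  assumes "is_L2_time_deriv \<Omega> T u d" "is_L2_time_deriv \<Omega> T v e"
    and "slice u \<in> bochner_L2 T (L2_space \<Omega>) (L2_norm \<Omega>)" "slice v \<in> bochner_L2 T (L2_space \<Omega>) (L2_norm \<Omega>)"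
  shows "is_L2_time_deriv \<Omega> T (\<lambda>z. u z + v z) (\<lambda>z. d z + e z)"
  using assms
  by (auto simp: is_L2_time_deriv_def slice_arith L2.bochner_add L2Q_inner_add_left tensor_test_L2 time_test_facts(3))

lemma is_L2_time_deriv_scale:
  assumes "is_L2_time_deriv \<Omega> T u d"
  shows "is_L2_time_deriv \<Omega> T (\<lambda>z. c * u z) (\<lambda>z. c * d z)"
  using assms by (auto simp: is_L2_time_deriv_def slice_arith L2.bochner_scale L2Q_inner_scale_left)

end

section \<open>Primitives of weak derivatives\<close>

lemma indicator_measurable_lebesgue_on:
  "A \<in> sets lebesgue \<Longrightarrow> (indicator A :: 'a::euclidean_space \<Rightarrow> real) \<in> borel_measurable (lebesgue_on S)"
  by (intro measurable_restrict_space1 borel_measurable_indicator)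

lemma continuous_interval_bounded:
  fixes f :: "real \<Rightarrow> real"
  assumes "continuous_on {a..b} f"
  obtains M where "\<And>t. t \<in> {a..b} \<Longrightarrow> \<bar>f t\<bar> \<le> M"
proof -
  have "bounded (f ` {a..b})"
    using assms by (intro compact_imp_bounded compact_continuous_image) auto
  then obtain M where "\<forall>x\<in>f ` {a..b}. norm x \<le> M" unfolding bounded_iff by blast
  then show thesis by (intro that[of M]) auto
qed

text \<open>The \<open>\<psi> k\<close> are nonnegative densities whose primitives rise from 0 at
  \<open>a\<close> to nearly 1 immediately afterwards, so they concentrate at \<open>a\<close>. On
  \<open>{a..c}\<close> the oscillation of \<open>f\<close> is small; on \<open>{c..m}\<close> the
  mass \<open>\<phi> k m - \<phi> k c\<close> tends to zero.\<close>

lemma rising_limit: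
  fixes f :: "real \<Rightarrow> real"
  assumes am: "a < m" and f: "continuous_on {a..m} f"
    and der: "\<And>k::nat. \<And>t. (\<phi> k has_real_derivative \<psi> k t) (at t)"
    and \<psi>: "\<And>k. continuous_on UNIV (\<psi> k)" "\<And>k t. t \<in> {a..m} \<Longrightarrow> 0 \<le> \<psi> k t"
    and \<phi>: "\<And>k. \<phi> k a = 0" "\<And>t. a < t \<Longrightarrow> t \<le> m \<Longrightarrow> (\<lambda>k. \<phi> k t) \<longlonglongrightarrow> 1"
  shows "(\<lambda>k. integral {a..m} (\<lambda>t. f t * \<psi> k t)) \<longlonglongrightarrow> f a"
proof -
  have FTC: "(\<psi> k has_integral \<phi> k d - \<phi> k c) {c..d}" if "c \<le> d" for c d k
    using that der by (intro fundamental_theorem_of_calculus)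
      (auto simp: has_real_derivative_iff_has_vector_derivative intro: has_vector_derivative_at_within)
  have cont: "continuous_on R (\<psi> k)" for R k using \<psi>(1) continuous_on_subset by blast
  obtain M0 where M0: "\<And>t. t \<in> {a..m} \<Longrightarrow> \<bar>f t\<bar> \<le> M0" using continuous_interval_bounded[OF f] by blast
  define M where "M = \<bar>M0\<bar> + 1"
  have M: "0 < M" "\<And>t. t \<in> {a..m} \<Longrightarrow> \<bar>f t\<bar> \<le> M" using M0 by (force simp: M_def)+
  have "(\<lambda>k. integral {a..m} (\<lambda>t. (f t - f a) * \<psi> k t)) \<longlonglongrightarrow> 0"
  proof (rule LIMSEQ_I)
    fix e :: real assume e: "0 < e"
    obtain d where d: "d > 0" "\<And>t. t \<in> {a..m} \<Longrightarrow> dist t a < d \<Longrightarrow> dist (f t) (f a) < e / 2"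
      using f[unfolded continuous_on_iff, rule_format, of a "e / 2"] am e by auto
    define c where "c = min m (a + d / 2)"
    have c: "a < c" "c \<le> m" using am d by (auto simp: c_def)
    have near: "\<bar>f t - f a\<bar> \<le> e / 2" if "t \<in> {a..c}" for t
      using d(2)[of t] that c d(1) by (auto simp: c_def dist_real_def)
    have bound: "norm (integral {a..m} (\<lambda>t. (f t - f a) * \<psi> k t)) \<le> e / 2 * \<phi> k c + 2 * M * (\<phi> k m - \<phi> k c)" for k
    proof -
      have int: "(\<lambda>t. (f t - f a) * \<psi> k t) integrable_on {c1..c2}" if "{c1..c2} \<subseteq> {a..m}" for c1 c2
        using that f by (intro integrable_continuous_real continuous_intros cont) (auto intro: continuous_on_subset)
      have "integral {a..m} (\<lambda>t. (f t - f a) * \<psi> k t) =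
          integral {a..c} (\<lambda>t. (f t - f a) * \<psi> k t) + integral {c..m} (\<lambda>t. (f t - f a) * \<psi> k t)"
        using c int by (intro Henstock_Kurzweil_Integration.integral_combine[symmetric]) auto
      moreover have "norm (integral {a..c} (\<lambda>t. (f t - f a) * \<psi> k t)) \<le> integral {a..c} (\<lambda>t. e / 2 * \<psi> k t)"
      proof (rule integral_norm_bound_integral)
        show "norm ((f t - f a) * \<psi> k t) \<le> e / 2 * \<psi> k t" if "t \<in> {a..c}" for t
          using mult_right_mono[OF near[OF that], of "\<psi> k t"] \<psi>(2)[of t k] that c by (simp add: abs_mult)
      qed (use c int in \<open>auto intro!: integrable_continuous_real continuous_intros cont\<close>)
      moreover have "norm (integral {c..m} (\<lambda>t. (f t - f a) * \<psi> k t)) \<le> integral {c..m} (\<lambda>t. 2 * M * \<psi> k t)"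
      proof (rule integral_norm_bound_integral)
        fix t assume t: "t \<in> {c..m}"
        have "\<bar>f t - f a\<bar> \<le> 2 * M" using M(2)[of t] M(2)[of a] t c am by auto
        then show "norm ((f t - f a) * \<psi> k t) \<le> 2 * M * \<psi> k t"
          using \<psi>(2)[of t k] t c by (auto simp: abs_mult intro!: mult_right_mono)
      qed (use c int in \<open>auto intro!: integrable_continuous_real continuous_intros cont\<close>)
      moreover have "integral {a..c} (\<lambda>t. e / 2 * \<psi> k t) = e / 2 * \<phi> k c"
        using integral_unique[OF FTC[of a c k]] c \<phi>(1) by simp
      moreover have "integral {c..m} (\<lambda>t. 2 * M * \<psi> k t) = 2 * M * (\<phi> k m - \<phi> k c)"
        using integral_unique[OF FTC[of c m k]] c by simp
      ultimately show ?thesis unfolding real_norm_def by linarith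
    qed
    have "(\<lambda>k. e / 2 * \<phi> k c + 2 * M * (\<phi> k m - \<phi> k c)) \<longlonglongrightarrow> e / 2 * 1 + 2 * M * (1 - 1)"
      using c am by (intro tendsto_intros \<phi>(2)) auto
    then have "\<forall>\<^sub>F k in sequentially. e / 2 * \<phi> k c + 2 * M * (\<phi> k m - \<phi> k c) < e"
      by (rule order_tendstoD) (use e in simp)
    then obtain no where "\<And>k. k \<ge> no \<Longrightarrow> e / 2 * \<phi> k c + 2 * M * (\<phi> k m - \<phi> k c) < e"
      unfolding eventually_sequentially by blast
    then have "norm (integral {a..m} (\<lambda>t. (f t - f a) * \<psi> k t) - 0) < e" if "k \<ge> no" for k
      using order_le_less_trans[OF bound[of k]] that by simp
    then show "\<exists>no. \<forall>k\<ge>no. norm (integral {a..m} (\<lambda>t. (f t - f a) * \<psi> k t) - 0) < e" by blast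
  qed
  moreover have "(\<lambda>k. f a * \<phi> k m) \<longlonglongrightarrow> f a * 1" by (intro tendsto_intros \<phi>(2)) (use am in auto)
  ultimately have "(\<lambda>k. integral {a..m} (\<lambda>t. (f t - f a) * \<psi> k t) + f a * \<phi> k m) \<longlonglongrightarrow> 0 + f a * 1"
    by (rule tendsto_add)
  moreover have "integral {a..m} (\<lambda>t. (f t - f a) * \<psi> k t) + f a * \<phi> k m = integral {a..m} (\<lambda>t. f t * \<psi> k t)" for k
  proof -
    have "integral {a..m} (\<lambda>t. f a * \<psi> k t) = f a * \<phi> k m"
      using integral_unique[OF FTC[of a m k]] am \<phi>(1) by simp
    moreover have "integral {a..m} (\<lambda>t. (f t - f a) * \<psi> k t + f a * \<psi> k t)
        = integral {a..m} (\<lambda>t. (f t - f a) * \<psi> k t) + integral {a..m} (\<lambda>t. f a * \<psi> k t)"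
      using f by (intro Henstock_Kurzweil_Integration.integral_add integrable_continuous_real continuous_intros cont)
    moreover have "(\<lambda>t. (f t - f a) * \<psi> k t + f a * \<psi> k t) = (\<lambda>t. f t * \<psi> k t)"
      by (intro ext) (simp add: algebra_simps)
    ultimately show ?thesis by (simp only:)
  qed
  ultimately show ?thesis by simp
qed

text \<open>The mirror image of \<open>rising_limit\<close> under
  \<open>t \<mapsto> - t\<close>.\<close>

lemma falling_limit:
  fixes f :: "real \<Rightarrow> real"
  assumes mb: "m < b" and f: "continuous_on {m..b} f"
    and der: "\<And>k::nat. \<And>t. (\<phi> k has_real_derivative \<psi> k t) (at t)"
    and \<psi>: "\<And>k. continuous_on UNIV (\<psi> k)" "\<And>k t. t \<in> {m..b} \<Longrightarrow> \<psi> k t \<le> 0"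
    and \<phi>: "\<And>k. \<phi> k b = 0" "\<And>t. m \<le> t \<Longrightarrow> t < b \<Longrightarrow> (\<lambda>k. \<phi> k t) \<longlonglongrightarrow> 1"
  shows "(\<lambda>k. integral {m..b} (\<lambda>t. f t * \<psi> k t)) \<longlonglongrightarrow> - f b"
proof -
  have "(\<lambda>k. integral {-b..-m} (\<lambda>t. f (- t) * (- \<psi> k (- t)))) \<longlonglongrightarrow> f (- (- b))"
  proof (rule rising_limit[where \<phi>="\<lambda>k t. \<phi> k (- t)"])
    show "continuous_on {- b..- m} (\<lambda>t. f (- t))"
      by (rule continuous_on_compose2[OF f]) (auto intro!: continuous_intros)
    show "((\<lambda>t. \<phi> k (- t)) has_real_derivative - \<psi> k (- t)) (at t)" for k t
      using der[of k "- t"] by (simp add: DERIV_mirror)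
    show "continuous_on UNIV (\<lambda>t. - \<psi> k (- t))" for k
      by (intro continuous_intros continuous_on_compose2[OF \<psi>(1)]) auto
  qed (use mb \<psi>(2) \<phi> in auto)
  moreover have "integral {-b..-m} (\<lambda>t. f (- t) * (- \<psi> k (- t))) = - integral {m..b} (\<lambda>t. f t * \<psi> k t)" for k
    using Henstock_Kurzweil_Integration.integral_reflect_real[of b m "\<lambda>t. f t * \<psi> k t"] by simp
  ultimately show ?thesis using tendsto_minus_cancel_left by fastforce
qed

lemma time_integral_Henstock:
  fixes f :: "real \<Rightarrow> real"
  assumes "integrable (lebesgue_on {0<..<T}) f" "{a..b} \<subseteq> {0<..<T}" "\<And>t. t \<notin> {a..b} \<Longrightarrow> f t = 0"
  shows "(LINT t|lebesgue_on {0<..<T}. f t) = integral {a..b} f"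
proof -
  have "(\<lambda>t. if t \<in> {a..b} then f t else 0) = f" using assms(3) by auto
  then have "integral {0<..<T} f = integral {a..b} f"
    using integral_restrict_Int[of "{0<..<T}" "{a..b}" f] Int_absorb2[OF assms(2)] by (simp only:)
  then show ?thesis using lebesgue_integral_eq_integral[OF assms(1)] by simp
qed

text \<open>The weak identity is tested with bumps converging to the indicator of the interval.
  Their derivatives are nonnegative up to the midpoint and nonpositive after it, so they act in the
  limit as a point mass at \<open>a\<close> minus one at \<open>b\<close>.\<close>

lemma weak_primitive_interior:
  fixes f g :: "real \<Rightarrow> real"
  assumes f: "continuous_on {0..T} f" and g: "integrable (time_measure T) g"
    and weak: "\<And>\<phi>. \<phi> \<in> test_functions {0<..<T} \<Longrightarrow>
      (LINT t|time_measure T. g t * \<phi> t) = - (LINT t|time_measure T. f t * deriv \<phi> t)"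
    and ab: "0 < a" "a < b" "b < T"
  shows "(LINT t|time_measure T. g t * indicator {a<..<b} t) = f b - f a"
proof -
  define n where "n k = real (Suc k)" for k
  have n: "n k > 0" for k by (simp add: n_def)
  define \<phi> where "\<phi> = bump a b"
  have \<phi>: "\<phi> k t = flat_exp 0 (n k * (t - a)) * flat_exp 0 (n k * (b - t))" for k t
    by (simp add: \<phi>_def bump_def n_def)
  \<comment> \<open>The derivative of the bump; \<open>flat_exp 2\<close> is the derivative of
    \<open>flat_exp 0\<close>.\<close>
  define \<psi> where "\<psi> k t = n k * (flat_exp 2 (n k * (t - a)) * flat_exp 0 (n k * (b - t))
      - flat_exp 0 (n k * (t - a)) * flat_exp 2 (n k * (b - t)))" for k t
  have der: "(\<phi> k has_real_derivative \<psi> k t) (at t)" for k t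
  proof -
    have F: "(flat_exp 0 has_real_derivative flat_exp 2 t) (at t)" for t
      using flat_exp_has_derivative[of 0 t] by (simp add: numeral_2_eq_2)
    have "((\<lambda>t. flat_exp 0 (n k * (t - a)) * flat_exp 0 (n k * (b - t))) has_real_derivative \<psi> k t) (at t)"
      unfolding \<psi>_def
      by (rule derivative_eq_intros DERIV_chain2[OF F] refl)+ (simp add: algebra_simps)
    then show ?thesis unfolding \<phi>[abs_def] .
  qed
  have test: "\<phi> k \<in> test_functions {0<..<T}" for k
  proof (rule test_functionsI[where K="{a..b}"])
    show "C_k j (\<phi> k)" for j unfolding \<phi>_def by (rule smooth_gen_C_k[OF bump_smooth])
    show "\<phi> k t = 0" if "t \<notin> {a..b}" for t
      unfolding \<phi>_def using that by (intro bump_outside) auto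
  qed (use ab in auto)
  have dphi: "deriv (\<phi> k) = \<psi> k" for k using DERIV_imp_deriv[OF der] by auto
  \<comment> \<open>The spatial domain is a dummy; the locale is entered for its facts on test
    functions of time.\<close>
  interpret cyl: cylinder "{0<..<1::real}" T by standard (use ab in auto)
  have \<psi>test: "\<psi> k \<in> test_functions {0<..<T}" for k using cyl.time_test_facts(3)[OF test[of k]] by (simp add: dphi)
  have \<psi>cont: "continuous_on UNIV (\<psi> k)" for k by (rule test_functions_continuous[OF \<psi>test])
  have \<psi>0: "\<psi> k t = 0" if "t \<notin> {a..b}" for k t
    using that ab n[of k] by (auto simp: \<psi>_def flat_exp_def zero_less_mult_iff not_le)
  have flat2: "flat_exp 2 x = flat_exp 0 x / x\<^sup>2" for x by (simp add: flat_exp_def)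
  define m where "m = (a + b) / 2"
  have m: "a < m" "m < b" using ab by (auto simp: m_def)
  have pos: "\<psi> k t \<ge> 0" if "t \<in> {a..m}" for k t
  proof (cases "t = a")
    case True
    then show ?thesis by (simp add: \<psi>_def flat_exp_def)
  next
    case False
    then have x: "0 < n k * (t - a)" "n k * (t - a) \<le> n k * (b - t)" using that n[of k] by (auto simp: m_def)
    \<comment> \<open>Left of the midpoint \<open>t\<close> is closer to \<open>a\<close> than to
      \<open>b\<close>, so the rising factor has the larger logarithmic derivative.\<close>
    have "1 / (n k * (b - t))\<^sup>2 \<le> 1 / (n k * (t - a))\<^sup>2"
      by (intro frac_le power_mono zero_less_power) (use x in linarith)+
    then have "0 \<le> flat_exp 0 (n k * (t - a)) * flat_exp 0 (n k * (b - t)) * (1 / (n k * (t - a))\<^sup>2 - 1 / (n k * (b - t))\<^sup>2)"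
      by (intro mult_nonneg_nonneg flat_exp_0_bounds) simp
    moreover have "u / X * v - u * (v / Y) = u * v * (1 / X - 1 / Y)" for u v X Y :: real
      by (simp add: algebra_simps)
    ultimately show ?thesis using n[of k] unfolding \<psi>_def flat2 by simp
  qed
  have neg: "\<psi> k t \<le> 0" if "t \<in> {m..b}" for k t
  proof -
    \<comment> \<open>The derivative of the bump is antisymmetric about the midpoint, which reduces
      this half to the other one.\<close>
    have "a + b - t \<in> {a..m}" using that by (auto simp: m_def)
    from pos[OF this, of k] have "\<psi> k (a + b - t) \<ge> 0" .
    moreover have "\<psi> k (a + b - t) = - \<psi> k t" by (simp add: \<psi>_def algebra_simps)
    ultimately show ?thesis by simp
  qed
  have to1: "(\<lambda>k. \<phi> k t) \<longlonglongrightarrow> 1" if "a < t" "t < b" for t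
    unfolding \<phi>_def using that by (intro bump_tendsto) simp
  have fsub: "continuous_on R f" if "R \<subseteq> {a..b}" for R
    by (rule continuous_on_subset[OF f]) (use that ab in auto)
  have lim1: "(\<lambda>k. LINT t|time_measure T. f t * deriv (\<phi> k) t) \<longlonglongrightarrow> f a + - f b"
  proof -
    have "(LINT t|time_measure T. f t * deriv (\<phi> k) t) = integral {a..m} (\<lambda>t. f t * \<psi> k t) + integral {m..b} (\<lambda>t. f t * \<psi> k t)" for k
    proof -
      obtain B1 where B1: "\<And>t. \<bar>\<psi> k t\<bar> \<le> B1" using test_functions_bounded[OF \<psi>test] by metis
      obtain B2 where B2: "\<And>t. t \<in> {0..T} \<Longrightarrow> \<bar>f t\<bar> \<le> B2" using continuous_interval_bounded[OF f] by blast
      have "integrable (time_measure T) (\<lambda>t. f t * \<psi> k t)"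
      proof (rule integrable_bounded_lebesgue_on[where B="B2 * B1"])
        show "(\<lambda>t. f t * \<psi> k t) \<in> borel_measurable (time_measure T)"
          using f by (intro continuous_imp_measurable_on_sets_lebesgue continuous_intros
              test_functions_continuous[OF \<psi>test]) (auto intro: continuous_on_subset)
        show "\<bar>f t * \<psi> k t\<bar> \<le> B2 * B1" if "t \<in> {0<..<T}" for t
          using B1[of t] B2[of t] that by (auto simp: abs_mult intro!: mult_mono)
      qed simp
      then have "(LINT t|time_measure T. f t * \<psi> k t) = integral {a..b} (\<lambda>t. f t * \<psi> k t)"
        by (rule time_integral_Henstock) (use \<psi>0 ab in auto)
      also have "\<dots> = integral {a..m} (\<lambda>t. f t * \<psi> k t) + integral {m..b} (\<lambda>t. f t * \<psi> k t)"
        using m by (intro Henstock_Kurzweil_Integration.integral_combine[symmetric]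
            integrable_continuous_real continuous_intros fsub test_functions_continuous[OF \<psi>test]) auto
      finally show ?thesis by (simp add: dphi)
    qed
    moreover have "(\<lambda>k. integral {a..m} (\<lambda>t. f t * \<psi> k t)) \<longlonglongrightarrow> f a"
      by (rule rising_limit[OF m(1) fsub der \<psi>cont pos]) (use m to1 in \<open>auto simp: \<phi> flat_exp_def\<close>)
    moreover have "(\<lambda>k. integral {m..b} (\<lambda>t. f t * \<psi> k t)) \<longlonglongrightarrow> - f b"
      by (rule falling_limit[OF m(2) fsub der \<psi>cont neg]) (use m to1 in \<open>auto simp: \<phi> flat_exp_def\<close>)
    ultimately show ?thesis by (simp add: tendsto_add del: add_uminus_conv_diff)
  qed
  have lim2: "(\<lambda>k. LINT t|time_measure T. g t * \<phi> k t) \<longlonglongrightarrow> (LINT t|time_measure T. g t * indicator {a<..<b} t)"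
  proof (rule integral_dominated_convergence)
    show "integrable (time_measure T) (\<lambda>t. \<bar>g t\<bar>)" using g by simp
    show "(\<lambda>t. g t * indicator {a<..<b} t) \<in> borel_measurable (time_measure T)"
      by (intro borel_measurable_times borel_measurable_integrable[OF g] indicator_measurable_lebesgue_on) simp
    show "(\<lambda>t. g t * \<phi> k t) \<in> borel_measurable (time_measure T)" for k
      by (intro borel_measurable_times borel_measurable_integrable[OF g] test_functions_measurable[OF test]) auto
    show "AE t in time_measure T. (\<lambda>k. g t * \<phi> k t) \<longlonglongrightarrow> g t * indicator {a<..<b} t"
    proof (rule AE_I2)
      fix t
      show "(\<lambda>k. g t * \<phi> k t) \<longlonglongrightarrow> g t * indicator {a<..<b} t"
      proof (cases "t \<in> {a<..<b}")
        case True
        then show ?thesis using to1[of t] by (intro tendsto_intros) auto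
      next
        case False
        then have "\<phi> k t = 0" for k unfolding \<phi>_def by (intro bump_outside) auto
        then show ?thesis using False by simp
      qed
    qed
    show "AE t in time_measure T. norm (g t * \<phi> k t) \<le> \<bar>g t\<bar>" for k
      by (intro AE_I2) (simp add: \<phi>_def abs_mult bump_bounds mult_left_le)
  qed
  have "(\<lambda>k. LINT t|time_measure T. g t * \<phi> k t) \<longlonglongrightarrow> - (f a + - f b)"
    using tendsto_minus[OF lim1] weak[OF test] by simp
  then show ?thesis using LIMSEQ_unique[OF lim2] by simp
qed

text \<open>A bump on an interval reaching 0 or \<open>T\<close> has no compact support inside the
  open time interval. Such intervals are therefore exhausted from inside, using that
  \<open>f\<close> is continuous up to the ends.\<close>

lemma weak_primitive:
  fixes f g :: "real \<Rightarrow> real"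
  assumes f: "continuous_on {0..T} f" and g: "integrable (time_measure T) g"
    and weak: "\<And>\<phi>. \<phi> \<in> test_functions {0<..<T} \<Longrightarrow>
      (LINT t|time_measure T. g t * \<phi> t) = - (LINT t|time_measure T. f t * deriv \<phi> t)"
    and ab: "0 \<le> a" "a \<le> b" "b \<le> T"
  shows "(LINT t|time_measure T. g t * indicator {a<..<b} t) = f b - f a"
proof (cases "a = b")
  case True
  then show ?thesis by simp
next
  case False
  then have lt: "a < b" using ab by simp
  \<comment> \<open>The shift by 2 keeps the factor at or below 1/3, so that the shrunken interval
    does not collapse.\<close>
  define r where "r k = (b - a) * inverse (real (Suc (k + 2)))" for k
  have r: "0 < r k" "a + r k < b - r k" for k
  proof -
    show "0 < r k" using lt by (simp add: r_def)
    have "inverse (real (Suc (k + 2))) \<le> 1 / 3" by (simp add: field_simps)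
    then have "r k \<le> (b - a) * (1 / 3)" unfolding r_def by (rule mult_left_mono) (use lt in simp)
    then have "2 * r k < b - a" using lt by simp
    then show "a + r k < b - r k" by simp
  qed
  have "(\<lambda>k. (b - a) * inverse (real (Suc (k + 2)))) \<longlonglongrightarrow> (b - a) * 0"
    by (intro tendsto_intros LIMSEQ_ignore_initial_segment[OF LIMSEQ_inverse_real_of_nat])
  then have r0: "r \<longlonglongrightarrow> 0" by (simp add: r_def[abs_def])
  have eq: "(LINT t|time_measure T. g t * indicator {a + r k<..<b - r k} t) = f (b - r k) - f (a + r k)" for k
    using weak_primitive_interior[OF f g weak, of "a + r k" "b - r k"] r[of k] ab by simp
  have "(\<lambda>k. LINT t|time_measure T. g t * indicator {a + r k<..<b - r k} t) \<longlonglongrightarrow> (LINT t|time_measure T. g t * indicator {a<..<b} t)"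
  proof (rule integral_dominated_convergence)
    show "integrable (time_measure T) (\<lambda>t. \<bar>g t\<bar>)" using g by simp
    show "(\<lambda>t. g t * indicator {a<..<b} t) \<in> borel_measurable (time_measure T)"
      by (intro borel_measurable_times borel_measurable_integrable[OF g] indicator_measurable_lebesgue_on) simp
    show "(\<lambda>t. g t * indicator {a + r k<..<b - r k} t) \<in> borel_measurable (time_measure T)" for k
      by (intro borel_measurable_times borel_measurable_integrable[OF g] indicator_measurable_lebesgue_on) simp
    show "AE t in time_measure T. (\<lambda>k. g t * indicator {a + r k<..<b - r k} t) \<longlonglongrightarrow> g t * indicator {a<..<b} t"
    proof (rule AE_I2)
      fix t
      have "(\<lambda>k. indicat_real {a + r k<..<b - r k} t) \<longlonglongrightarrow> indicator {a<..<b} t"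
      proof (cases "t \<in> {a<..<b}")
        case True
        have "\<forall>\<^sub>F k in sequentially. r k < min (t - a) (b - t)"
          by (rule order_tendstoD[OF r0]) (use True in auto)
        then have "\<forall>\<^sub>F k in sequentially. indicat_real {a + r k<..<b - r k} t = indicator {a<..<b} t"
          by eventually_elim (use True in auto)
        then show ?thesis by (rule tendsto_eventually)
      next
        case False
        have "indicat_real {a + r k<..<b - r k} t = indicator {a<..<b} t" for k
          using False r[of k] by (auto simp: indicator_def)
        then show ?thesis by simp
      qed
      then show "(\<lambda>k. g t * indicator {a + r k<..<b - r k} t) \<longlonglongrightarrow> g t * indicator {a<..<b} t"
        by (rule tendsto_mult_left)
    qed
    show "AE t in time_measure T. norm (g t * indicator {a + r k<..<b - r k} t) \<le> \<bar>g t\<bar>" for k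
      by (intro AE_I2) (auto simp: indicator_def)
  qed
  moreover have "(\<lambda>k. f (b - r k) - f (a + r k)) \<longlonglongrightarrow> f b - f a"
  proof (rule tendsto_diff)
    have in1: "b - r k \<in> {0..T}" "a + r k \<in> {0..T}" for k using r[of k] ab by auto
    have "(\<lambda>k. b - r k) \<longlonglongrightarrow> b - 0" by (intro tendsto_intros r0)
    then show "(\<lambda>k. f (b - r k)) \<longlonglongrightarrow> f b"
      using in1(1) ab by (intro continuous_on_tendsto_compose[OF f]) auto
    have "(\<lambda>k. a + r k) \<longlonglongrightarrow> a + 0" by (intro tendsto_intros r0)
    then show "(\<lambda>k. f (a + r k)) \<longlonglongrightarrow> f a"
      using in1(2) ab by (intro continuous_on_tendsto_compose[OF f]) auto
  qed
  ultimately show ?thesis unfolding eq by (rule LIMSEQ_unique)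
qed

section \<open>Piecewise linear functions in time\<close>

text \<open>The number of the cell containing \<open>t\<close>; a node is assigned to the cell on
  its right.\<close>

definition interval_index :: "real \<Rightarrow> real \<Rightarrow> nat" where
  "interval_index h t = nat \<lfloor>t / h\<rfloor>"

lemma interval_index_iff:
  assumes "0 < h" "0 \<le> t"
  shows "interval_index h t = k \<longleftrightarrow> real k * h \<le> t \<and> t < real (Suc k) * h"
proof -
  have "0 \<le> t / h" using assms by simp
  then have "interval_index h t = k \<longleftrightarrow> \<lfloor>t / h\<rfloor> = int k" by (auto simp: interval_index_def)
  also have "\<dots> \<longleftrightarrow> real k \<le> t / h \<and> t / h < real k + 1" by (simp add: floor_eq_iff)
  also have "\<dots> \<longleftrightarrow> real k * h \<le> t \<and> t < real (Suc k) * h" using assms(1) by (simp add: field_simps)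
  finally show ?thesis .
qed

lemma interval_index_finitely_valued:
  assumes h: "h = T / real N" "N \<ge> 1" "0 < T"
  shows "finitely_valued T (interval_index h)" and "\<And>t. t \<in> {0<..<T} \<Longrightarrow> interval_index h t < N"
proof -
  have hpos: "0 < h" and hN: "real N * h = T" unfolding h(1) using h(2,3) by auto
  show lt: "interval_index h t < N" if "t \<in> {0<..<T}" for t
  proof -
    have "real (interval_index h t) * h \<le> t" using interval_index_iff[OF hpos, of t "interval_index h t"] that by simp
    then have "real (interval_index h t) * h < real N * h" using that hN by simp
    then show ?thesis using hpos by simp
  qed
  have "finite (interval_index h ` {0<..<T})" by (rule finite_subset[of _ "{..<N}"]) (use lt in auto)
  moreover have "{t\<in>{0<..<T}. interval_index h t = k} = {0<..<T} \<inter> {real k * h..<real (Suc k) * h}" for k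
  proof (rule set_eqI)
    show "t \<in> {t\<in>{0<..<T}. interval_index h t = k} \<longleftrightarrow> t \<in> {0<..<T} \<inter> {real k * h..<real (Suc k) * h}" for t
      using interval_index_iff[OF hpos, of t k] by (auto simp del: of_nat_Suc)
  qed
  ultimately show "finitely_valued T (interval_index h)" by (simp add: finitely_valued_def sets.Int)
qed

text \<open>The slope on the cell of \<open>t\<close>, expressed through nodal values: it is thus
  defined at the nodes too and depends on \<open>t\<close> only through the number of the
  cell.\<close>

definition difference_quotient :: "real \<Rightarrow> (real \<Rightarrow> real) \<Rightarrow> real \<Rightarrow> real" where
  "difference_quotient h \<phi> t =
    (\<phi> (real (Suc (interval_index h t)) * h) - \<phi> (real (interval_index h t) * h)) / h"

lemma W1_h_linear:
  assumes \<phi>: "\<phi> \<in> W1_h T N" and h: "h = T / real N" "N \<ge> 1" "0 < T" and k: "k < N"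
    and t: "t \<in> {real k * h..real (Suc k) * h}"
  shows "\<phi> t = \<phi> (real k * h) + (t - real k * h) * ((\<phi> (real (Suc k) * h) - \<phi> (real k * h)) / h)"
proof -
  obtain \<alpha> \<beta> where ab: "\<And>t. t \<in> {real k * h..real (Suc k) * h} \<Longrightarrow> \<phi> t = \<alpha> * t + \<beta>"
    using \<phi> k unfolding W1_h_def h(1) by blast
  have hpos: "0 < h" unfolding h(1) using h(2,3) by simp
  have "real k * h \<in> {real k * h..real (Suc k) * h}" "real (Suc k) * h \<in> {real k * h..real (Suc k) * h}"
    using hpos by (auto simp: algebra_simps)
  then show ?thesis using ab t hpos by (simp add: field_simps)
qed

text \<open>Integrate the derivative of \<open>\<phi> t * \<eta> t\<close>, which exists except at
  the finitely many nodes; the boundary terms vanish with \<open>\<eta>\<close>.\<close>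

lemma W1_h_weak_derivative:
  assumes \<phi>: "\<phi> \<in> W1_h T N" and N: "N \<ge> 1" and T: "0 < T" and \<eta>: "\<eta> \<in> test_functions {0<..<T}"
  shows "(LINT t|time_measure T. difference_quotient (T / real N) \<phi> t * \<eta> t) = - (LINT t|time_measure T. \<phi> t * deriv \<eta> t)"
proof -
  define h where "h = T / real N"
  have hpos: "0 < h" and hN: "real N * h = T" using N T by (auto simp: h_def)
  interpret cyl: cylinder "{0<..<1::real}" T by standard (use T in auto)
  let ?D = "difference_quotient h \<phi>"
  have \<phi>cont: "continuous_on {0..T} \<phi>" using \<phi> by (simp add: W1_h_def)
  have "((\<lambda>t. ?D t * \<eta> t + \<phi> t * deriv \<eta> t) has_integral (\<phi> T * \<eta> T - \<phi> 0 * \<eta> 0)) {0..T}"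
  proof (rule fundamental_theorem_of_calculus_interior_strong[where S="(\<lambda>k. real k * h) ` {..N}"])
    show "continuous_on {0..T} (\<lambda>t. \<phi> t * \<eta> t)"
      by (intro continuous_intros \<phi>cont test_functions_continuous[OF \<eta>])
    fix t assume t: "t \<in> {0<..<T} - (\<lambda>k. real k * h) ` {..N}"
    define k where "k = interval_index h t"
    have k: "k < N" using interval_index_finitely_valued(2)[OF h_def N T] t by (simp add: k_def)
    have kt: "real k * h \<le> t" "t < real (Suc k) * h" using interval_index_iff[OF hpos, of t k] t by (auto simp: k_def)
    moreover have "t \<noteq> real k * h" using t k by auto
    ultimately have kt': "real k * h < t" by simp
    have "((\<lambda>t. \<phi> (real k * h) + (t - real k * h) * ((\<phi> (real (Suc k) * h) - \<phi> (real k * h)) / h))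
        has_real_derivative ?D t) (at t)"
      unfolding difference_quotient_def k_def[symmetric] using hpos by (auto intro!: derivative_eq_intros)
    then have "(\<phi> has_real_derivative ?D t) (at t)"
    proof (rule has_field_derivative_transform_within_open[where S="{real k * h<..<real (Suc k) * h}"])
      show "t \<in> {real k * h<..<real (Suc k) * h}" using kt kt' by simp
      show "\<phi> (real k * h) + (x - real k * h) * ((\<phi> (real (Suc k) * h) - \<phi> (real k * h)) / h) = \<phi> x"
        if "x \<in> {real k * h<..<real (Suc k) * h}" for x
        using W1_h_linear[OF \<phi> h_def N T k, of x] that by simp
    qed simp
    then have "((\<lambda>t. \<phi> t * \<eta> t) has_real_derivative ?D t * \<eta> t + deriv \<eta> t * \<phi> t) (at t)"
      by (rule DERIV_mult[OF _ cyl.time_test_facts(4)[OF \<eta>]])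
    then show "((\<lambda>t. \<phi> t * \<eta> t) has_vector_derivative ?D t * \<eta> t + \<phi> t * deriv \<eta> t) (at t)"
      by (simp add: has_real_derivative_iff_has_vector_derivative mult.commute)
  qed (use T in auto)
  moreover have "\<eta> 0 = 0" "\<eta> T = 0" using test_functions_zero_outside[OF \<eta>] by auto
  ultimately have I0: "integral {0..T} (\<lambda>t. ?D t * \<eta> t + \<phi> t * deriv \<eta> t) = 0" by (simp add: integral_unique)
  have fvD: "finitely_valued T ?D"
    using finitely_valued_comp[OF interval_index_finitely_valued(1)[OF h_def N T],
        of "\<lambda>k. (\<phi> (real (Suc k) * h) - \<phi> (real k * h)) / h"] by (simp add: difference_quotient_def[abs_def])
  obtain B1 where B1: "\<And>t. t \<in> {0<..<T} \<Longrightarrow> \<bar>?D t\<bar> \<le> B1" using finitely_valued_bounded[OF fvD] by metis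
  obtain B2 where B2: "\<And>t. \<bar>\<eta> t\<bar> \<le> B2" using test_functions_bounded[OF \<eta>] by metis
  obtain B3 where B3: "\<And>t. \<bar>deriv \<eta> t\<bar> \<le> B3" using test_functions_bounded[OF cyl.time_test_facts(3)[OF \<eta>]] by metis
  obtain B4 where B4: "\<And>t. t \<in> {0..T} \<Longrightarrow> \<bar>\<phi> t\<bar> \<le> B4" using continuous_interval_bounded[OF \<phi>cont] by blast
  have i1: "integrable (time_measure T) (\<lambda>t. ?D t * \<eta> t)"
  proof (rule integrable_bounded_lebesgue_on[where B="B1 * B2"])
    show "(\<lambda>t. ?D t * \<eta> t) \<in> borel_measurable (time_measure T)"
      by (intro borel_measurable_times finitely_valued_borel[OF fvD] cyl.time_test_facts(1)[OF \<eta>])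
    show "\<bar>?D t * \<eta> t\<bar> \<le> B1 * B2" if "t \<in> {0<..<T}" for t
      unfolding abs_mult by (rule mult_mono'[OF B1[OF that] B2]) auto
  qed simp
  have i2: "integrable (time_measure T) (\<lambda>t. \<phi> t * deriv \<eta> t)"
  proof (rule integrable_bounded_lebesgue_on[where B="B4 * B3"])
    have "\<phi> \<in> borel_measurable (time_measure T)"
      using \<phi>cont by (intro continuous_imp_measurable_on_sets_lebesgue) (auto intro: continuous_on_subset)
    then show "(\<lambda>t. \<phi> t * deriv \<eta> t) \<in> borel_measurable (time_measure T)"
      by (intro borel_measurable_times cyl.time_test_facts(1)[OF cyl.time_test_facts(3)[OF \<eta>]])
    show "\<bar>\<phi> t * deriv \<eta> t\<bar> \<le> B4 * B3" if "t \<in> {0<..<T}" for t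
      unfolding abs_mult by (rule mult_mono'[OF B4 B3]) (use that in auto)
  qed simp
  have "(LINT t|time_measure T. ?D t * \<eta> t + \<phi> t * deriv \<eta> t) = integral {0<..<T} (\<lambda>t. ?D t * \<eta> t + \<phi> t * deriv \<eta> t)"
    using i1 i2 by (intro lebesgue_integral_eq_integral) auto
  also have "\<dots> = 0" using I0 by (simp add: integral_open_interval_real)
  finally show ?thesis using i1 i2 by (simp add: h_def)
qed

section \<open>Curves in the dual space\<close>

text \<open>The simple functions approximating a strongly measurable curve supply a countable norming
  family of vectors, so that a curve of functionals vanishing weakly vanishes strongly.\<close>

lemma (in seminormed) bochner_dual_zero:
  assumes E: "E \<in> bochner_L2 T (dual_space V N) (dual_norm V N)"
    and weak: "\<And>w. w \<in> V \<Longrightarrow> AE t in time_measure T. E t w = 0"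
  shows "AE t in time_measure T. dual_norm V N (E t) = 0"
proof -
  interpret D: seminormed "dual_space V N" "dual_norm V N" by (rule dual_seminormed)
  obtain a where a: "\<And>k. simple_into T (dual_space V N) (a k)"
    "AE t in time_measure T. (\<lambda>k::nat. dual_norm V N (\<lambda>x. a k t x - E t x)) \<longlonglongrightarrow> 0"
    using bochner_L2E[OF E] by blast
  \<comment> \<open>All values of all approximants: a countable set, as each simple function has
    finitely many.\<close>
  define \<F> where "\<F> = (\<Union>k. a k ` {0<..<T})"
  have "countable \<F>" unfolding \<F>_def
    using a(1) by (intro countable_UN) (auto simp: simple_into_def intro: countable_finite)
  have \<F>: "F \<in> dual_space V N" if "F \<in> \<F>" for F
    using that simple_intoD[OF a(1)] by (auto simp: \<F>_def)
  define good where "good F m w \<longleftrightarrow> w \<in> V \<and> N w \<le> 1 \<and> dual_norm V N F - 1 / real (Suc m) \<le> \<bar>F w\<bar>" for F m w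
  define w where "w F m = (SOME w. good F m w)" for F and m :: nat
  have "good F m (w F m)" if "F \<in> \<F>" for F m
    using dual_almost_attained[OF \<F>[OF that], of "1 / real (Suc m)"] someI_ex[of "good F m"]
    by (auto simp: good_def w_def)
  then have w: "\<And>F m. F \<in> \<F> \<Longrightarrow> w F m \<in> V" "\<And>F m. F \<in> \<F> \<Longrightarrow> N (w F m) \<le> 1"
    "\<And>F m. F \<in> \<F> \<Longrightarrow> dual_norm V N F - 1 / real (Suc m) \<le> \<bar>F (w F m)\<bar>"
    unfolding good_def by blast+
  have "AE t in time_measure T. \<forall>F\<in>\<F>. \<forall>m. E t (w F m) = 0"
    using \<open>countable \<F>\<close> weak w(1) by (subst AE_ball_countable) (auto simp: AE_all_countable)
  then show ?thesis
    using a(2) bochner_L2_AE[OF E] AE_time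
  proof eventually_elim
    case (elim t)
    have aV: "a k t \<in> dual_space V N" for k by (rule simple_intoD[OF a(1) elim(4)])
    \<comment> \<open>\<open>E t\<close> vanishes on the norming vectors of \<open>a k t\<close>, so
      the norm of \<open>a k t\<close> is already seen by the difference, which tends to
      zero.\<close>
    have le: "dual_norm V N (a k t) \<le> dual_norm V N (\<lambda>x. a k t x - E t x)" for k
    proof (rule field_le_epsilon)
      fix e :: real assume "e > 0"
      then obtain m where m: "1 / real (Suc m) < e" using reals_Archimedean[of e] by (auto simp: inverse_eq_divide)
      have mem: "a k t \<in> \<F>" unfolding \<F>_def by (rule UN_I[of k]) (use elim(4) in auto)
      let ?w = "w (a k t) m"
      have "\<bar>a k t ?w\<bar> = \<bar>(\<lambda>x. a k t x - E t x) ?w\<bar>" using elim(1) mem by simp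
      also have "\<dots> \<le> dual_norm V N (\<lambda>x. a k t x - E t x) * N ?w"
        by (rule dual_norm_bound[OF D.diff_mem[OF aV elim(3)] w(1)[OF mem]])
      also have "\<dots> \<le> dual_norm V N (\<lambda>x. a k t x - E t x)"
        using w(2)[OF mem] N_nonneg[OF w(1)[OF mem]] D.N_nonneg[OF D.diff_mem[OF aV elim(3)]] by (simp add: mult_left_le)
      finally show "dual_norm V N (a k t) \<le> dual_norm V N (\<lambda>x. a k t x - E t x) + e"
        using w(3)[OF mem, of m] m by linarith
    qed
    have le2: "dual_norm V N (E t) \<le> 2 * dual_norm V N (\<lambda>x. a k t x - E t x)" for k
      using le[of k] D.N_le_diff[OF elim(3) aV, of k] D.N_diff_commute[OF elim(3) aV, of k] by linarith
    have "(\<lambda>k. 2 * dual_norm V N (\<lambda>x. a k t x - E t x)) \<longlonglongrightarrow> 2 * 0"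
      by (rule tendsto_mult_left[OF elim(2)])
    then have "dual_norm V N (E t) \<le> 2 * 0"
      by (rule LIMSEQ_le_const) (use le2 in blast)
    then show ?case using D.N_nonneg[OF elim(3)] by simp
  qed
qed

section \<open>The time derivative as a function, as a functional and as a curve\<close>

context cylinder
begin

lemma Hm1_diff: "F \<in> Hm1_space \<Omega> \<Longrightarrow> u \<in> H10_space \<Omega> \<Longrightarrow> v \<in> H10_space \<Omega> \<Longrightarrow> F (\<lambda>x. u x - v x) = F u - F v"
  unfolding Hm1_space_def by (rule H10.dual_diff)

lemma Hm1_le:
  "0 \<le> C \<Longrightarrow> (\<And>w. w \<in> H10_space \<Omega> \<Longrightarrow> \<bar>F w\<bar> \<le> C * H10_norm \<Omega> w) \<Longrightarrow> Hm1_norm \<Omega> F \<le> C"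
  unfolding Hm1_norm_def by (rule H10.dual_norm_le)

lemma Hm1_cong: "(\<And>w. w \<in> H10_space \<Omega> \<Longrightarrow> F w = G w) \<Longrightarrow> Hm1_norm \<Omega> F = Hm1_norm \<Omega> G"
  unfolding Hm1_norm_def by (rule H10.dual_norm_cong)

lemma L2_functional:
  obtains C where "0 \<le> C" "\<And>u. u \<in> L2_space \<Omega> \<Longrightarrow> (\<lambda>w. L2_inner \<Omega> u w) \<in> Hm1_space \<Omega>"
    "\<And>u. u \<in> L2_space \<Omega> \<Longrightarrow> Hm1_norm \<Omega> (\<lambda>w. L2_inner \<Omega> u w) \<le> C * L2_norm \<Omega> u"
proof -
  obtain C where C: "0 \<le> C" "\<And>u. u \<in> H10_space \<Omega> \<Longrightarrow> L2_norm \<Omega> u \<le> C * H10_norm \<Omega> u"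
    using poincare by blast
  have bd: "\<bar>L2_inner \<Omega> u w\<bar> \<le> (C * L2_norm \<Omega> u) * H10_norm \<Omega> w"
    if u: "u \<in> L2_space \<Omega>" and w: "w \<in> H10_space \<Omega>" for u w :: "'a \<Rightarrow> real"
  proof -
    have "\<bar>L2_inner \<Omega> u w\<bar> \<le> L2_norm \<Omega> u * L2_norm \<Omega> w" by (rule L2_Cauchy_Schwarz[OF u H10_L2[OF w]])
    also have "\<dots> \<le> L2_norm \<Omega> u * (C * H10_norm \<Omega> w)" by (intro mult_left_mono C(2) w) simp
    finally show ?thesis by (simp add: mult_ac)
  qed
  show thesis
  proof (rule that[OF C(1)])
    fix u :: "'a \<Rightarrow> real" assume u: "u \<in> L2_space \<Omega>"
    have "\<exists>C. \<forall>w\<in>H10_space \<Omega>. \<bar>L2_inner \<Omega> u w\<bar> \<le> C * H10_norm \<Omega> w" using bd[OF u] by blast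
    then show "(\<lambda>w. L2_inner \<Omega> u w) \<in> Hm1_space \<Omega>"
      using u by (simp add: Hm1_space_def dual_space_def L2_inner_add_right L2_inner_mult_right H10_L2)
    show "Hm1_norm \<Omega> (\<lambda>w. L2_inner \<Omega> u w) \<le> C * L2_norm \<Omega> u"
      using bd[OF u] C(1) by (intro Hm1_le) auto
  qed
qed

lemma L2_curve_Hm1:
  assumes "d \<in> bochner_L2 T (L2_space \<Omega>) (L2_norm \<Omega>)"
  shows "(\<lambda>t w. L2_inner \<Omega> (d t) w) \<in> bochner_L2 T (Hm1_space \<Omega>) (Hm1_norm \<Omega>)"
proof -
  obtain C where C: "0 \<le> C" "\<And>u. u \<in> L2_space \<Omega> \<Longrightarrow> (\<lambda>w. L2_inner \<Omega> u w) \<in> Hm1_space \<Omega>"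
    "\<And>u. u \<in> L2_space \<Omega> \<Longrightarrow> Hm1_norm \<Omega> (\<lambda>w. L2_inner \<Omega> u w) \<le> C * L2_norm \<Omega> u"
    using L2_functional by blast
  show ?thesis
  proof (rule bochner_map[where A="\<lambda>u w. L2_inner \<Omega> u w" and C=C, OF seminormed_L2 Hm1.seminormed_axioms _ _ _ assms])
    fix a b :: "'a \<Rightarrow> real" assume ab: "a \<in> L2_space \<Omega>" "b \<in> L2_space \<Omega>"
    have "Hm1_norm \<Omega> (\<lambda>w. L2_inner \<Omega> a w - L2_inner \<Omega> b w) = Hm1_norm \<Omega> (\<lambda>w. L2_inner \<Omega> (\<lambda>x. a x - b x) w)"
      using ab by (intro Hm1_cong) (simp add: L2_inner_diff_left H10_L2)
    then show "Hm1_norm \<Omega> (\<lambda>w. L2_inner \<Omega> a w - L2_inner \<Omega> b w) \<le> C * L2_norm \<Omega> (\<lambda>x. a x - b x)"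
      using C(3)[OF L2_space_diff[OF ab]] by simp
  qed (use C in auto)
qed

lemma Hm1_evaluation_L2:
  assumes F: "F \<in> bochner_L2 T (Hm1_space \<Omega>) (Hm1_norm \<Omega>)" and w: "w \<in> H10_space \<Omega>"
  shows "(\<lambda>t. F t w) \<in> L2_space {0<..<T}"
proof -
  have meas: "(\<lambda>t. F t w) \<in> borel_measurable (time_measure T)"
  proof (rule Hm1.bochner_measurable1[OF F])
    fix x a
    assume h: "x \<in> Hm1_space \<Omega>" "\<And>k. a k \<in> Hm1_space \<Omega>" "(\<lambda>k::nat. Hm1_norm \<Omega> (\<lambda>z. a k z - x z)) \<longlonglongrightarrow> 0"
    have "(\<lambda>k. a k w - x w) \<longlonglongrightarrow> 0"
    proof (rule Lim_null_comparison)
      show "(\<lambda>k. Hm1_norm \<Omega> (\<lambda>z. a k z - x z) * H10_norm \<Omega> w) \<longlonglongrightarrow> 0"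
        using tendsto_mult_right[OF h(3), of "H10_norm \<Omega> w"] by simp
      show "\<forall>\<^sub>F k in sequentially. norm (a k w - x w) \<le> Hm1_norm \<Omega> (\<lambda>z. a k z - x z) * H10_norm \<Omega> w"
        using Hm1_bound[OF Hm1.diff_mem[OF h(2,1)] w] by simp
    qed
    then show "(\<lambda>k. a k w) \<longlonglongrightarrow> x w" by (simp add: LIM_zero_iff)
  qed
  have "integrable (time_measure T) (\<lambda>t. (norm (F t w))\<^sup>2)"
  proof (rule Bochner_Integration.integrable_bound)
    show "integrable (time_measure T) (\<lambda>t. (Hm1_norm \<Omega> (F t))\<^sup>2 * (H10_norm \<Omega> w)\<^sup>2)"
      using F by (simp add: bochner_L2_def)
    show "(\<lambda>t. (norm (F t w))\<^sup>2) \<in> borel_measurable (time_measure T)" using meas by simp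
    show "AE t in time_measure T. norm ((norm (F t w))\<^sup>2) \<le> norm ((Hm1_norm \<Omega> (F t))\<^sup>2 * (H10_norm \<Omega> w)\<^sup>2)"
      using bochner_L2_AE[OF F]
    proof eventually_elim
      case (elim t)
      show ?case using power_mono[OF Hm1_bound[OF elim w], of 2] by (simp add: power_mult_distrib)
    qed
  qed
  then show ?thesis using meas by (simp add: L2_space_def)
qed

lemma L2_inner_tensor:
  fixes a w :: "'a \<Rightarrow> real"
  shows "L2_inner \<Omega> a (slice (tensor w \<phi>) t) = \<phi> t * L2_inner \<Omega> a w"
proof -
  have "slice (tensor w \<phi>) t = (\<lambda>x. \<phi> t * w x)" by (simp add: slice_def tensor_def fun_eq_iff)
  then show ?thesis by (simp add: L2_inner_mult_right)
qed

text \<open>For fixed \<open>w\<close> both sides are weak derivatives of the same real function of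
  time, hence equal off a null set depending on \<open>w\<close>; \<open>bochner_dual_zero\<close>
  removes this dependence. The result links the derivative behind \<open>H32_Hm1_norm\<close> to the
  one behind \<open>H21_norm\<close>.\<close>

lemma Hm1_time_deriv_eq:
  assumes d: "is_Hm1_time_deriv \<Omega> T u d" and \<delta>: "is_L2_time_deriv \<Omega> T u \<delta>"
  shows "AE t in time_measure T. d t \<in> Hm1_space \<Omega> \<and> (\<forall>w\<in>H10_space \<Omega>. d t w = L2_inner \<Omega> (slice \<delta> t) w)"
proof -
  let ?\<delta> = "\<lambda>t w. L2_inner \<Omega> (slice \<delta> t) w"
  have dB: "d \<in> bochner_L2 T (Hm1_space \<Omega>) (Hm1_norm \<Omega>)" using d by (simp add: is_Hm1_time_deriv_def)
  have \<delta>B: "?\<delta> \<in> bochner_L2 T (Hm1_space \<Omega>) (Hm1_norm \<Omega>)"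
    using \<delta> by (intro L2_curve_Hm1) (simp add: is_L2_time_deriv_def)
  have weak: "AE t in time_measure T. d t w - ?\<delta> t w = 0" if w: "w \<in> H10_space \<Omega>" for w
  proof (rule fundamental_lemma)
    note L = Hm1_evaluation_L2[OF dB w] Hm1_evaluation_L2[OF \<delta>B w]
    show "(\<lambda>t. d t w - ?\<delta> t w) \<in> L2_space {0<..<T}" using L by (rule L2_space_diff)
    fix \<phi> assume \<phi>: "\<phi> \<in> test_functions {0<..<T}"
    have \<phi>L: "\<phi> \<in> L2_space {0<..<T}" by (rule test_functions_L2[OF \<phi>]) simp
    have "L2_inner {0<..<T} (\<lambda>t. d t w) \<phi> = - (LINT t|time_measure T. deriv \<phi> t * Hm1_curve \<Omega> u t w)"
      using d w \<phi> by (simp add: is_Hm1_time_deriv_def L2_inner_def mult.commute)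
    also have "\<dots> = L2_inner {0<..<T} (\<lambda>t. ?\<delta> t w) \<phi>"
      using \<delta> H10_L2[OF w] \<phi>
      by (simp add: is_L2_time_deriv_def L2Q_inner_def L2_inner_tensor Hm1_curve_def) (simp add: L2_inner_def mult.commute)
    finally show "L2_inner {0<..<T} (\<lambda>t. d t w - ?\<delta> t w) \<phi> = 0"
      using L2_inner_diff_left[OF L \<phi>L] by simp
  qed auto
  \<comment> \<open>Equality in norm does not mention \<open>w\<close>, so a single null set now
    serves all of \<open>H10_space\<close>.\<close>
  have "AE t in time_measure T. Hm1_norm \<Omega> (\<lambda>w. d t w - ?\<delta> t w) = 0"
    unfolding Hm1_norm_def using Hm1.bochner_diff[OF dB \<delta>B] weak
    by (intro H10.bochner_dual_zero) (auto simp: Hm1_space_def Hm1_norm_def)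
  then show ?thesis using bochner_L2_AE[OF dB] bochner_L2_AE[OF \<delta>B]
  proof eventually_elim
    case (elim t)
    have "d t w = ?\<delta> t w" if w: "w \<in> H10_space \<Omega>" for w
      using Hm1_bound[OF Hm1.diff_mem[OF elim(2,3)] w] elim(1) by simp
    then show ?case using elim(2) by simp
  qed
qed

text \<open>Testing with a fixed \<open>v\<close> reduces the claim to \<open>weak_primitive\<close>
  for the continuous real function \<open>L2_inner \<Omega> (w t) v\<close>, and the initial
  condition fixes the constant of integration. The curve \<open>w\<close> provides the values of the
  solution at the nodes.\<close>

lemma initial_value_primitive:
  assumes u: "slice u \<in> bochner_L2 T (L2_space \<Omega>) (L2_norm \<Omega>)" and \<delta>: "is_L2_time_deriv \<Omega> T u \<delta>"
    and init: "has_initial_value \<Omega> T u (\<lambda>x. 0)"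
  obtains w where "\<And>t. t \<in> {0..T} \<Longrightarrow> w t \<in> L2_space \<Omega>"
    "AE t in time_measure T. L2_norm \<Omega> (\<lambda>x. slice u t x - w t x) = 0"
    "\<And>t v. t \<in> {0..T} \<Longrightarrow> v \<in> L2_space \<Omega> \<Longrightarrow>
      L2_inner \<Omega> (w t) v = (LINT s|time_measure T. L2_inner \<Omega> (slice \<delta> s) v * indicator {0<..<t} s)"
proof -
  obtain w where w: "\<And>t. t \<in> {0..T} \<Longrightarrow> w t \<in> L2_space \<Omega>"
    "\<And>t. t \<in> {0..T} \<Longrightarrow> ((\<lambda>r. L2_norm \<Omega> (\<lambda>x. w r x - w t x)) \<longlongrightarrow> 0) (at t within {0..T})"
    "AE t in time_measure T. L2_norm \<Omega> (\<lambda>x. slice u t x - w t x) = 0" "L2_norm \<Omega> (\<lambda>x. w 0 x - 0) = 0"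
    using init unfolding has_initial_value_def by blast
  have \<delta>B: "slice \<delta> \<in> bochner_L2 T (L2_space \<Omega>) (L2_norm \<Omega>)" using \<delta> by (simp add: is_L2_time_deriv_def)
  have "L2_inner \<Omega> (w t) v = (LINT s|time_measure T. L2_inner \<Omega> (slice \<delta> s) v * indicator {0<..<t} s)"
    if t: "t \<in> {0..T}" and v: "v \<in> L2_space \<Omega>" for t v
  proof -
    have vB: "(\<lambda>_. v) \<in> bochner_L2 T (L2_space \<Omega>) (L2_norm \<Omega>)" by (rule L2.bochner_const[OF v])
    have cont: "continuous_on {0..T} (\<lambda>t. L2_inner \<Omega> (w t) v)"
      unfolding continuous_on_def
    proof
      fix t assume t: "t \<in> {0..T}"
      have "((\<lambda>r. L2_inner \<Omega> (w r) v - L2_inner \<Omega> (w t) v) \<longlongrightarrow> 0) (at t within {0..T})"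
      proof (rule Lim_null_comparison)
        show "((\<lambda>r. L2_norm \<Omega> (\<lambda>x. w r x - w t x) * L2_norm \<Omega> v) \<longlongrightarrow> 0) (at t within {0..T})"
          using tendsto_mult_right[OF w(2)[OF t], of "L2_norm \<Omega> v"] by simp
        have "norm (L2_inner \<Omega> (w r) v - L2_inner \<Omega> (w t) v) \<le> L2_norm \<Omega> (\<lambda>x. w r x - w t x) * L2_norm \<Omega> v"
          if "r \<in> {0..T}" for r
          using L2_Cauchy_Schwarz[OF L2_space_diff[OF w(1)[OF that] w(1)[OF t]] v] L2_inner_diff_left[OF w(1)[OF that] w(1)[OF t] v]
          by simp
        then show "\<forall>\<^sub>F r in at t within {0..T}. norm (L2_inner \<Omega> (w r) v - L2_inner \<Omega> (w t) v)
            \<le> L2_norm \<Omega> (\<lambda>x. w r x - w t x) * L2_norm \<Omega> v"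
          by (auto simp: eventually_at_filter)
      qed
      then show "((\<lambda>t. L2_inner \<Omega> (w t) v) \<longlongrightarrow> L2_inner \<Omega> (w t) v) (at t within {0..T})"
        by (simp add: LIM_zero_iff)
    qed
    have int: "integrable (time_measure T) (\<lambda>s. L2_inner \<Omega> (slice \<delta> s) v)"
      by (rule L2_inner_bochner(2)[OF \<delta>B vB])
    have "(LINT s|time_measure T. L2_inner \<Omega> (slice \<delta> s) v * indicator {0<..<t} s)
        = L2_inner \<Omega> (w t) v - L2_inner \<Omega> (w 0) v"
    proof (rule weak_primitive[OF cont int])
      fix \<phi> assume \<phi>: "\<phi> \<in> test_functions {0<..<T}"
      have "(LINT t|time_measure T. L2_inner \<Omega> (slice \<delta> t) v * \<phi> t) = - (LINT t|time_measure T. deriv \<phi> t * L2_inner \<Omega> (slice u t) v)"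
        using \<delta> v \<phi> by (simp add: is_L2_time_deriv_def L2Q_inner_def L2_inner_tensor mult.commute)
      \<comment> \<open>At almost every time \<open>u\<close> and its continuous representative
        differ by a function of norm zero.\<close>
      also have "(LINT t|time_measure T. deriv \<phi> t * L2_inner \<Omega> (slice u t) v) = (LINT t|time_measure T. L2_inner \<Omega> (w t) v * deriv \<phi> t)"
      proof (rule integral_cong_AE)
        have m: "deriv \<phi> \<in> borel_measurable (time_measure T)" by (rule time_test_facts(1)[OF time_test_facts(3)[OF \<phi>]])
        show "(\<lambda>t. deriv \<phi> t * L2_inner \<Omega> (slice u t) v) \<in> borel_measurable (time_measure T)"
          by (intro borel_measurable_times m L2_inner_bochner(1)[OF u vB])
        have "(\<lambda>t. L2_inner \<Omega> (w t) v) \<in> borel_measurable (time_measure T)"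
          using cont by (intro continuous_imp_measurable_on_sets_lebesgue) (auto intro: continuous_on_subset)
        then show "(\<lambda>t. L2_inner \<Omega> (w t) v * deriv \<phi> t) \<in> borel_measurable (time_measure T)"
          by (intro borel_measurable_times m)
        show "AE t in time_measure T. deriv \<phi> t * L2_inner \<Omega> (slice u t) v = L2_inner \<Omega> (w t) v * deriv \<phi> t"
          using w(3) bochner_L2_AE[OF u] AE_time
        proof eventually_elim
          case (elim t)
          have wt: "w t \<in> L2_space \<Omega>" using w(1) elim(3) by auto
          have "L2_inner \<Omega> (slice u t) v = L2_inner \<Omega> (w t) v"
            using L2_Cauchy_Schwarz[OF L2_space_diff[OF elim(2) wt] v] L2_inner_diff_left[OF elim(2) wt v] elim(1) by simp
          then show ?case by simp
        qed
      qed
      finally show "(LINT t|time_measure T. L2_inner \<Omega> (slice \<delta> t) v * \<phi> t) = - (LINT t|time_measure T. L2_inner \<Omega> (w t) v * deriv \<phi> t)" .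
    qed (use t in auto)
    moreover have "L2_inner \<Omega> (w 0) v = 0"
      using L2_Cauchy_Schwarz[OF w(1) v, of 0] w(4) T_pos by simp
    ultimately show ?thesis by simp
  qed
  then show thesis using that[of w] w(1,3) by blast
qed

end

section \<open>The orthogonal projection onto the finite element space\<close>

text \<open>A subspace whose members are determined by finitely many point values admits orthogonal
  projections: remove the points one at a time.\<close>

lemma orthogonal_projection_exists:
  fixes V :: "('a::euclidean_space \<Rightarrow> real) set"
  assumes "finite P" "V \<subseteq> L2_space S" "(\<lambda>_. 0) \<in> V"
    "\<And>u v. u \<in> V \<Longrightarrow> v \<in> V \<Longrightarrow> (\<lambda>x. u x + v x) \<in> V" "\<And>c u. u \<in> V \<Longrightarrow> (\<lambda>x. c * u x) \<in> V"
    "\<And>v. v \<in> V \<Longrightarrow> (\<And>p. p \<in> P \<Longrightarrow> v p = 0) \<Longrightarrow> L2_norm S v = 0"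
    "u \<in> L2_space S"
  shows "\<exists>p\<in>V. \<forall>v\<in>V. L2_inner S p v = L2_inner S u v"
  using assms
proof (induction P arbitrary: V u rule: finite_induct)
  case empty
  have "L2_inner S u v = 0" if "v \<in> V" for v
    using L2_Cauchy_Schwarz[of u S v] empty that by auto
  then show ?case using empty by (intro bexI[of _ "\<lambda>_. 0"]) auto
next
  case (insert q P)
  note L2 = subsetD[OF insert.prems(1)] and add = insert.prems(3) and scale = insert.prems(4)
  define V' where "V' = {v\<in>V. v q = 0}"
  have proj': "\<exists>p\<in>V'. \<forall>v\<in>V'. L2_inner S p v = L2_inner S u v" if "u \<in> L2_space S" for u
  proof (rule insert.IH[OF _ _ _ _ _ that])
    show "L2_norm S v = 0" if "v \<in> V'" "\<And>p. p \<in> P \<Longrightarrow> v p = 0" for v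
      by (rule insert.prems(5)) (use that in \<open>auto simp: V'_def\<close>)
  qed (use insert.prems(1-4) in \<open>auto simp: V'_def\<close>)
  show ?case
  proof (cases "V' = V")
    case True
    then show ?thesis using proj'[OF insert.prems(6)] by simp
  next
    case False
    then obtain w where w: "w \<in> V" "w q \<noteq> 0" by (auto simp: V'_def)
    obtain r where r: "r \<in> V'" "\<And>v. v \<in> V' \<Longrightarrow> L2_inner S r v = L2_inner S w v"
      using proj'[OF L2[OF w(1)]] by blast
    \<comment> \<open>\<open>e\<close> is orthogonal to \<open>V'\<close> and, as \<open>r\<close>
      vanishes at \<open>q\<close>, it has the same nonzero value at \<open>q\<close> as
      \<open>w\<close>. Hence \<open>V\<close> is \<open>V'\<close> plus the line through
      \<open>e\<close>.\<close>
    define e where "e = (\<lambda>x. w x + (-1) * r x)"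
    have eV: "e \<in> V" unfolding e_def using w r by (intro add scale) (auto simp: V'_def)
    have eq: "e q = w q" using r by (simp add: e_def V'_def)
    have rV: "r \<in> V" using r by (simp add: V'_def)
    have e_orth: "L2_inner S e v = 0" if "v \<in> V'" for v
      using r(2)[OF that] L2_inner_diff_left[OF L2[OF w(1)] L2[OF rV] L2, of v] that by (simp add: e_def V'_def)
    obtain p where p: "p \<in> V'" "\<And>v. v \<in> V' \<Longrightarrow> L2_inner S p v = L2_inner S u v"
      using proj'[OF insert.prems(6)] by blast
    have pV: "p \<in> V" using p by (simp add: V'_def)
    define \<alpha> where "\<alpha> = L2_inner S u e / L2_inner S e e"
    \<comment> \<open>If \<open>e\<close> has norm zero, the quotient \<open>\<alpha>\<close> is 0
      by convention, and both sides vanish.\<close>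
    have ue: "\<alpha> * L2_inner S e e = L2_inner S u e"
    proof (cases "L2_inner S e e = 0")
      case True
      then have "L2_norm S e = 0" by (simp add: L2_norm_def)
      then have "L2_inner S u e = 0" using L2_Cauchy_Schwarz[OF insert.prems(6) L2[OF eV]] by simp
      then show ?thesis using True by simp
    qed (simp add: \<alpha>_def)
    let ?p = "\<lambda>x. p x + \<alpha> * e x"
    have ae: "(\<lambda>x. \<alpha> * e x) \<in> V" by (rule scale[OF eV])
    show ?thesis
    proof (intro bexI[of _ ?p] ballI)
      show "?p \<in> V" by (rule add[OF pV ae])
      fix v assume v: "v \<in> V"
      \<comment> \<open>The coefficient for which subtracting a multiple of \<open>e\<close> makes
        \<open>v\<close> vanish at \<open>q\<close>.\<close>
      define \<beta> where "\<beta> = v q / e q"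
      define v' where "v' = (\<lambda>x. v x + (- \<beta>) * e x)"
      have "v' \<in> V" unfolding v'_def by (rule add[OF v scale[OF eV]])
      moreover have "v' q = 0" using w(2) by (simp add: v'_def \<beta>_def eq)
      ultimately have v'V: "v' \<in> V'" by (simp add: V'_def)
      have v'L: "v' \<in> L2_space S" using v'V L2 by (simp add: V'_def)
      have be: "(\<lambda>x. \<beta> * e x) \<in> L2_space S" by (rule L2[OF scale[OF eV]])
      have veq: "v = (\<lambda>x. v' x + \<beta> * e x)" by (simp add: v'_def)
      have split: "L2_inner S a v = L2_inner S a v' + \<beta> * L2_inner S a e" if "a \<in> L2_space S" for a
        unfolding veq using L2_inner_add_right[OF v'L be that] by (simp add: L2_inner_mult_right v'_def)
      have "L2_inner S ?p v' = L2_inner S u v'"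
        using L2_inner_add_left[OF L2[OF pV] L2[OF ae] v'L] p(2)[OF v'V] e_orth[OF v'V] by (simp add: L2_inner_mult_left)
      moreover have "L2_inner S ?p e = L2_inner S u e"
        using L2_inner_add_left[OF L2[OF pV] L2[OF ae] L2[OF eV]] e_orth[OF p(1)] ue
        by (simp add: L2_inner_mult_left L2_inner_commute[of S p])
      ultimately show "L2_inner S ?p v = L2_inner S u v"
        using split[OF L2[OF add[OF pV ae]]] split[OF insert.prems(6)] by simp
    qed
  qed
qed

context bounded_domain
begin

lemma V_h_H10: "v \<in> V_h \<Omega> \<T> \<Longrightarrow> v \<in> H10_space \<Omega>"
  by (simp add: V_h_def)

lemma V_h_zero: "(\<lambda>_. 0) \<in> V_h \<Omega> \<T>"
proof -
  interpret H: seminormed "H10_space \<Omega>" "H10_norm \<Omega>" by (rule seminormed_H10)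
  have "\<exists>a \<beta>. \<forall>x\<in>K. 0 = a \<bullet> x + \<beta>" for K :: "'a set"
    by (intro exI[of _ 0] exI[of _ "0::real"]) simp
  then show ?thesis using H.zero_mem by (auto simp: V_h_def)
qed

lemma V_h_add:
  assumes "u \<in> V_h \<Omega> \<T>" "v \<in> V_h \<Omega> \<T>"
  shows "(\<lambda>x. u x + v x) \<in> V_h \<Omega> \<T>"
proof -
  interpret H: seminormed "H10_space \<Omega>" "H10_norm \<Omega>" by (rule seminormed_H10)
  have "\<exists>a \<beta>. \<forall>x\<in>K. u x + v x = a \<bullet> x + \<beta>" if "K \<in> \<T>" for K
  proof -
    obtain a \<beta> b \<gamma> where "\<forall>x\<in>K. u x = a \<bullet> x + \<beta>" "\<forall>x\<in>K. v x = b \<bullet> x + \<gamma>"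
      using assms \<open>K \<in> \<T>\<close> unfolding V_h_def by blast
    then show ?thesis by (intro exI[of _ "a + b"] exI[of _ "\<beta> + \<gamma>"]) (simp add: inner_add_left)
  qed
  then show ?thesis using assms H.add_mem by (simp add: V_h_def continuous_on_add)
qed

lemma V_h_scale:
  assumes "u \<in> V_h \<Omega> \<T>"
  shows "(\<lambda>x. c * u x) \<in> V_h \<Omega> \<T>"
proof -
  interpret H: seminormed "H10_space \<Omega>" "H10_norm \<Omega>" by (rule seminormed_H10)
  have "\<exists>a \<beta>. \<forall>x\<in>K. c * u x = a \<bullet> x + \<beta>" if "K \<in> \<T>" for K
  proof -
    obtain a \<beta> where "\<forall>x\<in>K. u x = a \<bullet> x + \<beta>" using assms \<open>K \<in> \<T>\<close> unfolding V_h_def by blast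
    then show ?thesis by (intro exI[of _ "c *\<^sub>R a"] exI[of _ "c * \<beta>"]) (simp add: algebra_simps)
  qed
  then show ?thesis using assms H.scale_mem by (simp add: V_h_def continuous_on_mult_left)
qed

text \<open>The determining points are the vertices of the simplices: an affine function vanishing
  at the vertices vanishes on their convex hull. Existence then justifies the choice in
  \<open>L2_proj\<close>.\<close>

lemma L2_proj_V_h:
  assumes mesh: "admissible_mesh \<Omega> \<T>" and u: "u \<in> L2_space \<Omega>"
  shows "L2_proj \<Omega> (V_h \<Omega> \<T>) u \<in> V_h \<Omega> \<T>"
    and "v \<in> V_h \<Omega> \<T> \<Longrightarrow> L2_inner \<Omega> (L2_proj \<Omega> (V_h \<Omega> \<T>) u) v = L2_inner \<Omega> u v"
proof -
  have \<T>: "finite \<T>" "\<Union>\<T> = closure \<Omega>" "\<And>K. K \<in> \<T> \<Longrightarrow> int DIM('a) simplex K"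
    using mesh by (auto simp: admissible_mesh_def triangulation_def)
  have "\<exists>C. finite C \<and> K = convex hull C" if "K \<in> \<T>" for K
    using \<T>(3)[OF that] by (auto simp: simplex)
  then obtain C where C: "\<And>K. K \<in> \<T> \<Longrightarrow> finite (C K)" "\<And>K. K \<in> \<T> \<Longrightarrow> K = convex hull (C K)" by metis
  have zero: "L2_norm \<Omega> v = 0" if v: "v \<in> V_h \<Omega> \<T>" and vz: "\<And>p. p \<in> (\<Union>K\<in>\<T>. C K) \<Longrightarrow> v p = 0" for v
  proof -
    have "v x = 0" if x: "x \<in> \<Omega>" for x
    proof -
      have "x \<in> \<Union>\<T>" using x closure_subset[of \<Omega>] \<T>(2) by auto
      then obtain K where K: "K \<in> \<T>" "x \<in> K" by blast
      obtain a \<beta> where a: "\<And>x. x \<in> K \<Longrightarrow> v x = a \<bullet> x + \<beta>" using v K(1) unfolding V_h_def by blast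
      have sub: "C K \<subseteq> K" using C(2)[OF K(1)] hull_subset[of "C K" convex] by simp
      have "convex hull (C K) \<subseteq> {y. a \<bullet> y = - \<beta>}"
      proof (rule hull_minimal)
        show "C K \<subseteq> {y. a \<bullet> y = - \<beta>}"
        proof
          fix y assume y: "y \<in> C K"
          have "v y = 0" by (rule vz) (use y K(1) in blast)
          then have "a \<bullet> y + \<beta> = 0" using a[OF subsetD[OF sub y]] by simp
          then show "y \<in> {y. a \<bullet> y = - \<beta>}" by simp
        qed
      qed (rule convex_hyperplane)
      then show ?thesis using a[OF K(2)] K(2) C(2)[OF K(1)] by auto
    qed
    then have "L2_inner \<Omega> v v = (LINT x|lebesgue_on \<Omega>. 0)"
      unfolding L2_inner_def by (intro Bochner_Integration.integral_cong) auto
    then show ?thesis by (simp add: L2_norm_def)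
  qed
  have "\<exists>p\<in>V_h \<Omega> \<T>. \<forall>v\<in>V_h \<Omega> \<T>. L2_inner \<Omega> p v = L2_inner \<Omega> u v"
  proof (rule orthogonal_projection_exists[where P="\<Union>K\<in>\<T>. C K"])
    show "finite (\<Union>K\<in>\<T>. C K)" using \<T>(1) C(1) by simp
    show "V_h \<Omega> \<T> \<subseteq> L2_space \<Omega>" using V_h_H10 H10_L2 by blast
  qed (use V_h_zero V_h_add V_h_scale zero u in simp_all)
  then have "\<exists>p. p \<in> V_h \<Omega> \<T> \<and> (\<forall>v\<in>V_h \<Omega> \<T>. L2_inner \<Omega> p v = L2_inner \<Omega> u v)" by blast
  from someI_ex[OF this] show "L2_proj \<Omega> (V_h \<Omega> \<T>) u \<in> V_h \<Omega> \<T>"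
    "v \<in> V_h \<Omega> \<T> \<Longrightarrow> L2_inner \<Omega> (L2_proj \<Omega> (V_h \<Omega> \<T>) u) v = L2_inner \<Omega> u v"
    unfolding L2_proj_def by blast+
qed

end

section \<open>The time grid\<close>

lemma bochner_cong:
  assumes "u \<in> bochner_L2 T V N" "\<And>t. t \<in> {0<..<T} \<Longrightarrow> u t = v t"
  shows "v \<in> bochner_L2 T V N"
proof -
  obtain a where a: "\<And>k. simple_into T V (a k)"
    "AE t in time_measure T. (\<lambda>k::nat. N (\<lambda>x. a k t x - u t x)) \<longlonglongrightarrow> 0"
    using bochner_L2E[OF assms(1)] by blast
  show ?thesis
  proof (rule bochner_L2I[OF _ a(1)])
    show "AE t in time_measure T. v t \<in> V"
      using bochner_L2_AE[OF assms(1)] AE_time by eventually_elim (simp add: assms(2))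
    show "AE t in time_measure T. (\<lambda>k. N (\<lambda>x. a k t x - v t x)) \<longlonglongrightarrow> 0"
      using a(2) AE_time by eventually_elim (simp add: assms(2))
    have "integrable (time_measure T) (\<lambda>t. (N (u t))\<^sup>2)" using assms(1) by (simp add: bochner_L2_def)
    moreover have "integrable (time_measure T) (\<lambda>t. (N (u t))\<^sup>2) = integrable (time_measure T) (\<lambda>t. (N (v t))\<^sup>2)"
      by (intro Bochner_Integration.integrable_cong) (simp_all add: assms(2))
    ultimately show "integrable (time_measure T) (\<lambda>t. (N (v t))\<^sup>2)" by simp
  qed
qed

locale time_grid =
  fixes T :: real and N :: nat
  assumes T_pos: "0 < T" and N_pos: "1 \<le> N"
begin

definition \<tau> :: real where "\<tau> = T / real N"

text \<open>Open cells match \<open>W0_h\<close>, which leaves the values at the nodes free; the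
  nodes themselves form a null set.\<close>

definition cell :: "nat \<Rightarrow> real set" where "cell k = {real k * \<tau><..<real (Suc k) * \<tau>}"

abbreviation charc :: "nat \<Rightarrow> real \<Rightarrow> real" where "charc k \<equiv> indicator (cell k)"

abbreviation idx :: "real \<Rightarrow> nat" where "idx \<equiv> interval_index \<tau>"

lemma \<tau>_pos: "0 < \<tau>"
  using T_pos N_pos by (simp add: \<tau>_def)

lemma N_\<tau>: "real N * \<tau> = T"
  using N_pos by (simp add: \<tau>_def)

lemma node_le: "k \<le> N \<Longrightarrow> real k * \<tau> \<le> T"
  using mult_right_mono[of "real k" "real N" \<tau>] \<tau>_pos N_\<tau> by simp

lemma node_mem: "k \<le> N \<Longrightarrow> real k * \<tau> \<in> {0..T}"
  using node_le \<tau>_pos by simp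

lemma Suc_node: "real (Suc k) * \<tau> = real k * \<tau> + \<tau>"
  by (simp add: algebra_simps)

lemma cell_subset: "k < N \<Longrightarrow> cell k \<subseteq> {0<..<T}"
proof
  fix t assume k: "k < N" and t: "t \<in> cell k"
  have "0 \<le> real k * \<tau>" "real (Suc k) * \<tau> \<le> T" using node_le[of "Suc k"] k \<tau>_pos by auto
  then show "t \<in> {0<..<T}" using t by (auto simp: cell_def)
qed

lemma idx_cell:
  assumes "t \<in> cell k"
  shows "idx t = k"
proof -
  have t: "real k * \<tau> \<le> t" "t < real (Suc k) * \<tau>" using assms by (auto simp: cell_def)
  moreover have "0 \<le> real k * \<tau>" using \<tau>_pos by simp
  ultimately show ?thesis using interval_index_iff[OF \<tau>_pos, of t k] by linarith
qed

lemma idx_less: "t \<in> {0<..<T} \<Longrightarrow> idx t < N"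
  by (rule interval_index_finitely_valued(2)[OF \<tau>_def N_pos T_pos])

lemma idx_bounds:
  assumes "t \<in> {0<..<T}"
  shows "real (idx t) * \<tau> \<le> t" "t < real (Suc (idx t)) * \<tau>"
  using interval_index_iff[OF \<tau>_pos, of t "idx t"] assms by (auto simp del: of_nat_Suc)

lemma AE_not_node: "AE t in time_measure T. t \<notin> (\<lambda>k. real k * \<tau>) ` {..N}"
proof -
  have "AE t in lebesgue. t \<notin> (\<lambda>k. real k * \<tau>) ` {..N}"
    by (rule AE_not_in) (intro negligible_iff_null_sets[THEN iffD1] negligible_finite finite_imageI finite_atMost)
  then show ?thesis by (subst AE_lebesgue_on_iff) auto
qed

lemma AE_cell: "AE t in time_measure T. t \<in> cell (idx t) \<and> idx t < N \<and> t \<in> {0<..<T}"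
  using AE_not_node AE_time
proof eventually_elim
  case (elim t)
  have lt: "idx t < N" by (rule idx_less[OF elim(2)])
  then have "t \<noteq> real (idx t) * \<tau>" using elim(1) by auto
  then show ?case using idx_bounds[OF elim(2)] lt elim(2) by (simp add: cell_def)
qed

lemma cell_measurable [simp]: "charc k \<in> borel_measurable (time_measure T)"
  by (rule indicator_measurable_lebesgue_on) (simp add: cell_def)

lemma integrable_cell_mult:
  fixes f :: "real \<Rightarrow> real"
  assumes "integrable (time_measure T) f"
  shows "integrable (time_measure T) (\<lambda>t. charc k t * f t)"
proof (rule Bochner_Integration.integrable_bound[OF assms])
  show "(\<lambda>t. charc k t * f t) \<in> borel_measurable (time_measure T)"
    by (intro borel_measurable_times cell_measurable borel_measurable_integrable[OF assms])
  show "AE t in time_measure T. norm (charc k t * f t) \<le> norm (f t)"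
    by (intro AE_I2) (simp add: indicator_def)
qed

lemma cell_L2: "charc k \<in> L2_space {0<..<T}"
  by (rule L2_space_bounded[where B=1]) (auto simp: indicator_def)

lemma cell_mult_L2: "f \<in> L2_space {0<..<T} \<Longrightarrow> (\<lambda>t. charc k t * f t) \<in> L2_space {0<..<T}" for f :: "real \<Rightarrow> real"
  by (rule L2_space_mult_bounded[where B=1, OF _ cell_measurable]) (simp_all add: indicator_def)

text \<open>Transfers integrals over a cell to the Henstock-Kurzweil integral, where the fundamental
  theorem of calculus can evaluate them.\<close>

lemma integral_cell:
  fixes f :: "real \<Rightarrow> real"
  assumes k: "k < N" and f: "continuous_on {real k * \<tau>..real (Suc k) * \<tau>} f"
  shows "(LINT t|time_measure T. charc k t * f t) = integral {real k * \<tau>..real (Suc k) * \<tau>} f"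
proof -
  have cs: "cell k \<in> lmeasurable" "cell k \<in> sets lebesgue" by (simp_all add: cell_def)
  have fc: "f \<in> borel_measurable (lebesgue_on (cell k))"
    by (intro continuous_imp_measurable_on_sets_lebesgue continuous_on_subset[OF f] cs) (auto simp: cell_def)
  obtain M where "\<And>t. t \<in> {real k * \<tau>..real (Suc k) * \<tau>} \<Longrightarrow> \<bar>f t\<bar> \<le> M"
    using continuous_interval_bounded[OF f] by blast
  then have "integrable (lebesgue_on (cell k)) f"
    by (intro integrable_bounded_lebesgue_on[OF cs(1) fc, of M]) (auto simp: cell_def)
  then have "(LINT t|lebesgue_on (cell k). f t) = integral (cell k) f"
    using cs by (intro lebesgue_integral_eq_integral)
  also have "integral (cell k) f = integral {real k * \<tau>..real (Suc k) * \<tau>} f"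
    unfolding cell_def by (rule integral_open_interval_real[symmetric])
  also have "(LINT t|lebesgue_on (cell k). f t) = (LINT t|lebesgue. indicator (cell k) t *\<^sub>R f t)"
    using cs by (intro integral_restrict_space) auto
  also have "\<dots> = (LINT t|lebesgue. indicator {0<..<T} t *\<^sub>R (charc k t * f t))"
    using cell_subset[OF k] by (intro Bochner_Integration.integral_cong) (auto simp: indicator_def)
  also have "\<dots> = (LINT t|time_measure T. charc k t * f t)"
    by (rule integral_restrict_space[symmetric]) simp
  finally show ?thesis by simp
qed

lemma integral_cell_const: "k < N \<Longrightarrow> (LINT t|time_measure T. charc k t * c) = \<tau> * c"
  using integral_cell[of k "\<lambda>_. c"] \<tau>_pos Suc_node[of k] by simp

text \<open>The mean one half of the interpolation weight is what produces midpoints in the discrete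
  equation.\<close>

lemma integral_cell_linear: "k < N \<Longrightarrow> (LINT t|time_measure T. charc k t * ((t - real k * \<tau>) / \<tau>)) = \<tau> / 2"
proof -
  assume k: "k < N"
  have "((\<lambda>t. (t - real k * \<tau>) / \<tau>) has_integral
      ((real (Suc k) * \<tau> - real k * \<tau>)\<^sup>2 / (2 * \<tau>) - (real k * \<tau> - real k * \<tau>)\<^sup>2 / (2 * \<tau>))) {real k * \<tau>..real (Suc k) * \<tau>}"
  proof (rule fundamental_theorem_of_calculus)
    show "real k * \<tau> \<le> real (Suc k) * \<tau>" using \<tau>_pos by simp
    show "((\<lambda>t. (t - real k * \<tau>)\<^sup>2 / (2 * \<tau>)) has_vector_derivative (t - real k * \<tau>) / \<tau>)
        (at t within {real k * \<tau>..real (Suc k) * \<tau>})" for t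
      unfolding has_real_derivative_iff_has_vector_derivative[symmetric]
      using \<tau>_pos by (auto intro!: derivative_eq_intros simp: field_simps)
  qed
  then have "integral {real k * \<tau>..real (Suc k) * \<tau>} (\<lambda>t. (t - real k * \<tau>) / \<tau>) =
      (real (Suc k) * \<tau> - real k * \<tau>)\<^sup>2 / (2 * \<tau>) - (real k * \<tau> - real k * \<tau>)\<^sup>2 / (2 * \<tau>)"
    by (rule integral_unique)
  also have "\<dots> = \<tau> / 2" using \<tau>_pos by (simp add: Suc_node power2_eq_square del: of_nat_Suc)
  finally show ?thesis
    using \<tau>_pos k by (subst integral_cell) (auto intro!: continuous_intros)
qed

lemma integral_sum_cells:
  fixes f :: "real \<Rightarrow> real"
  assumes f: "integrable (time_measure T) f"
  shows "(LINT t|time_measure T. f t) = (\<Sum>k<N. LINT t|time_measure T. charc k t * f t)"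
proof -
  have "(\<Sum>k<N. LINT t|time_measure T. charc k t * f t) = (LINT t|time_measure T. (\<Sum>k<N. charc k t * f t))"
    by (rule Bochner_Integration.integral_sum[symmetric]) (rule integrable_cell_mult[OF f])
  also have "\<dots> = (LINT t|time_measure T. f t)"
  proof (rule integral_cong_AE)
    show "AE t in time_measure T. (\<Sum>k<N. charc k t * f t) = f t"
      using AE_cell
    proof eventually_elim
      case (elim t)
      have "(\<Sum>k<N. charc k t * f t) = (\<Sum>k<N. if k = idx t then f t else 0)"
        using elim idx_cell by (intro sum.cong) (auto simp: indicator_def)
      then show ?case using elim by simp
    qed
    show "(\<lambda>t. \<Sum>k<N. charc k t * f t) \<in> borel_measurable (time_measure T)"
      by (intro borel_measurable_sum borel_measurable_times cell_measurable borel_measurable_integrable[OF f])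
    show "f \<in> borel_measurable (time_measure T)" by (rule borel_measurable_integrable[OF f])
  qed
  finally show ?thesis by simp
qed

lemma idx_finitely_valued: "finitely_valued T (\<lambda>t. a (idx t))"
  by (rule finitely_valued_comp[OF interval_index_finitely_valued(1)[OF \<tau>_def N_pos T_pos]])

lemma integrable_idx: "integrable (time_measure T) (\<lambda>t. a (idx t) :: real)"
proof -
  obtain B where "\<And>t. t \<in> {0<..<T} \<Longrightarrow> \<bar>a (idx t)\<bar> \<le> B"
    using finitely_valued_bounded[OF idx_finitely_valued, of a] by blast
  then show ?thesis
    by (intro integrable_bounded_lebesgue_on[of _ _ B] finitely_valued_borel idx_finitely_valued) auto
qed

lemma integral_idx: "(LINT t|time_measure T. a (idx t)) = \<tau> * (\<Sum>k<N. a k)"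
proof -
  have "(LINT t|time_measure T. charc k t * a (idx t)) = \<tau> * a k" if "k < N" for k
  proof -
    have "(LINT t|time_measure T. charc k t * a (idx t)) = (LINT t|time_measure T. charc k t * a k)"
      using idx_cell by (intro Bochner_Integration.integral_cong) (auto simp: indicator_def)
    then show ?thesis using integral_cell_const[OF that] by simp
  qed
  then show ?thesis using integral_sum_cells[OF integrable_idx, of a] by (simp add: sum_distrib_left)
qed

text \<open>The indicator is its own square, so it may be paired with its product with
  \<open>f\<close>; its norm is the root of the cell length.\<close>

lemma cell_Cauchy_Schwarz:
  fixes f :: "real \<Rightarrow> real"
  assumes f: "f \<in> L2_space {0<..<T}" and k: "k < N"
  shows "\<bar>LINT t|time_measure T. charc k t * f t\<bar> \<le> sqrt \<tau> * sqrt (LINT t|time_measure T. charc k t * (f t)\<^sup>2)"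
proof -
  have sq: "charc k t * charc k t = charc k t" for t by (simp add: indicator_def)
  have n1: "L2_norm {0<..<T} (charc k) = sqrt \<tau>"
    using integral_cell_const[OF k, of 1] by (simp add: L2_norm_def L2_inner_def sq)
  have sq2: "(charc k t * f t) * (charc k t * f t) = charc k t * (f t)\<^sup>2" for t
    by (simp add: indicator_def power2_eq_square)
  have n2: "L2_norm {0<..<T} (\<lambda>t. charc k t * f t) = sqrt (LINT t|time_measure T. charc k t * (f t)\<^sup>2)"
    unfolding L2_norm_def L2_inner_def inner_real_def by (simp only: sq2)
  have sq3: "charc k t * (charc k t * f t) = charc k t * f t" for t by (simp add: indicator_def)
  have "L2_inner {0<..<T} (charc k) (\<lambda>t. charc k t * f t) = (LINT t|time_measure T. charc k t * f t)"
    unfolding L2_inner_def inner_real_def by (simp only: sq3)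
  then show ?thesis using L2_Cauchy_Schwarz[OF cell_L2 cell_mult_L2[OF f], of k k] n1 n2 by simp
qed

text \<open>One formula for all cells, the cell of \<open>t\<close> being looked up through
  \<open>idx\<close>. Nodal values are functions of space, so this is a curve.\<close>

definition interp :: "(nat \<Rightarrow> 'b \<Rightarrow> real) \<Rightarrow> real \<Rightarrow> 'b \<Rightarrow> real" where
  "interp e t x = e (idx t) x + (t - real (idx t) * \<tau>) / \<tau> * (e (Suc (idx t)) x - e (idx t) x)"

lemma weight_bounds:
  assumes "t \<in> {0<..<T}"
  shows "0 \<le> (t - real (idx t) * \<tau>) / \<tau>" "(t - real (idx t) * \<tau>) / \<tau> \<le> 1"
  using idx_bounds[OF assms] \<tau>_pos by (auto simp: Suc_node divide_le_eq simp del: of_nat_Suc)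

lemma W1_h_interp:
  assumes \<phi>: "\<phi> \<in> W1_h T N" and t: "t \<in> {0<..<T}"
  shows "\<phi> t = \<phi> (real (idx t) * \<tau>) + (t - real (idx t) * \<tau>) / \<tau> * (\<phi> (real (Suc (idx t)) * \<tau>) - \<phi> (real (idx t) * \<tau>))"
proof -
  have "t \<in> {real (idx t) * \<tau>..real (Suc (idx t)) * \<tau>}"
    using idx_bounds[OF t] by (simp del: of_nat_Suc)
  from W1_h_linear[OF \<phi> \<tau>_def N_pos T_pos idx_less[OF t] this] show ?thesis
    by (simp del: of_nat_Suc)
qed

end

text \<open>The interpolant is a sum over the cells of tensors of nodal values with the two linear
  weights. The cell is selected by \<open>idx t = k\<close> instead of \<open>charc k\<close>, so
  that the formula holds at the nodes too.\<close>

lemma (in seminormed) bochner_interp: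
  assumes grid: "time_grid T M" and e: "\<And>k. k \<le> M \<Longrightarrow> e k \<in> V"
  shows "time_grid.interp T M e \<in> bochner_L2 T V N"
proof -
  interpret G: time_grid T M by (rule grid)
  let ?\<theta> = "\<lambda>t. (t - real (G.idx t) * G.\<tau>) / G.\<tau>"
  let ?in = "\<lambda>k t. if G.idx t = k then 1 else (0::real)"
  have \<theta>: "?\<theta> \<in> borel_measurable (time_measure T)"
  proof -
    have "(\<lambda>t. real (G.idx t)) \<in> borel_measurable (time_measure T)"
      by (rule finitely_valued_borel[OF G.idx_finitely_valued])
    moreover have "(\<lambda>t. t) \<in> borel_measurable (time_measure T)"
      by (rule continuous_imp_measurable_on_sets_lebesgue) auto
    ultimately show ?thesis by simp
  qed
  have inm: "?in k \<in> borel_measurable (time_measure T)" for k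
    by (rule finitely_valued_borel[OF G.idx_finitely_valued[of "\<lambda>j. if j = k then 1 else 0"]])
  have 1: "slice (tensor (e k) (\<lambda>t. ?in k t * (1 - ?\<theta> t))) \<in> bochner_L2 T V N" if "k < M" for k
  proof (rule bochner_tensor[where B=1])
    show "\<bar>?in k t * (1 - ?\<theta> t)\<bar> \<le> 1" if "t \<in> {0<..<T}" for t using G.weight_bounds[OF that] by auto
    show "(\<lambda>t. ?in k t * (1 - ?\<theta> t)) \<in> borel_measurable (time_measure T)"
      by (intro borel_measurable_times borel_measurable_diff borel_measurable_const \<theta> inm)
  qed (use e that in auto)
  have 2: "slice (tensor (e (Suc k)) (\<lambda>t. ?in k t * ?\<theta> t)) \<in> bochner_L2 T V N" if "k < M" for k
  proof (rule bochner_tensor[where B=1])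
    show "\<bar>?in k t * ?\<theta> t\<bar> \<le> 1" if "t \<in> {0<..<T}" for t using G.weight_bounds[OF that] by auto
    show "(\<lambda>t. ?in k t * ?\<theta> t) \<in> borel_measurable (time_measure T)"
      by (rule borel_measurable_times[OF inm \<theta>])
  qed (use e that in auto)
  have "(\<lambda>t x. \<Sum>k<M. slice (tensor (e k) (\<lambda>t. ?in k t * (1 - ?\<theta> t))) t x + slice (tensor (e (Suc k)) (\<lambda>t. ?in k t * ?\<theta> t)) t x) \<in> bochner_L2 T V N"
    using 1 2 by (intro bochner_sum bochner_add) auto
  then show ?thesis
  proof (rule bochner_cong)
    fix t assume t: "t \<in> {0<..<T}"
    have key: "(\<Sum>k<M. e k x * (?in k t * (1 - s)) + e (Suc k) x * (?in k t * s))
        = e (G.idx t) x + s * (e (Suc (G.idx t)) x - e (G.idx t) x)" for x s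
    proof -
      have "(\<Sum>k<M. e k x * (?in k t * (1 - s)) + e (Suc k) x * (?in k t * s))
          = (\<Sum>k<M. if k = G.idx t then e k x * (1 - s) + e (Suc k) x * s else 0)"
        by (intro sum.cong) auto
      also have "\<dots> = e (G.idx t) x * (1 - s) + e (Suc (G.idx t)) x * s"
        using G.idx_less[OF t] by simp
      finally show ?thesis by (simp add: algebra_simps)
    qed
    show "(\<lambda>x. \<Sum>k<M. slice (tensor (e k) (\<lambda>t. ?in k t * (1 - ?\<theta> t))) t x
        + slice (tensor (e (Suc k)) (\<lambda>t. ?in k t * ?\<theta> t)) t x) = G.interp e t"
      by (rule ext) (simp only: slice_def tensor_def G.interp_def prod.case key)
  qed
qed

section \<open>The error analysis\<close>

text \<open>Nothing is assumed about the measurability of \<open>B\<close>, since the inner integral of the Slobodeckii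
  double integral is not known to be measurable.\<close>

lemma integral_le_nn_integral:
  fixes f a :: "'b \<Rightarrow> real"
  assumes f: "integrable M f" and a: "integrable M a" and c: "0 < c"
    and fin: "(\<integral>\<^sup>+x. B x \<partial>M) < \<infinity>" and le: "AE x in M. ennreal ((f x - a x) / c) \<le> B x"
  shows "(LINT x|M. f x) \<le> (LINT x|M. a x) + c * enn2real (\<integral>\<^sup>+x. B x \<partial>M)"
proof -
  \<comment> \<open>\<open>ennreal\<close> sends negative numbers to 0, so the positive part is the
    quantity that can be compared with \<open>B\<close>.\<close>
  let ?J = "LINT x|M. max ((f x - a x) / c) 0"
  have int: "integrable M (\<lambda>x. (f x - a x) / c)" using f a by simp
  then have intm: "integrable M (\<lambda>x. max ((f x - a x) / c) 0)" by (intro integrable_max) auto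
  have "ennreal ?J = (\<integral>\<^sup>+x. ennreal (max ((f x - a x) / c) 0) \<partial>M)"
    by (rule nn_integral_eq_integral[symmetric, OF intm]) auto
  also have "\<dots> \<le> (\<integral>\<^sup>+x. B x \<partial>M)"
    by (rule nn_integral_mono_AE) (use le in \<open>eventually_elim, simp add: max_def ennreal_neg\<close>)
  finally have "enn2real (ennreal ?J) \<le> enn2real (\<integral>\<^sup>+x. B x \<partial>M)"
    using fin by (intro enn2real_mono) (auto simp: top_ennreal_def)
  moreover have "0 \<le> ?J" by (rule Bochner_Integration.integral_nonneg) simp
  ultimately have "?J \<le> enn2real (\<integral>\<^sup>+x. B x \<partial>M)" by simp
  moreover have "(LINT x|M. (f x - a x) / c) \<le> ?J" using int intm by (intro integral_mono) auto
  ultimately have "(LINT x|M. (f x - a x) / c) \<le> enn2real (\<integral>\<^sup>+x. B x \<partial>M)" by linarith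
  moreover have "(LINT x|M. (f x - a x) / c) = ((LINT x|M. f x) - (LINT x|M. a x)) / c" using f a by simp
  ultimately show ?thesis using c by (simp add: divide_le_eq algebra_simps)
qed

text \<open>The curve \<open>w\<close> is the representative of \<open>u\<close> in \<open>C([0,T]; L\<^sup>2)\<close>; \<open>\<delta>\<close> and \<open>d\<close> are the time derivative of
  \<open>u\<close> as a square integrable function and as a curve in \<open>H\<^sup>-\<^sup>1\<close>; \<open>U k\<close> is the value of the discrete
  solution at the node \<open>t\<^sub>k\<close>, and \<open>orth\<close> is the Galerkin orthogonality on the k-th time cell.\<close>

locale galerkin = cylinder \<Omega> T + time_grid T N
  for \<Omega> :: "'a::euclidean_space set" and T :: real and N :: nat +
  fixes \<T> :: "'a set set" and hx c\<^sub>I c\<^sub>Q c\<^sub>1 c\<^sub>2 \<kappa> :: real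
    and u \<delta> :: "'a \<times> real \<Rightarrow> real" and w :: "real \<Rightarrow> 'a \<Rightarrow> real"
    and d :: "real \<Rightarrow> ('a \<Rightarrow> real) \<Rightarrow> real" and U :: "nat \<Rightarrow> 'a \<Rightarrow> real"
  assumes mesh: "admissible_mesh \<Omega> \<T>" and hx: "0 < hx"
    and const: "0 \<le> c\<^sub>I" "0 < c\<^sub>Q" "0 \<le> c\<^sub>1" "0 \<le> c\<^sub>2" "0 \<le> \<kappa>" and step: "\<tau> \<le> \<kappa> * hx\<^sup>2"
    and inverse_ineq: "\<And>v. v \<in> V_h \<Omega> \<T> \<Longrightarrow> H10_norm \<Omega> v \<le> c\<^sub>I / hx * L2_norm \<Omega> v"
    and stable: "\<And>v. v \<in> H10_space \<Omega> \<Longrightarrow> H10_norm \<Omega> (L2_proj \<Omega> (V_h \<Omega> \<T>) v) \<le> c\<^sub>Q * H10_norm \<Omega> v"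
    and approx1: "\<And>v. v \<in> H10_space \<Omega> \<Longrightarrow>
      L2_norm \<Omega> (\<lambda>x. v x - L2_proj \<Omega> (V_h \<Omega> \<T>) v x) \<le> c\<^sub>1 * hx * H10_norm \<Omega> v"
    and approx2: "\<And>v. v \<in> H10_space \<Omega> \<Longrightarrow> v \<in> H2_space \<Omega> \<Longrightarrow>
      H10_norm \<Omega> (\<lambda>x. v x - L2_proj \<Omega> (V_h \<Omega> \<T>) v x) \<le> c\<^sub>2 * hx * H2_norm \<Omega> v"
    and uB: "slice u \<in> bochner_L2 T (H10_space \<Omega>) (H10_norm \<Omega>)"
    and u_H2: "AE t in time_measure T. slice u t \<in> H2_space \<Omega>"
    and u_H2_int: "integrable (time_measure T) (\<lambda>t. (H2_norm \<Omega> (slice u t))\<^sup>2)"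
    and \<delta>B: "slice \<delta> \<in> bochner_L2 T (L2_space \<Omega>) (L2_norm \<Omega>)"
    and w_L2: "\<And>t. t \<in> {0..T} \<Longrightarrow> w t \<in> L2_space \<Omega>"
    and w_u: "AE t in time_measure T. L2_norm \<Omega> (\<lambda>x. slice u t x - w t x) = 0"
    and w_prim: "\<And>t v. t \<in> {0..T} \<Longrightarrow> v \<in> L2_space \<Omega> \<Longrightarrow>
      L2_inner \<Omega> (w t) v = (LINT s|time_measure T. L2_inner \<Omega> (slice \<delta> s) v * indicator {0<..<t} s)"
    and dB: "d \<in> bochner_L2 T (Hm1_space \<Omega>) (Hm1_norm \<Omega>)"
    and d_eq: "AE t in time_measure T. \<forall>v\<in>H10_space \<Omega>. d t v = L2_inner \<Omega> (slice \<delta> t) v"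
    and slob: "slobodeckii_half_Hm1 \<Omega> T d < \<infinity>"
    and U_V: "\<And>k. k \<le> N \<Longrightarrow> U k \<in> V_h \<Omega> \<T>" and U_0: "U 0 = (\<lambda>_. 0)"
    and orth: "\<And>k v. k < N \<Longrightarrow> v \<in> V_h \<Omega> \<T> \<Longrightarrow>
      (LINT t|time_measure T. charc k t * L2_inner \<Omega> (slice \<delta> t) v) - L2_inner \<Omega> (\<lambda>x. U (Suc k) x - U k x) v
      + (LINT t|time_measure T. charc k t * dirichlet (\<lambda>x. slice u t x - interp U t x) v) = 0"
begin

section \<open>Discrete functions and their interpolants in time\<close>

abbreviation V where "V \<equiv> V_h \<Omega> \<T>"
abbreviation Q where "Q \<equiv> L2_proj \<Omega> V"

lemma V_H10: "v \<in> V \<Longrightarrow> v \<in> H10_space \<Omega>"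
  by (rule V_h_H10)

lemma V_L2: "v \<in> V \<Longrightarrow> v \<in> L2_space \<Omega>"
  by (intro H10_L2 V_H10)

lemma V_diff: "a \<in> V \<Longrightarrow> b \<in> V \<Longrightarrow> (\<lambda>x. a x - b x) \<in> V"
  using V_h_add[OF _ V_h_scale, of a \<T> b "-1"] by simp

lemma interp_V:
  assumes "\<And>k. k \<le> N \<Longrightarrow> e k \<in> V" "t \<in> {0<..<T}"
  shows "interp e t \<in> V"
  unfolding interp_def[abs_def]
  using idx_less[OF assms(2)] by (intro V_h_add V_h_scale V_diff assms(1)) auto

lemma dirichlet_interp:
  assumes "\<And>k. k \<le> N \<Longrightarrow> e k \<in> V" "t \<in> {0<..<T}" "v \<in> V"
  shows "dirichlet (interp e t) v = dirichlet (e (idx t)) v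
    + (t - real (idx t) * \<tau>) / \<tau> * (dirichlet (e (Suc (idx t))) v - dirichlet (e (idx t)) v)"
proof -
  have e: "e (idx t) \<in> H10_space \<Omega>" "e (Suc (idx t)) \<in> H10_space \<Omega>"
    using assms(1) idx_less[OF assms(2)] by (auto intro: V_H10)
  note v = V_H10[OF assms(3)]
  note H = H10_H1[OF e(1)] H10_H1[OF H10.diff_mem[OF e(2,1)]] H10_H1[OF v]
  show ?thesis
    unfolding interp_def[abs_def]
    by (simp only: dirichlet_add_left[OF H(1) H1_scale[OF H(2)] H(3)] dirichlet_scale_left[OF H(2,3)]
        dirichlet_diff_left[OF e(2,1) v])
qed

lemma L2_interp:
  assumes "\<And>k. k \<le> N \<Longrightarrow> e k \<in> V" "t \<in> {0<..<T}" "v \<in> V"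
  shows "L2_inner \<Omega> (interp e t) v = L2_inner \<Omega> (e (idx t)) v
    + (t - real (idx t) * \<tau>) / \<tau> * (L2_inner \<Omega> (e (Suc (idx t))) v - L2_inner \<Omega> (e (idx t)) v)"
proof -
  have e: "e (idx t) \<in> L2_space \<Omega>" "e (Suc (idx t)) \<in> L2_space \<Omega>"
    using assms(1) idx_less[OF assms(2)] by (auto intro: V_L2)
  note v = V_L2[OF assms(3)]
  show ?thesis
    unfolding interp_def[abs_def]
    by (simp only: L2_inner_add_left[OF e(1) L2_space_scale[OF L2_space_diff[OF e(2,1)]] v] L2_inner_mult_left
        L2_inner_diff_left[OF e(2,1) v])
qed

lemma interp_H10: "(\<And>k. k \<le> N \<Longrightarrow> e k \<in> V) \<Longrightarrow> interp e \<in> bochner_L2 T (H10_space \<Omega>) (H10_norm \<Omega>)"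
  using H10.bochner_interp[OF time_grid_axioms] V_H10 by blast

section \<open>Nodal values of the projected solution\<close>

lemma \<delta>_integrable: "v \<in> L2_space \<Omega> \<Longrightarrow> integrable (time_measure T) (\<lambda>s. L2_inner \<Omega> (slice \<delta> s) v)"
  by (rule L2_inner_bochner(2)[OF \<delta>B L2.bochner_const])

text \<open>The case \<open>k = 0\<close> avoids projecting a function of norm zero, whose
  projection is again a choice; with it the discrete error vanishes identically at the first
  node.\<close>

definition z :: "nat \<Rightarrow> 'a \<Rightarrow> real" where
  "z k = (if k = 0 then (\<lambda>_. 0) else Q (w (real k * \<tau>)))"

lemma z_V: "k \<le> N \<Longrightarrow> z k \<in> V"
  using V_h_zero L2_proj_V_h(1)[OF mesh w_L2[OF node_mem]] by (simp add: z_def)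

lemma z_inner:
  assumes "k \<le> N" "v \<in> V"
  shows "L2_inner \<Omega> (z k) v = (LINT s|time_measure T. L2_inner \<Omega> (slice \<delta> s) v * indicator {0<..<real k * \<tau>} s)"
proof (cases "k = 0")
  case True
  then show ?thesis by (simp add: z_def)
next
  case False
  then show ?thesis
    using L2_proj_V_h(2)[OF mesh w_L2[OF node_mem[OF assms(1)]] assms(2)] w_prim[OF node_mem[OF assms(1)] V_L2[OF assms(2)]]
    by (simp add: z_def)
qed

lemma integrable_mult_indicator_interval:
  fixes f :: "real \<Rightarrow> real"
  assumes "integrable (time_measure T) f"
  shows "integrable (time_measure T) (\<lambda>s. f s * indicator {0<..<a} s)"
proof (rule Bochner_Integration.integrable_bound[OF assms])
  show "(\<lambda>s. f s * indicator {0<..<a} s) \<in> borel_measurable (time_measure T)"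
    by (intro borel_measurable_times borel_measurable_integrable[OF assms] indicator_measurable_lebesgue_on) simp
  show "AE s in time_measure T. norm (f s * indicator {0<..<a} s) \<le> norm (f s)"
    by (intro AE_I2) (simp add: indicator_def)
qed

text \<open>Tested with \<open>v\<close> in \<open>V\<close> the projection is invisible, so the
  increment of \<open>z\<close> is the integral of the derivative over the cell. This is the
  commutation of projection and time derivative, and it cancels the derivative term in
  \<open>orth\<close>.\<close>

lemma z_diff:
  assumes k: "k < N" and v: "v \<in> V"
  shows "L2_inner \<Omega> (\<lambda>x. z (Suc k) x - z k x) v = (LINT s|time_measure T. charc k s * L2_inner \<Omega> (slice \<delta> s) v)"
proof -
  let ?f = "\<lambda>s. L2_inner \<Omega> (slice \<delta> s) v"
  note f = \<delta>_integrable[OF V_L2[OF v]]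
  have "L2_inner \<Omega> (\<lambda>x. z (Suc k) x - z k x) v = L2_inner \<Omega> (z (Suc k)) v - L2_inner \<Omega> (z k) v"
    using k by (intro L2_inner_diff_left V_L2 z_V v) auto
  also have "\<dots> = (LINT s|time_measure T. ?f s * indicator {0<..<real (Suc k) * \<tau>} s - ?f s * indicator {0<..<real k * \<tau>} s)"
    using k z_inner[OF _ v, of k] z_inner[OF _ v, of "Suc k"]
      Bochner_Integration.integral_diff[OF integrable_mult_indicator_interval[OF f] integrable_mult_indicator_interval[OF f]]
    by (simp del: of_nat_Suc)
  also have "\<dots> = (LINT s|time_measure T. charc k s * ?f s)"
  proof (rule integral_cong_AE)
    show "AE s in time_measure T. ?f s * indicator {0<..<real (Suc k) * \<tau>} s - ?f s * indicator {0<..<real k * \<tau>} s = charc k s * ?f s"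
      using AE_not_node AE_time
    proof eventually_elim
      case (elim s)
      have "s \<noteq> real k * \<tau>" using elim(1) k by auto
      moreover have "real k * \<tau> < real (Suc k) * \<tau>" using \<tau>_pos by simp
      ultimately show ?case using elim(2) by (auto simp: indicator_def cell_def simp del: of_nat_Suc)
    qed
  qed (use borel_measurable_integrable[OF integrable_cell_mult[OF f]]
      borel_measurable_integrable[OF integrable_mult_indicator_interval[OF f]] in \<open>auto intro!: borel_measurable_diff simp del: of_nat_Suc\<close>)
  finally show ?thesis .
qed

section \<open>Splitting of the error and the Crank-Nicolson scheme\<close>

definition E :: "nat \<Rightarrow> 'a \<Rightarrow> real" where "E k = (\<lambda>x. U k x - z k x)"
definition Mid :: "nat \<Rightarrow> 'a \<Rightarrow> real" where "Mid k = (\<lambda>x. 1 / 2 * (E k x + E (Suc k) x))"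
definition Dif :: "nat \<Rightarrow> 'a \<Rightarrow> real" where "Dif k = (\<lambda>x. E (Suc k) x - E k x)"
definition err :: "real \<Rightarrow> 'a \<Rightarrow> real" where "err t = (\<lambda>x. slice u t x - interp z t x)"
text \<open>The gradient norm of the projection and interpolation error over the k-th cell; it
  bounds the right-hand side of the scheme.\<close>

definition \<rho> :: "nat \<Rightarrow> real" where "\<rho> k = sqrt (LINT t|time_measure T. charc k t * (H10_norm \<Omega> (err t))\<^sup>2)"

lemma E_V: "k \<le> N \<Longrightarrow> E k \<in> V"
  unfolding E_def by (intro V_diff U_V z_V)

lemma Mid_V: "k < N \<Longrightarrow> Mid k \<in> V"
  unfolding Mid_def by (intro V_h_scale V_h_add E_V) auto

lemma Dif_V: "k < N \<Longrightarrow> Dif k \<in> V"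
  unfolding Dif_def by (intro V_diff E_V) auto

lemma errB: "err \<in> bochner_L2 T (H10_space \<Omega>) (H10_norm \<Omega>)"
  unfolding err_def[abs_def] by (intro H10.bochner_diff uB interp_H10 z_V)

lemma interp_split: "slice u t x - interp U t x = err t x - interp E t x"
proof -
  have "e - (a + r * (b - a)) = (e - (p + r * (q - p))) - ((a - p) + r * ((b - q) - (a - p)))" for a b e p q r :: real
    by (simp add: algebra_simps)
  then show ?thesis unfolding err_def interp_def E_def .
qed

lemma \<rho>_nonneg: "0 \<le> \<rho> k"
  by (simp add: \<rho>_def)

lemma \<rho>_power2: "(\<rho> k)\<^sup>2 = (LINT t|time_measure T. charc k t * (H10_norm \<Omega> (err t))\<^sup>2)"
  by (simp add: \<rho>_def indicator_def)

lemma sum_\<rho>: "(\<Sum>k<N. (\<rho> k)\<^sup>2) = (LINT t|time_measure T. (H10_norm \<Omega> (err t))\<^sup>2)"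
  unfolding \<rho>_power2 using errB by (intro integral_sum_cells[symmetric]) (simp add: bochner_L2_def)

definition residual :: "nat \<Rightarrow> ('a \<Rightarrow> real) \<Rightarrow> real" where
  "residual k v = (LINT t|time_measure T. charc k t * dirichlet (err t) v)"

lemma err_integrable: "v \<in> H10_space \<Omega> \<Longrightarrow> integrable (time_measure T) (\<lambda>t. dirichlet (err t) v)"
  by (rule dirichlet_bochner(1)[OF errB H10.bochner_const])

lemma residual_bound:
  assumes k: "k < N" and v: "v \<in> H10_space \<Omega>"
  shows "\<bar>residual k v\<bar> \<le> sqrt \<tau> * \<rho> k * H10_norm \<Omega> v"
proof -
  let ?n = "\<lambda>t. H10_norm \<Omega> (err t)"
  have nL: "?n \<in> L2_space {0<..<T}" by (rule H10.bochner_N_L2[OF errB])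
  have n_int: "integrable (time_measure T) (\<lambda>t. charc k t * ?n t)"
    using L2_inner_integrable[OF cell_L2 nL] by simp
  have "\<bar>residual k v\<bar> \<le> (LINT t|time_measure T. \<bar>charc k t * dirichlet (err t) v\<bar>)"
    unfolding residual_def by (rule integral_abs_bound)
  also have "\<dots> \<le> (LINT t|time_measure T. charc k t * ?n t * H10_norm \<Omega> v)"
  proof (rule integral_mono_AE)
    show "integrable (time_measure T) (\<lambda>t. \<bar>charc k t * dirichlet (err t) v\<bar>)"
      by (intro integrable_abs integrable_cell_mult err_integrable v)
    show "integrable (time_measure T) (\<lambda>t. charc k t * ?n t * H10_norm \<Omega> v)" using n_int by simp
    show "AE t in time_measure T. \<bar>charc k t * dirichlet (err t) v\<bar> \<le> charc k t * ?n t * H10_norm \<Omega> v"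
      using bochner_L2_AE[OF errB]
    proof eventually_elim
      case (elim t)
      show ?case using dirichlet_bound[OF H10_H1[OF elim] H10_H1[OF v]] by (simp add: indicator_def)
    qed
  qed
  also have "\<dots> = (LINT t|time_measure T. charc k t * ?n t) * H10_norm \<Omega> v" by simp
  also have "\<dots> \<le> (sqrt \<tau> * \<rho> k) * H10_norm \<Omega> v"
    using cell_Cauchy_Schwarz[OF nL k] H10.N_nonneg[OF v] by (intro mult_right_mono) (auto simp: \<rho>_def)
  finally show ?thesis .
qed

text \<open>Subtracting the increment of \<open>z\<close> from \<open>orth\<close> removes the
  derivative of the solution. The remaining Dirichlet term splits by \<open>interp_split\<close>,
  and averaging the linear interpolant of \<open>E\<close> over the cell leaves the
  midpoint.\<close>

lemma discrete_equation:
  assumes k: "k < N" and v: "v \<in> V"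
  shows "L2_inner \<Omega> (Dif k) v + \<tau> * dirichlet (Mid k) v = residual k v"
proof -
  note vH = V_H10[OF v]
  have kN: "k \<le> N" "Suc k \<le> N" using k by auto
  let ?a = "dirichlet (E k) v" and ?b = "dirichlet (E (Suc k)) v"
  have "(LINT t|time_measure T. charc k t * dirichlet (\<lambda>x. slice u t x - interp U t x) v)
      = (LINT t|time_measure T. charc k t * dirichlet (err t) v - charc k t * dirichlet (interp E t) v)"
  proof (rule integral_cong_AE)
    have "(\<lambda>t x. slice u t x - interp U t x) \<in> bochner_L2 T (H10_space \<Omega>) (H10_norm \<Omega>)"
      by (intro H10.bochner_diff uB interp_H10 U_V)
    from dirichlet_bochner(1)[OF this H10.bochner_const[OF vH]]
    show "(\<lambda>t. charc k t * dirichlet (\<lambda>x. slice u t x - interp U t x) v) \<in> borel_measurable (time_measure T)"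
      by (intro borel_measurable_times cell_measurable borel_measurable_integrable)
    show "(\<lambda>t. charc k t * dirichlet (err t) v - charc k t * dirichlet (interp E t) v) \<in> borel_measurable (time_measure T)"
      by (intro borel_measurable_diff borel_measurable_times cell_measurable borel_measurable_integrable err_integrable vH
          dirichlet_bochner(1)[OF interp_H10[OF E_V] H10.bochner_const])
    show "AE t in time_measure T. charc k t * dirichlet (\<lambda>x. slice u t x - interp U t x) v
        = charc k t * dirichlet (err t) v - charc k t * dirichlet (interp E t) v"
      using bochner_L2_AE[OF errB] AE_time
    proof eventually_elim
      case (elim t)
      have "interp E t \<in> H10_space \<Omega>" by (rule V_H10[OF interp_V[OF E_V elim(2)]])
      then have "dirichlet (\<lambda>x. err t x - interp E t x) v = dirichlet (err t) v - dirichlet (interp E t) v"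
        by (rule dirichlet_diff_left[OF elim(1) _ vH])
      then show ?case by (simp add: interp_split right_diff_distrib)
    qed
  qed
  also have "\<dots> = residual k v - (LINT t|time_measure T. charc k t * dirichlet (interp E t) v)"
    unfolding residual_def
    by (intro Bochner_Integration.integral_diff integrable_cell_mult err_integrable vH
        dirichlet_bochner(1)[OF interp_H10[OF E_V] H10.bochner_const])
  also have "(LINT t|time_measure T. charc k t * dirichlet (interp E t) v)
      = (LINT t|time_measure T. charc k t * ?a + charc k t * ((t - real k * \<tau>) / \<tau>) * (?b - ?a))"
  proof (rule Bochner_Integration.integral_cong)
    fix t assume "t \<in> space (time_measure T)"
    then have t: "t \<in> {0<..<T}" by simp
    show "charc k t * dirichlet (interp E t) v = charc k t * ?a + charc k t * ((t - real k * \<tau>) / \<tau>) * (?b - ?a)"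
    proof (cases "t \<in> cell k")
      case True
      then show ?thesis using dirichlet_interp[OF E_V t v] idx_cell[OF True] by simp
    qed simp
  qed simp
  \<comment> \<open>The weight of the increment integrates to \<open>\<tau> / 2\<close> by
    \<open>integral_cell_linear\<close>.\<close>
  also have "\<dots> = \<tau> * ?a + \<tau> / 2 * (?b - ?a)"
  proof -
    have i1: "integrable (time_measure T) (\<lambda>t. charc k t * ?a)"
      by (intro integrable_cell_mult integrable_bounded_lebesgue_on[where B="\<bar>?a\<bar>"]) auto
    have i2: "integrable (time_measure T) (\<lambda>t. charc k t * ((t - real k * \<tau>) / \<tau>))"
    proof (rule integrable_bounded_lebesgue_on[where B=1])
      have "(\<lambda>t. (t - real k * \<tau>) / \<tau>) \<in> borel_measurable (time_measure T)"
        using \<tau>_pos by (intro continuous_imp_measurable_on_sets_lebesgue continuous_intros) auto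
      then show "(\<lambda>t. charc k t * ((t - real k * \<tau>) / \<tau>)) \<in> borel_measurable (time_measure T)"
        by (intro borel_measurable_times cell_measurable)
      show "\<bar>charc k t * ((t - real k * \<tau>) / \<tau>)\<bar> \<le> 1" if "t \<in> {0<..<T}" for t
        using weight_bounds[OF that] idx_cell[of t k] by (cases "t \<in> cell k") auto
    qed simp
    show ?thesis
      unfolding Bochner_Integration.integral_add[OF i1 integrable_mult_left[OF i2]] integral_cell_const[OF k]
      unfolding integral_mult_left_zero integral_cell_linear[OF k] ..
  qed
  also have "\<tau> * ?a + \<tau> / 2 * (?b - ?a) = \<tau> * dirichlet (Mid k) v"
  proof -
    note e = H10_H1[OF V_H10[OF E_V[OF kN(1)]]] H10_H1[OF V_H10[OF E_V[OF kN(2)]]] H10_H1[OF vH]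
    have "dirichlet (Mid k) v = 1 / 2 * (?a + ?b)"
      unfolding Mid_def by (simp only: dirichlet_scale_left[OF H1_add[OF e(1,2)] e(3)] dirichlet_add_left[OF e])
    then show ?thesis by (simp add: algebra_simps)
  qed
  finally have B: "(LINT t|time_measure T. charc k t * dirichlet (\<lambda>x. slice u t x - interp U t x) v)
      = residual k v - \<tau> * dirichlet (Mid k) v" .
  have "L2_inner \<Omega> (Dif k) v = L2_inner \<Omega> (\<lambda>x. (U (Suc k) x - U k x) - (z (Suc k) x - z k x)) v"
    by (simp add: Dif_def E_def algebra_simps)
  also have "\<dots> = L2_inner \<Omega> (\<lambda>x. U (Suc k) x - U k x) v - L2_inner \<Omega> (\<lambda>x. z (Suc k) x - z k x) v"
    using kN by (intro L2_inner_diff_left V_L2 V_diff U_V z_V v)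
  finally show ?thesis using orth[OF k v] z_diff[OF k v] B by simp
qed

section \<open>Stability of the scheme\<close>

definition m :: "nat \<Rightarrow> real" where "m k = H10_norm \<Omega> (Mid k)"
definition g :: "nat \<Rightarrow> real" where "g k = H10_norm \<Omega> (Dif k)"

lemma m_nonneg: "0 \<le> m k" and g_nonneg: "0 \<le> g k"
  by (simp_all add: m_def g_def H10_norm_def)

text \<open>With the test function \<open>Mid k\<close> the increment term is half the difference of
  the squared norms at the two nodes. These differences telescope, the sum starts at zero, and the
  last square may be dropped.\<close>

lemma energy_estimate: "\<tau> * (\<Sum>k<N. (m k)\<^sup>2) \<le> (\<Sum>k<N. (\<rho> k)\<^sup>2)"
proof -
  let ?e = "\<lambda>k. (L2_norm \<Omega> (E k))\<^sup>2"
  have "(?e (Suc k) - ?e k) + \<tau> * (m k)\<^sup>2 \<le> (\<rho> k)\<^sup>2" if k: "k < N" for k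
  proof -
    have kN: "k \<le> N" "Suc k \<le> N" using k by auto
    note e = V_L2[OF E_V[OF kN(1)]] V_L2[OF E_V[OF kN(2)]]
    have "L2_inner \<Omega> (Dif k) (Mid k) = 1 / 2 * L2_inner \<Omega> (Dif k) (\<lambda>x. E k x + E (Suc k) x)"
      unfolding Mid_def by (rule L2_inner_mult_right)
    also have "L2_inner \<Omega> (Dif k) (\<lambda>x. E k x + E (Suc k) x) = ?e (Suc k) - ?e k"
      unfolding Dif_def L2_norm_power2
      using L2_inner_diff_left[OF e(2,1) L2_space_add[OF e]] L2_inner_add_right[OF e e(1)] L2_inner_add_right[OF e e(2)]
        L2_inner_commute[of \<Omega> "E k" "E (Suc k)"] by simp
    finally have "L2_inner \<Omega> (Dif k) (Mid k) = 1 / 2 * (?e (Suc k) - ?e k)" .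
    moreover have "(m k)\<^sup>2 = dirichlet (Mid k) (Mid k)" by (simp add: m_def H10_norm_power2)
    ultimately have eq: "1 / 2 * (?e (Suc k) - ?e k) + \<tau> * (m k)\<^sup>2 = residual k (Mid k)"
      using discrete_equation[OF k Mid_V[OF k]] by (simp only:)
    have "residual k (Mid k) \<le> sqrt \<tau> * \<rho> k * m k"
      using residual_bound[OF k V_H10[OF Mid_V[OF k]]] by (simp add: m_def)
    \<comment> \<open>Young's inequality, weighted so that half of
      \<open>\<tau> * (m k)\<^sup>2\<close> can be absorbed on the left.\<close>
    also have "\<dots> \<le> ((\<rho> k)\<^sup>2 + \<tau> * (m k)\<^sup>2) / 2"
      using sum_squares_bound[of "\<rho> k" "sqrt \<tau> * m k"] \<tau>_pos by (simp add: power_mult_distrib mult_ac)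
    finally have "residual k (Mid k) \<le> ((\<rho> k)\<^sup>2 + \<tau> * (m k)\<^sup>2) / 2" .
    moreover have "d + t \<le> r" if "1 / 2 * d + t = q" "q \<le> (r + t) / 2" for d t r q :: real
      using that by (simp add: field_simps)
    ultimately show ?thesis using eq by blast
  qed
  then have "(\<Sum>k<N. (?e (Suc k) - ?e k) + \<tau> * (m k)\<^sup>2) \<le> (\<Sum>k<N. (\<rho> k)\<^sup>2)" by (intro sum_mono) auto
  moreover have "(\<Sum>k<N. ?e (Suc k) - ?e k) = ?e N - ?e 0" by (rule sum_lessThan_telescope)
  moreover have "?e 0 = 0" by (simp add: E_def U_0 z_def)
  ultimately have "?e N + \<tau> * (\<Sum>k<N. (m k)\<^sup>2) \<le> (\<Sum>k<N. (\<rho> k)\<^sup>2)" by (simp add: sum.distrib sum_distrib_left)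
  then show ?thesis using zero_le_power2[of "L2_norm \<Omega> (E N)"] by linarith
qed

text \<open>Testing with the increment gives \<open>?n\<^sup>2 \<le> ?s * g k\<close>. The inverse
  inequality enters twice: once to replace \<open>g k\<close> here, which leaves a bound for
  \<open>?n\<close> after cancellation, and once to return from \<open>?n\<close> to
  \<open>g k\<close>.\<close>

lemma difference_estimate:
  assumes k: "k < N"
  shows "\<tau> * (g k)\<^sup>2 \<le> 2 * c\<^sub>I ^ 4 * \<kappa>\<^sup>2 * ((\<rho> k)\<^sup>2 + \<tau> * (m k)\<^sup>2)"
proof -
  let ?n = "L2_norm \<Omega> (Dif k)" and ?s = "sqrt \<tau> * \<rho> k + \<tau> * m k"
  have s: "0 \<le> ?s" using \<rho>_nonneg m_nonneg \<tau>_pos by simp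
  note D = Dif_V[OF k] and M = Mid_V[OF k]
  have inv: "g k \<le> c\<^sub>I / hx * ?n" unfolding g_def by (rule inverse_ineq[OF D])
  have "?n\<^sup>2 = residual k (Dif k) - \<tau> * dirichlet (Mid k) (Dif k)"
    using discrete_equation[OF k D] by (simp add: L2_norm_power2)
  also have "\<dots> \<le> sqrt \<tau> * \<rho> k * g k + \<tau> * (m k * g k)"
  proof -
    have "\<tau> * \<bar>dirichlet (Mid k) (Dif k)\<bar> \<le> \<tau> * (m k * g k)"
      unfolding m_def g_def using \<tau>_pos by (intro mult_left_mono dirichlet_bound H10_H1 V_H10 D M) auto
    moreover have "\<tau> * dirichlet (Mid k) (Dif k) \<ge> - (\<tau> * \<bar>dirichlet (Mid k) (Dif k)\<bar>)"
      using \<tau>_pos mult_left_mono[of "- \<bar>dirichlet (Mid k) (Dif k)\<bar>" "dirichlet (Mid k) (Dif k)" \<tau>] by simp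
    moreover have "residual k (Dif k) \<le> sqrt \<tau> * \<rho> k * g k"
      using residual_bound[OF k V_H10[OF D]] by (simp add: g_def)
    ultimately show ?thesis by linarith
  qed
  also have "\<dots> = ?s * g k" by (simp add: algebra_simps)
  also have "\<dots> \<le> ?s * (c\<^sub>I / hx * ?n)" by (rule mult_left_mono[OF inv s])
  finally have "?n * ?n \<le> (?s * (c\<^sub>I / hx)) * ?n" by (simp add: power2_eq_square mult_ac)
  then have n: "?n \<le> ?s * (c\<^sub>I / hx)"
  proof (cases "?n = 0")
    case True
    then show ?thesis using s const(1) hx by simp
  next
    case False
    then have "0 < ?n" using L2_norm_nonneg[of \<Omega> "Dif k"] by linarith
    then show ?thesis by (rule mult_right_le_imp_le[OF \<open>?n * ?n \<le> _\<close>])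
  qed
  have "g k \<le> c\<^sub>I / hx * (?s * (c\<^sub>I / hx))"
    using inv mult_left_mono[OF n, of "c\<^sub>I / hx"] const(1) hx by simp
  then have g: "g k \<le> (c\<^sub>I / hx)\<^sup>2 * ?s" by (simp add: power2_eq_square mult_ac)
  have s2: "?s\<^sup>2 \<le> 2 * \<tau> * ((\<rho> k)\<^sup>2 + \<tau> * (m k)\<^sup>2)"
  proof -
    have "?s\<^sup>2 \<le> 2 * (sqrt \<tau> * \<rho> k)\<^sup>2 + 2 * (\<tau> * m k)\<^sup>2"
      using sum_squares_bound[of "sqrt \<tau> * \<rho> k" "\<tau> * m k"] by (simp add: power2_sum)
    also have "\<dots> = 2 * \<tau> * ((\<rho> k)\<^sup>2 + \<tau> * (m k)\<^sup>2)"
      using \<tau>_pos by (simp add: power_mult_distrib power2_eq_square algebra_simps)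
    finally show ?thesis .
  qed
  have "\<tau> * (g k)\<^sup>2 \<le> \<tau> * ((c\<^sub>I / hx)\<^sup>2 * ?s)\<^sup>2"
    using power_mono[OF g g_nonneg, of 2] \<tau>_pos by (intro mult_left_mono) auto
  also have "\<dots> = \<tau> * (c\<^sub>I / hx) ^ 4 * ?s\<^sup>2" by (simp add: power_mult_distrib flip: power_mult)
  also have "\<dots> \<le> \<tau> * (c\<^sub>I / hx) ^ 4 * (2 * \<tau> * ((\<rho> k)\<^sup>2 + \<tau> * (m k)\<^sup>2))"
    using s2 \<tau>_pos const(1) hx by (intro mult_left_mono) auto
  \<comment> \<open>The two factors \<tau>, one from the claim and one from the bound for
    \<open>?s\<close>, match the fourth power of \<open>hx\<close> in the denominator.\<close>
  also have "\<dots> = 2 * c\<^sub>I ^ 4 * (\<tau> / hx\<^sup>2)\<^sup>2 * ((\<rho> k)\<^sup>2 + \<tau> * (m k)\<^sup>2)"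
    by (simp add: power_divide power2_eq_square power4_eq_xxxx field_simps)
  also have "\<dots> \<le> 2 * c\<^sub>I ^ 4 * \<kappa>\<^sup>2 * ((\<rho> k)\<^sup>2 + \<tau> * (m k)\<^sup>2)"
  proof -
    have "\<tau> / hx\<^sup>2 \<le> \<kappa>" using step hx by (simp add: divide_le_eq)
    then have "(\<tau> / hx\<^sup>2)\<^sup>2 \<le> \<kappa>\<^sup>2" using \<tau>_pos by (intro power_mono) auto
    then show ?thesis using \<tau>_pos const(1) by (intro mult_right_mono mult_left_mono) auto
  qed
  finally show ?thesis .
qed

text \<open>Expanded about the midpoint, the interpolant is \<open>Mid\<close> plus a multiple of
  \<open>Dif\<close> whose coefficient is at most 1/2 in absolute value.\<close>

lemma interp_E_bound:
  assumes t: "t \<in> {0<..<T}"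
  shows "(H10_norm \<Omega> (interp E t))\<^sup>2 \<le> 2 * (m (idx t))\<^sup>2 + 1 / 2 * (g (idx t))\<^sup>2"
proof -
  let ?k = "idx t" and ?\<theta> = "(t - real (idx t) * \<tau>) / \<tau>"
  have k: "?k < N" by (rule idx_less[OF t])
  have "a + r * (b - a) = 1 / 2 * (a + b) + (r - 1 / 2) * (b - a)" for a b r :: real
    by (simp add: field_simps)
  then have "interp E t = (\<lambda>x. Mid ?k x + (?\<theta> - 1 / 2) * Dif ?k x)"
    unfolding interp_def[abs_def] Mid_def Dif_def by (rule ext)
  then have "H10_norm \<Omega> (interp E t) \<le> m ?k + \<bar>?\<theta> - 1 / 2\<bar> * g ?k"
    using H10.N_triangle[OF V_H10[OF Mid_V[OF k]] H10.scale_mem[OF V_H10[OF Dif_V[OF k]], of "?\<theta> - 1 / 2"]]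
      H10.N_scale[OF V_H10[OF Dif_V[OF k]], of "?\<theta> - 1 / 2"] by (simp add: m_def g_def)
  also have "\<dots> \<le> m ?k + 1 / 2 * g ?k"
  proof -
    have "\<bar>r - 1 / 2\<bar> \<le> 1 / 2" if "0 \<le> r" "r \<le> 1" for r :: real
      using that by linarith
    from this[OF weight_bounds[OF t]] show ?thesis by (intro add_left_mono mult_right_mono g_nonneg)
  qed
  finally have "(H10_norm \<Omega> (interp E t))\<^sup>2 \<le> (m ?k + 1 / 2 * g ?k)\<^sup>2"
    by (rule power_mono) (simp add: H10_norm_def)
  also have "\<dots> \<le> 2 * (m ?k)\<^sup>2 + 1 / 2 * (g ?k)\<^sup>2"
    using sum_squares_bound[of "m ?k" "1 / 2 * g ?k"] by (simp add: power2_eq_square algebra_simps)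
  finally show ?thesis .
qed

text \<open>The midpoints contribute the factor 2 directly by \<open>energy_estimate\<close>. The
  increments contribute half of \<open>difference_estimate\<close>, whose midpoint term is bounded
  by \<open>energy_estimate\<close> once more.\<close>

lemma stability:
  "(LINT t|time_measure T. (H10_norm \<Omega> (interp E t))\<^sup>2) \<le> (2 + 2 * c\<^sub>I ^ 4 * \<kappa>\<^sup>2) * (\<Sum>k<N. (\<rho> k)\<^sup>2)"
proof -
  let ?R = "\<Sum>k<N. (\<rho> k)\<^sup>2"
  have "(LINT t|time_measure T. (H10_norm \<Omega> (interp E t))\<^sup>2)
      \<le> (LINT t|time_measure T. (\<lambda>k. 2 * (m k)\<^sup>2 + 1 / 2 * (g k)\<^sup>2) (idx t))"
  proof (rule integral_mono_AE)
    show "integrable (time_measure T) (\<lambda>t. (H10_norm \<Omega> (interp E t))\<^sup>2)"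
      using interp_H10[OF E_V] by (simp add: bochner_L2_def)
    show "AE t in time_measure T. (H10_norm \<Omega> (interp E t))\<^sup>2 \<le> (\<lambda>k. 2 * (m k)\<^sup>2 + 1 / 2 * (g k)\<^sup>2) (idx t)"
      using AE_time by eventually_elim (rule interp_E_bound)
  qed (rule integrable_idx)
  also have "\<dots> = \<tau> * (\<Sum>k<N. 2 * (m k)\<^sup>2 + 1 / 2 * (g k)\<^sup>2)" by (rule integral_idx)
  also have "\<dots> = 2 * (\<tau> * (\<Sum>k<N. (m k)\<^sup>2)) + 1 / 2 * (\<Sum>k<N. \<tau> * (g k)\<^sup>2)"
    by (simp add: sum.distrib sum_distrib_left algebra_simps)
  also have "\<dots> \<le> 2 * ?R + 1 / 2 * (\<Sum>k<N. 2 * c\<^sub>I ^ 4 * \<kappa>\<^sup>2 * ((\<rho> k)\<^sup>2 + \<tau> * (m k)\<^sup>2))"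
    using energy_estimate by (intro add_mono mult_left_mono sum_mono difference_estimate) auto
  also have "\<dots> = 2 * ?R + c\<^sub>I ^ 4 * \<kappa>\<^sup>2 * (?R + \<tau> * (\<Sum>k<N. (m k)\<^sup>2))"
    by (simp add: sum.distrib sum_distrib_left algebra_simps)
  also have "\<dots> \<le> 2 * ?R + c\<^sub>I ^ 4 * \<kappa>\<^sup>2 * (?R + ?R)"
    using energy_estimate const by (intro add_left_mono mult_left_mono) auto
  finally show ?thesis by (simp add: algebra_simps)
qed

section \<open>Projection and interpolation error\<close>

definition \<delta>n :: "nat \<Rightarrow> real" where
  "\<delta>n k = sqrt (LINT t|time_measure T. charc k t * (L2_norm \<Omega> (slice \<delta> t))\<^sup>2)"

lemma \<delta>n_power2: "(\<delta>n k)\<^sup>2 = (LINT t|time_measure T. charc k t * (L2_norm \<Omega> (slice \<delta> t))\<^sup>2)"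
  by (simp add: \<delta>n_def indicator_def)

lemma \<delta>_sq_integrable: "integrable (time_measure T) (\<lambda>t. (L2_norm \<Omega> (slice \<delta> t))\<^sup>2)"
  using \<delta>B by (simp add: bochner_L2_def)

lemma sum_\<delta>n: "(\<Sum>k<N. (\<delta>n k)\<^sup>2) = (LINT t|time_measure T. (L2_norm \<Omega> (slice \<delta> t))\<^sup>2)"
  unfolding \<delta>n_power2 by (rule integral_sum_cells[OF \<delta>_sq_integrable, symmetric])

text \<open>The difference \<open>p\<close> lies in \<open>V\<close>, so in its inner product with
  itself the projections drop out. What is left is the value of a primitive minus its linear
  interpolant, an integral of the time derivative over the single cell of \<open>t\<close>.\<close>

lemma projection_interpolation_error:
  assumes t: "t \<in> {0<..<T}" and ut: "slice u t \<in> H10_space \<Omega>" and wt: "L2_norm \<Omega> (\<lambda>x. slice u t x - w t x) = 0"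
  shows "L2_norm \<Omega> (\<lambda>x. Q (slice u t) x - interp z t x) \<le> sqrt \<tau> * \<delta>n (idx t)"
proof -
  let ?k = "idx t" and ?\<theta> = "(t - real (idx t) * \<tau>) / \<tau>"
  define p where "p = (\<lambda>x. Q (slice u t) x - interp z t x)"
  have k: "?k < N" by (rule idx_less[OF t])
  note uL = H10_L2[OF ut]
  have QV: "Q (slice u t) \<in> V" by (rule L2_proj_V_h(1)[OF mesh uL])
  have iV: "interp z t \<in> V" by (rule interp_V[OF z_V t])
  have pV: "p \<in> V" unfolding p_def by (rule V_diff[OF QV iV])
  note pL = V_L2[OF pV]
  have wL: "w t \<in> L2_space \<Omega>" using t by (intro w_L2) auto
  let ?f = "\<lambda>s. L2_inner \<Omega> (slice \<delta> s) p" and ?I = "\<lambda>a s. indicat_real {0<..<a} s"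
  note fint = \<delta>_integrable[OF pL]
  note fI = integrable_mult_indicator_interval[OF fint]
  \<comment> \<open>The Peano kernel of linear interpolation: on the cell it equals
    \<open>1 - ?\<theta>\<close> before \<open>t\<close> and \<open>- ?\<theta>\<close> afterwards,
    and off the closed cell it vanishes. Hence it is bounded by the indicator of the cell, up to
    nodes.\<close>
  let ?\<phi> = "\<lambda>s. ?I t s - (?I (real ?k * \<tau>) s + ?\<theta> * (?I (real (Suc ?k) * \<tau>) s - ?I (real ?k * \<tau>) s))"
  have "(L2_norm \<Omega> p)\<^sup>2 = L2_inner \<Omega> (Q (slice u t)) p - L2_inner \<Omega> (interp z t) p"
    unfolding L2_norm_power2 using L2_inner_diff_left[OF V_L2[OF QV] V_L2[OF iV] pL] by (simp add: p_def)
  also have "L2_inner \<Omega> (Q (slice u t)) p = L2_inner \<Omega> (slice u t) p" by (rule L2_proj_V_h(2)[OF mesh uL pV])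
  also have "\<dots> = L2_inner \<Omega> (w t) p"
    using L2_Cauchy_Schwarz[OF L2_space_diff[OF uL wL] pL] L2_inner_diff_left[OF uL wL pL] wt by simp
  also have "\<dots> = (LINT s|time_measure T. ?f s * ?I t s)" using t by (intro w_prim pL) auto
  also have "L2_inner \<Omega> (interp z t) p = (LINT s|time_measure T. ?f s * ?I (real ?k * \<tau>) s)
      + ?\<theta> * ((LINT s|time_measure T. ?f s * ?I (real (Suc ?k) * \<tau>) s) - (LINT s|time_measure T. ?f s * ?I (real ?k * \<tau>) s))"
    using k by (simp only: L2_interp[OF z_V t pV] z_inner[OF less_imp_le[OF k] pV] z_inner[OF Suc_leI[OF k] pV])
  also have "(LINT s|time_measure T. ?f s * ?I t s) - \<dots> = (LINT s|time_measure T. ?f s * ?I t s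
      - (?f s * ?I (real ?k * \<tau>) s + ?\<theta> * (?f s * ?I (real (Suc ?k) * \<tau>) s - ?f s * ?I (real ?k * \<tau>) s)))"
    using fI by (simp del: of_nat_Suc)
  also have "\<dots> \<le> (LINT s|time_measure T. charc ?k s * L2_norm \<Omega> (slice \<delta> s) * L2_norm \<Omega> p)"
  proof (rule integral_mono_AE)
    show "integrable (time_measure T) (\<lambda>s. ?f s * ?I t s
      - (?f s * ?I (real ?k * \<tau>) s + ?\<theta> * (?f s * ?I (real (Suc ?k) * \<tau>) s - ?f s * ?I (real ?k * \<tau>) s)))"
      using fI by (simp del: of_nat_Suc)
    show "integrable (time_measure T) (\<lambda>s. charc ?k s * L2_norm \<Omega> (slice \<delta> s) * L2_norm \<Omega> p)"
      using L2_inner_integrable[OF cell_L2 L2.bochner_N_L2[OF \<delta>B]] by simp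
    show "AE s in time_measure T. ?f s * ?I t s
      - (?f s * ?I (real ?k * \<tau>) s + ?\<theta> * (?f s * ?I (real (Suc ?k) * \<tau>) s - ?f s * ?I (real ?k * \<tau>) s))
      \<le> charc ?k s * L2_norm \<Omega> (slice \<delta> s) * L2_norm \<Omega> p"
      using AE_not_node AE_time bochner_L2_AE[OF \<delta>B]
    proof eventually_elim
      case (elim s)
      have ne: "s \<noteq> real ?k * \<tau>" using elim(1) k by auto
      have less: "real ?k * \<tau> < real (Suc ?k) * \<tau>" using \<tau>_pos by simp
      have bd: "\<bar>?\<phi> s\<bar> \<le> charc ?k s"
        using weight_bounds[OF t] idx_bounds[OF t] elim(2) ne less
        by (auto simp: indicator_def cell_def simp del: of_nat_Suc)
      have "?f s * ?I t s - (?f s * ?I (real ?k * \<tau>) s + ?\<theta> * (?f s * ?I (real (Suc ?k) * \<tau>) s - ?f s * ?I (real ?k * \<tau>) s)) = ?f s * ?\<phi> s"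
        by (simp only: right_diff_distrib distrib_left mult.left_commute)
      also have "\<dots> \<le> \<bar>?f s\<bar> * \<bar>?\<phi> s\<bar>" using abs_ge_self[of "?f s * ?\<phi> s"] by (simp only: abs_mult)
      also have "\<dots> \<le> (L2_norm \<Omega> (slice \<delta> s) * L2_norm \<Omega> p) * charc ?k s"
        by (rule mult_mono[OF L2_Cauchy_Schwarz[OF elim(3) pL] bd]) simp_all
      finally show ?case by (simp add: mult_ac)
    qed
  qed
  also have "\<dots> = (LINT s|time_measure T. charc ?k s * L2_norm \<Omega> (slice \<delta> s)) * L2_norm \<Omega> p" by simp
  also have "\<dots> \<le> (sqrt \<tau> * \<delta>n ?k) * L2_norm \<Omega> p"
    using cell_Cauchy_Schwarz[OF L2.bochner_N_L2[OF \<delta>B] k] by (intro mult_right_mono) (auto simp: \<delta>n_def)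
  finally have fin: "L2_norm \<Omega> p * L2_norm \<Omega> p \<le> (sqrt \<tau> * \<delta>n ?k) * L2_norm \<Omega> p" by (simp add: power2_eq_square)
  have "0 \<le> \<delta>n ?k" by (simp add: \<delta>n_def)
  have "L2_norm \<Omega> p \<le> sqrt \<tau> * \<delta>n ?k"
  proof (cases "L2_norm \<Omega> p = 0")
    case True
    then show ?thesis using \<open>0 \<le> \<delta>n ?k\<close> \<tau>_pos by simp
  next
    case False
    then have "0 < L2_norm \<Omega> p" using L2_norm_nonneg[of \<Omega> p] by linarith
    then show ?thesis by (rule mult_right_le_imp_le[OF fin])
  qed
  then show ?thesis by (simp add: p_def)
qed

abbreviation normA where "normA \<equiv> LINT t|time_measure T. (H2_norm \<Omega> (slice u t))\<^sup>2"
abbreviation normB where "normB \<equiv> LINT t|time_measure T. (L2_norm \<Omega> (slice \<delta> t))\<^sup>2"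
abbreviation normS where "normS \<equiv> enn2real (slobodeckii_half_Hm1 \<Omega> T d)"
abbreviation normR where "normR \<equiv> \<Sum>k<N. (\<rho> k)\<^sup>2"

text \<open>The error is split at the projection of \<open>u\<close> at the same time. The first
  part is \<open>approx2\<close>; the second lies in \<open>V\<close>, where the inverse inequality
  turns the root of \<tau> into a quotient by \<open>hx\<close>. After integration this leaves the
  square of \<open>\<tau> / hx\<close>, which is at most that of
  \<open>\<kappa> * hx\<close>.\<close>

lemma normR_bound: "normR \<le> (2 * c\<^sub>2\<^sup>2 * normA + 2 * c\<^sub>I\<^sup>2 * \<kappa>\<^sup>2 * normB) * hx\<^sup>2"
proof -
  have le: "AE t in time_measure T. (H10_norm \<Omega> (err t))\<^sup>2
      \<le> 2 * (c\<^sub>2 * hx)\<^sup>2 * (H2_norm \<Omega> (slice u t))\<^sup>2 + (\<lambda>k. 2 * (c\<^sub>I / hx)\<^sup>2 * \<tau> * (\<delta>n k)\<^sup>2) (idx t)"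
    using bochner_L2_AE[OF uB] u_H2 w_u AE_time
  proof eventually_elim
    case (elim t)
    let ?q = "\<lambda>x. Q (slice u t) x - interp z t x"
    have QV: "Q (slice u t) \<in> V" by (rule L2_proj_V_h(1)[OF mesh H10_L2[OF elim(1)]])
    have iV: "interp z t \<in> V" by (rule interp_V[OF z_V elim(4)])
    have "H10_norm \<Omega> (err t) \<le> H10_norm \<Omega> (\<lambda>x. slice u t x - Q (slice u t) x) + H10_norm \<Omega> ?q"
      unfolding err_def by (rule H10.N_diff_triangle[OF elim(1) V_H10[OF QV] V_H10[OF iV]])
    also have "\<dots> \<le> c\<^sub>2 * hx * H2_norm \<Omega> (slice u t) + c\<^sub>I / hx * (sqrt \<tau> * \<delta>n (idx t))"
    proof (rule add_mono)
      show "H10_norm \<Omega> (\<lambda>x. slice u t x - Q (slice u t) x) \<le> c\<^sub>2 * hx * H2_norm \<Omega> (slice u t)"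
        by (rule approx2[OF elim(1,2)])
      have "H10_norm \<Omega> ?q \<le> c\<^sub>I / hx * L2_norm \<Omega> ?q" by (rule inverse_ineq[OF V_diff[OF QV iV]])
      also have "\<dots> \<le> c\<^sub>I / hx * (sqrt \<tau> * \<delta>n (idx t))"
        using const(1) hx by (intro mult_left_mono projection_interpolation_error elim) auto
      finally show "H10_norm \<Omega> ?q \<le> c\<^sub>I / hx * (sqrt \<tau> * \<delta>n (idx t))" .
    qed
    finally have "(H10_norm \<Omega> (err t))\<^sup>2 \<le> (c\<^sub>2 * hx * H2_norm \<Omega> (slice u t) + c\<^sub>I / hx * (sqrt \<tau> * \<delta>n (idx t)))\<^sup>2"
      by (rule power_mono) (simp add: H10_norm_def)
    also have "\<dots> \<le> 2 * (c\<^sub>2 * hx * H2_norm \<Omega> (slice u t))\<^sup>2 + 2 * (c\<^sub>I / hx * (sqrt \<tau> * \<delta>n (idx t)))\<^sup>2"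
      using sum_squares_bound[of "c\<^sub>2 * hx * H2_norm \<Omega> (slice u t)" "c\<^sub>I / hx * (sqrt \<tau> * \<delta>n (idx t))"]
      by (simp only: power2_sum)
    also have "\<dots> = 2 * (c\<^sub>2 * hx)\<^sup>2 * (H2_norm \<Omega> (slice u t))\<^sup>2 + 2 * (c\<^sub>I / hx)\<^sup>2 * \<tau> * (\<delta>n (idx t))\<^sup>2"
      by (simp only: power_mult_distrib real_sqrt_pow2[OF less_imp_le[OF \<tau>_pos]] mult.assoc)
    finally show ?case .
  qed
  have "normR = (LINT t|time_measure T. (H10_norm \<Omega> (err t))\<^sup>2)" by (rule sum_\<rho>)
  also have "\<dots> \<le> (LINT t|time_measure T. 2 * (c\<^sub>2 * hx)\<^sup>2 * (H2_norm \<Omega> (slice u t))\<^sup>2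
      + (\<lambda>k. 2 * (c\<^sub>I / hx)\<^sup>2 * \<tau> * (\<delta>n k)\<^sup>2) (idx t))"
    using errB u_H2_int le integrable_idx[of "\<lambda>k. 2 * (c\<^sub>I / hx)\<^sup>2 * \<tau> * (\<delta>n k)\<^sup>2"]
    by (intro integral_mono_AE) (auto simp: bochner_L2_def)
  also have "\<dots> = 2 * (c\<^sub>2 * hx)\<^sup>2 * normA + \<tau> * (\<Sum>k<N. 2 * (c\<^sub>I / hx)\<^sup>2 * \<tau> * (\<delta>n k)\<^sup>2)"
    using u_H2_int integrable_idx[of "\<lambda>k. 2 * (c\<^sub>I / hx)\<^sup>2 * \<tau> * (\<delta>n k)\<^sup>2"]
      integral_idx[of "\<lambda>k. 2 * (c\<^sub>I / hx)\<^sup>2 * \<tau> * (\<delta>n k)\<^sup>2"] by simp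
  also have "\<tau> * (\<Sum>k<N. 2 * (c\<^sub>I / hx)\<^sup>2 * \<tau> * (\<delta>n k)\<^sup>2) = 2 * c\<^sub>I\<^sup>2 * (\<tau> / hx)\<^sup>2 * normB"
    unfolding sum_\<delta>n[symmetric] by (simp add: sum_distrib_left sum_divide_distrib power_divide power2_eq_square mult_ac)
  also have "\<dots> \<le> 2 * c\<^sub>I\<^sup>2 * (\<kappa> * hx)\<^sup>2 * normB"
  proof -
    have "\<tau> / hx \<le> \<kappa> * hx" using step hx by (simp add: divide_le_eq power2_eq_square mult.assoc)
    then have "(\<tau> / hx)\<^sup>2 \<le> (\<kappa> * hx)\<^sup>2" using \<tau>_pos hx by (intro power_mono) auto
    then show ?thesis by (intro mult_right_mono mult_left_mono Bochner_Integration.integral_nonneg) auto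
  qed
  finally show ?thesis by (simp add: power_mult_distrib algebra_simps)
qed

text \<open>The outer factors 2 come from squaring a sum of two norms; the inner bracket is the
  constant of \<open>stability\<close>.\<close>

lemma energy_error:
  "(bochner_norm T (H10_norm \<Omega>) (\<lambda>t x. slice u t x - interp U t x))\<^sup>2
    \<le> (2 + 2 * (2 + 2 * c\<^sub>I ^ 4 * \<kappa>\<^sup>2)) * normR"
proof -
  have iB: "interp E \<in> bochner_L2 T (H10_space \<Omega>) (H10_norm \<Omega>)" by (rule interp_H10[OF E_V])
  have eq: "(\<lambda>t x. slice u t x - interp U t x) = (\<lambda>t x. err t x - interp E t x)" by (intro ext) (rule interp_split)
  have B: "(\<lambda>t x. err t x - interp E t x) \<in> bochner_L2 T (H10_space \<Omega>) (H10_norm \<Omega>)"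
    by (rule H10.bochner_diff[OF errB iB])
  have "(bochner_norm T (H10_norm \<Omega>) (\<lambda>t x. slice u t x - interp U t x))\<^sup>2
      = (LINT t|time_measure T. (H10_norm \<Omega> (\<lambda>x. err t x - interp E t x))\<^sup>2)"
    unfolding eq by (simp add: bochner_norm_def)
  also have "\<dots> \<le> (LINT t|time_measure T. 2 * (H10_norm \<Omega> (err t))\<^sup>2 + 2 * (H10_norm \<Omega> (interp E t))\<^sup>2)"
  proof (rule integral_mono_AE)
    show "AE t in time_measure T. (H10_norm \<Omega> (\<lambda>x. err t x - interp E t x))\<^sup>2
        \<le> 2 * (H10_norm \<Omega> (err t))\<^sup>2 + 2 * (H10_norm \<Omega> (interp E t))\<^sup>2"
      using bochner_L2_AE[OF errB] bochner_L2_AE[OF iB]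
    proof eventually_elim
      case (elim t)
      have "(H10_norm \<Omega> (\<lambda>x. err t x - interp E t x))\<^sup>2 \<le> (H10_norm \<Omega> (err t) + H10_norm \<Omega> (interp E t))\<^sup>2"
        by (rule power_mono[OF H10.N_diff[OF elim] H10.N_nonneg[OF H10.diff_mem[OF elim]]])
      also have "\<dots> \<le> 2 * (H10_norm \<Omega> (err t))\<^sup>2 + 2 * (H10_norm \<Omega> (interp E t))\<^sup>2"
        using sum_squares_bound[of "H10_norm \<Omega> (err t)" "H10_norm \<Omega> (interp E t)"] by (simp add: power2_sum)
      finally show ?case .
    qed
  qed (use B errB iB in \<open>simp_all add: bochner_L2_def\<close>)
  also have "\<dots> = 2 * normR + 2 * (LINT t|time_measure T. (H10_norm \<Omega> (interp E t))\<^sup>2)"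
    using errB iB by (simp add: bochner_L2_def sum_\<rho>)
  also have "\<dots> \<le> 2 * normR + 2 * ((2 + 2 * c\<^sub>I ^ 4 * \<kappa>\<^sup>2) * normR)" using stability by simp
  finally show ?thesis by (simp add: algebra_simps)
qed

section \<open>The time derivative in the dual norm\<close>

definition dU :: "real \<Rightarrow> 'a \<Rightarrow> real" where "dU t = (\<lambda>x. 1 / \<tau> * (U (Suc (idx t)) x - U (idx t) x))"
definition ev :: "real \<Rightarrow> 'a \<Rightarrow> real" where "ev t = (\<lambda>x. slice \<delta> t x - dU t x)"
text \<open>The mean over the cell of the distance between \<open>d t\<close> and
  \<open>d s\<close>. It bounds the distance of \<open>d t\<close> from the cell mean without
  integrating functionals, as only real integrals occur.\<close>

definition G :: "real \<Rightarrow> real" where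
  "G t = 1 / \<tau> * (LINT s|time_measure T. charc (idx t) s * Hm1_norm \<Omega> (\<lambda>v. d t v - d s v))"
definition nrm :: "real \<Rightarrow> real" where "nrm t = Hm1_norm \<Omega> (\<lambda>v. L2_inner \<Omega> (ev t) v)"

lemma dU_V: "t \<in> {0<..<T} \<Longrightarrow> dU t \<in> V"
  unfolding dU_def using idx_less[of t] by (intro V_h_scale V_diff U_V) auto

lemma evB: "ev \<in> bochner_L2 T (L2_space \<Omega>) (L2_norm \<Omega>)"
proof -
  have "simple_into T (L2_space \<Omega>) dU"
    using idx_finitely_valued[of "\<lambda>k x. 1 / \<tau> * (U (Suc k) x - U k x)"] dU_V V_L2
    by (auto simp: simple_into_iff dU_def[abs_def])
  then show ?thesis unfolding ev_def[abs_def] by (intro L2.bochner_diff \<delta>B L2.simple_into_bochner)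
qed

lemma rB: "(\<lambda>t v. L2_inner \<Omega> (ev t) v) \<in> bochner_L2 T (Hm1_space \<Omega>) (Hm1_norm \<Omega>)"
  by (rule L2_curve_Hm1[OF evB])

lemma d_diff_L2:
  assumes "d t \<in> Hm1_space \<Omega>"
  shows "(\<lambda>s. Hm1_norm \<Omega> (\<lambda>v. d t v - d s v)) \<in> L2_space {0<..<T}"
  by (rule Hm1.bochner_N_L2[OF Hm1.bochner_diff[OF Hm1.bochner_const[OF assms] dB]])

lemma G_nonneg:
  assumes "d t \<in> Hm1_space \<Omega>"
  shows "0 \<le> G t"
proof -
  have "0 \<le> (LINT s|time_measure T. charc (idx t) s * Hm1_norm \<Omega> (\<lambda>v. d t v - d s v))"
  proof (rule integral_nonneg_AE)
    show "AE s in time_measure T. 0 \<le> charc (idx t) s * Hm1_norm \<Omega> (\<lambda>v. d t v - d s v)"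
      using bochner_L2_AE[OF dB] by eventually_elim (intro mult_nonneg_nonneg Hm1.N_nonneg Hm1.diff_mem assms, auto)
  qed
  then show ?thesis using \<tau>_pos by (simp add: G_def)
qed

text \<open>A test function \<open>v\<close> is split into its projection \<open>q\<close> and the
  rest. On the rest the discrete derivative vanishes and \<open>approx1\<close> gains a factor
  \<open>hx\<close>, so no spatial smoothness of the derivative is asked for. On \<open>q\<close>
  the scheme expresses the discrete derivative, and \<open>stable\<close> returns from
  \<open>q\<close> to \<open>v\<close>.\<close>

lemma nrm_bound:
  assumes t: "t \<in> {0<..<T}" and dt: "d t \<in> Hm1_space \<Omega>" "\<And>v. v \<in> H10_space \<Omega> \<Longrightarrow> d t v = L2_inner \<Omega> (slice \<delta> t) v"
    and \<delta>t: "slice \<delta> t \<in> L2_space \<Omega>"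
  shows "nrm t \<le> c\<^sub>1 * hx * L2_norm \<Omega> (slice \<delta> t) + c\<^sub>Q * (G t + \<rho> (idx t) / sqrt \<tau> + m (idx t))"
  unfolding nrm_def
proof (rule Hm1_le)
  let ?k = "idx t"
  have k: "?k < N" by (rule idx_less[OF t])
  have kN: "?k \<le> N" "Suc ?k \<le> N" using k by auto
  show "0 \<le> c\<^sub>1 * hx * L2_norm \<Omega> (slice \<delta> t) + c\<^sub>Q * (G t + \<rho> ?k / sqrt \<tau> + m ?k)"
    using const hx \<tau>_pos G_nonneg[OF dt(1)] \<rho>_nonneg m_nonneg
    by (intro add_nonneg_nonneg mult_nonneg_nonneg divide_nonneg_nonneg) auto
  fix v assume v: "v \<in> H10_space \<Omega>"
  note vL = H10_L2[OF v]
  define q where "q = Q v"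
  have qV: "q \<in> V" unfolding q_def by (rule L2_proj_V_h(1)[OF mesh vL])
  note qL = V_L2[OF qV] and qH = V_H10[OF qV]
  have vq: "(\<lambda>x. v x - q x) \<in> L2_space \<Omega>" by (rule L2_space_diff[OF vL qL])
  define DU where "DU = (\<lambda>x. U (Suc ?k) x - U ?k x)"
  have DUV: "DU \<in> V" unfolding DU_def using kN by (intro V_diff U_V)
  note DUL = V_L2[OF DUV]
  have evt: "L2_inner \<Omega> (ev t) y = L2_inner \<Omega> (slice \<delta> t) y - 1 / \<tau> * L2_inner \<Omega> DU y" if "y \<in> L2_space \<Omega>" for y
  proof -
    have "dU t = (\<lambda>x. 1 / \<tau> * DU x)" by (simp add: dU_def DU_def)
    then show ?thesis
      unfolding ev_def using L2_inner_diff_left[OF \<delta>t L2_space_scale[OF DUL] that] by (simp only: L2_inner_mult_left)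
  qed
  \<comment> \<open>\<open>DU\<close> lies in \<open>V\<close>, to which \<open>v - q\<close> is
    orthogonal.\<close>
  have "L2_inner \<Omega> DU (\<lambda>x. v x - q x) = 0"
    using L2_inner_diff_right[OF vL qL DUL] L2_proj_V_h(2)[OF mesh vL DUV]
    by (simp add: q_def L2_inner_commute[of \<Omega> DU])
  then have part1: "L2_inner \<Omega> (ev t) (\<lambda>x. v x - q x) = L2_inner \<Omega> (slice \<delta> t) (\<lambda>x. v x - q x)"
    using evt[OF vq] by simp
  have "\<bar>L2_inner \<Omega> (slice \<delta> t) (\<lambda>x. v x - q x)\<bar> \<le> L2_norm \<Omega> (slice \<delta> t) * L2_norm \<Omega> (\<lambda>x. v x - q x)"
    by (rule L2_Cauchy_Schwarz[OF \<delta>t vq])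
  also have "\<dots> \<le> L2_norm \<Omega> (slice \<delta> t) * (c\<^sub>1 * hx * H10_norm \<Omega> v)"
    unfolding q_def by (rule mult_left_mono[OF approx1[OF v]]) simp
  finally have b1: "\<bar>L2_inner \<Omega> (slice \<delta> t) (\<lambda>x. v x - q x)\<bar> \<le> c\<^sub>1 * hx * L2_norm \<Omega> (slice \<delta> t) * H10_norm \<Omega> v"
    by (simp add: mult_ac)
  let ?f = "\<lambda>s. L2_inner \<Omega> (slice \<delta> s) q" and ?h = "\<lambda>s. Hm1_norm \<Omega> (\<lambda>v. d t v - d s v)"
  have cint: "integrable (time_measure T) (\<lambda>s. charc ?k s * ?f t)"
    by (intro integrable_cell_mult integrable_bounded_lebesgue_on[where B="\<bar>?f t\<bar>"]) auto
  note fint = integrable_cell_mult[OF \<delta>_integrable[OF qL], of ?k]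
  have hint: "integrable (time_measure T) (\<lambda>s. charc ?k s * ?h s)"
    using L2_inner_integrable[OF cell_L2 d_diff_L2[OF dt(1)]] by simp
  \<comment> \<open>By \<open>z_diff\<close> the mean of \<open>?f\<close> over the cell is the
    difference quotient of \<open>z\<close>, so \<open>J\<close> is \<tau> times the deviation of
    \<open>?f t\<close> from that mean.\<close>
  define J where "J = (LINT s|time_measure T. charc ?k s * ?f t - charc ?k s * ?f s)"
  have J_eq: "J = \<tau> * ?f t - L2_inner \<Omega> (\<lambda>x. z (Suc ?k) x - z ?k x) q"
    unfolding J_def Bochner_Integration.integral_diff[OF cint fint] integral_cell_const[OF k] z_diff[OF k qV] ..
  have "\<bar>J\<bar> \<le> (LINT s|time_measure T. \<bar>charc ?k s * ?f t - charc ?k s * ?f s\<bar>)"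
    unfolding J_def by (rule integral_abs_bound)
  also have "\<dots> \<le> (LINT s|time_measure T. charc ?k s * ?h s * H10_norm \<Omega> q)"
  proof (rule integral_mono_AE)
    show "integrable (time_measure T) (\<lambda>s. \<bar>charc ?k s * ?f t - charc ?k s * ?f s\<bar>)"
      by (intro integrable_abs Bochner_Integration.integrable_diff cint fint)
    show "integrable (time_measure T) (\<lambda>s. charc ?k s * ?h s * H10_norm \<Omega> q)"
      by (rule integrable_mult_left[OF hint])
    show "AE s in time_measure T. \<bar>charc ?k s * ?f t - charc ?k s * ?f s\<bar> \<le> charc ?k s * ?h s * H10_norm \<Omega> q"
      using bochner_L2_AE[OF dB] d_eq
    proof eventually_elim
      case (elim s)
      have "\<bar>?f t - ?f s\<bar> \<le> ?h s * H10_norm \<Omega> q"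
        using Hm1_bound[OF Hm1.diff_mem[OF dt(1) elim(1)] qH] dt(2)[OF qH] elim(2) qH by simp
      then show ?case by (simp add: indicator_def)
    qed
  qed
  also have "\<dots> = \<tau> * G t * H10_norm \<Omega> q" using \<tau>_pos by (simp add: G_def)
  finally have J_bound: "\<bar>J\<bar> \<le> \<tau> * G t * H10_norm \<Omega> q" .
  have "L2_inner \<Omega> (Dif ?k) q = L2_inner \<Omega> (\<lambda>x. DU x - (z (Suc ?k) x - z ?k x)) q"
    by (simp add: Dif_def E_def DU_def algebra_simps)
  also have "\<dots> = L2_inner \<Omega> DU q - L2_inner \<Omega> (\<lambda>x. z (Suc ?k) x - z ?k x) q"
    using kN by (intro L2_inner_diff_left DUL qL V_L2 V_diff z_V)
  finally have DUq: "L2_inner \<Omega> DU q = L2_inner \<Omega> (\<lambda>x. z (Suc ?k) x - z ?k x) q + residual ?k q - \<tau> * dirichlet (Mid ?k) q"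
    using discrete_equation[OF k qV] by simp
  \<comment> \<open>Three contributions: oscillation of the derivative within the cell, residual of
    the scheme, and gradient of the midpoint.\<close>
  have part2: "L2_inner \<Omega> (ev t) q = 1 / \<tau> * J - 1 / \<tau> * residual ?k q + dirichlet (Mid ?k) q"
    using \<tau>_pos by (simp add: evt[OF qL] J_eq DUq field_simps)
  have J1: "\<bar>1 / \<tau> * J\<bar> \<le> G t * H10_norm \<Omega> q"
    using mult_left_mono[OF J_bound, of "1 / \<tau>"] \<tau>_pos by (simp add: abs_mult)
  have R1: "\<bar>1 / \<tau> * residual ?k q\<bar> \<le> \<rho> ?k / sqrt \<tau> * H10_norm \<Omega> q"
  proof -
    have "1 / \<tau> * \<bar>residual ?k q\<bar> \<le> 1 / \<tau> * (sqrt \<tau> * \<rho> ?k * H10_norm \<Omega> q)"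
      using residual_bound[OF k qH] \<tau>_pos by (intro mult_left_mono) auto
    also have "\<dots> = (sqrt \<tau> / \<tau>) * (\<rho> ?k * H10_norm \<Omega> q)" by simp
    also have "sqrt \<tau> / \<tau> = 1 / sqrt \<tau>" using \<tau>_pos by (simp add: field_simps)
    finally show ?thesis using \<tau>_pos by (simp add: abs_mult)
  qed
  have M1: "\<bar>dirichlet (Mid ?k) q\<bar> \<le> m ?k * H10_norm \<Omega> q"
    unfolding m_def by (rule dirichlet_bound[OF H10_H1[OF V_H10[OF Mid_V[OF k]]] H10_H1[OF qH]])
  let ?S = "G t + \<rho> ?k / sqrt \<tau> + m ?k"
  have S: "0 \<le> ?S" using G_nonneg[OF dt(1)] \<rho>_nonneg m_nonneg \<tau>_pos by (intro add_nonneg_nonneg divide_nonneg_nonneg) auto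
  have "\<bar>L2_inner \<Omega> (ev t) q\<bar> \<le> ?S * H10_norm \<Omega> q"
    using part2 J1 R1 M1 unfolding distrib_right by linarith
  also have "\<dots> \<le> ?S * (c\<^sub>Q * H10_norm \<Omega> v)" unfolding q_def by (rule mult_left_mono[OF stable[OF v] S])
  finally have b2: "\<bar>L2_inner \<Omega> (ev t) q\<bar> \<le> c\<^sub>Q * ?S * H10_norm \<Omega> v" by (simp only: mult_ac)
  have evL: "ev t \<in> L2_space \<Omega>" unfolding ev_def by (rule L2_space_diff[OF \<delta>t V_L2[OF dU_V[OF t]]])
  have "L2_inner \<Omega> (ev t) v = L2_inner \<Omega> (ev t) q + L2_inner \<Omega> (ev t) (\<lambda>x. v x - q x)"
    using L2_inner_diff_right[OF vL qL evL] by simp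
  then show "\<bar>L2_inner \<Omega> (ev t) v\<bar> \<le> (c\<^sub>1 * hx * L2_norm \<Omega> (slice \<delta> t) + c\<^sub>Q * ?S) * H10_norm \<Omega> v"
    using part1 b1 b2 unfolding distrib_right[of "c\<^sub>1 * hx * L2_norm \<Omega> (slice \<delta> t)"] by linarith
qed

text \<open>Cauchy-Schwarz bounds \<open>(G t)\<^sup>2 / \<tau>\<close> by the integral of the
  squared distances over the cell divided by the square of \<tau>. Points of one cell are at most
  \<tau> apart, so replacing \<tau> by their distance only enlarges the integrand and gives the
  Slobodeckii kernel.\<close>

lemma G_bound:
  assumes t: "t \<in> cell (idx t)" "idx t < N" and dt: "d t \<in> Hm1_space \<Omega>"
  shows "ennreal ((G t)\<^sup>2 / \<tau>) \<le> (\<integral>\<^sup>+s. ennreal ((Hm1_norm \<Omega> (\<lambda>v. d t v - d s v))\<^sup>2 / (t - s)\<^sup>2) \<partial>time_measure T)"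
proof -
  let ?h = "\<lambda>s. Hm1_norm \<Omega> (\<lambda>v. d t v - d s v)" and ?k = "idx t"
  have h2: "integrable (time_measure T) (\<lambda>s. (?h s)\<^sup>2)" using d_diff_L2[OF dt] by (simp add: L2_space_def)
  note int = integrable_cell_mult[OF h2, of ?k]
  let ?L = "LINT s|time_measure T. charc ?k s * (?h s)\<^sup>2"
  have L: "0 \<le> ?L" by (rule Bochner_Integration.integral_nonneg) simp
  have "G t \<le> 1 / \<tau> * (sqrt \<tau> * sqrt ?L)"
    unfolding G_def using cell_Cauchy_Schwarz[OF d_diff_L2[OF dt] t(2)] \<tau>_pos by (intro mult_left_mono) auto
  then have "(G t)\<^sup>2 \<le> (1 / \<tau> * (sqrt \<tau> * sqrt ?L))\<^sup>2" by (rule power_mono[OF _ G_nonneg[OF dt]])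
  also have "\<dots> = ?L / \<tau>"
  proof -
    have "(1 / \<tau> * (sqrt \<tau> * sqrt x))\<^sup>2 = x / \<tau>" if "0 \<le> x" for x
      using that \<tau>_pos by (simp add: power_mult_distrib power_divide) (simp add: power2_eq_square)
    then show ?thesis using L .
  qed
  finally have "(G t)\<^sup>2 / \<tau> \<le> ?L / \<tau>\<^sup>2" using \<tau>_pos by (simp add: power2_eq_square field_simps)
  then have "ennreal ((G t)\<^sup>2 / \<tau>) \<le> ennreal (?L / \<tau>\<^sup>2)" by (rule ennreal_leI)
  also have "\<dots> = ennreal (LINT s|time_measure T. charc ?k s * (?h s)\<^sup>2 / \<tau>\<^sup>2)" by simp
  also have "\<dots> = (\<integral>\<^sup>+s. ennreal (charc ?k s * (?h s)\<^sup>2 / \<tau>\<^sup>2) \<partial>time_measure T)"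
    using int by (intro nn_integral_eq_integral[symmetric]) auto
  also have "\<dots> \<le> (\<integral>\<^sup>+s. ennreal ((?h s)\<^sup>2 / (t - s)\<^sup>2) \<partial>time_measure T)"
  proof (intro nn_integral_mono ennreal_leI)
    fix s
    show "charc ?k s * (?h s)\<^sup>2 / \<tau>\<^sup>2 \<le> (?h s)\<^sup>2 / (t - s)\<^sup>2"
    proof (cases "s \<in> cell ?k \<and> s \<noteq> t")
      case True
      have "\<bar>t - s\<bar> \<le> \<tau>" using True t(1) by (auto simp: cell_def Suc_node simp del: of_nat_Suc)
      then have "(t - s)\<^sup>2 \<le> \<tau>\<^sup>2" using power_mono[of "\<bar>t - s\<bar>" \<tau> 2] by simp
      then show ?thesis using True \<tau>_pos by (auto intro!: divide_left_mono mult_pos_pos)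
    next
      \<comment> \<open>At \<open>s = t\<close> the numerator is zero on both sides; outside the
        cell the left-hand side vanishes.\<close>
      case False
      then consider "s \<notin> cell ?k" | "s = t" by blast
      then show ?thesis
      proof cases
        case 2
        then show ?thesis using Hm1.N_zero by simp
      qed simp
    qed
  qed
  finally show ?thesis .
qed

text \<open>The square of \<open>nrm_bound\<close> is split into four squares, hence the factors 4.
  The measurability of \<open>G\<close> in time is not at hand, so its term is not integrated but
  passed to \<open>integral_le_nn_integral\<close>, while the other three form the integrable
  function \<open>?a\<close>.\<close>

lemma derivative_error:
  "(LINT t|time_measure T. (nrm t)\<^sup>2) \<le> 4 * c\<^sub>1\<^sup>2 * hx\<^sup>2 * normB + 8 * c\<^sub>Q\<^sup>2 * normR + 4 * c\<^sub>Q\<^sup>2 * \<kappa> * hx\<^sup>2 * normS"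
proof -
  let ?b = "\<lambda>k. 4 * c\<^sub>Q\<^sup>2 * ((\<rho> k)\<^sup>2 / \<tau> + (m k)\<^sup>2)"
  let ?a = "\<lambda>t. 4 * c\<^sub>1\<^sup>2 * hx\<^sup>2 * (L2_norm \<Omega> (slice \<delta> t))\<^sup>2 + ?b (idx t)"
  let ?c = "4 * c\<^sub>Q\<^sup>2 * \<tau>"
  let ?B = "\<lambda>t. \<integral>\<^sup>+s. ennreal ((Hm1_norm \<Omega> (\<lambda>v. d t v - d s v))\<^sup>2 / (t - s)\<^sup>2) \<partial>time_measure T"
  have c: "0 < ?c" using const(2) \<tau>_pos by simp
  have ni: "integrable (time_measure T) (\<lambda>t. (nrm t)\<^sup>2)" using rB by (simp add: bochner_L2_def nrm_def)
  have ai: "integrable (time_measure T) ?a"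
    by (rule Bochner_Integration.integrable_add[OF integrable_mult_right[OF \<delta>_sq_integrable] integrable_idx[of ?b]])
  have le: "AE t in time_measure T. ennreal (((nrm t)\<^sup>2 - ?a t) / ?c) \<le> ?B t"
    using AE_cell bochner_L2_AE[OF dB] d_eq bochner_L2_AE[OF \<delta>B] bochner_L2_AE[OF rB]
  proof eventually_elim
    case (elim t)
    let ?x = "c\<^sub>1 * hx * L2_norm \<Omega> (slice \<delta> t)"
    have t: "t \<in> {0<..<T}" using elim(1) by blast
    have "nrm t \<le> ?x + c\<^sub>Q * (G t + \<rho> (idx t) / sqrt \<tau> + m (idx t))"
      using elim by (intro nrm_bound t) auto
    moreover have "0 \<le> nrm t" unfolding nrm_def by (rule Hm1.N_nonneg[OF elim(5)])
    ultimately have "(nrm t)\<^sup>2 \<le> (?x + c\<^sub>Q * (G t + \<rho> (idx t) / sqrt \<tau> + m (idx t)))\<^sup>2" by (intro power_mono)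
    also have "\<dots> = (?x + c\<^sub>Q * G t + c\<^sub>Q * (\<rho> (idx t) / sqrt \<tau>) + c\<^sub>Q * m (idx t))\<^sup>2" by (simp add: distrib_left add.assoc)
    also have "\<dots> \<le> 4 * (?x\<^sup>2 + (c\<^sub>Q * G t)\<^sup>2 + (c\<^sub>Q * (\<rho> (idx t) / sqrt \<tau>))\<^sup>2 + (c\<^sub>Q * m (idx t))\<^sup>2)"
    proof -
      have "(a + b + p + r)\<^sup>2 \<le> 4 * (a\<^sup>2 + b\<^sup>2 + p\<^sup>2 + r\<^sup>2)" for a b p r :: real
        using sum_squares_bound[of a b] sum_squares_bound[of a p] sum_squares_bound[of a r]
          sum_squares_bound[of b p] sum_squares_bound[of b r] sum_squares_bound[of p r]
        by (simp add: power2_eq_square algebra_simps)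
      then show ?thesis .
    qed
    also have "\<dots> = ?a t + 4 * c\<^sub>Q\<^sup>2 * (G t)\<^sup>2"
      using \<tau>_pos by (simp add: power_mult_distrib power_divide algebra_simps)
    finally have "((nrm t)\<^sup>2 - ?a t) / ?c \<le> (4 * c\<^sub>Q\<^sup>2 * (G t)\<^sup>2) / ?c"
      using c by (intro divide_right_mono) auto
    also have "\<dots> = (G t)\<^sup>2 / \<tau>" using const(2) by simp
    finally have "ennreal (((nrm t)\<^sup>2 - ?a t) / ?c) \<le> ennreal ((G t)\<^sup>2 / \<tau>)" by (rule ennreal_leI)
    also have "\<dots> \<le> ?B t" using elim by (intro G_bound) auto
    finally show ?case .
  qed
  have "(LINT t|time_measure T. (nrm t)\<^sup>2) \<le> (LINT t|time_measure T. ?a t) + ?c * normS"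
    unfolding slobodeckii_half_Hm1_def
    by (rule integral_le_nn_integral[OF ni ai c _ le]) (use slob in \<open>simp add: slobodeckii_half_Hm1_def\<close>)
  also have "(LINT t|time_measure T. ?a t) = 4 * c\<^sub>1\<^sup>2 * hx\<^sup>2 * normB + \<tau> * (\<Sum>k<N. ?b k)"
    using Bochner_Integration.integral_add[OF integrable_mult_right[OF \<delta>_sq_integrable, of "4 * c\<^sub>1\<^sup>2 * hx\<^sup>2"] integrable_idx[of ?b]]
      integral_idx[of ?b] by simp
  \<comment> \<open>The midpoint terms are bounded by \<open>normR\<close> a second time, which
    turns the factor 4 into 8.\<close>
  also have "\<tau> * (\<Sum>k<N. ?b k) = 4 * c\<^sub>Q\<^sup>2 * (normR + \<tau> * (\<Sum>k<N. (m k)\<^sup>2))"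
    using \<tau>_pos by (simp add: sum_distrib_left sum.distrib[symmetric] algebra_simps)
  also have "\<dots> \<le> 4 * c\<^sub>Q\<^sup>2 * (normR + normR)" using energy_estimate by (intro mult_left_mono add_left_mono) auto
  also have "?c * normS \<le> 4 * c\<^sub>Q\<^sup>2 * (\<kappa> * hx\<^sup>2) * normS"
    using step by (intro mult_right_mono mult_left_mono) auto
  finally show ?thesis by (simp add: algebra_simps)
qed

section \<open>Assembly of the bound\<close>

definition err_const :: real where
  "err_const = (2 + 2 * (2 + 2 * c\<^sub>I ^ 4 * \<kappa>\<^sup>2) + 8 * c\<^sub>Q\<^sup>2) * (2 * c\<^sub>2\<^sup>2 + 2 * c\<^sub>I\<^sup>2 * \<kappa>\<^sup>2) + 4 * c\<^sub>1\<^sup>2 + 4 * c\<^sub>Q\<^sup>2 * \<kappa>"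

lemma total_error:
  "(bochner_norm T (H10_norm \<Omega>) (\<lambda>t x. slice u t x - interp U t x))\<^sup>2 + (LINT t|time_measure T. (nrm t)\<^sup>2)
    \<le> err_const * hx\<^sup>2 * (normA + normB + normS)"
proof -
  \<comment> \<open>\<open>?K\<close> is the total factor of \<open>normR\<close> in the two error
    estimates; \<open>?L\<close> is a common factor for its bound by the regularity terms.\<close>
  let ?K = "2 + 2 * (2 + 2 * c\<^sub>I ^ 4 * \<kappa>\<^sup>2) + 8 * c\<^sub>Q\<^sup>2" and ?L = "2 * c\<^sub>2\<^sup>2 + 2 * c\<^sub>I\<^sup>2 * \<kappa>\<^sup>2"
  have A: "0 \<le> normA" and B: "0 \<le> normB" by (auto intro!: Bochner_Integration.integral_nonneg)
  have S: "0 \<le> normS" by simp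
  let ?F = "normA + normB + normS"
  have K: "0 \<le> ?K" using const by (intro add_nonneg_nonneg mult_nonneg_nonneg) auto
  have "2 * c\<^sub>2\<^sup>2 * normA + 2 * c\<^sub>I\<^sup>2 * \<kappa>\<^sup>2 * normB \<le> 2 * c\<^sub>2\<^sup>2 * ?F + 2 * c\<^sub>I\<^sup>2 * \<kappa>\<^sup>2 * ?F"
    using A B S by (intro add_mono mult_left_mono) auto
  also have "\<dots> = ?L * ?F" by (simp only: distrib_right)
  finally have "(2 * c\<^sub>2\<^sup>2 * normA + 2 * c\<^sub>I\<^sup>2 * \<kappa>\<^sup>2 * normB) * hx\<^sup>2 \<le> ?L * ?F * hx\<^sup>2" by (rule mult_right_mono) simp
  with normR_bound have "normR \<le> ?L * ?F * hx\<^sup>2" by linarith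
  then have R: "?K * normR \<le> ?K * (?L * ?F * hx\<^sup>2)" by (rule mult_left_mono[OF _ K])
  have c1: "4 * c\<^sub>1\<^sup>2 * hx\<^sup>2 * normB \<le> 4 * c\<^sub>1\<^sup>2 * hx\<^sup>2 * ?F" using A S by (intro mult_left_mono) auto
  have c2: "4 * c\<^sub>Q\<^sup>2 * \<kappa> * hx\<^sup>2 * normS \<le> 4 * c\<^sub>Q\<^sup>2 * \<kappa> * hx\<^sup>2 * ?F" using A B const by (intro mult_left_mono) auto
  have "(bochner_norm T (H10_norm \<Omega>) (\<lambda>t x. slice u t x - interp U t x))\<^sup>2 + (LINT t|time_measure T. (nrm t)\<^sup>2)
      \<le> (2 + 2 * (2 + 2 * c\<^sub>I ^ 4 * \<kappa>\<^sup>2)) * normR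
        + (4 * c\<^sub>1\<^sup>2 * hx\<^sup>2 * normB + 8 * c\<^sub>Q\<^sup>2 * normR + 4 * c\<^sub>Q\<^sup>2 * \<kappa> * hx\<^sup>2 * normS)"
    by (rule add_mono[OF energy_error derivative_error])
  also have "\<dots> = ?K * normR + 4 * c\<^sub>1\<^sup>2 * hx\<^sup>2 * normB + 4 * c\<^sub>Q\<^sup>2 * \<kappa> * hx\<^sup>2 * normS"
    by (simp add: algebra_simps)
  also have "\<dots> \<le> ?K * (?L * ?F * hx\<^sup>2) + 4 * c\<^sub>1\<^sup>2 * hx\<^sup>2 * ?F + 4 * c\<^sub>Q\<^sup>2 * \<kappa> * hx\<^sup>2 * ?F"
    by (intro add_mono R c1 c2)
  also have "\<dots> = err_const * hx\<^sup>2 * ?F"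
  proof -
    have "K * (L * F * h) + p * h * F + r * h * F = (K * L + p + r) * h * F" for K L F h p r :: real
      by (simp add: algebra_simps)
    then show ?thesis unfolding err_const_def .
  qed
  finally show ?thesis .
qed

end

section \<open>The error estimate\<close>

context cylinder
begin

text \<open>Reduces the dual norm over \<open>Y_space\<close> to the dual norms of the time slices,
  by Cauchy-Schwarz in time.\<close>

lemma L2Q_Hm1_bound:
  assumes e: "slice e \<in> bochner_L2 T (L2_space \<Omega>) (L2_norm \<Omega>)" and y: "y \<in> Y_space \<Omega> T"
  shows "\<bar>L2Q_inner \<Omega> T e y\<bar> \<le> bochner_norm T (Hm1_norm \<Omega>) (\<lambda>t v. L2_inner \<Omega> (slice e t) v) * Y_norm \<Omega> T y"
proof -
  have 1: "\<bar>F v\<bar> \<le> 1 * Hm1_norm \<Omega> F * H10_norm \<Omega> v" if "F \<in> Hm1_space \<Omega>" "v \<in> H10_space \<Omega>" for F v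
    using Hm1_bound[OF that] by simp
  \<comment> \<open>The bilinear form is the evaluation of a functional at a vector.\<close>
  have "\<bar>LINT t|time_measure T. (\<lambda>F v. F v) (\<lambda>v. L2_inner \<Omega> (slice e t) v) (slice y t)\<bar>
      \<le> 1 * bochner_norm T (Hm1_norm \<Omega>) (\<lambda>t v. L2_inner \<Omega> (slice e t) v) * bochner_norm T (H10_norm \<Omega>) (slice y)"
    by (rule bochner_bilinear(3)[OF Hm1.seminormed_axioms seminormed_H10 _ _ _ _ L2_curve_Hm1[OF e] Y_spaceD[OF y]])
      (simp_all add: 1[simplified] Hm1_diff)
  then show ?thesis by (simp add: L2Q_inner_def Y_norm_bochner)
qed

text \<open>Space and time factors separate in every integral, so the claim is the one-dimensional
  \<open>W1_h_weak_derivative\<close>.\<close>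

lemma tensor_weak_derivative:
  assumes v: "v \<in> L2_space \<Omega>" and \<phi>: "\<phi> \<in> W1_h T N" and N: "1 \<le> N"
  shows "slice (tensor v \<phi>) \<in> bochner_L2 T (L2_space \<Omega>) (L2_norm \<Omega>)"
    and "is_L2_time_deriv \<Omega> T (tensor v \<phi>) (tensor v (difference_quotient (T / real N) \<phi>))"
proof -
  let ?D = "difference_quotient (T / real N) \<phi>"
  have cont: "continuous_on {0..T} \<phi>" using \<phi> by (simp add: W1_h_def)
  obtain M where M: "\<And>t. t \<in> {0..T} \<Longrightarrow> \<bar>\<phi> t\<bar> \<le> M" using continuous_interval_bounded[OF cont] by blast
  show "slice (tensor v \<phi>) \<in> bochner_L2 T (L2_space \<Omega>) (L2_norm \<Omega>)"
  proof (rule L2.bochner_tensor[OF v])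
    show "\<phi> \<in> borel_measurable (time_measure T)"
      by (rule continuous_imp_measurable_on_sets_lebesgue) (auto intro: continuous_on_subset[OF cont])
    show "\<bar>\<phi> t\<bar> \<le> M" if "t \<in> {0<..<T}" for t using M[of t] that by simp
  qed
  have fv: "finitely_valued T ?D"
    using finitely_valued_comp[OF interval_index_finitely_valued(1)[OF refl N T_pos],
        of "\<lambda>k. (\<phi> (real (Suc k) * (T / real N)) - \<phi> (real k * (T / real N))) / (T / real N)"]
    by (simp only: difference_quotient_def[abs_def])
  obtain B where B: "\<And>t. t \<in> {0<..<T} \<Longrightarrow> \<bar>?D t\<bar> \<le> B" using finitely_valued_bounded[OF fv] by blast
  have DB: "slice (tensor v ?D) \<in> bochner_L2 T (L2_space \<Omega>) (L2_norm \<Omega>)"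
    by (rule L2.bochner_tensor[OF v finitely_valued_borel[OF fv] B])
  have inner: "L2Q_inner \<Omega> T (tensor v f) (tensor y \<eta>) = (LINT t|time_measure T. f t * \<eta> t) * L2_inner \<Omega> v y" for f \<eta> y
  proof -
    have "L2_inner \<Omega> (slice (tensor v f) t) y = f t * L2_inner \<Omega> v y" for t
      using L2_inner_tensor[of y v f t] by (simp only: L2_inner_commute[of \<Omega> y])
    then have "L2_inner \<Omega> (slice (tensor v f) t) (slice (tensor y \<eta>) t) = f t * \<eta> t * L2_inner \<Omega> v y" for t
      by (simp only: L2_inner_tensor mult_ac)
    then show ?thesis unfolding L2Q_inner_def by (simp only: integral_mult_left_zero)
  qed
  show "is_L2_time_deriv \<Omega> T (tensor v \<phi>) (tensor v ?D)"
    unfolding is_L2_time_deriv_def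
    using DB W1_h_weak_derivative[OF \<phi> N T_pos] by (simp add: inner)
qed

lemma is_L2_time_deriv_sum:
  assumes "finite A" "\<And>j. j \<in> A \<Longrightarrow> is_L2_time_deriv \<Omega> T (f j) (g j)"
    "\<And>j. j \<in> A \<Longrightarrow> slice (f j) \<in> bochner_L2 T (L2_space \<Omega>) (L2_norm \<Omega>)"
  shows "is_L2_time_deriv \<Omega> T (\<lambda>z. \<Sum>j\<in>A. f j z) (\<lambda>z. \<Sum>j\<in>A. g j z)"
  using assms
proof (induction rule: finite_induct)
  case empty
  show ?case by (simp add: is_L2_time_deriv_def slice_arith L2.bochner_zero L2Q_inner_def)
next
  case (insert j A)
  have "slice (\<lambda>z. \<Sum>j\<in>A. f j z) \<in> bochner_L2 T (L2_space \<Omega>) (L2_norm \<Omega>)"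
    unfolding slice_arith using insert by (intro L2.bochner_sum) auto
  then have "is_L2_time_deriv \<Omega> T (\<lambda>z. f j z + (\<Sum>j\<in>A. f j z)) (\<lambda>z. g j z + (\<Sum>j\<in>A. g j z))"
    using insert by (intro is_L2_time_deriv_add) auto
  then show ?case using insert by simp
qed

text \<open>The time derivative inside \<open>b_form\<close> is chosen for the sum as a whole.
  Uniqueness on \<open>Y_space\<close> replaces it by the sum of given derivatives, so that the
  common extension \<open>U\<^sub>0\<close> of the initial value can cancel from the two
  problems.\<close>

lemma b_form_add:
  assumes u: "u \<in> Y_space \<Omega> T" "is_time_deriv \<Omega> T u F" and v: "v \<in> Y_space \<Omega> T" "is_time_deriv \<Omega> T v F'"
    and y: "y \<in> Y_space \<Omega> T"
  shows "b_form \<Omega> T (\<lambda>z. u z + v z) y = F y + F' y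
    + (LINT t|time_measure T. dirichlet (slice u t) (slice y t)) + (LINT t|time_measure T. dirichlet (slice v t) (slice y t))"
proof -
  note B = Y_spaceD[OF u(1)] Y_spaceD[OF v(1)] Y_spaceD[OF y]
  have "(LINT t|time_measure T. dirichlet (\<lambda>x. slice u t x + slice v t x) (slice y t))
      = (LINT t|time_measure T. dirichlet (slice u t) (slice y t) + dirichlet (slice v t) (slice y t))"
  proof (rule integral_cong_AE)
    show "AE t in time_measure T. dirichlet (\<lambda>x. slice u t x + slice v t x) (slice y t)
        = dirichlet (slice u t) (slice y t) + dirichlet (slice v t) (slice y t)"
      using bochner_L2_AE[OF B(1)] bochner_L2_AE[OF B(2)] bochner_L2_AE[OF B(3)]
      by eventually_elim (intro dirichlet_add_left H10_H1)
    show "(\<lambda>t. dirichlet (\<lambda>x. slice u t x + slice v t x) (slice y t)) \<in> borel_measurable (time_measure T)"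
      by (rule borel_measurable_integrable[OF dirichlet_bochner(1)[OF H10.bochner_add[OF B(1,2)] B(3)]])
    show "(\<lambda>t. dirichlet (slice u t) (slice y t) + dirichlet (slice v t) (slice y t)) \<in> borel_measurable (time_measure T)"
      by (intro borel_measurable_add borel_measurable_integrable dirichlet_bochner(1) B)
  qed
  then show ?thesis
    using time_deriv_eq[OF is_time_deriv_add[OF u v] y] dirichlet_bochner(1)[OF B(1,3)] dirichlet_bochner(1)[OF B(2,3)]
    by (simp add: b_form_def L2Q_grad slice_arith)
qed

text \<open>\<open>H32_Hm1_space\<close> provides some derivative with finite seminorm, while
  \<open>H32_Hm1_norm\<close> uses one chosen by \<open>SOME\<close>. Both agree with the square
  integrable derivative almost everywhere on \<open>H10_space\<close>, hence the seminorms
  coincide.\<close>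

lemma slobodeckii_finite:
  assumes u: "u \<in> H32_Hm1_space \<Omega> T" and \<delta>: "is_L2_time_deriv \<Omega> T u \<delta>" and d: "is_Hm1_time_deriv \<Omega> T u d"
  shows "slobodeckii_half_Hm1 \<Omega> T d < \<infinity>"
proof -
  obtain d' where d': "is_Hm1_time_deriv \<Omega> T u d'" "slobodeckii_half_Hm1 \<Omega> T d' < \<infinity>"
    using u by (auto simp: H32_Hm1_space_def)
  have eq: "AE t in time_measure T. \<forall>w\<in>H10_space \<Omega>. d t w = d' t w"
    using Hm1_time_deriv_eq[OF d \<delta>] Hm1_time_deriv_eq[OF d'(1) \<delta>] by eventually_elim auto
  have "slobodeckii_half_Hm1 \<Omega> T d = slobodeckii_half_Hm1 \<Omega> T d'"
    unfolding slobodeckii_half_Hm1_def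
  proof (rule nn_integral_cong_AE)
    show "AE t in time_measure T. (\<integral>\<^sup>+r. ennreal ((Hm1_norm \<Omega> (\<lambda>w. d t w - d r w))\<^sup>2 / (t - r)\<^sup>2) \<partial>time_measure T)
        = (\<integral>\<^sup>+r. ennreal ((Hm1_norm \<Omega> (\<lambda>w. d' t w - d' r w))\<^sup>2 / (t - r)\<^sup>2) \<partial>time_measure T)"
      using eq
    proof eventually_elim
      case (elim t)
      show ?case
      proof (rule nn_integral_cong_AE)
        show "AE r in time_measure T. ennreal ((Hm1_norm \<Omega> (\<lambda>w. d t w - d r w))\<^sup>2 / (t - r)\<^sup>2)
            = ennreal ((Hm1_norm \<Omega> (\<lambda>w. d' t w - d' r w))\<^sup>2 / (t - r)\<^sup>2)"
          using eq
        proof eventually_elim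
          case (elim r)
          have "Hm1_norm \<Omega> (\<lambda>w. d t w - d r w) = Hm1_norm \<Omega> (\<lambda>w. d' t w - d' r w)"
            using elim \<open>\<forall>w\<in>H10_space \<Omega>. d t w = d' t w\<close> by (intro Hm1_cong) simp
          then show ?case by simp
        qed
      qed
    qed
  qed
  then show ?thesis using d'(2) by simp
qed

end

text \<open>The closure of a nonempty set is covered, so there is at least one simplex and the
  maximum in \<open>mesh_size\<close> is attained.\<close>

lemma admissible_mesh_size_nonneg:
  assumes "admissible_mesh \<Omega> \<T>" "\<Omega> \<noteq> {}"
  shows "0 \<le> mesh_size \<T>"
proof -
  have \<T>: "finite \<T>" "\<Union>\<T> = closure \<Omega>" "\<And>K. K \<in> \<T> \<Longrightarrow> int DIM('a) simplex K"
    using assms(1) by (auto simp: admissible_mesh_def triangulation_def)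
  then obtain K where K: "K \<in> \<T>" using assms(2) closure_subset[of \<Omega>] by (cases "\<T> = {}") auto
  obtain C where "finite C" "K = convex hull C" using \<T>(3)[OF K] by (auto simp: simplex)
  then have "bounded K" by (simp add: finite_imp_compact compact_convex_hull compact_imp_bounded)
  then have "0 \<le> diameter K" by (rule diameter_ge_0)
  also have "diameter K \<le> mesh_size \<T>" unfolding mesh_size_def using \<T>(1) K by (intro Max_ge) auto
  finally show ?thesis .
qed

lemma (in bounded_domain) V_h_sum:
  "finite A \<Longrightarrow> (\<And>j. j \<in> A \<Longrightarrow> f j \<in> V_h \<Omega> \<T>) \<Longrightarrow> (\<lambda>x. \<Sum>j\<in>A. f j x) \<in> V_h \<Omega> \<T>"
  by (induction rule: finite_induct) (auto intro: V_h_zero V_h_add)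

context galerkin
begin

text \<open>Passes from curves to functions on the cylinder: the slices of \<open>u\<^sub>h\<close>
  and of its derivative are \<open>interp U\<close> and \<open>dU\<close>, and the time derivative
  of the error is represented by \<open>ev\<close>.\<close>

lemma final_bound:
  assumes uY: "u \<in> Y_space \<Omega> T" and \<delta>: "is_L2_time_deriv \<Omega> T u \<delta>"
    and uh: "is_L2_time_deriv \<Omega> T u\<^sub>h D" "\<And>t. t \<in> {0<..<T} \<Longrightarrow> slice u\<^sub>h t = interp U t"
      "\<And>t. t \<in> {0<..<T} \<Longrightarrow> slice D t = dU t"
  shows "(X_norm \<Omega> T (\<lambda>z. u z - u\<^sub>h z))\<^sup>2 \<le> err_const * hx\<^sup>2 * (normA + normB + normS)"
proof -
  have uhB: "slice u\<^sub>h \<in> bochner_L2 T (H10_space \<Omega>) (H10_norm \<Omega>)"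
    by (rule bochner_cong[OF interp_H10[OF U_V]]) (simp_all add: uh(2))
  then have uhY: "u\<^sub>h \<in> Y_space \<Omega> T" by (simp add: Y_space_def)
  have "slice (\<lambda>z. (-1) * u\<^sub>h z) \<in> bochner_L2 T (L2_space \<Omega>) (L2_norm \<Omega>)"
    unfolding slice_arith by (rule L2.bochner_scale[OF Y_L2[OF uhY]])
  then have "is_L2_time_deriv \<Omega> T (\<lambda>z. u z + (-1) * u\<^sub>h z) (\<lambda>z. \<delta> z + (-1) * D z)"
    by (rule is_L2_time_deriv_add[OF \<delta> is_L2_time_deriv_scale[OF uh(1)] Y_L2[OF uY]])
  then have dd: "is_L2_time_deriv \<Omega> T (\<lambda>z. u z - u\<^sub>h z) (\<lambda>z. \<delta> z - D z)" by simp
  let ?e = "\<lambda>z. \<delta> z - D z"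
  have eB: "slice ?e \<in> bochner_L2 T (L2_space \<Omega>) (L2_norm \<Omega>)" using dd by (simp add: is_L2_time_deriv_def)
  have e_ev: "slice ?e t = ev t" if "t \<in> {0<..<T}" for t
    using uh(3)[OF that] by (simp add: slice_arith ev_def)
  have nrm: "bochner_norm T (Hm1_norm \<Omega>) (\<lambda>t v. L2_inner \<Omega> (slice ?e t) v) = sqrt (LINT t|time_measure T. (nrm t)\<^sup>2)"
    unfolding bochner_norm_def
    by (intro arg_cong[where f=sqrt] Bochner_Integration.integral_cong) (simp_all add: e_ev nrm_def)
  have Ystar: "Ystar_norm \<Omega> T (time_deriv \<Omega> T (\<lambda>z. u z - u\<^sub>h z)) \<le> sqrt (LINT t|time_measure T. (nrm t)\<^sup>2)"
    unfolding Ystar_norm_def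
  proof (rule Y.dual_norm_le)
    show "\<bar>time_deriv \<Omega> T (\<lambda>z. u z - u\<^sub>h z) y\<bar> \<le> sqrt (LINT t|time_measure T. (nrm t)\<^sup>2) * Y_norm \<Omega> T y"
      if "y \<in> Y_space \<Omega> T" for y
      using L2Q_Hm1_bound[OF eB that] time_deriv_eq[OF L2_time_deriv_is_time_deriv[OF dd] that] by (simp add: nrm)
  qed simp
  have td: "time_deriv \<Omega> T (\<lambda>z. u z - u\<^sub>h z) \<in> Ystar_space \<Omega> T"
    unfolding time_deriv_def
    using someI[of "is_time_deriv \<Omega> T (\<lambda>z. u z - u\<^sub>h z)", OF L2_time_deriv_is_time_deriv[OF dd]]
    by (simp add: is_time_deriv_def)
  have "(Ystar_norm \<Omega> T (time_deriv \<Omega> T (\<lambda>z. u z - u\<^sub>h z)))\<^sup>2 \<le> (sqrt (LINT t|time_measure T. (nrm t)\<^sup>2))\<^sup>2"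
    by (rule power_mono[OF Ystar Ystar.N_nonneg[OF td]])
  also have "\<dots> = (LINT t|time_measure T. (nrm t)\<^sup>2)" by simp
  finally have 2: "(Ystar_norm \<Omega> T (time_deriv \<Omega> T (\<lambda>z. u z - u\<^sub>h z)))\<^sup>2 \<le> (LINT t|time_measure T. (nrm t)\<^sup>2)" .
  have "Y_norm \<Omega> T (\<lambda>z. u z - u\<^sub>h z) = bochner_norm T (H10_norm \<Omega>) (\<lambda>t x. slice u t x - interp U t x)"
    unfolding Y_norm_bochner bochner_norm_def
    by (intro arg_cong[where f=sqrt] Bochner_Integration.integral_cong) (simp_all add: slice_arith uh(2))
  then have "(X_norm \<Omega> T (\<lambda>z. u z - u\<^sub>h z))\<^sup>2 = (bochner_norm T (H10_norm \<Omega>) (\<lambda>t x. slice u t x - interp U t x))\<^sup>2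
      + (Ystar_norm \<Omega> T (time_deriv \<Omega> T (\<lambda>z. u z - u\<^sub>h z)))\<^sup>2"
    by (simp add: X_norm_def)
  then show ?thesis using 2 total_error by linarith
qed

end

context cylinder
begin

text \<open>The constants are arguments, so the bound visibly depends on the mesh through
  \<open>hx\<close> alone. The proof produces the data of \<open>galerkin\<close>: nodal values of
  the discrete solution, the two derivatives, and the orthogonality on each cell.\<close>

lemma galerkin_error:
  fixes \<T> :: "'a set set" and N :: nat and hx c\<^sub>I c\<^sub>Q c\<^sub>1 c\<^sub>2 \<kappa> :: real
  assumes mesh: "admissible_mesh \<Omega> \<T>" and N: "1 \<le> N" and hx: "0 < hx"
    and const: "0 \<le> c\<^sub>I" "0 < c\<^sub>Q" "0 \<le> c\<^sub>1" "0 \<le> c\<^sub>2" "0 \<le> \<kappa>" and step: "T / real N \<le> \<kappa> * hx\<^sup>2"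
    and inverse_ineq: "\<And>v. v \<in> V_h \<Omega> \<T> \<Longrightarrow> H10_norm \<Omega> v \<le> c\<^sub>I / hx * L2_norm \<Omega> v"
    and stable: "\<And>v. v \<in> H10_space \<Omega> \<Longrightarrow> H10_norm \<Omega> (L2_proj \<Omega> (V_h \<Omega> \<T>) v) \<le> c\<^sub>Q * H10_norm \<Omega> v"
    and approx1: "\<And>v. v \<in> H10_space \<Omega> \<Longrightarrow>
      L2_norm \<Omega> (\<lambda>x. v x - L2_proj \<Omega> (V_h \<Omega> \<T>) v x) \<le> c\<^sub>1 * hx * H10_norm \<Omega> v"
    and approx2: "\<And>v. v \<in> H10_space \<Omega> \<Longrightarrow> v \<in> H2_space \<Omega> \<Longrightarrow>
      H10_norm \<Omega> (\<lambda>x. v x - L2_proj \<Omega> (V_h \<Omega> \<T>) v x) \<le> c\<^sub>2 * hx * H2_norm \<Omega> v"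
    and U\<^sub>0: "U\<^sub>0 \<in> X_space \<Omega> T" and u: "u \<in> X0_space \<Omega> T"
    and eq: "\<And>v. v \<in> Y_space \<Omega> T \<Longrightarrow> b_form \<Omega> T (\<lambda>z. u z + U\<^sub>0 z) v = f v"
    and u\<^sub>h: "u\<^sub>h \<in> X0_h \<Omega> T \<T> N"
    and eq\<^sub>h: "\<And>v. v \<in> Y_h \<Omega> T \<T> N \<Longrightarrow> b_form \<Omega> T (\<lambda>z. u\<^sub>h z + U\<^sub>0 z) v = f v"
    and H21: "u \<in> H21_space \<Omega> T" and H32: "u \<in> H32_Hm1_space \<Omega> T"
  shows "(X_norm \<Omega> T (\<lambda>z. u z - u\<^sub>h z))\<^sup>2 \<le>
    ((2 + 2 * (2 + 2 * c\<^sub>I ^ 4 * \<kappa>\<^sup>2) + 8 * c\<^sub>Q\<^sup>2) * (2 * c\<^sub>2\<^sup>2 + 2 * c\<^sub>I\<^sup>2 * \<kappa>\<^sup>2) + 4 * c\<^sub>1\<^sup>2 + 4 * c\<^sub>Q\<^sup>2 * \<kappa>)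
    * hx\<^sup>2 * ((H21_norm \<Omega> T u)\<^sup>2 + (H32_Hm1_norm \<Omega> T u)\<^sup>2)"
proof -
  interpret time_grid T N by standard (use T_pos N in auto)
  have uY: "u \<in> Y_space \<Omega> T" and init: "has_initial_value \<Omega> T u (\<lambda>x. 0)"
    using u by (auto simp: X0_space_def X_space_def)
  have U\<^sub>0Y: "U\<^sub>0 \<in> Y_space \<Omega> T" using U\<^sub>0 by (simp add: X_space_def)
  have "\<exists>F. is_time_deriv \<Omega> T U\<^sub>0 F" using U\<^sub>0 by (simp add: X_space_def)
  then obtain F\<^sub>0 where F\<^sub>0: "is_time_deriv \<Omega> T U\<^sub>0 F\<^sub>0" ..
  \<comment> \<open>This is the very derivative selected inside \<open>H21_norm\<close>, so its norm
    is literally one of the summands there; likewise \<open>d\<close> below for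
    \<open>H32_Hm1_norm\<close>.\<close>
  define \<delta> where "\<delta> = (SOME d. is_L2_time_deriv \<Omega> T u d)"
  have \<delta>: "is_L2_time_deriv \<Omega> T u \<delta>"
    unfolding \<delta>_def
    using H21 by (intro someI_ex[of "is_L2_time_deriv \<Omega> T u"]) (simp add: H21_space_def)
  have \<delta>B: "slice \<delta> \<in> bochner_L2 T (L2_space \<Omega>) (L2_norm \<Omega>)" using \<delta> by (simp add: is_L2_time_deriv_def)
  define d where "d = (SOME d. is_Hm1_time_deriv \<Omega> T u d)"
  have d: "is_Hm1_time_deriv \<Omega> T u d"
    unfolding d_def using H32 unfolding H32_Hm1_space_def
    by (intro someI_ex[of "is_Hm1_time_deriv \<Omega> T u"]) blast
  obtain w where w: "\<And>t. t \<in> {0..T} \<Longrightarrow> w t \<in> L2_space \<Omega>"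
    "AE t in time_measure T. L2_norm \<Omega> (\<lambda>x. slice u t x - w t x) = 0"
    "\<And>t v. t \<in> {0..T} \<Longrightarrow> v \<in> L2_space \<Omega> \<Longrightarrow>
      L2_inner \<Omega> (w t) v = (LINT s|time_measure T. L2_inner \<Omega> (slice \<delta> s) v * indicator {0<..<t} s)"
    using initial_value_primitive[OF Y_L2[OF uY] \<delta> init] by blast
  obtain J :: nat and v\<^sub>j \<phi> where J: "\<And>j. j < J \<Longrightarrow> v\<^sub>j j \<in> V_h \<Omega> \<T>" "\<And>j. j < J \<Longrightarrow> \<phi> j \<in> W1_h T N"
    "u\<^sub>h = (\<lambda>z. \<Sum>j<J. tensor (v\<^sub>j j) (\<phi> j) z)"
    using u\<^sub>h unfolding X0_h_def tensor_space_def by blast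
  \<comment> \<open>Nodal values are read off from the tensor representation; all time factors
    vanish at 0, so \<open>U 0\<close> is the zero function.\<close>
  define U where "U k = (\<lambda>x. \<Sum>j<J. \<phi> j (real k * \<tau>) * v\<^sub>j j x)" for k
  have U_V: "U k \<in> V_h \<Omega> \<T>" for k
    unfolding U_def using J(1) by (intro V_h_sum V_h_scale) auto
  have U_0: "U 0 = (\<lambda>_. 0)" using J(2) by (simp add: U_def W1_h_def)
  define D where "D = (\<lambda>z. \<Sum>j<J. tensor (v\<^sub>j j) (difference_quotient \<tau> (\<phi> j)) z)"
  have u\<^sub>h_deriv: "is_L2_time_deriv \<Omega> T u\<^sub>h D"
    unfolding J(3) D_def \<tau>_def
    by (intro is_L2_time_deriv_sum tensor_weak_derivative[OF _ _ N] H10_L2 V_h_H10)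
      (rule finite_lessThan J lessThan_iff[THEN iffD1] | assumption)+
  have u\<^sub>h_slice: "slice u\<^sub>h t = interp U t" if t: "t \<in> {0<..<T}" for t
  proof (rule ext)
    fix x
    let ?a = "\<lambda>j. \<phi> j (real (idx t) * \<tau>)" and ?b = "\<lambda>j. \<phi> j (real (Suc (idx t)) * \<tau>)"
      and ?\<theta> = "(t - real (idx t) * \<tau>) / \<tau>"
    have "slice u\<^sub>h t x = (\<Sum>j<J. v\<^sub>j j x * \<phi> j t)" by (simp add: J(3) slice_def tensor_def)
    also have "\<dots> = (\<Sum>j<J. v\<^sub>j j x * (?a j + ?\<theta> * (?b j - ?a j)))"
      using W1_h_interp[OF J(2) t] by (intro sum.cong) auto
    also have "\<dots> = (\<Sum>j<J. ?a j * v\<^sub>j j x) + ?\<theta> * ((\<Sum>j<J. ?b j * v\<^sub>j j x) - (\<Sum>j<J. ?a j * v\<^sub>j j x))"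
      by (simp only: sum_subtractf[symmetric] sum_distrib_left sum.distrib[symmetric])
        (intro sum.cong refl, simp only: algebra_simps)
    finally show "slice u\<^sub>h t x = interp U t x" by (simp only: interp_def U_def)
  qed
  have D_slice: "slice D t = (\<lambda>x. 1 / \<tau> * (U (Suc (idx t)) x - U (idx t) x))" for t
  proof (rule ext)
    fix x
    have "slice D t x = (\<Sum>j<J. v\<^sub>j j x * ((\<phi> j (real (Suc (idx t)) * \<tau>) - \<phi> j (real (idx t) * \<tau>)) / \<tau>))"
      by (simp add: D_def slice_def tensor_def difference_quotient_def)
    also have "\<dots> = 1 / \<tau> * (U (Suc (idx t)) x - U (idx t) x)"
      unfolding U_def sum_subtractf[symmetric] sum_distrib_left
      by (intro sum.cong refl) (simp add: algebra_simps diff_divide_distrib)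
    finally show "slice D t x = 1 / \<tau> * (U (Suc (idx t)) x - U (idx t) x)" .
  qed
  have UB: "interp U \<in> bochner_L2 T (H10_space \<Omega>) (H10_norm \<Omega>)"
    using H10.bochner_interp[OF time_grid_axioms] V_h_H10[OF U_V] by blast
  have u\<^sub>hY: "u\<^sub>h \<in> Y_space \<Omega> T"
    using bochner_cong[OF UB, of "slice u\<^sub>h"] u\<^sub>h_slice by (simp add: Y_space_def)
  \<comment> \<open>Both equations are tested with \<open>v\<close> times the indicator of the k-th
    cell, which belongs to \<open>Y_space\<close> and to \<open>Y_h\<close>. On subtraction the load
    and the extension of the initial value drop out.\<close>
  have orth: "(LINT t|time_measure T. charc k t * L2_inner \<Omega> (slice \<delta> t) v) - L2_inner \<Omega> (\<lambda>x. U (Suc k) x - U k x) v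
      + (LINT t|time_measure T. charc k t * dirichlet (\<lambda>x. slice u t x - interp U t x) v) = 0"
    if k: "k < N" and v: "v \<in> V_h \<Omega> \<T>" for k v
  proof -
    note vH = V_h_H10[OF v]
    let ?y = "tensor v (charc k)"
    have yY: "?y \<in> Y_space \<Omega> T"
      by (rule tensor_Y[OF vH cell_measurable, where B=1]) (simp add: indicator_def)
    have "charc k \<in> W0_h T N"
      unfolding W0_h_def
    proof (intro CollectI allI impI)
      fix i assume "i < N"
      show "\<exists>\<beta>. \<forall>t\<in>{real i * (T / real N)<..<real (Suc i) * (T / real N)}. charc k t = \<beta>"
      proof (intro exI ballI)
        fix t assume "t \<in> {real i * (T / real N)<..<real (Suc i) * (T / real N)}"
        then have "t \<in> cell i" by (simp add: cell_def \<tau>_def)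
        then show "charc k t = (if i = k then 1 else 0)" using idx_cell[of t i] idx_cell[of t k] by (auto simp: indicator_def)
      qed
    qed
    then have yYh: "?y \<in> Y_h \<Omega> T \<T> N"
      unfolding Y_h_def tensor_space_def using v
      by (intro CollectI exI[of _ "1::nat"] exI[of _ "\<lambda>_. v"] exI[of _ "\<lambda>_. charc k"]) auto
    have ysl: "slice ?y t = (\<lambda>x. charc k t * v x)" for t by (simp add: slice_def tensor_def fun_eq_iff)
    note tu = L2_time_deriv_is_time_deriv[OF \<delta>] and tuh = L2_time_deriv_is_time_deriv[OF u\<^sub>h_deriv]
    have dir: "AE t in time_measure T. dirichlet (slice a t) (slice ?y t) = charc k t * dirichlet (slice a t) v"
      if "slice a \<in> bochner_L2 T (H10_space \<Omega>) (H10_norm \<Omega>)" for a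
      using bochner_L2_AE[OF that]
    proof eventually_elim
      case (elim t)
      show ?case unfolding ysl using dirichlet_scale_left[OF H10_H1[OF vH] H10_H1[OF elim]] by (simp add: dirichlet_commute)
    qed
    have int: "integrable (time_measure T) (\<lambda>t. charc k t * dirichlet (slice a t) v)"
      if "slice a \<in> bochner_L2 T (H10_space \<Omega>) (H10_norm \<Omega>)" for a
      by (intro integrable_cell_mult dirichlet_bochner(1)[OF that H10.bochner_const[OF vH]])
    have dirI: "(LINT t|time_measure T. dirichlet (slice a t) (slice ?y t)) = (LINT t|time_measure T. charc k t * dirichlet (slice a t) v)"
      if a: "slice a \<in> bochner_L2 T (H10_space \<Omega>) (H10_norm \<Omega>)" for a
      by (rule integral_cong_AE[OF borel_measurable_integrable[OF dirichlet_bochner(1)[OF a Y_spaceD[OF yY]]]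
            borel_measurable_integrable[OF int[OF a]] dir[OF a]])
    have "b_form \<Omega> T (\<lambda>z. u z + U\<^sub>0 z) ?y = b_form \<Omega> T (\<lambda>z. u\<^sub>h z + U\<^sub>0 z) ?y"
      by (simp only: eq[OF yY] eq\<^sub>h[OF yYh])
    then have main: "L2Q_inner \<Omega> T \<delta> ?y + (LINT t|time_measure T. charc k t * dirichlet (slice u t) v)
        = L2Q_inner \<Omega> T D ?y + (LINT t|time_measure T. charc k t * dirichlet (slice u\<^sub>h t) v)"
      unfolding b_form_add[OF uY tu U\<^sub>0Y F\<^sub>0 yY] b_form_add[OF u\<^sub>hY tuh U\<^sub>0Y F\<^sub>0 yY] dirI[OF Y_spaceD[OF uY]] dirI[OF Y_spaceD[OF u\<^sub>hY]]
      by linarith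
    have 1: "L2Q_inner \<Omega> T \<delta> ?y = (LINT t|time_measure T. charc k t * L2_inner \<Omega> (slice \<delta> t) v)"
      by (simp only: L2Q_inner_def L2_inner_tensor)
    \<comment> \<open>On the cell \<open>D\<close> is the constant difference quotient of
      \<open>U\<close>; integration cancels the factor \<open>1 / \<tau>\<close>.\<close>
    have "L2Q_inner \<Omega> T D ?y = (LINT t|time_measure T. charc k t * (1 / \<tau> * L2_inner \<Omega> (\<lambda>x. U (Suc k) x - U k x) v))"
      unfolding L2Q_inner_def L2_inner_tensor D_slice L2_inner_mult_left
      using idx_cell by (intro Bochner_Integration.integral_cong) (auto simp: indicator_def)
    then have 2: "L2Q_inner \<Omega> T D ?y = L2_inner \<Omega> (\<lambda>x. U (Suc k) x - U k x) v"
      using integral_cell_const[OF k, of "1 / \<tau> * L2_inner \<Omega> (\<lambda>x. U (Suc k) x - U k x) v"] \<tau>_pos by simp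
    have "(LINT t|time_measure T. charc k t * dirichlet (\<lambda>x. slice u t x - interp U t x) v)
        = (LINT t|time_measure T. charc k t * dirichlet (slice u t) v - charc k t * dirichlet (slice u\<^sub>h t) v)"
    proof (rule integral_cong_AE)
      show "AE t in time_measure T. charc k t * dirichlet (\<lambda>x. slice u t x - interp U t x) v
          = charc k t * dirichlet (slice u t) v - charc k t * dirichlet (slice u\<^sub>h t) v"
        using bochner_L2_AE[OF Y_spaceD[OF uY]] bochner_L2_AE[OF Y_spaceD[OF u\<^sub>hY]] AE_time
      proof eventually_elim
        case (elim t)
        show ?case
          using dirichlet_diff_left[OF elim(1,2) vH] u\<^sub>h_slice[OF elim(3)] by (simp add: right_diff_distrib)
      qed
      show "(\<lambda>t. charc k t * dirichlet (\<lambda>x. slice u t x - interp U t x) v) \<in> borel_measurable (time_measure T)"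
        by (intro borel_measurable_integrable integrable_cell_mult
            dirichlet_bochner(1)[OF H10.bochner_diff[OF Y_spaceD[OF uY] UB] H10.bochner_const[OF vH]])
      show "(\<lambda>t. charc k t * dirichlet (slice u t) v - charc k t * dirichlet (slice u\<^sub>h t) v) \<in> borel_measurable (time_measure T)"
        by (intro borel_measurable_diff borel_measurable_integrable int Y_spaceD uY u\<^sub>hY)
    qed
    also have "\<dots> = (LINT t|time_measure T. charc k t * dirichlet (slice u t) v) - (LINT t|time_measure T. charc k t * dirichlet (slice u\<^sub>h t) v)"
      by (intro Bochner_Integration.integral_diff int Y_spaceD uY u\<^sub>hY)
    finally show ?thesis using main 1 2 by linarith
  qed
  have H2B: "AE t in time_measure T. slice u t \<in> H2_space \<Omega>" "integrable (time_measure T) (\<lambda>t. (H2_norm \<Omega> (slice u t))\<^sup>2)"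
    using H21 by (auto simp: H21_space_def bochner_L2_def)
  have d_eq: "AE t in time_measure T. \<forall>v\<in>H10_space \<Omega>. d t v = L2_inner \<Omega> (slice \<delta> t) v"
    using Hm1_time_deriv_eq[OF d \<delta>] by eventually_elim simp
  have dB: "d \<in> bochner_L2 T (Hm1_space \<Omega>) (Hm1_norm \<Omega>)" using d by (simp add: is_Hm1_time_deriv_def)
  note slob = slobodeckii_finite[OF H32 \<delta> d]
  interpret galerkin \<Omega> T N \<T> hx c\<^sub>I c\<^sub>Q c\<^sub>1 c\<^sub>2 \<kappa> u \<delta> w d U
    by unfold_locales (fact mesh hx const step[folded \<tau>_def] inverse_ineq stable approx1 approx2 Y_spaceD[OF uY]
      H2B \<delta>B w dB d_eq slob U_0 | rule U_V | erule (1) orth)+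
  have "(X_norm \<Omega> T (\<lambda>z. u z - u\<^sub>h z))\<^sup>2 \<le> err_const * hx\<^sup>2 * (normA + normB + normS)"
    by (rule final_bound[OF uY \<delta> u\<^sub>h_deriv u\<^sub>h_slice]) (simp_all add: D_slice dU_def)
  also have "\<dots> \<le> err_const * hx\<^sup>2 * ((H21_norm \<Omega> T u)\<^sup>2 + (H32_Hm1_norm \<Omega> T u)\<^sup>2)"
  proof (rule mult_left_mono)
    show "0 \<le> err_const * hx\<^sup>2"
      unfolding err_const_def using const by (intro mult_nonneg_nonneg add_nonneg_nonneg) auto
    have B: "normB = (L2Q_norm \<Omega> T \<delta>)\<^sup>2"
      by (simp add: L2Q_norm_def L2Q_inner_def L2_norm_power2)
    \<comment> \<open>The squared regularity norms consist of these terms and further nonnegative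
      ones.\<close>
    have "normA + normB \<le> (H21_norm \<Omega> T u)\<^sup>2"
      unfolding B by (simp add: H21_norm_def bochner_norm_def \<delta>_def)
    moreover have "normS \<le> (H32_Hm1_norm \<Omega> T u)\<^sup>2"
      by (simp add: H32_Hm1_norm_def Let_def d_def)
    ultimately show "normA + normB + normS \<le> (H21_norm \<Omega> T u)\<^sup>2 + (H32_Hm1_norm \<Omega> T u)\<^sup>2" by linarith
  qed
  finally show ?thesis unfolding err_const_def .
qed

end

theorem lemma4p8:
  fixes \<Omega> :: "(real ^ 'n) set"
    and T \<sigma> q \<kappa>\<^sub>1 \<kappa>\<^sub>2 c\<^sub>I c\<^sub>Q :: real and c\<^sub>A :: "real \<Rightarrow> real"
  assumes "CARD('n) \<in> {1, 2, 3}"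
    and "lipschitz_domain \<Omega>" and "bounded \<Omega>"
    and "T > 0" and "\<kappa>\<^sub>1 > 0" and "\<kappa>\<^sub>2 > 0"
  shows "\<exists>c>0. \<forall>(\<T> :: (real ^ 'n) set set) (N :: nat).
    admissible_mesh \<Omega> \<T> \<and> shape_regular \<sigma> \<T> \<and> quasi_uniform q \<T> \<and>
    inverse_inequality c\<^sub>I \<Omega> \<T> \<and> L2_proj_H1_stable c\<^sub>Q \<Omega> \<T> \<and> L2_proj_approximation c\<^sub>A \<Omega> \<T> \<and>
    N \<ge> 1 \<and> \<kappa>\<^sub>1 * (mesh_size \<T>)\<^sup>2 \<le> T / N \<and> T / N \<le> \<kappa>\<^sub>2 * (mesh_size \<T>)\<^sup>2 \<longrightarrow>
    (\<forall>f u\<^sub>0 U\<^sub>0 u u\<^sub>h.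
      f \<in> Ystar_space \<Omega> T \<and> u\<^sub>0 \<in> L2_space \<Omega> \<and>
      U\<^sub>0 \<in> X_space \<Omega> T \<and> has_initial_value \<Omega> T U\<^sub>0 u\<^sub>0 \<and>
      u \<in> X0_space \<Omega> T \<and>
      (\<forall>v\<in>Y_space \<Omega> T. b_form \<Omega> T (\<lambda>z. u z + U\<^sub>0 z) v = f v) \<and>
      u\<^sub>h \<in> X0_h \<Omega> T \<T> N \<and>
      (\<forall>v\<in>Y_h \<Omega> T \<T> N. b_form \<Omega> T (\<lambda>z. u\<^sub>h z + U\<^sub>0 z) v = f v) \<and>
      u \<in> H21_space \<Omega> T \<and> u \<in> H32_Hm1_space \<Omega> T \<longrightarrow>
      X_norm \<Omega> T (\<lambda>z. u z - u\<^sub>h z)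
        \<le> c * mesh_size \<T> * sqrt ((H21_norm \<Omega> T u)\<^sup>2 + (H32_Hm1_norm \<Omega> T u)\<^sup>2))"
proof -
  interpret cylinder \<Omega> T
    using assms by unfold_locales (auto simp: lipschitz_domain_def)
  \<comment> \<open>The given constants are arbitrary reals. Absolute values make them nonnegative;
    the maximum with 1 makes the stability constant positive, as it appears in a divisor in
    \<open>derivative_error\<close>.\<close>
  let ?cI = "\<bar>c\<^sub>I\<bar>" and ?cQ = "max c\<^sub>Q 1" and ?c1 = "\<bar>c\<^sub>A 1\<bar>" and ?c2 = "\<bar>c\<^sub>A 2\<bar>"
  define K where "K = (2 + 2 * (2 + 2 * ?cI ^ 4 * \<kappa>\<^sub>2\<^sup>2) + 8 * ?cQ\<^sup>2) * (2 * ?c2\<^sup>2 + 2 * ?cI\<^sup>2 * \<kappa>\<^sub>2\<^sup>2) + 4 * ?c1\<^sup>2 + 4 * ?cQ\<^sup>2 * \<kappa>\<^sub>2"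
  \<comment> \<open>The last summand is positive, the others are nonnegative.\<close>
  have K: "0 < K" unfolding K_def using assms(6) by (intro add_nonneg_pos add_nonneg_nonneg mult_nonneg_nonneg) auto
  have est: "X_norm \<Omega> T (\<lambda>z. u z - u\<^sub>h z)
      \<le> sqrt K * mesh_size \<T> * sqrt ((H21_norm \<Omega> T u)\<^sup>2 + (H32_Hm1_norm \<Omega> T u)\<^sup>2)"
    if mesh: "admissible_mesh \<Omega> \<T>" and inv: "inverse_inequality c\<^sub>I \<Omega> \<T>"
      and stab: "L2_proj_H1_stable c\<^sub>Q \<Omega> \<T>" and appr: "L2_proj_approximation c\<^sub>A \<Omega> \<T>"
      and N: "N \<ge> 1" and step: "T / N \<le> \<kappa>\<^sub>2 * (mesh_size \<T>)\<^sup>2"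
      and U\<^sub>0: "U\<^sub>0 \<in> X_space \<Omega> T" and u: "u \<in> X0_space \<Omega> T"
      and eq: "\<forall>v\<in>Y_space \<Omega> T. b_form \<Omega> T (\<lambda>z. u z + U\<^sub>0 z) v = f v"
      and u\<^sub>h: "u\<^sub>h \<in> X0_h \<Omega> T \<T> N"
      and eq\<^sub>h: "\<forall>v\<in>Y_h \<Omega> T \<T> N. b_form \<Omega> T (\<lambda>z. u\<^sub>h z + U\<^sub>0 z) v = f v"
      and reg: "u \<in> H21_space \<Omega> T" "u \<in> H32_Hm1_space \<Omega> T"
    for \<T> :: "(real ^ 'n) set set" and N :: nat and f U\<^sub>0 u u\<^sub>h
  proof -
    let ?h = "mesh_size \<T>"
    have "0 \<le> ?h" using admissible_mesh_size_nonneg[OF mesh] assms(2) by (simp add: lipschitz_domain_def)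
    \<comment> \<open>A mesh of size 0 would force \<open>T / N \<le> 0\<close> through the upper
      bound for the time step.\<close>
    moreover have "?h \<noteq> 0"
    proof
      assume "?h = 0"
      then show False using step T_pos N by (simp add: divide_le_eq)
    qed
    ultimately have h: "0 < ?h" by simp
    \<comment> \<open>Order 1 of the approximation property serves the test functions in the
      estimate of the time derivative, order 2 the solution itself.\<close>
    have H1s: "Hs_space \<Omega> 1 = H1_space \<Omega>" "Hs_seminorm \<Omega> 1 = H10_norm \<Omega>"
      "Hs_space \<Omega> 2 = H2_space \<Omega>" "Hs_seminorm \<Omega> 2 = H2_seminorm \<Omega>"
      by (auto simp: Hs_space_def Hs_seminorm_def H10_norm_def fun_eq_iff)
    have proj: "L2_norm \<Omega> (\<lambda>x. v x - L2_proj \<Omega> (V_h \<Omega> \<T>) v x) \<le> c\<^sub>A s * ?h powr s * Hs_seminorm \<Omega> s v"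
      "L2_norm \<Omega> (wgrad \<Omega> (\<lambda>x. v x - L2_proj \<Omega> (V_h \<Omega> \<T>) v x)) \<le> c\<^sub>A s * ?h powr (s - 1) * Hs_seminorm \<Omega> s v"
      if "s \<in> {1..2}" "v \<in> H10_space \<Omega> \<inter> Hs_space \<Omega> s" for s v
      using appr that unfolding L2_proj_approximation_def Let_def by blast+
    have "(X_norm \<Omega> T (\<lambda>z. u z - u\<^sub>h z))\<^sup>2 \<le> K * ?h\<^sup>2 * ((H21_norm \<Omega> T u)\<^sup>2 + (H32_Hm1_norm \<Omega> T u)\<^sup>2)"
      unfolding K_def
    proof (rule galerkin_error[OF mesh N h _ _ _ _ _ step _ _ _ _ U\<^sub>0 u _ u\<^sub>h _ reg])
      fix v
      show "H10_norm \<Omega> v \<le> ?cI / ?h * L2_norm \<Omega> v" if "v \<in> V_h \<Omega> \<T>"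
      proof -
        have "H10_norm \<Omega> v \<le> c\<^sub>I * inverse ?h * L2_norm \<Omega> v"
          using inv that by (simp add: inverse_inequality_def H10_norm_def)
        also have "\<dots> \<le> ?cI * inverse ?h * L2_norm \<Omega> v" using h by (intro mult_right_mono) auto
        finally show ?thesis by (simp add: divide_inverse)
      qed
      show "H10_norm \<Omega> (L2_proj \<Omega> (V_h \<Omega> \<T>) v) \<le> ?cQ * H10_norm \<Omega> v" if "v \<in> H10_space \<Omega>"
      proof -
        have "H10_norm \<Omega> (L2_proj \<Omega> (V_h \<Omega> \<T>) v) \<le> c\<^sub>Q * H10_norm \<Omega> v"
          using stab that by (simp add: L2_proj_H1_stable_def H10_norm_def)
        also have "\<dots> \<le> ?cQ * H10_norm \<Omega> v" by (intro mult_right_mono H10.N_nonneg that) simp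
        finally show ?thesis .
      qed
      show "L2_norm \<Omega> (\<lambda>x. v x - L2_proj \<Omega> (V_h \<Omega> \<T>) v x) \<le> ?c1 * ?h * H10_norm \<Omega> v" if v: "v \<in> H10_space \<Omega>"
      proof -
        have "v \<in> H10_space \<Omega> \<inter> Hs_space \<Omega> 1" using v by (simp add: H1s H10_H1)
        from proj(1)[OF _ this] have "L2_norm \<Omega> (\<lambda>x. v x - L2_proj \<Omega> (V_h \<Omega> \<T>) v x) \<le> c\<^sub>A 1 * ?h powr 1 * Hs_seminorm \<Omega> 1 v"
          by simp
        also have "\<dots> = c\<^sub>A 1 * ?h * H10_norm \<Omega> v" using h by (simp add: H1s)
        also have "\<dots> \<le> ?c1 * ?h * H10_norm \<Omega> v" using h by (intro mult_right_mono H10.N_nonneg v) auto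
        finally show ?thesis .
      qed
      show "H10_norm \<Omega> (\<lambda>x. v x - L2_proj \<Omega> (V_h \<Omega> \<T>) v x) \<le> ?c2 * ?h * H2_norm \<Omega> v"
        if v: "v \<in> H10_space \<Omega>" "v \<in> H2_space \<Omega>"
      proof -
        have "v \<in> H10_space \<Omega> \<inter> Hs_space \<Omega> 2" using v by (simp add: H1s)
        from proj(2)[OF _ this] have "L2_norm \<Omega> (wgrad \<Omega> (\<lambda>x. v x - L2_proj \<Omega> (V_h \<Omega> \<T>) v x)) \<le> c\<^sub>A 2 * ?h powr (2 - 1) * Hs_seminorm \<Omega> 2 v"
          by simp
        then have "H10_norm \<Omega> (\<lambda>x. v x - L2_proj \<Omega> (V_h \<Omega> \<T>) v x) \<le> c\<^sub>A 2 * ?h * H2_seminorm \<Omega> v"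
          using h by (simp add: H1s H10_norm_def)
        also have "\<dots> \<le> ?c2 * ?h * H2_seminorm \<Omega> v"
          using h by (intro mult_right_mono) (auto simp: H2_seminorm_def intro!: sum_nonneg)
        also have "\<dots> \<le> ?c2 * ?h * H2_norm \<Omega> v"
          using h by (intro mult_left_mono) (auto simp: H2_norm_def intro!: real_le_rsqrt)
        finally show ?thesis .
      qed
    qed (use assms(6) eq eq\<^sub>h in auto)
    then have "sqrt ((X_norm \<Omega> T (\<lambda>z. u z - u\<^sub>h z))\<^sup>2) \<le> sqrt (K * ?h\<^sup>2 * ((H21_norm \<Omega> T u)\<^sup>2 + (H32_Hm1_norm \<Omega> T u)\<^sup>2))"
      by (rule real_sqrt_le_mono)
    then show ?thesis using h by (simp add: real_sqrt_mult X_norm_def)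
  qed
  show ?thesis
    by (rule exI[of _ "sqrt K"]) (use K est in auto)
qed

end
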